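(* Let $B$ be a stably uniform Banach ring such that its Banach norm defines a Huber ring, giving a Huber pair $(B,B^{+})$. Then $\mathrm{Spa}(B,B^{+})$ is an adic space (i.e. its structure presheaf is a sheaf) and $\mathcal{O}_{\mathrm{Spa}(B,B^{+})}$ is an acyclic sheaf.
   Context: A Huber ring is a (complete) topological ring $A$ containing an open subring $A_0$ whose topology is the $I$-adic one for a finitely generated ideal $I\subset A_0$. A Huber pair $(A,A^+)$ is a Huber ring with an open integrally closed subring $A^+$ of the ring $A^\circ$ of power-bounded elements. No analyticity assumption is made, and no topologically nilpotent unit is assumed. A (nonarchimedean commutative) Banach ring is a commutative ring $B$, complete for a norm $|\cdot|:B\to\mathbb{R}_{\ge0}$ with $|x-y|\le\max\{|x|,|y|\}$ and $|xy|\le|x||y|$. It is uniform if its norm is equivalent to a power-multiplicative norm; equivalently there is $c>0$ with $|x|_{sp}\ge c|x|$ for all $x$, where $|x|_{sp}=\lim_n|x^n|^{1/n}$. "The Banach norm of $B$ defines a Huber ring" means the underlying topological ring of $B$ is a Huber ring. Such a $B$ is stably uniform if for every rational localization $(B,B^+)\to(C,C^+)$, $C$ is a uniform Banach ring, i.e. the topology of $C$ is defined by a power-multiplicative Banach norm. The structure presheaf of $\mathrm{Spa}(B,B^+)$ sends a rational subspace $U=\{v: v(f_i)\le v(g)\ne 0\ \forall i\}$, with $(f_1,\dots,f_n,g)$ an open ideal of $B$, to the corresponding complete rational localization, and a general open $V$ to the inverse limit over rational subspaces contained in $V$. A sheaf $\mathcal{F}$ is acyclic if $H^i(U,\mathcal{F})=0$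 for every rational subspace $U$ and every $i>0$. *)

theory Defs
  imports "HOL-Analysis.Analysis" "HOL-Algebra.Algebra"
begin

section \<open>Topological rings, Huber pairs and Banach rings\<close>

definition topological_ring :: "('a, 'm) ring_scheme \<Rightarrow> 'a topology \<Rightarrow> bool" where
  "topological_ring R T \<longleftrightarrow>
     cring R \<and> topspace T = carrier R \<and>
     continuous_map (prod_topology T T) T (\<lambda>(x, y). x \<oplus>\<^bsub>R\<^esub> y) \<and>
     continuous_map T T (\<lambda>x. \<ominus>\<^bsub>R\<^esub> x) \<and>
     continuous_map (prod_topology T T) T (\<lambda>(x, y). x \<otimes>\<^bsub>R\<^esub> y)"

text \<open>\<open>T\<close> restricts to the \<open>I\<close>-adic topology on the open subring \<open>A\<close>. The powers of the ideal \<open>I\<close> are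
  formed in \<open>A\<close>.\<close>

definition adic_on :: "'a ring \<Rightarrow> 'a topology \<Rightarrow> 'a set \<Rightarrow> 'a set \<Rightarrow> bool" where
  "adic_on R T A I \<longleftrightarrow>
     (\<forall>n::nat. openin T (I [^]\<^bsub>ideals_set (R\<lparr>carrier := A\<rparr>)\<^esub> n)) \<and>
     (\<forall>U. openin T U \<and> \<zero>\<^bsub>R\<^esub> \<in> U \<longrightarrow> (\<exists>n::nat. I [^]\<^bsub>ideals_set (R\<lparr>carrier := A\<rparr>)\<^esub> n \<subseteq> U))"

definition huber_ring :: "'a ring \<Rightarrow> 'a topology \<Rightarrow> bool" where
  "huber_ring R T \<longleftrightarrow>
     topological_ring R T \<and>
     (\<exists>A S. subring A R \<and> openin T A \<and> finite S \<and> S \<subseteq> A \<and>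
            adic_on R T A (genideal (R\<lparr>carrier := A\<rparr>) S))"

definition bounded_subset :: "'a ring \<Rightarrow> 'a topology \<Rightarrow> 'a set \<Rightarrow> bool" where
  "bounded_subset R T S \<longleftrightarrow> S \<subseteq> carrier R \<and>
     (\<forall>U. openin T U \<and> \<zero>\<^bsub>R\<^esub> \<in> U \<longrightarrow>
       (\<exists>V. openin T V \<and> \<zero>\<^bsub>R\<^esub> \<in> V \<and> (\<forall>v\<in>V. \<forall>s\<in>S. v \<otimes>\<^bsub>R\<^esub> s \<in> U)))"

definition power_bounded :: "'a ring \<Rightarrow> 'a topology \<Rightarrow> 'a set" where
  "power_bounded R T = {x \<in> carrier R. bounded_subset R T (range (\<lambda>n::nat. x [^]\<^bsub>R\<^esub> n))}"

definition integral_over :: "'a ring \<Rightarrow> 'a set \<Rightarrow> 'a \<Rightarrow> bool" where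
  "integral_over R P x \<longleftrightarrow>
     (\<exists>n c. 0 < n \<and> (\<forall>i<n. c i \<in> P) \<and>
        x [^]\<^bsub>R\<^esub> (n::nat) = (\<Oplus>\<^bsub>R\<^esub>i\<in>{..<n}. c i \<otimes>\<^bsub>R\<^esub> x [^]\<^bsub>R\<^esub> i))"

definition huber_pair :: "'a ring \<Rightarrow> 'a topology \<Rightarrow> 'a set \<Rightarrow> bool" where
  "huber_pair R T P \<longleftrightarrow>
     huber_ring R T \<and> subring P R \<and> openin T P \<and> P \<subseteq> power_bounded R T \<and>
     (\<forall>x\<in>carrier R. integral_over R P x \<longrightarrow> x \<in> P)"

text \<open>The locale \<^locale>\<open>Metric_space\<close> asks for symmetry and nonnegativity on the whole type, so the
  distance is cut off outside the carrier.\<close>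

definition norm_dist :: "'a ring \<Rightarrow> ('a \<Rightarrow> real) \<Rightarrow> 'a \<Rightarrow> 'a \<Rightarrow> real" where
  "norm_dist R N x y = (if x \<in> carrier R \<and> y \<in> carrier R then N (x \<ominus>\<^bsub>R\<^esub> y) else 0)"

definition norm_topology :: "'a ring \<Rightarrow> ('a \<Rightarrow> real) \<Rightarrow> 'a topology" where
  "norm_topology R N = Metric_space.mtopology (carrier R) (norm_dist R N)"

definition banach_ring :: "'a ring \<Rightarrow> ('a \<Rightarrow> real) \<Rightarrow> bool" where
  "banach_ring R N \<longleftrightarrow>
     cring R \<and>
     (\<forall>x\<in>carrier R. 0 \<le> N x \<and> (N x = 0 \<longleftrightarrow> x = \<zero>\<^bsub>R\<^esub>)) \<and>
     (\<forall>x\<in>carrier R. \<forall>y\<in>carrier R. N (x \<ominus>\<^bsub>R\<^esub> y) \<le> max (N x) (N y)) \<and>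
     (\<forall>x\<in>carrier R. \<forall>y\<in>carrier R. N (x \<otimes>\<^bsub>R\<^esub> y) \<le> N x * N y) \<and>
     Metric_space.mcomplete (carrier R) (norm_dist R N)"

text \<open>The exponent 0 is excluded, so that the zero ring is allowed.\<close>

definition power_multiplicative :: "'a ring \<Rightarrow> ('a \<Rightarrow> real) \<Rightarrow> bool" where
  "power_multiplicative R N \<longleftrightarrow> (\<forall>x\<in>carrier R. \<forall>n::nat. 0 < n \<longrightarrow> N (x [^]\<^bsub>R\<^esub> n) = N x ^ n)"

definition uniform_banach :: "'a ring \<Rightarrow> 'a topology \<Rightarrow> bool" where
  "uniform_banach R T \<longleftrightarrow>
     (\<exists>N. banach_ring R N \<and> power_multiplicative R N \<and> norm_topology R N = T)"

section \<open>Complete rational localizations\<close>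

definition open_subgroups :: "'a ring \<Rightarrow> 'a topology \<Rightarrow> 'a set set" where
  "open_subgroups R T = {U. additive_subgroup U R \<and> openin T U}"

text \<open>The group topology in which the members of \<open>\<U>\<close> form a fundamental system of neighbourhoods of 0.\<close>

definition subgroup_topology :: "'a ring \<Rightarrow> 'a set set \<Rightarrow> 'a topology" where
  "subgroup_topology R \<U> = topology_generated_by {U +>\<^bsub>R\<^esub> x |U x. U \<in> \<U> \<and> x \<in> carrier R}"

text \<open>\<open>R[1/g] = R[X]/(gX - 1)\<close>, and the fraction \<open>a/g\<^sup>k\<close> in it.\<close>

definition loc_ideal :: "'a ring \<Rightarrow> 'a \<Rightarrow> (nat \<Rightarrow> 'a) set" where
  "loc_ideal R g = genideal (UP R) {monom (UP R) g 1 \<ominus>\<^bsub>UP R\<^esub> \<one>\<^bsub>UP R\<^esub>}"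

definition loc_ring :: "'a ring \<Rightarrow> 'a \<Rightarrow> (nat \<Rightarrow> 'a) set ring" where
  "loc_ring R g = UP R Quot loc_ideal R g"

definition loc_frac :: "'a ring \<Rightarrow> 'a \<Rightarrow> 'a \<Rightarrow> nat \<Rightarrow> (nat \<Rightarrow> 'a) set" where
  "loc_frac R g a k = loc_ideal R g +>\<^bsub>UP R\<^esub> monom (UP R) a k"

text \<open>A neighbourhood basis of 0 in \<open>R[1/g]\<close> is given by the subgroups \<open>D \<cdot> U\<close>, where \<open>D\<close> is the subring
  generated by the fractions \<open>f/g\<close> and \<open>U\<close> is an open subgroup of \<open>R\<close>. For a ring of definition \<open>A\<close>
  with ideal of definition \<open>I\<close> and \<open>U = I\<^sup>n\<close> this is \<open>I\<^sup>n A[f/g]\<close>, so this is Huber's topology,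
  described without a choice of \<open>(A, I)\<close>.\<close>

definition loc_nbhd :: "'a ring \<Rightarrow> 'a set \<Rightarrow> 'a \<Rightarrow> 'a set \<Rightarrow> (nat \<Rightarrow> 'a) set set" where
  "loc_nbhd R F g U =
     generate (add_monoid (loc_ring R g))
       {d \<otimes>\<^bsub>loc_ring R g\<^esub> loc_frac R g u 0 |d u.
          d \<in> generate_ring (loc_ring R g) ((\<lambda>f. loc_frac R g f 1) ` F) \<and> u \<in> U}"

definition loc_topology :: "'a ring \<Rightarrow> 'a topology \<Rightarrow> 'a set \<Rightarrow> 'a \<Rightarrow> (nat \<Rightarrow> 'a) set topology" where
  "loc_topology R T F g = subgroup_topology (loc_ring R g) (loc_nbhd R F g ` open_subgroups R T)"

text \<open>Hausdorff completion, as Cauchy sequences modulo null sequences. It is used only for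
  topologies in which 0 has a countable neighbourhood basis of open subgroups.\<close>

definition cauchy_seqs :: "'a ring \<Rightarrow> 'a topology \<Rightarrow> (nat \<Rightarrow> 'a) set" where
  "cauchy_seqs R T = {s. (\<forall>n. s n \<in> carrier R) \<and>
     (\<forall>U\<in>open_subgroups R T. \<exists>n0. \<forall>m\<ge>n0. \<forall>n\<ge>n0. s m \<ominus>\<^bsub>R\<^esub> s n \<in> U)}"

definition null_seqs :: "'a ring \<Rightarrow> 'a topology \<Rightarrow> (nat \<Rightarrow> 'a) set" where
  "null_seqs R T = {s. (\<forall>n. s n \<in> carrier R) \<and>
     (\<forall>U\<in>open_subgroups R T. \<exists>n0. \<forall>n\<ge>n0. s n \<in> U)}"

definition cauchy_ring :: "'a ring \<Rightarrow> 'a topology \<Rightarrow> (nat \<Rightarrow> 'a) ring" where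
  "cauchy_ring R T =
     \<lparr>carrier = cauchy_seqs R T,
      monoid.mult = (\<lambda>s t n. s n \<otimes>\<^bsub>R\<^esub> t n),
      monoid.one = (\<lambda>n. \<one>\<^bsub>R\<^esub>),
      ring.zero = (\<lambda>n. \<zero>\<^bsub>R\<^esub>),
      ring.add = (\<lambda>s t n. s n \<oplus>\<^bsub>R\<^esub> t n)\<rparr>"

definition completion :: "'a ring \<Rightarrow> 'a topology \<Rightarrow> (nat \<Rightarrow> 'a) set ring" where
  "completion R T = cauchy_ring R T Quot null_seqs R T"

definition completion_map :: "'a ring \<Rightarrow> 'a topology \<Rightarrow> 'a \<Rightarrow> (nat \<Rightarrow> 'a) set" where
  "completion_map R T x = null_seqs R T +>\<^bsub>cauchy_ring R T\<^esub> (\<lambda>n. x)"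

definition completion_nbhd :: "'a ring \<Rightarrow> 'a topology \<Rightarrow> 'a set \<Rightarrow> (nat \<Rightarrow> 'a) set set" where
  "completion_nbhd R T U = {c \<in> carrier (completion R T). \<exists>s\<in>c. \<exists>n0. \<forall>n\<ge>n0. s n \<in> U}"

definition completion_topology :: "'a ring \<Rightarrow> 'a topology \<Rightarrow> (nat \<Rightarrow> 'a) set topology" where
  "completion_topology R T =
     subgroup_topology (completion R T) (completion_nbhd R T ` open_subgroups R T)"

text \<open>A rational datum \<open>(F, g)\<close> presents the rational subspace
  \<open>{v. v f \<le> v g \<noteq> 0 for all f in F}\<close>.\<close>

type_synonym 'a datum = "'a set \<times> 'a"

type_synonym 'a rat_elt = "(nat \<Rightarrow> (nat \<Rightarrow> 'a) set) set"

definition rational_data :: "'a ring \<Rightarrow> 'a topology \<Rightarrow> 'a datum set" where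
  "rational_data R T = {(F, g). finite F \<and> F \<subseteq> carrier R \<and> g \<in> carrier R \<and>
                                openin T (genideal R (insert g F))}"

definition rat_ring :: "'a ring \<Rightarrow> 'a topology \<Rightarrow> 'a datum \<Rightarrow> 'a rat_elt ring" where
  "rat_ring R T D = completion (loc_ring R (snd D)) (loc_topology R T (fst D) (snd D))"

definition rat_topology :: "'a ring \<Rightarrow> 'a topology \<Rightarrow> 'a datum \<Rightarrow> 'a rat_elt topology" where
  "rat_topology R T D = completion_topology (loc_ring R (snd D)) (loc_topology R T (fst D) (snd D))"

definition rat_map :: "'a ring \<Rightarrow> 'a topology \<Rightarrow> 'a datum \<Rightarrow> 'a \<Rightarrow> 'a rat_elt" where
  "rat_map R T D b =
     completion_map (loc_ring R (snd D)) (loc_topology R T (fst D) (snd D)) (loc_frac R (snd D) b 0)"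

definition stably_uniform :: "'a ring \<Rightarrow> 'a topology \<Rightarrow> bool" where
  "stably_uniform R T \<longleftrightarrow>
     (\<forall>D\<in>rational_data R T. uniform_banach (rat_ring R T D) (rat_topology R T D))"

section \<open>The adic spectrum\<close>

text \<open>The value monoid \<open>\<Gamma> \<union> {0}\<close> is \<open>'g option\<close>, with \<open>None\<close> for 0.\<close>

definition ordered_comm_group :: "'g monoid \<Rightarrow> ('g \<Rightarrow> 'g \<Rightarrow> bool) \<Rightarrow> bool" where
  "ordered_comm_group \<Gamma> leq \<longleftrightarrow>
     comm_group \<Gamma> \<and>
     (\<forall>x\<in>carrier \<Gamma>. leq x x) \<and>
     (\<forall>x\<in>carrier \<Gamma>. \<forall>y\<in>carrier \<Gamma>. leq x y \<or> leq y x) \<and>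
     (\<forall>x\<in>carrier \<Gamma>. \<forall>y\<in>carrier \<Gamma>. leq x y \<and> leq y x \<longrightarrow> x = y) \<and>
     (\<forall>x\<in>carrier \<Gamma>. \<forall>y\<in>carrier \<Gamma>. \<forall>z\<in>carrier \<Gamma>. leq x y \<and> leq y z \<longrightarrow> leq x z) \<and>
     (\<forall>x\<in>carrier \<Gamma>. \<forall>y\<in>carrier \<Gamma>. \<forall>z\<in>carrier \<Gamma>. leq x y \<longrightarrow> leq (x \<otimes>\<^bsub>\<Gamma>\<^esub> z) (y \<otimes>\<^bsub>\<Gamma>\<^esub> z))"

fun val_le :: "('g \<Rightarrow> 'g \<Rightarrow> bool) \<Rightarrow> 'g option \<Rightarrow> 'g option \<Rightarrow> bool" where
  "val_le leq None b = True"
| "val_le leq (Some x) None = False"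
| "val_le leq (Some x) (Some y) = leq x y"

fun val_mult :: "'g monoid \<Rightarrow> 'g option \<Rightarrow> 'g option \<Rightarrow> 'g option" where
  "val_mult \<Gamma> (Some x) (Some y) = Some (x \<otimes>\<^bsub>\<Gamma>\<^esub> y)"
| "val_mult \<Gamma> a b = None"

definition valuation ::
  "'a ring \<Rightarrow> 'g monoid \<Rightarrow> ('g \<Rightarrow> 'g \<Rightarrow> bool) \<Rightarrow> ('a \<Rightarrow> 'g option) \<Rightarrow> bool" where
  "valuation R \<Gamma> leq v \<longleftrightarrow>
     ordered_comm_group \<Gamma> leq \<and>
     (\<forall>x\<in>carrier R. set_option (v x) \<subseteq> carrier \<Gamma>) \<and>
     v \<zero>\<^bsub>R\<^esub> = None \<and> v \<one>\<^bsub>R\<^esub> = Some \<one>\<^bsub>\<Gamma>\<^esub> \<and>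
     (\<forall>x\<in>carrier R. \<forall>y\<in>carrier R. v (x \<otimes>\<^bsub>R\<^esub> y) = val_mult \<Gamma> (v x) (v y)) \<and>
     (\<forall>x\<in>carrier R. \<forall>y\<in>carrier R.
        val_le leq (v (x \<oplus>\<^bsub>R\<^esub> y)) (v x) \<or> val_le leq (v (x \<oplus>\<^bsub>R\<^esub> y)) (v y))"

definition value_group :: "'a ring \<Rightarrow> 'g monoid \<Rightarrow> ('a \<Rightarrow> 'g option) \<Rightarrow> 'g set" where
  "value_group R \<Gamma> v = generate \<Gamma> {\<gamma>. \<exists>x\<in>carrier R. v x = Some \<gamma>}"

definition continuous_valuation ::
  "'a ring \<Rightarrow> 'a topology \<Rightarrow> 'g monoid \<Rightarrow> ('g \<Rightarrow> 'g \<Rightarrow> bool) \<Rightarrow> ('a \<Rightarrow> 'g option) \<Rightarrow> bool" where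
  "continuous_valuation R T \<Gamma> leq v \<longleftrightarrow>
     valuation R \<Gamma> leq v \<and>
     (\<forall>\<gamma>\<in>value_group R \<Gamma> v. openin T {x \<in> carrier R. \<not> val_le leq (Some \<gamma>) (v x)})"

text \<open>Two valuations are equivalent iff they induce the same relation \<open>v a \<le> v b\<close>; this relation
  stands for the equivalence class. The elements of the value group are quotients \<open>v a / v b\<close>,
  hence correspond to classes of pairs \<open>(a, b)\<close>, so up to equivalence every valuation has its values
  in an ordered group on the type \<open>('a \<times> 'a) set\<close>.\<close>

type_synonym 'a spa_point = "('a \<times> 'a) set"

definition valuation_class ::
  "'a ring \<Rightarrow> ('g \<Rightarrow> 'g \<Rightarrow> bool) \<Rightarrow> ('a \<Rightarrow> 'g option) \<Rightarrow> 'a spa_point" where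
  "valuation_class R leq v = {(a, b) \<in> carrier R \<times> carrier R. val_le leq (v a) (v b)}"

definition Spa :: "'a ring \<Rightarrow> 'a topology \<Rightarrow> 'a set \<Rightarrow> 'a spa_point set" where
  "Spa R T P =
     {valuation_class R leq v |(\<Gamma> :: ('a \<times> 'a) set monoid) leq v.
        continuous_valuation R T \<Gamma> leq v \<and> (\<forall>x\<in>P. val_le leq (v x) (Some \<one>\<^bsub>\<Gamma>\<^esub>))}"

definition rational_subset ::
  "'a ring \<Rightarrow> 'a topology \<Rightarrow> 'a set \<Rightarrow> 'a datum \<Rightarrow> 'a spa_point set" where
  "rational_subset R T P D =
     {p \<in> Spa R T P. (\<forall>f\<in>fst D. (f, snd D) \<in> p) \<and> (snd D, \<zero>\<^bsub>R\<^esub>) \<notin> p}"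

definition rational_subspaces ::
  "'a ring \<Rightarrow> 'a topology \<Rightarrow> 'a set \<Rightarrow> 'a spa_point set set" where
  "rational_subspaces R T P = rational_subset R T P ` rational_data R T"

definition spa_topology :: "'a ring \<Rightarrow> 'a topology \<Rightarrow> 'a set \<Rightarrow> 'a spa_point topology" where
  "spa_topology R T P =
     topology_generated_by {rational_subset R T P ({f}, g) |f g. f \<in> carrier R \<and> g \<in> carrier R}"

section \<open>Sheaves of topological rings\<close>

record ('p, 's) ring_presheaf =
  sect :: "'p set \<Rightarrow> 's ring"
  sect_top :: "'p set \<Rightarrow> 's topology"
  restr :: "'p set \<Rightarrow> 'p set \<Rightarrow> 's \<Rightarrow> 's"

text \<open>\<open>restr F V W\<close> is the restriction map from \<open>V\<close> to \<open>W \<subseteq> V\<close>.\<close>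

definition top_ring_presheaf :: "'p topology \<Rightarrow> ('p, 's) ring_presheaf \<Rightarrow> bool" where
  "top_ring_presheaf Y F \<longleftrightarrow>
     (\<forall>V. openin Y V \<longrightarrow>
        topological_ring (sect F V) (sect_top F V) \<and>
        (\<forall>s\<in>carrier (sect F V). restr F V V s = s)) \<and>
     (\<forall>V W. openin Y V \<and> openin Y W \<and> W \<subseteq> V \<longrightarrow>
        restr F V W \<in> ring_hom (sect F V) (sect F W) \<and>
        continuous_map (sect_top F V) (sect_top F W) (restr F V W)) \<and>
     (\<forall>V W Z. openin Y V \<and> openin Y W \<and> openin Y Z \<and> Z \<subseteq> W \<and> W \<subseteq> V \<longrightarrow>
        (\<forall>s\<in>carrier (sect F V). restr F W Z (restr F V W s) = restr F V Z s))"

text \<open>The sheaf condition in the category of topological rings: besides unique gluing, the sections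
  over \<open>V\<close> carry the subspace topology of the product over the covering.\<close>

definition top_ring_sheaf :: "'p topology \<Rightarrow> ('p, 's) ring_presheaf \<Rightarrow> bool" where
  "top_ring_sheaf Y F \<longleftrightarrow>
     top_ring_presheaf Y F \<and>
     (\<forall>V \<W>. openin Y V \<and> (\<forall>W\<in>\<W>. openin Y W) \<and> \<Union>\<W> = V \<longrightarrow>
        (\<forall>\<sigma>. (\<forall>W\<in>\<W>. \<sigma> W \<in> carrier (sect F W)) \<and>
             (\<forall>W\<in>\<W>. \<forall>W'\<in>\<W>. restr F W (W \<inter> W') (\<sigma> W) = restr F W' (W \<inter> W') (\<sigma> W')) \<longrightarrow>
             (\<exists>!s. s \<in> carrier (sect F V) \<and> (\<forall>W\<in>\<W>. restr F V W s = \<sigma> W))) \<and>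
        embedding_map (sect_top F V) (product_topology (sect_top F) \<W>)
          (\<lambda>s. \<lambda>W\<in>\<W>. restr F V W s))"

section \<open>Sheaf cohomology\<close>

definition germ ::
  "'p topology \<Rightarrow> ('p, 's) ring_presheaf \<Rightarrow> 'p \<Rightarrow> 'p set \<Rightarrow> 's \<Rightarrow> ('p set \<times> 's) set" where
  "germ Y F x V s =
     {(W, u). openin Y W \<and> x \<in> W \<and> u \<in> carrier (sect F W) \<and>
        (\<exists>Z. openin Y Z \<and> x \<in> Z \<and> Z \<subseteq> V \<inter> W \<and> restr F V Z s = restr F W Z u)}"

definition germ_op ::
  "'p topology \<Rightarrow> ('p, 's) ring_presheaf \<Rightarrow> 'p \<Rightarrow> ('s ring \<Rightarrow> 's \<Rightarrow> 's \<Rightarrow> 's) \<Rightarrow>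
   ('p set \<times> 's) set \<Rightarrow> ('p set \<times> 's) set \<Rightarrow> ('p set \<times> 's) set" where
  "germ_op Y F x f A B =
     {(W, u). openin Y W \<and> x \<in> W \<and> u \<in> carrier (sect F W) \<and>
        (\<exists>(V, s)\<in>A. \<exists>(V', t)\<in>B. \<exists>Z. openin Y Z \<and> x \<in> Z \<and> Z \<subseteq> V \<inter> V' \<inter> W \<and>
           restr F W Z u = f (sect F Z) (restr F V Z s) (restr F V' Z t))}"

definition stalk ::
  "'p topology \<Rightarrow> ('p, 's) ring_presheaf \<Rightarrow> 'p \<Rightarrow> ('p set \<times> 's) set ring" where
  "stalk Y F x =
     \<lparr>carrier = {germ Y F x V s |V s. openin Y V \<and> x \<in> V \<and> s \<in> carrier (sect F V)},
      monoid.mult = germ_op Y F x monoid.mult,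
      monoid.one = germ Y F x (topspace Y) \<one>\<^bsub>sect F (topspace Y)\<^esub>,
      ring.zero = germ Y F x (topspace Y) \<zero>\<^bsub>sect F (topspace Y)\<^esub>,
      ring.add = germ_op Y F x ring.add\<rparr>"

text \<open>Cohomology is defined by Godement's canonical flasque resolution
  \<open>F \<rightarrow> C\<^sup>0 F \<rightarrow> C\<^sup>1 F \<rightarrow> \<dots>\<close> in its cosimplicial form: \<open>C\<^sup>n F\<close> is the \<open>(n+1)\<close>-fold iterate of the
  functor sending \<open>F\<close> to its sheaf of discontinuous sections, \<open>(C F) U = (\<Prod>x\<in>U. F\<^sub>x)\<close>.

  A section of \<open>C\<^sup>n F\<close> over \<open>U\<close> assigns to \<open>x\<^sub>0 \<in> U\<close> a germ at \<open>x\<^sub>0\<close> of sections of \<open>C\<^sup>n\<^sup>-\<^sup>1 F\<close>. Unwinding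
  this, it is represented by a function \<open>f\<close> with \<open>f [x\<^sub>0, \<dots>, x\<^sub>n]\<close> in the stalk of \<open>F\<close> at \<open>x\<^sub>n\<close>. Two
  such functions represent the same section iff for all \<open>x\<^sub>0 \<in> U\<close> there is a neighbourhood \<open>V\<^sub>1\<close> of \<open>x\<^sub>0\<close>
  such that for all \<open>x\<^sub>1 \<in> V\<^sub>1\<close> there is a neighbourhood \<open>V\<^sub>2\<close> of \<open>x\<^sub>1\<close> such that \dots for all \<open>x\<^sub>n \<in> V\<^sub>n\<close>
  their values at \<open>[x\<^sub>0, \<dots>, x\<^sub>n]\<close> agree. The quantifier prefix is \<open>locally_on Y n U\<close>.\<close>

primrec locally_on :: "'p topology \<Rightarrow> nat \<Rightarrow> 'p set \<Rightarrow> ('p list \<Rightarrow> bool) \<Rightarrow> bool" where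
  "locally_on Y 0 U Q \<longleftrightarrow> (\<forall>x\<in>U. Q [x])"
| "locally_on Y (Suc n) U Q \<longleftrightarrow>
     (\<forall>x\<in>U. \<exists>V. openin Y V \<and> x \<in> V \<and> locally_on Y n V (\<lambda>xs. Q (x # xs)))"

definition chains :: "'p topology \<Rightarrow> nat \<Rightarrow> 'p list set" where
  "chains Y n = {xs. length xs = Suc n \<and> set xs \<subseteq> topspace Y}"

definition cochains ::
  "'p topology \<Rightarrow> ('p, 's) ring_presheaf \<Rightarrow> nat \<Rightarrow> ('p list \<Rightarrow> ('p set \<times> 's) set) monoid" where
  "cochains Y F n = product_group (chains Y n) (\<lambda>xs. add_monoid (stalk Y F (last xs)))"

text \<open>The germ at \<open>y\<close> of a section representing the germ \<open>A\<close>. The choice of the representative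
  matters only for points \<open>y\<close> outside some neighbourhood of the base point of \<open>A\<close>.\<close>

definition spread ::
  "'p topology \<Rightarrow> ('p, 's) ring_presheaf \<Rightarrow> ('p set \<times> 's) set \<Rightarrow> 'p \<Rightarrow> ('p set \<times> 's) set" where
  "spread Y F A y =
     (let (V, s) = (SOME p. p \<in> A) in if y \<in> V then germ Y F y V s else \<zero>\<^bsub>stalk Y F y\<^esub>)"

text \<open>The alternating sum of the coface maps: the first \<open>n+1\<close> of them omit \<open>x\<^sub>0, \<dots>, x\<^sub>n\<close>, the last one
  passes from the germ \<open>f [x\<^sub>0, \<dots>, x\<^sub>n]\<close> at \<open>x\<^sub>n\<close> to the germ of the same section at \<open>x\<^sub>n\<^sub>+\<^sub>1\<close>.\<close>

definition coface ::
  "'p topology \<Rightarrow> ('p, 's) ring_presheaf \<Rightarrow> nat \<Rightarrow> nat \<Rightarrow> ('p list \<Rightarrow> ('p set \<times> 's) set) \<Rightarrow>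
   'p list \<Rightarrow> ('p set \<times> 's) set" where
  "coface Y F n i f xs =
     (if i \<le> n then f (take i xs @ drop (Suc i) xs) else spread Y F (f (butlast xs)) (last xs))"

definition differential ::
  "'p topology \<Rightarrow> ('p, 's) ring_presheaf \<Rightarrow> nat \<Rightarrow> ('p list \<Rightarrow> ('p set \<times> 's) set) \<Rightarrow>
   'p list \<Rightarrow> ('p set \<times> 's) set" where
  "differential Y F n f =
     (\<lambda>xs\<in>chains Y (Suc n).
        \<Oplus>\<^bsub>stalk Y F (last xs)\<^esub>i\<in>{..Suc n}.
          if even i then coface Y F n i f xs else \<ominus>\<^bsub>stalk Y F (last xs)\<^esub> coface Y F n i f xs)"

definition cocycles ::
  "'p topology \<Rightarrow> ('p, 's) ring_presheaf \<Rightarrow> nat \<Rightarrow> 'p set \<Rightarrow> ('p list \<Rightarrow> ('p set \<times> 's) set) set" where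
  "cocycles Y F n U =
     {f \<in> carrier (cochains Y F n).
        locally_on Y (Suc n) U (\<lambda>xs. differential Y F n f xs = \<zero>\<^bsub>stalk Y F (last xs)\<^esub>)}"

text \<open>Functions representing the section 0 are included among the coboundaries, which accounts for
  the passage from functions to the sections of \<open>C\<^sup>n F\<close> that they represent.\<close>

definition coboundaries ::
  "'p topology \<Rightarrow> ('p, 's) ring_presheaf \<Rightarrow> nat \<Rightarrow> 'p set \<Rightarrow> ('p list \<Rightarrow> ('p set \<times> 's) set) set" where
  "coboundaries Y F n U =
     {f \<in> carrier (cochains Y F n).
        case n of
          0 \<Rightarrow> locally_on Y 0 U (\<lambda>xs. f xs = \<zero>\<^bsub>stalk Y F (last xs)\<^esub>)
        | Suc m \<Rightarrow> \<exists>h\<in>carrier (cochains Y F m).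
                     locally_on Y n U (\<lambda>xs. f xs = differential Y F m h xs)}"

definition sheaf_cohomology ::
  "'p topology \<Rightarrow> ('p, 's) ring_presheaf \<Rightarrow> nat \<Rightarrow> 'p set \<Rightarrow>
   ('p list \<Rightarrow> ('p set \<times> 's) set) set monoid" where
  "sheaf_cohomology Y F n U =
     (cochains Y F n)\<lparr>carrier := cocycles Y F n U\<rparr> Mod coboundaries Y F n U"

section \<open>The structure presheaf\<close>

text \<open>For an inclusion of rational subspaces, the continuous homomorphism over \<open>R\<close> between the
  corresponding rational localizations; it is unique since the image of \<open>R[1/g]\<close> is dense.\<close>

definition rat_restr ::
  "'a ring \<Rightarrow> 'a topology \<Rightarrow> 'a datum \<Rightarrow> 'a datum \<Rightarrow> 'a rat_elt \<Rightarrow> 'a rat_elt" where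
  "rat_restr R T D E =
     (THE \<phi>. \<phi> \<in> extensional (carrier (rat_ring R T D)) \<and>
        \<phi> \<in> ring_hom (rat_ring R T D) (rat_ring R T E) \<and>
        continuous_map (rat_topology R T D) (rat_topology R T E) \<phi> \<and>
        (\<forall>b\<in>carrier R. \<phi> (rat_map R T D b) = rat_map R T E b))"

definition data_within ::
  "'a ring \<Rightarrow> 'a topology \<Rightarrow> 'a set \<Rightarrow> 'a spa_point set \<Rightarrow> 'a datum set" where
  "data_within R T P V = {D \<in> rational_data R T. rational_subset R T P D \<subseteq> V}"

text \<open>The limit is indexed by rational data instead of rational subspaces. This avoids choosing a
  presentation: data with the same rational subspace are linked by mutually inverse restrictions, so
  for \<open>V = rational_subset R T P D\<close> the projection to \<open>rat_ring R T D\<close> is an isomorphism.\<close>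

definition structure_sections ::
  "'a ring \<Rightarrow> 'a topology \<Rightarrow> 'a set \<Rightarrow> 'a spa_point set \<Rightarrow> ('a datum \<Rightarrow> 'a rat_elt) set" where
  "structure_sections R T P V =
     {s \<in> (\<Pi>\<^sub>E D\<in>data_within R T P V. carrier (rat_ring R T D)).
        \<forall>D\<in>data_within R T P V. \<forall>E\<in>data_within R T P V.
          rational_subset R T P E \<subseteq> rational_subset R T P D \<longrightarrow> rat_restr R T D E (s D) = s E}"

definition structure_presheaf ::
  "'a ring \<Rightarrow> 'a topology \<Rightarrow> 'a set \<Rightarrow> ('a spa_point, 'a datum \<Rightarrow> 'a rat_elt) ring_presheaf" where
  "structure_presheaf R T P =
     \<lparr>sect = (\<lambda>V.
        \<lparr>carrier = structure_sections R T P V,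
         monoid.mult = (\<lambda>s t. \<lambda>D\<in>data_within R T P V. s D \<otimes>\<^bsub>rat_ring R T D\<^esub> t D),
         monoid.one = (\<lambda>D\<in>data_within R T P V. \<one>\<^bsub>rat_ring R T D\<^esub>),
         ring.zero = (\<lambda>D\<in>data_within R T P V. \<zero>\<^bsub>rat_ring R T D\<^esub>),
         ring.add = (\<lambda>s t. \<lambda>D\<in>data_within R T P V. s D \<oplus>\<^bsub>rat_ring R T D\<^esub> t D)\<rparr>),
      sect_top = (\<lambda>V. subtopology (product_topology (rat_topology R T) (data_within R T P V))
                                  (structure_sections R T P V)),
      restr = (\<lambda>V W s. restrict s (data_within R T P W))\<rparr>"

definition spa_is_adic_space :: "'a ring \<Rightarrow> 'a topology \<Rightarrow> 'a set \<Rightarrow> bool" where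
  "spa_is_adic_space R T P \<longleftrightarrow> top_ring_sheaf (spa_topology R T P) (structure_presheaf R T P)"

definition structure_sheaf_acyclic :: "'a ring \<Rightarrow> 'a topology \<Rightarrow> 'a set \<Rightarrow> bool" where
  "structure_sheaf_acyclic R T P \<longleftrightarrow>
     (\<forall>U\<in>rational_subspaces R T P. \<forall>i>0.
        trivial_group (sheaf_cohomology (spa_topology R T P) (structure_presheaf R T P) i U))"

end

(*
  Every rational localization C(D) is uniform, so its topology is given by a power-multiplicative
  norm. For such norms an estimate for h^K l and f^K l in terms of monomials in f and h gives the same
  estimate for l itself, because alpha f + beta h = 1 allows l^n to be bounded without a loss that
  grows with n. Hence for a covering of a rational subset D by the two subsets f <= h and h <= f the
  sequence  0 -> C(D) -> C(D1) x C(D2) -> C(D12) -> 0  is strictly exact.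

  Rational subsets are quasi-compact in the following sharp form: a family of rational data that
  covers D can be reached from D by finitely many binary splittings, up to data on which a
  topologically nilpotent element dominates 1. Otherwise Zorn's lemma yields a prime filter of rational
  data, and "some member of the filter forces v a <= v b" defines a continuous valuation which is
  not covered. Induction along these splittings carries the binary exactness to arbitrary open coverings and gives
  the sheaf property. A cocycle in Godement's resolution is locally a coboundary, and the same
  induction, with exactness on the right for the passage from degree 1, makes it one globally.
*)
theory Submission
  imports Defs
begin

text \<open>Without a topologically nilpotent unit elements cannot be rescaled, and two elements f,
  h without common zero on D need not generate an open ideal of B. Each splitting therefore carries
  a finite set S of small elements that generate an open ideal and are added to the numerators; S is
  chosen so small that its extra inequalities follow from the relation between f and h.

  Inequalities are handled by certificates: \<open>forces D a b\<close> says that a/b lies in the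
  subring P[F/g] of B[1/g], before completion and integral closure. Certificates compose and pass to
  refinements by pure algebra. An inclusion of rational subsets yields certificates only after
  splitting, so even the restriction maps for inclusions are built by gluing.

  The norms of different localizations are unrelated; estimates are transported by neighbourhoods of
  0 in B. These have to be stable under P, whose elements may have norm above 1; balls of radius
  below 1 of a power-multiplicative seminorm are.\<close>

abbreviation mult_in :: "'a => ('a, 'm) monoid_scheme => 'a => 'a" ("(_ *[_]/ _)" [70, 0, 71] 70)
  where "x *[G] y \<equiv> x \<otimes>\<^bsub>G\<^esub> y"
abbreviation pow_in :: "'a => ('a, 'm) monoid_scheme => nat => 'a" ("(_ ^[_]/ _)" [76, 0, 75] 75)
  where "x ^[G] n \<equiv> x [^]\<^bsub>G\<^esub> n"
abbreviation inv_in :: "('a, 'm) monoid_scheme => 'a => 'a" ("(inv[_]/ _)" [0, 81] 80)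
  where "inv[G] x \<equiv> inv\<^bsub>G\<^esub> x"
abbreviation add_in :: "'a => ('a, 'm) ring_scheme => 'a => 'a" ("(_ +[_]/ _)" [65, 0, 66] 65)
  where "x +[G] y \<equiv> x \<oplus>\<^bsub>G\<^esub> y"
abbreviation minus_in :: "'a => ('a, 'm) ring_scheme => 'a => 'a" ("(_ -[_]/ _)" [65, 0, 66] 65)
  where "x -[G] y \<equiv> x \<ominus>\<^bsub>G\<^esub> y"
abbreviation uminus_in :: "('a, 'm) ring_scheme => 'a => 'a" ("(-[_]/ _)" [0, 81] 80)
  where "-[G] x \<equiv> \<ominus>\<^bsub>G\<^esub> x"
abbreviation zero_in :: "('a, 'm) ring_scheme => 'a" ("\<zero>[_]")
  where "\<zero>[G] \<equiv> \<zero>\<^bsub>G\<^esub>"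
abbreviation one_in :: "('a, 'm) monoid_scheme => 'a" ("\<one>[_]")
  where "\<one>[G] \<equiv> \<one>\<^bsub>G\<^esub>"
abbreviation mem_in :: "'a => ('a, 'm) partial_object_scheme => bool" ("(_ :[_])" [51, 0] 50)
  where "x :[G] \<equiv> x \<in> carrier G"
abbreviation mult_ix :: "('a, 'm) monoid_scheme => 'a => 'a => 'a" (infixl "*.\<index>" 70)
  where "x *.\<^bsub>G\<^esub> y \<equiv> x \<otimes>\<^bsub>G\<^esub> y"
abbreviation add_ix :: "('a, 'm) ring_scheme => 'a => 'a => 'a" (infixl "+.\<index>" 65)
  where "x +.\<^bsub>G\<^esub> y \<equiv> x \<oplus>\<^bsub>G\<^esub> y"
abbreviation minus_ix :: "('a, 'm) ring_scheme => 'a => 'a => 'a" ("(_ -.\<index> _)" [65, 66] 65)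
  where "x -.\<^bsub>G\<^esub> y \<equiv> x \<ominus>\<^bsub>G\<^esub> y"
abbreviation uminus_ix :: "('a, 'm) ring_scheme => 'a => 'a" ("-.\<index> _" [81] 80)
  where "-.\<^bsub>G\<^esub> x \<equiv> \<ominus>\<^bsub>G\<^esub> x"

section \<open>Additive subgroups and localization\<close>

lemma (in abelian_group) additive_subgroupI_minus:
 assumes "H <= carrier G" "\<zero>:H" "!!x y. x:H ==> y:H ==> x -. y:H"
 shows "additive_subgroup H G"
proof (rule additive_subgroupI)
 have inv: "-. x:H" if "x:H" for x using assms(3)[OF assms(2) that] assms(1) that by (auto simp: a_minus_def)
 show "subgroup H (add_monoid G)"
 proof (rule add.subgroupI)
  show "a +. b:H" if "a:H" "b:H" for a b
  proof -
   have "a -. (-. b):H" using assms(3) inv that by blast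
   thus ?thesis using assms(1) that by (auto simp: a_minus_def)
  qed
 qed (use assms inv in auto)
qed

lemma additive_subgroup_minus_closed:
 assumes "additive_subgroup H G" "abelian_group G" "x:H" "y:H"
 shows "x -[G] y:H"
proof -
 interpret additive_subgroup H G by fact
 interpret abelian_group G by fact
 show ?thesis unfolding a_minus_def using assms(3,4) a_inv_closed by blast
qed

definition aspan :: "('a, 'm) ring_scheme => 'a set => 'a set" where
 "aspan R S = generate (add_monoid R) S"

context abelian_group
begin

lemma aspan_least: "S <= H ==> additive_subgroup H G ==> aspan G S <= H"
 unfolding aspan_def by (rule add.generate_subgroup_incl) (auto dest: additive_subgroup.a_subgroup)

lemma aspan_subgroup: "S <= carrier G ==> additive_subgroup (aspan G S) G" unfolding aspan_def
 by (rule additive_subgroupI) (rule add.generate_is_subgroup, simp)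

lemma aspan_incl: "S <= aspan G S" unfolding aspan_def by (auto intro: generate.incl)

lemma aspan_mono: "S <= S' ==> S' <= carrier G ==> aspan G S <= aspan G S'" using aspan_least[of S "aspan G S'"] aspan_subgroup aspan_incl by blast

end

lemma (in monoid) Units_pow_closed':
 "x:Units G ==> x [^] (n::nat):Units G" by (induction n) auto

lemma (in cring) Units_r_cancel:
 "u:Units R ==> x :[R] ==> y :[R] ==> x *. u = y *. u ==> x = y" by (metis Units_closed Units_l_cancel m_comm)

text \<open>A model-free description of \<open>R[1/g]\<close>: fractions have powers of g as
  denominators, and only g-power torsion dies. The universal property \<open>lift\<close> follows
  from this, so the polynomial quotient is opened only in
  \<open>loc_ring_localization\<close>.\<close>

locale localization = R: cring R + L: cring L
 for R (structure) and L (structure) and fi and g +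
 assumes phi: "fi:ring_hom R L" and g_carr: "g :[R]" and g_unit: "fi g:Units L"
  and frac: "y :[L] ==> EX b:carrier R. EX k::nat. y *[L] fi g ^[L] k = fi b"
  and ker: "b :[R] ==> fi b = \<zero>[L] ==> EX m::nat. g ^[R] m *[R] b = \<zero>[R]"
begin

sublocale H: ring_hom_cring R L fi using phi by unfold_locales auto

lemma phi_eqE:
 assumes "a :[R]" "b :[R]" "fi a = fi b"
 obtains m :: nat where "g ^[R] m *[R] a = g ^[R] m *[R] b"
proof -
 have "fi (a -[R] b) = \<zero>[L]" using assms by (simp add: a_minus_def L.r_neg)
 then obtain m :: nat where "g ^[R] m *[R] (a -[R] b) = \<zero>[R]" using ker[of "a -[R] b"] assms by auto
 hence "g ^[R] m *[R] a -[R] g ^[R] m *[R] b = \<zero>[R]" using assms g_carr by (simp add: R.r_distr R.r_minus R.minus_eq)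
 hence "g ^[R] m *[R] a = g ^[R] m *[R] b" using assms g_carr R.r_right_minus_eq by simp
 thus ?thesis by (rule that)
qed

lemma lift:
 assumes "cring S" and th: "th:ring_hom R S" and u: "th g:Units S"
 shows "EX ps:ring_hom L S. ALL b:carrier R. ps (fi b) = th b"
proof -
 interpret S: cring S by fact
 interpret T: ring_hom_cring R S th using th by unfold_locales auto
 define ps where "ps y = (let (b,k) = (SOME (b,k). b :[R] & y *[L] fi g ^[L] (k::nat) = fi b)
   in th b *[S] inv[S] (th g ^[S] k))" for y
 have up: "th g ^[S] (k::nat):Units S" for k using u S.Units_pow_closed' by blast
 \<comment> \<open>Every way to write y as a fraction computes \<open>ps y\<close>, not only the one
   chosen by \<open>SOME\<close>; the homomorphism laws then follow by cross-multiplication.\<close>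
 have key: "ps y *[S] th g ^[S] k = th b & ps y :[S]"
  if y: "y :[L]" and b: "b :[R]" and e: "y *[L] fi g ^[L] (k::nat) = fi b" for y b k
 proof -
  let ?P = "%(b,k). b :[R] & y *[L] fi g ^[L] (k::nat) = fi b"
  obtain b' k' where bk': "(SOME p. ?P p) = (b',k')" by fastforce
  have "?P (SOME p. ?P p)" by (rule someI[of ?P "(b,k)"]) (use b e in auto)
  hence b': "b' :[R]" and e': "y *[L] fi g ^[L] k' = fi b'" unfolding bk' by auto
  have psi: "ps y = th b' *[S] inv[S] (th g ^[S] k')" unfolding ps_def bk' by simp
  have c: "ps y :[S]" unfolding psi using b' up[of k'] by auto
  have psi': "ps y *[S] th g ^[S] k' = th b'" unfolding psi using b' up[of k'] g_carr by (simp add: S.m_assoc S.Units_l_inv)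
  have "fi (b' *[R] g ^[R] k) = fi b' *[L] fi g ^[L] k" using b' g_carr by simp
  also have "... = fi b *[L] fi g ^[L] k'" unfolding e[symmetric] e'[symmetric] using y g_carr by (simp add: L.m_ac)
  also have "... = fi (b *[R] g ^[R] k')" using b g_carr by simp
  finally obtain m :: nat where "g ^[R] m *[R] (b' *[R] g ^[R] k) = g ^[R] m *[R] (b *[R] g ^[R] k')"
   using phi_eqE b b' g_carr by (metis R.m_closed R.nat_pow_closed)
  hence "th (g ^[R] m *[R] (b' *[R] g ^[R] k)) = th (g ^[R] m *[R] (b *[R] g ^[R] k'))" by simp
  hence "th g ^[S] m *[S] (th b' *[S] th g ^[S] k) = th g ^[S] m *[S] (th b *[S] th g ^[S] k')" using b b' g_carr by simp
  hence "th b' *[S] th g ^[S] k = th b *[S] th g ^[S] k'" using up[of m] b b' g_carr by simp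
  hence "(ps y *[S] th g ^[S] k) *[S] th g ^[S] k' = th b *[S] th g ^[S] k'" unfolding psi'[symmetric] using c g_carr by (simp add: S.m_ac)
  hence "ps y *[S] th g ^[S] k = th b" using S.Units_r_cancel[OF up[of k']] c b g_carr by simp
  thus ?thesis using c by simp
 qed
 have hom: "ps:ring_hom L S"
 proof (rule ring_hom_memI)
  fix x y assume x: "x :[L]" and y: "y :[L]"
  obtain b k where b: "b :[R]" "x *[L] fi g ^[L] (k::nat) = fi b" using frac[OF x] by blast
  obtain c l where c: "c :[R]" "y *[L] fi g ^[L] (l::nat) = fi c" using frac[OF y] by blast
  note kb = key[OF x b] and kc = key[OF y c]
  show "ps x :[S]" using kb by simp
  have "(x *[L] y) *[L] fi g ^[L] (k+l) = (x *[L] fi g ^[L] k) *[L] (y *[L] fi g ^[L] l)"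
   using x y g_carr by (simp add: L.m_ac L.nat_pow_mult[symmetric])
  also have "... = fi (b *[R] c)" using b c by simp
  finally have "ps (x *[L] y) *[S] th g ^[S] (k+l) = th b *[S] th c" "ps (x *[L] y) :[S]" using key[of "x *[L] y" "b *[R] c" "k+l"] x y b c by auto
  moreover have "(ps x *[S] ps y) *[S] th g ^[S] (k+l) = (ps x *[S] th g ^[S] k) *[S] (ps y *[S] th g ^[S] l)"
   using conjunct2[OF kb] conjunct2[OF kc] g_carr by (simp add: S.m_ac S.nat_pow_mult[symmetric])
  ultimately show "ps (x *[L] y) = ps x *[S] ps y" using S.Units_r_cancel[OF up[of "k+l"]] kb kc by simp
  have "(x +[L] y) *[L] fi g ^[L] (k+l) = (x *[L] fi g ^[L] k) *[L] fi g ^[L] l +[L] (y *[L] fi g ^[L] l) *[L] fi g ^[L] k"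
   using x y g_carr by (simp add: L.m_ac L.l_distr L.r_distr L.nat_pow_mult[symmetric])
  also have "... = fi (b *[R] g ^[R] l +[R] c *[R] g ^[R] k)" using b c g_carr by simp
  finally have "ps (x +[L] y) *[S] th g ^[S] (k+l) = th (b *[R] g ^[R] l +[R] c *[R] g ^[R] k)" "ps (x +[L] y) :[S]"
   using key[of "x +[L] y" "b *[R] g ^[R] l +[R] c *[R] g ^[R] k" "k+l"] x y b c g_carr by auto
  moreover have "(ps x +[S] ps y) *[S] th g ^[S] (k+l) = (ps x *[S] th g ^[S] k) *[S] th g ^[S] l +[S] (ps y *[S] th g ^[S] l) *[S] th g ^[S] k"
   using conjunct2[OF kb] conjunct2[OF kc] g_carr by (simp add: S.m_ac S.l_distr S.r_distr S.nat_pow_mult[symmetric])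
  moreover have "... = th (b *[R] g ^[R] l +[R] c *[R] g ^[R] k)" using kb kc b c g_carr by simp
  ultimately show "ps (x +[L] y) = ps x +[S] ps y" using S.Units_r_cancel[OF up[of "k+l"]] kb kc by simp
 next
  have "ps \<one>[L] *[S] th g ^[S] (0::nat) = th \<one>[R]" "ps \<one>[L] :[S]" using key[of "\<one>[L]" "\<one>[R]" 0] by auto
  thus "ps \<one>[L] = \<one>[S]" by simp
 qed
 have "ps (fi b) = th b" if b: "b :[R]" for b using key[of "fi b" b 0] b by auto
 thus ?thesis using hom by blast
qed

end

text \<open>The kernel is the only real point: if b = h (gX - 1), comparing coefficients gives h_n =
  - g^n b, and since h has finite degree a power of g kills b. In the quotient X is the inverse of
  g.\<close>

lemma loc_ring_localization:
 fixes R :: "'a ring" (structure)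
 assumes "cring R" and g: "g :[R]"
 shows "localization R (loc_ring R g) (%a. loc_frac R g a 0) g"
  and "!!a k. a :[R] ==> loc_frac R g a k *[loc_ring R g] loc_frac R g g 0 ^[loc_ring R g] (k::nat) = loc_frac R g a 0"
  and "!!a k. a :[R] ==> loc_frac R g a k :[loc_ring R g]"
proof -
 interpret cring R by fact
 interpret U: UP_cring R "UP R" by unfold_locales auto
 let ?P = "UP R"
 let ?e = "up_ring.monom ?P g 1 -[?P] \<one>[?P]"
 have ec: "?e :[?P]" using g by simp
 interpret I: ideal "loc_ideal R g" ?P unfolding loc_ideal_def using ec by (intro U.P.genideal_ideal) auto
 let ?L = "loc_ring R g"
 interpret L: cring ?L unfolding loc_ring_def by (rule I.quotient_is_cring) unfold_locales
 let ?c = "%p. loc_ideal R g +>\<^bsub>?P\<^esub> p"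
 interpret c: ring_hom_cring ?P ?L ?c unfolding loc_ring_def using I.rcos_ring_hom_cring[OF U.P.is_cring] .
 have frac_c: "loc_frac R g a k = ?c (up_ring.monom ?P a k)" for a k by (simp add: loc_frac_def)
 have ceq: "?c p = ?c q \<longleftrightarrow> p -[?P] q:loc_ideal R g" if "p :[?P]" "q :[?P]" for p q
  using U.P.quotient_eq_iff_same_a_r_cos[OF I.ideal_axioms that] by simp
 have "?e:loc_ideal R g" unfolding loc_ideal_def by (rule U.P.genideal_self') (use ec in simp)
 hence c1: "?c (up_ring.monom ?P g 1) = \<one>[?L]" using ceq[of "up_ring.monom ?P g 1" "\<one>[?P]"] g by simp
 let ?x = "?c (up_ring.monom ?P \<one> 1)" and ?g = "?c (up_ring.monom ?P g 0)"
 have mon: "up_ring.monom ?P a k = up_ring.monom ?P a 0 *[?P] up_ring.monom ?P \<one> 1 ^[?P] k" if "a :[R]" for a k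
  using that by (simp add: U.monom_mult[symmetric] U.monom_pow del: U.monom_mult)
 have Xg: "?x *[?L] ?g = \<one>[?L]" unfolding c1[symmetric] using g
  by (simp add: c.hom_mult[symmetric] U.monom_mult[symmetric] del: c.hom_mult U.monom_mult)
 have Xc: "?x :[?L]" and gc: "?g :[?L]" using g by auto
 have gU: "?g:Units ?L" using Xg Xc gc L.m_comm[of ?x ?g] unfolding Units_def by auto
 have cm: "?c (up_ring.monom ?P a k) *[?L] ?g ^[?L] k = ?c (up_ring.monom ?P a 0)" if a: "a :[R]" for a and k :: nat
 proof -
  have "?c (up_ring.monom ?P a k) = ?c (up_ring.monom ?P a 0) *[?L] ?x ^[?L] k" unfolding mon[OF a, of k] using a by simp
  hence "?c (up_ring.monom ?P a k) *[?L] ?g ^[?L] k = ?c (up_ring.monom ?P a 0) *[?L] (?x *[?L] ?g) ^[?L] k"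
   using a g Xc gc by (simp add: L.nat_pow_distrib L.m_assoc)
  thus ?thesis unfolding Xg using a by simp
 qed
 thus "!!a k. a :[R] ==> loc_frac R g a k *[loc_ring R g] loc_frac R g g 0 ^[loc_ring R g] (k::nat) = loc_frac R g a 0" unfolding frac_c .
 show "!!a k. a :[R] ==> loc_frac R g a k :[?L]" unfolding frac_c by simp
 \<comment> \<open>S collects the polynomials whose class becomes a constant after multiplication by
   a power of g; it contains the monomials and is closed under sums.\<close>
 define S where "S = {p:carrier ?P. EX b:carrier R. EX k::nat. ?c p *[?L] ?g ^[?L] k = ?c (up_ring.monom ?P b 0)}"
 have Smon: "up_ring.monom ?P a k:S" if "a :[R]" for a k unfolding S_def using cm[OF that, of k] that by auto
 have Sadd: "p +[?P] q:S" if pq: "p:S" "q:S" for p q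
 proof -
  obtain b k where b: "p :[?P]" "b :[R]" "?c p *[?L] ?g ^[?L] (k::nat) = ?c (up_ring.monom ?P b 0)" using pq unfolding S_def by blast
  obtain b' l where b': "q :[?P]" "b' :[R]" "?c q *[?L] ?g ^[?L] (l::nat) = ?c (up_ring.monom ?P b' 0)" using pq unfolding S_def by blast
  have gp: "?g ^[?L] k = ?c (up_ring.monom ?P (g [^] k) 0)" for k :: nat
  proof -
   have "up_ring.monom ?P g 0 ^[?P] k = up_ring.monom ?P (g [^] k) 0"
    using g by (induction k) (auto simp: U.monom_mult[symmetric] simp del: U.monom_mult)
   thus ?thesis using g c.hom_pow[of "up_ring.monom ?P g 0" k] by simp
  qed
  have "?c (p +[?P] q) *[?L] ?g ^[?L] (k+l) =
    (?c p *[?L] ?g ^[?L] k) *[?L] ?g ^[?L] l +[?L] (?c q *[?L] ?g ^[?L] l) *[?L] ?g ^[?L] k"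
   using b(1) b'(1) gc by (simp add: L.m_ac L.l_distr L.r_distr L.nat_pow_mult[symmetric])
  also have "... = ?c (up_ring.monom ?P b 0) *[?L] ?g ^[?L] l +[?L] ?c (up_ring.monom ?P b' 0) *[?L] ?g ^[?L] k" unfolding b(3) b'(3) ..
  also have "... = ?c (up_ring.monom ?P (b *. g [^] l +. b' *. g [^] k) 0)" unfolding gp using b(2) b'(2) g
   by (simp add: c.hom_mult[symmetric] c.hom_add[symmetric] U.monom_mult[symmetric] del: c.hom_mult c.hom_add U.monom_mult)
  finally show ?thesis unfolding S_def using b b' g by blast
 qed
 have Sfin: "(\<Oplus>\<^bsub>?P\<^esub> i\<in>{..n}. up_ring.monom ?P (p i) i):S" if "!!i. p i :[R]" for p and n :: nat
 proof (induction n)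
  case 0 thus ?case using that Smon by (simp add: Pi_def)
 next
  case (Suc n) thus ?case using that Smon Sadd by (simp add: Pi_def)
 qed
 have Sall: "p:S" if p: "p :[?P]" for p using Sfin[of "up_ring.coeff ?P p" "UnivPoly.deg R p"] U.up_repr[OF p] p by simp
 show "localization R ?L (%a. loc_frac R g a 0) g"
 proof unfold_locales
  show "(%a. loc_frac R g a 0):ring_hom R ?L"
  proof (rule ring_hom_memI)
   fix x y assume "x :[R]" "y :[R]"
   thus "loc_frac R g (x *. y) 0 = loc_frac R g x 0 *[?L] loc_frac R g y 0" unfolding frac_c using U.monom_mult[of x y 0 0] by simp
  qed (auto simp: frac_c)
  show "g :[R]" by fact
  show "loc_frac R g g 0:Units ?L" unfolding frac_c by (rule gU)
  fix y assume "y :[?L]"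
  then obtain p where p: "p :[?P]" "y = ?c p" unfolding loc_ring_def FactRing_def A_RCOSETS_def' by auto
  from Sall[OF p(1)] show "EX b:carrier R. EX k::nat. y *[?L] loc_frac R g g 0 ^[?L] k = loc_frac R g b 0" unfolding frac_c S_def p by auto
 next
  fix b assume b: "b :[R]" and "loc_frac R g b 0 = \<zero>[?L]"
  hence "?c (up_ring.monom ?P b 0) = ?c \<zero>[?P]" unfolding frac_c by simp
  hence "up_ring.monom ?P b 0:loc_ideal R g" using ceq[of "up_ring.monom ?P b 0" "\<zero>[?P]"] b by (simp add: a_minus_def)
  hence "up_ring.monom ?P b 0:PIdl\<^bsub>?P\<^esub> ?e" unfolding loc_ideal_def using U.P.cgenideal_eq_genideal[OF ec] by simp
  then obtain h where h: "h :[?P]" and hb: "up_ring.monom ?P b 0 = h *[?P] ?e" unfolding cgenideal_def by auto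
  have "h *[?P] ?e = (up_ring.monom ?P g 1 *[?P] h) -[?P] h" using h g by (simp add: a_minus_def U.P.r_distr U.P.r_minus U.P.m_comm)
  hence co: "up_ring.coeff ?P (up_ring.monom ?P b 0) n = up_ring.coeff ?P (up_ring.monom ?P g 1 *[?P] h) n -. up_ring.coeff ?P h n" for n
   unfolding hb using h g by simp
  have h0: "up_ring.coeff ?P h 0 = -. b"
  proof -
   have "b = up_ring.coeff ?P (up_ring.monom ?P g 1 *[?P] h) 0 -. up_ring.coeff ?P h 0" using co[of 0] b by simp
   moreover have "up_ring.coeff ?P (up_ring.monom ?P g 1 *[?P] h) 0 = \<zero>" using h g by (simp)
   ultimately have "b = -. up_ring.coeff ?P h 0" using h by (simp add: a_minus_def)
   thus ?thesis using h by simp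
  qed
  have hS: "up_ring.coeff ?P h (Suc n) = g *. up_ring.coeff ?P h n" for n
  proof -
have "up_ring.coeff ?P (up_ring.monom ?P g 1 *[?P] h) (Suc n) -. up_ring.coeff ?P h (Suc n) = \<zero>"
    using co[of "Suc n"] b by (simp del: U.coeff_mult)
   hence "g *. up_ring.coeff ?P h n -. up_ring.coeff ?P h (Suc n) = \<zero>"
    using U.coeff_monom_mult[OF g h, of 1 n] by (simp add: add.commute del: U.coeff_mult)
   thus ?thesis using h g r_right_minus_eq by simp
  qed
  have hn: "up_ring.coeff ?P h n = g [^] n *. -. b" for n
  proof (induction n)
   case 0 thus ?case using h0 b by simp
  next
   case (Suc n) thus ?case using hS[of n] b g by (simp add: m_ac)
  qed
  have "up_ring.coeff ?P h (Suc (UnivPoly.deg R h)) = \<zero>" using h by (intro U.deg_aboveD) auto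
  hence "g [^] (Suc (UnivPoly.deg R h)) *. -. b = \<zero>" using hn[of "Suc (UnivPoly.deg R h)"] by simp
  hence "-. (g [^] (Suc (UnivPoly.deg R h)) *. b) = \<zero>" using b g r_minus by auto
  hence "g [^] (Suc (UnivPoly.deg R h)) *. b = \<zero>" using b g by (metis a_inv_closed m_closed minus_minus minus_zero nat_pow_closed)
  thus "EX m::nat. g [^] m *. b = \<zero>" by blast
 qed
qed

section \<open>Seminorms and Banach rings\<close>

text \<open>Definiteness and completeness are left out because these seminorms are often norms of a
  completion pulled back to an uncompleted ring.\<close>

locale seminormed_ring = cring R for R :: "'a ring" (structure) and q :: "'a => real" +
 assumes q_nonneg: "x :[R] ==> 0 <= q x"
  and q_zero: "q \<zero> = 0"
  and q_diff: "x :[R] ==> y :[R] ==> q (x -. y) <= max (q x) (q y)"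
  and q_mult: "x :[R] ==> y :[R] ==> q (x *. y) <= q x * q y"
begin

lemma q_neg: "x :[R] ==> q (-. x) = q x"
proof -
 assume x: "x :[R]"
 have le: "q (-. y) <= q y" if y: "y :[R]" for y using q_diff[of \<zero> y] y q_zero q_nonneg[of y] by (simp add: a_minus_def max_def)
 show ?thesis using le[of x] le[of "-. x"] x by simp
qed

lemma q_add: "x :[R] ==> y :[R] ==> q (x +. y) <= max (q x) (q y)" using q_diff[of x "-. y"] q_neg[of y] by (simp add: a_minus_def)

lemma q_minus_comm: "x :[R] ==> y :[R] ==> q (x -. y) = q (y -. x)" using q_neg[of "x -. y"] by (simp add: a_minus_def minus_add a_comm)

lemma diff_trans: "x :[R] ==> y :[R] ==> z :[R] ==> (x -. y) +. (y -. z) = x -. z" by (simp add: a_minus_def a_assoc r_neg1)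

lemma q_diff_trans: "x :[R] ==> y :[R] ==> z :[R] ==> q (x -. z) <= max (q (x -. y)) (q (y -. z))"
 using q_add[of "x -. y" "y -. z"] by (simp add: diff_trans)

lemma q_le_of_diff: "x :[R] ==> y :[R] ==> q (x -. y) <= e ==> q y <= e ==> q x <= e" using q_diff_trans[of x y \<zero>] by (simp add: a_minus_def)

definition qball :: "real => 'a set" where "qball e = {x:carrier R. q x <= e}"

lemma qball_subgroup: "0 <= e ==> additive_subgroup (qball e) R"
 by (rule additive_subgroupI_minus) (use q_zero in \<open>auto simp: qball_def intro: order_trans[OF q_diff]\<close>)

end

locale banach = fixes R :: "'a ring" (structure) and N :: "'a => real"
 assumes banach: "banach_ring R N"
begin

sublocale seminormed_ring R N
proof -
 interpret cring R using banach by (simp add: banach_ring_def)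
 show "seminormed_ring R N" by unfold_locales (use banach in \<open>auto simp: banach_ring_def\<close>)
qed

lemma N_eq_0: "x :[R] ==> N x = 0 \<longleftrightarrow> x = \<zero>" using banach by (auto simp: banach_ring_def)

lemma N_small_eq: "x :[R] ==> y :[R] ==> (!!e. e > 0 ==> N (x -. y) <= e) ==> x = y"
 using N_eq_0[of "x -. y"] q_nonneg[of "x -. y"] field_le_epsilon[of "N (x -. y)" 0] r_right_minus_eq[of x y] by fastforce

sublocale M: Metric_space "carrier R" "norm_dist R N"
proof unfold_locales
 show "0 <= norm_dist R N x y" for x y by (auto simp: norm_dist_def q_nonneg)
 show "norm_dist R N x y = norm_dist R N y x" for x y by (auto simp: norm_dist_def q_minus_comm)
 show "(norm_dist R N x y = 0) = (x = y)" if "x :[R]" "y :[R]" for x y using that by (auto simp: norm_dist_def N_eq_0)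
 show "norm_dist R N x z <= norm_dist R N x y + norm_dist R N y z"
  if "x :[R]" "y :[R]" "z :[R]" for x y z using that q_diff_trans[of x y z] q_nonneg[of "x -. y"] q_nonneg[of "y -. z"] by (auto simp: norm_dist_def)
qed

lemma topspace_norm [simp]: "topspace (norm_topology R N) = carrier R" by (simp add: norm_topology_def)

lemma openin_norm: "openin (norm_topology R N) W \<longleftrightarrow>
  W <= carrier R & (ALL x:W. EX e>0. ALL y:carrier R. N (y -. x) < e --> y:W)"
proof -
 have "M.mball x e <= W \<longleftrightarrow> (ALL y:carrier R. N (y -. x) < e --> y:W)" if "x :[R]" for x e
  using that unfolding M.mball_def by (auto simp: norm_dist_def q_minus_comm)
 thus ?thesis unfolding norm_topology_def M.openin_mtopology by blast
qed

lemma open_ball: "x :[R] ==> openin (norm_topology R N) {y:carrier R. N (y -. x) < e}" unfolding openin_norm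
proof (intro conjI ballI)
 fix z assume x: "x :[R]" and z: "z:{y:carrier R. N (y -. x) < e}"
 have "e > 0" using z x q_nonneg[of "z -. x"] by auto
 moreover have "N (y -. x) < e" if "y :[R]" "N (y -. z) < e" for y using q_diff_trans[of y z x] that x z by auto
 ultimately show "EX d>0. ALL y:carrier R. N (y -. z) < d --> y:{y:carrier R. N (y -. x) < e}" by auto
qed auto

lemma complete:
 fixes s :: "nat => 'a"
 assumes "!!n. s n :[R]"
  and c: "!!e. e > 0 ==> EX n0. ALL m>=n0. ALL n>=n0. N (s m -. s n) < e"
 shows "EX l:carrier R. ALL e>0. EX n0. ALL n>=n0. N (s n -. l) < e"
proof -
 have "M.MCauchy s" unfolding M.MCauchy_def using assms by (auto simp: norm_dist_def)
 moreover have "M.mcomplete" using banach by (simp add: banach_ring_def)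
 ultimately obtain l where l: "limitin M.mtopology s l sequentially" unfolding M.mcomplete_def by blast
 thus ?thesis unfolding M.limitin_metric eventually_sequentially using assms(1) by (auto simp: norm_dist_def) blast
qed

lemma topological_ring: "topological_ring R (norm_topology R N)"
proof -
 have 1: "continuous_map (prod_topology (norm_topology R N) (norm_topology R N)) (norm_topology R N) (%(x, y). f x y)"
  if f: "!!x y. x :[R] ==> y :[R] ==> f x y :[R]"
   and d: "!!x y e. x :[R] ==> y :[R] ==> e > 0 ==>
    EX d>0. ALL x':carrier R. ALL y':carrier R. N (x' -. x) < d & N (y' -. y) < d --> N (f x' y' -. f x y) < e" for f
 proof (rule continuous_map_eq_topcontinuous_at[THEN iffD2], rule ballI)
  fix p assume "p:topspace (prod_topology (norm_topology R N) (norm_topology R N))"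
  then obtain x y where p: "p = (x,y)" "x :[R]" "y :[R]" by auto
  show "topcontinuous_at (prod_topology (norm_topology R N) (norm_topology R N)) (norm_topology R N) (%(x, y). f x y) p"
   unfolding topcontinuous_at_def
  proof (intro conjI allI impI)
   fix V assume "openin (norm_topology R N) V & (case p of (x, y) => f x y):V"
   then obtain e where e: "e > 0" "ALL z:carrier R. N (z -. f x y) < e --> z:V" unfolding openin_norm p by auto
   obtain d where dd: "d > 0" "ALL x':carrier R. ALL y':carrier R. N (x' -. x) < d & N (y' -. y) < d --> N (f x' y' -. f x y) < e"
    using d[OF p(2,3) e(1)] by blast
   show "EX U. openin (prod_topology (norm_topology R N) (norm_topology R N)) U & p:U & (ALL z:U. (case z of (x, y) => f x y):V)"
   proof (intro exI conjI)
    show "openin (prod_topology (norm_topology R N) (norm_topology R N))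
      ({x':carrier R. N (x' -. x) < d} \<times> {y':carrier R. N (y' -. y) < d})" unfolding openin_prod_Times_iff using open_ball p by auto
   qed (use p dd e f q_zero in \<open>auto simp: a_minus_def r_neg\<close>)
  qed (use p f in auto)
 qed
 have add: "EX d>0. ALL x':carrier R. ALL y':carrier R. N (x' -. x) < d & N (y' -. y) < d --> N (x' +. y' -. (x +. y)) < e"
  if "x :[R]" "y :[R]" "e > 0" for x y e
 proof (intro exI[of _ e] conjI ballI impI)
  fix x' y' assume a: "x' :[R]" "y' :[R]" "N (x' -. x) < e & N (y' -. y) < e"
  have "x' +. y' -. (x +. y) = (x' -. x) +. (y' -. y)" using a that by (simp add: a_minus_def minus_add a_ac)
  thus "N (x' +. y' -. (x +. y)) < e" using q_add[of "x' -. x" "y' -. y"] a that by auto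
 qed (use that in auto)
 have mult: "EX d>0. ALL x':carrier R. ALL y':carrier R. N (x' -. x) < d & N (y' -. y) < d --> N (x' *. y' -. (x *. y)) < e"
  if xy: "x :[R]" "y :[R]" and e: "e > 0" for x y e
 proof -
  \<comment> \<open>The difference of the products is uv + uy + xv with u = x' - x and v = y' - y:
    \<open>d <= 1\<close> reduces the first term to u, and \<open>d * (1 + N x + N y) <= e\<close>
    bounds all three.\<close>
  define d where "d = min 1 (e / (1 + N x + N y))"
  have p: "1 + N x + N y > 0" using q_nonneg xy by (smt (verit))
  have d: "d > 0" "d <= 1" unfolding d_def using p e by auto
  have "d * (1 + N x + N y) <= e / (1 + N x + N y) * (1 + N x + N y)" using p unfolding d_def by (intro mult_right_mono) auto
  hence dp: "d * (1 + N x + N y) <= e" using p by simp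
  have "d * N x <= d * (1 + N x + N y)" "d * N y <= d * (1 + N x + N y)" "d * 1 <= d * (1 + N x + N y)"
   using d q_nonneg[of x] q_nonneg[of y] xy by (intro mult_left_mono; simp)+
  hence dN: "d * N x <= e" "d * N y <= e" "d * 1 <= e" using dp by linarith+
  show ?thesis
  proof (intro exI[of _ d] conjI ballI impI)
   fix x' y' assume a: "x' :[R]" "y' :[R]" "N (x' -. x) < d & N (y' -. y) < d"
   have eq: "x' *. y' -. (x *. y) = (x' -. x) *. (y' -. y) +. ((x' -. x) *. y +. x *. (y' -. y))" using a xy by algebra
   let ?u = "x' -. x" and ?v = "y' -. y"
   have uv: "?u :[R]" "?v :[R]" using a xy by auto
   have n: "0 <= N ?u" "0 <= N ?v" "0 <= N x" "0 <= N y" using uv xy q_nonneg by auto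
   have "N ?u * N ?v < e"
   proof -
    have "N ?u * N ?v <= N ?u * 1" using n a d by (intro mult_left_mono) auto
    also have "... < d * 1" using a by simp
    finally show ?thesis using dN by simp
   qed
   moreover have "N ?u * N y < e"
   proof (cases "N y = 0")
    case False hence "N ?u * N y < d * N y" using n a by (intro mult_strict_right_mono) auto
    thus ?thesis using dN by simp
   qed (use e in simp)
   moreover have "N x * N ?v < e"
   proof (cases "N x = 0")
    case False hence "N x * N ?v < N x * d" using n a by (intro mult_strict_left_mono) auto
    thus ?thesis using dN by (simp add: mult.commute)
   qed (use e in simp)
   ultimately have "N (?u *. ?v) < e" "N (?u *. y) < e" "N (x *. ?v) < e" using q_mult[of ?u ?v] q_mult[of ?u y] q_mult[of x ?v] uv xy by linarith+
   thus "N (x' *. y' -. (x *. y)) < e" unfolding eq using q_add[of "?u *. ?v" "?u *. y +. x *. ?v"] q_add[of "?u *. y" "x *. ?v"] uv xy by auto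
  qed (use d in auto)
 qed
 have neg: "continuous_map (norm_topology R N) (norm_topology R N) (%x. -. x)" unfolding continuous_map_def
 proof (intro conjI allI impI)
  fix U assume U: "openin (norm_topology R N) U"
  show "openin (norm_topology R N) {x:topspace (norm_topology R N). -. x:U}" unfolding openin_norm
  proof (intro conjI ballI)
   fix x assume x: "x:{x:topspace (norm_topology R N). -. x:U}"
   then obtain e where e: "e > 0" "ALL y:carrier R. N (y -. (-. x)) < e --> y:U" using U unfolding openin_norm by auto
   have "-. y:U" if y: "y :[R]" "N (y -. x) < e" for y
   proof -
    have "-. y -. (-. x) = -. (y -. x)" using x y by (simp add: a_minus_def minus_add)
    thus ?thesis using e(2) y x q_neg[of "y -. x"] by auto
   qed
   thus "EX e>0. ALL y:carrier R. N (y -. x) < e --> y:{x:topspace (norm_topology R N). -. x:U}" using e(1) by auto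
  qed auto
 qed auto
 show ?thesis unfolding topological_ring_def using 1[OF _ add] 1[OF _ mult] neg is_cring by auto
qed

end

text \<open>By additivity continuity at 0 is enough. Restriction maps between rational localizations
  are handled through this epsilon-delta form.\<close>

lemma continuous_map_norm_hom:
 assumes "banach R N" "banach S N'" "f:ring_hom R S"
 shows "continuous_map (norm_topology R N) (norm_topology S N') f \<longleftrightarrow>
  (ALL e>0. EX d>0. ALL x:carrier R. N x <= d --> N' (f x) <= e)"
proof -
 interpret R: banach R N by fact
 interpret S: banach S N' by fact
 interpret f: ring_hom_cring R S f using assms(3) by unfold_locales auto
 show ?thesis
 proof
  assume c: "continuous_map (norm_topology R N) (norm_topology S N') f"
  show "ALL e>0. EX d>0. ALL x:carrier R. N x <= d --> N' (f x) <= e"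
  proof (intro allI impI)
   fix e :: real assume e: "e > 0"
   have "openin (norm_topology R N) {x:topspace (norm_topology R N). f x:{y:carrier S. N' (y -[S] \<zero>[S]) < e}}"
    using c S.open_ball[of "\<zero>[S]" e] unfolding continuous_map_def by blast
   moreover have "\<zero>[R]:{x:topspace (norm_topology R N). f x:{y:carrier S. N' (y -[S] \<zero>[S]) < e}}"
    using e S.q_zero by (simp add: S.minus_eq)
   ultimately obtain d where d: "d > 0"
    "ALL y:carrier R. N (y -[R] \<zero>[R]) < d --> y:{x:topspace (norm_topology R N). f x:{y:carrier S. N' (y -[S] \<zero>[S]) < e}}"
    unfolding R.openin_norm by blast
   show "EX d>0. ALL x:carrier R. N x <= d --> N' (f x) <= e" using d by (intro exI[of _ "d/2"]) (auto simp: R.minus_eq S.minus_eq)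
  qed
 next
  assume h: "ALL e>0. EX d>0. ALL x:carrier R. N x <= d --> N' (f x) <= e"
  show "continuous_map (norm_topology R N) (norm_topology S N') f" unfolding continuous_map_def
  proof (intro conjI allI impI)
   fix U assume U: "openin (norm_topology S N') U"
   show "openin (norm_topology R N) {x:topspace (norm_topology R N). f x:U}" unfolding R.openin_norm
   proof (intro conjI ballI)
    fix x assume x: "x:{x:topspace (norm_topology R N). f x:U}"
    then obtain e where e: "e > 0" "ALL y:carrier S. N' (y -[S] f x) < e --> y:U" using U unfolding S.openin_norm by auto
    obtain d where d: "d > 0" "ALL x:carrier R. N x <= d --> N' (f x) <= e/2" using h[rule_format, of "e/2"] e by auto
    have "f y:U" if y: "y :[R]" "N (y -[R] x) < d" for y
    proof -
     have eq: "f y -[S] f x = f (y -[R] x)" using x y by (simp add: R.minus_eq S.minus_eq)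
     have "N' (f y -[S] f x) <= e/2" unfolding eq by (rule d(2)[rule_format]) (use x y in auto)
     thus ?thesis using e y by auto
    qed
    thus "EX e>0. ALL y:carrier R. N (y -[R] x) < e --> y:{x:topspace (norm_topology R N). f x:U}" using d(1) by auto
   qed auto
  qed auto
 qed
qed

section \<open>Subgroup topologies and completions\<close>

lemma (in ring) coset_iff:
 assumes "additive_subgroup U R" "x :[R]"
 shows "y:U +> x \<longleftrightarrow> y :[R] & y -. x:U"
proof -
 interpret abelian_subgroup U R by (rule abelian_subgroupI3[OF assms(1) abelian_group_axioms])
 show ?thesis using a_rcos_module_minus[OF ring_axioms assms(2), of y] a_elemrcos_carrier[OF assms(2), of y] by blast
qed

text \<open>The cosets are declared only as a subbasis; \<open>dir\<close> provides a common smaller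
  subgroup for any two, so that the cosets through a point form a basis of its
  neighbourhoods.\<close>

lemma openin_subgroup_topology:
 fixes R :: "'a ring" (structure)
 assumes "ring R" and ne: "\<U> ~= {}" and sub: "!!U. U:\<U> ==> additive_subgroup U R"
  and dir: "!!U V. U:\<U> ==> V:\<U> ==> EX W:\<U>. W <= U Int V"
 shows "openin (subgroup_topology R \<U>) Y \<longleftrightarrow>
  Y <= carrier R & (ALL x:Y. EX U:\<U>. ALL y:carrier R. y -. x:U --> y:Y)" (is "_ \<longleftrightarrow> ?Q Y")
proof -
 interpret ring R by fact
 show ?thesis
proof
 assume "openin (subgroup_topology R \<U>) Y"
 hence "generate_topology_on {U +> x |U x. U:\<U> & x :[R]} Y" unfolding subgroup_topology_def openin_topology_generated_by_iff .
 thus "?Q Y"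
 proof (induction rule: generate_topology_on.induct)
  case Empty thus ?case by simp
 next
  case (Int a b)
  show ?case
  proof (intro conjI ballI)
   fix x assume x: "x:a Int b"
   obtain U where U: "U:\<U>" "ALL y:carrier R. y -. x:U --> y:a" using Int(3) x by (meson IntD1)
   obtain V where V: "V:\<U>" "ALL y:carrier R. y -. x:V --> y:b" using Int(4) x by (meson IntD2)
   obtain W where "W:\<U>" "W <= U Int V" using dir[OF U(1) V(1)] by blast
   thus "EX U:\<U>. ALL y:carrier R. y -. x:U --> y:a Int b" using U V by (intro bexI[of _ W]) auto
  qed (use Int in auto)
 next
  case (UN K)
  show ?case
  proof (intro conjI ballI)
   show "\<Union>K <= carrier R" using UN by blast
   fix x assume "x:\<Union>K"
   then obtain k where k: "k:K" "x:k" by blast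
   then obtain U where "U:\<U>" "ALL y:carrier R. y -. x:U --> y:k" using UN(2)[OF k(1)] by meson
   thus "EX U:\<U>. ALL y:carrier R. y -. x:U --> y:\<Union>K" using k(1) by (meson UnionI)
  qed
 next
  case (Basis s)
  then obtain U x where s: "s = U +> x" "U:\<U>" "x :[R]" by auto
  note ci = coset_iff[OF sub[OF s(2)] s(3)]
  show ?case
  proof (intro conjI ballI)
   fix z assume z: "z:s"
   have "y:s" if y: "y :[R]" "y -. z:U" for y
   proof -
    have "y -. x = (y -. z) +. (z -. x)" using y z s ci by (simp add: a_minus_def a_assoc r_neg1)
    thus ?thesis using y z s ci additive_subgroup.a_closed[OF sub[OF s(2)]] by auto
   qed
   thus "EX U:\<U>. ALL y:carrier R. y -. z:U --> y:s" using s(2) by blast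
  qed (use ci s in auto)
 qed
next
 assume Q: "?Q Y"
 let ?B = "{U +> x |U x. U:\<U> & x :[R]}"
 have "EX W. openin (subgroup_topology R \<U>) W & x:W & W <= Y" if x: "x:Y" for x
 proof -
  obtain U where U: "U:\<U>" "ALL y:carrier R. y -. x:U --> y:Y" using Q x by blast
  have xc: "x :[R]" using Q x by blast
  have "openin (subgroup_topology R \<U>) (U +> x)" unfolding subgroup_topology_def by (rule topology_generated_by_Basis) (use U xc in blast)
  moreover have "x:U +> x" using coset_iff[OF sub[OF U(1)] xc] xc additive_subgroup.zero_closed[OF sub[OF U(1)]] by (simp add: a_minus_def r_neg)
  moreover have "U +> x <= Y" using U coset_iff[OF sub[OF U(1)] xc] by auto
  ultimately show ?thesis by blast
 qed
 thus "openin (subgroup_topology R \<U>) Y" by (subst openin_subopen) blast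
qed
qed

text \<open>Multiplication is continuous at the origin, and so is multiplication by each fixed
  element: this makes termwise products of Cauchy sequences Cauchy. For \<open>B[1/g]\<close> it is
  the second condition that rests on the openness of a rational ideal
  (\<open>L_smult\<close>).\<close>

locale completable = cring R for R :: "'a ring" (structure) and T +
 assumes open_carrier: "openin T (carrier R)"
  and open_mult: "U:open_subgroups R T ==> EX V:open_subgroups R T. ALL x:V. ALL y:V. x *. y:U"
  and open_smult: "U:open_subgroups R T ==> x :[R] ==> EX V:open_subgroups R T. ALL y:V. x *. y:U"
begin

abbreviation "\<O> \<equiv> open_subgroups R T"
abbreviation "C \<equiv> cauchy_ring R T"

lemma opD: "U:\<O> ==> additive_subgroup U R" "U:\<O> ==> openin T U" by (simp_all add: open_subgroups_def)

lemma op_closed: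
 assumes "U:\<O>"
 shows "\<zero>:U" "x:U ==> y:U ==> x +. y:U" "x:U ==> x :[R]" "x:U ==> y:U ==> x -. y:U"
  "x:U ==> -. x:U"
proof -
 note as = opD(1)[OF assms]
 show z: "\<zero>:U" by (rule additive_subgroup.zero_closed[OF as])
 show "x:U ==> y:U ==> x +. y:U" by (rule additive_subgroup.a_closed[OF as])
 show c: "x:U ==> x :[R]" for x by (rule additive_subgroup.a_Hcarr[OF as])
 show m: "x:U ==> y:U ==> x -. y:U" for x y by (rule additive_subgroup_minus_closed[OF as abelian_group_axioms])
 show "x:U ==> -. x:U" using m[OF z] c by (auto simp: a_minus_def)
qed

lemma op_Int: 
 assumes U: "U:\<O>" and V: "V:\<O>" shows "U Int V:\<O>"
proof -
 have "additive_subgroup (U Int V) R" by (rule additive_subgroupI_minus) (use op_closed[OF U] op_closed[OF V] in auto)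
 thus ?thesis using opD(2)[OF U] opD(2)[OF V] by (simp add: open_subgroups_def openin_Int)
qed

lemma op_carrier: "carrier R:\<O>"
proof -
 have "additive_subgroup (carrier R) R" by (rule additive_subgroupI_minus) auto
 thus ?thesis using open_carrier by (simp add: open_subgroups_def)
qed

lemma cauchyD: "s:cauchy_seqs R T ==> s n :[R]"
 "s:cauchy_seqs R T ==> U:\<O> ==> EX n0. ALL m>=n0. ALL n>=n0. s m -. s n:U" by (auto simp: cauchy_seqs_def)

lemma cauchy_const: "x :[R] ==> (%n. x):cauchy_seqs R T" using op_closed(1) by (auto simp: cauchy_seqs_def a_minus_def r_neg)

lemma cauchy_add:
 assumes s: "s:cauchy_seqs R T" and t: "t:cauchy_seqs R T"
 shows "(%n. s n +. t n):cauchy_seqs R T" unfolding cauchy_seqs_def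
proof (intro CollectI conjI allI ballI)
 fix U assume U: "U:\<O>"
 obtain n1 where n1: "ALL m>=n1. ALL n>=n1. s m -. s n:U" using cauchyD(2)[OF s U] by blast
 obtain n2 where n2: "ALL m>=n2. ALL n>=n2. t m -. t n:U" using cauchyD(2)[OF t U] by blast
 show "EX n0. ALL m>=n0. ALL n>=n0. s m +. t m -. (s n +. t n):U"
 proof (intro exI[of _ "max n1 n2"] allI impI)
  fix m n assume "max n1 n2 <= m" "max n1 n2 <= n"
  hence "(s m -. s n) +. (t m -. t n):U" using n1 n2 by (intro op_closed(2)[OF U]) auto
  moreover have "(s m -. s n) +. (t m -. t n) = s m +. t m -. (s n +. t n)"
   using cauchyD(1)[OF s] cauchyD(1)[OF t] by (simp add: a_minus_def minus_add a_ac)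
  ultimately show "s m +. t m -. (s n +. t n):U" by simp
 qed
qed (use cauchyD(1)[OF s] cauchyD(1)[OF t] in auto)

lemma cauchy_neg:
 assumes s: "s:cauchy_seqs R T"
 shows "(%n. -. s n):cauchy_seqs R T" unfolding cauchy_seqs_def
proof (intro CollectI conjI allI ballI)
 fix U assume U: "U:\<O>"
 obtain n1 where n1: "ALL m>=n1. ALL n>=n1. s m -. s n:U" using cauchyD(2)[OF s U] by blast
 show "EX n0. ALL m>=n0. ALL n>=n0. -. s m -. -. s n:U"
 proof (intro exI[of _ n1] allI impI)
  fix m n assume "n1 <= m" "n1 <= n"
  hence "-. (s m -. s n):U" using n1 by (intro op_closed(5)[OF U]) auto
  moreover have "-. (s m -. s n) = -. s m -. -. s n" using cauchyD(1)[OF s] by (simp add: a_minus_def minus_add a_ac)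
  ultimately show "-. s m -. -. s n:U" by simp
 qed
qed (use cauchyD(1)[OF s] in auto)

text \<open>Each summand is a product of two small differences, or a small difference times one of
  the fixed elements z and c. In \<open>cauchy_mult\<close> these are the terms of index k, fixed
  before the final smallness is chosen.\<close>

lemma mult_diff:
 assumes [simp]: "a :[R]" "b :[R]" "c :[R]" "x :[R]" "y :[R]" "z :[R]"
 shows "((a -. b) *. (x -. z) +. z *. (a -. b)) +. (c *. (x -. y) +. (b -. c) *. (x -. y)) = a *. x -. (b *. y)"
proof -
 have "(a -. b) *. (x -. z) +. z *. (a -. b) = (a -. b) *. ((x -. z) +. z)" by (simp add: r_distr m_comm)
 also have "(x -. z) +. z = x" by (simp add: a_minus_def a_assoc l_neg)
 finally have 1: "(a -. b) *. (x -. z) +. z *. (a -. b) = a *. x -. b *. x" by (simp add: a_minus_def l_distr l_minus)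
 have "c *. (x -. y) +. (b -. c) *. (x -. y) = (c +. (b -. c)) *. (x -. y)" by (simp add: l_distr)
 also have "c +. (b -. c) = b" by (simp add: a_minus_def a_lcomm r_neg)
 finally have 2: "c *. (x -. y) +. (b -. c) *. (x -. y) = b *. x -. b *. y" by (simp add: a_minus_def r_distr r_minus)
 show ?thesis unfolding 1 2 by (simp add: a_minus_def a_assoc r_neg1)
qed

lemma cauchy_mult:
 assumes s: "s:cauchy_seqs R T" and t: "t:cauchy_seqs R T"
 shows "(%n. s n *. t n):cauchy_seqs R T" unfolding cauchy_seqs_def
proof (intro CollectI conjI allI ballI)
 fix U assume U: "U:\<O>"
 note sc = cauchyD(1)[OF s] and tc = cauchyD(1)[OF t]
 obtain V where V: "V:\<O>" "ALL x:V. ALL y:V. x *. y:U" using open_mult[OF U] by blast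
 obtain n1 where n1: "ALL m>=n1. ALL n>=n1. s m -. s n:V" using cauchyD(2)[OF s V(1)] by blast
 obtain n2 where n2: "ALL m>=n2. ALL n>=n2. t m -. t n:V" using cauchyD(2)[OF t V(1)] by blast
 define k where "k = max n1 n2"
 obtain V1 where V1: "V1:\<O>" "ALL y:V1. s k *. y:U" using open_smult[OF U sc] by blast
 obtain V2 where V2: "V2:\<O>" "ALL y:V2. t k *. y:U" using open_smult[OF U tc] by blast
 obtain n3 where n3: "ALL m>=n3. ALL n>=n3. t m -. t n:V1" using cauchyD(2)[OF t V1(1)] by blast
 obtain n4 where n4: "ALL m>=n4. ALL n>=n4. s m -. s n:V2" using cauchyD(2)[OF s V2(1)] by blast
 show "EX n0. ALL m>=n0. ALL n>=n0. s m *. t m -. (s n *. t n):U"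
 proof (intro exI[of _ "max k (max n3 n4)"] allI impI)
  fix m n assume mn: "max k (max n3 n4) <= m" "max k (max n3 n4) <= n"
  have ge: "m >= n1" "n >= n1" "k >= n1" "m >= n2" "n >= n2" "k >= n2" "m >= n3" "n >= n3" "m >= n4" "n >= n4" using mn by (auto simp: k_def)
  have "(s m -. s n) *. (t m -. t k):U" "(s n -. s k) *. (t m -. t n):U"
   "t k *. (s m -. s n):U" "s k *. (t m -. t n):U" using V(2) V1(2) V2(2) n1 n2 n3 n4 ge by blast+
  hence "((s m -. s n) *. (t m -. t k) +. t k *. (s m -. s n)) +. (s k *. (t m -. t n) +. (s n -. s k) *. (t m -. t n)):U"
   by (auto intro!: op_closed(2)[OF U])
  moreover have "((s m -. s n) *. (t m -. t k) +. t k *. (s m -. s n)) +. (s k *. (t m -. t n) +. (s n -. s k) *. (t m -. t n))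
    = s m *. t m -. (s n *. t n)" by (rule mult_diff) (use sc tc in auto)
  ultimately show "s m *. t m -. (s n *. t n):U" by simp
 qed
qed (use cauchyD(1)[OF s] cauchyD(1)[OF t] in auto)

lemma C_simps [simp]: "carrier C = cauchy_seqs R T" "s *[C] t = (%n. s n *. t n)" "s +[C] t = (%n. s n +. t n)"
 "\<one>[C] = (%n. \<one>)" "\<zero>[C] = (%n. \<zero>)" by (auto simp: cauchy_ring_def)

lemma cring_C: "cring C"
proof (rule cringI)
 show "abelian_group C"
 proof (rule abelian_groupI)
  fix s assume s: "s :[C]"
  thus "EX y:carrier C. y +[C] s = \<zero>[C]" using cauchy_neg[of s] cauchyD(1)[of s] by (intro bexI[of _ "%n. -. s n"]) (auto simp: l_neg)
 qed (auto simp: cauchy_add cauchy_const a_ac cauchyD)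
 show "comm_monoid C" by (rule comm_monoidI) (auto simp: cauchy_mult cauchy_const m_ac cauchyD)
qed (auto simp: l_distr cauchyD)

lemma C_neg: "s:cauchy_seqs R T ==> -[C] s = (%n. -. s n)"
 by (rule abelian_group.minus_equality[OF ring.is_abelian_group[OF cring.axioms(1)[OF cring_C]]])
   (auto simp: cauchy_neg cauchyD l_neg)

lemma C_minus: "s:cauchy_seqs R T ==> t:cauchy_seqs R T ==> s -[C] t = (%n. s n -. t n)" by (simp add: a_minus_def C_neg)

lemma nullD: "s:null_seqs R T ==> s n :[R]"
 "s:null_seqs R T ==> U:\<O> ==> EX n0. ALL n>=n0. s n:U" by (auto simp: null_seqs_def)

lemma null_cauchy:
 assumes s: "s:null_seqs R T" shows "s:cauchy_seqs R T" unfolding cauchy_seqs_def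
proof (intro CollectI conjI allI ballI)
 fix U assume U: "U:\<O>"
 show "EX n0. ALL m>=n0. ALL n>=n0. s m -. s n:U" using nullD(2)[OF s U] op_closed(4)[OF U] by blast
qed (use nullD[OF s] in auto)

lemma null_ideal: "ideal (null_seqs R T) C"
proof (rule idealI)
 interpret C: cring C by (rule cring_C)
 show "ring C" by (rule C.ring_axioms)
 have "additive_subgroup (null_seqs R T) C"
 proof (rule C.additive_subgroupI_minus)
  fix s t assume s: "s:null_seqs R T" and t: "t:null_seqs R T"
  have "(%n. s n -. t n):null_seqs R T" unfolding null_seqs_def
  proof (intro CollectI conjI allI ballI)
   fix U assume U: "U:\<O>"
   obtain n1 n2 where "ALL n>=n1. s n:U" "ALL n>=n2. t n:U" using nullD(2)[OF s U] nullD(2)[OF t U] by blast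
   thus "EX n0. ALL n>=n0. s n -. t n:U" by (intro exI[of _ "max n1 n2"] allI impI op_closed(4)[OF U]) auto
  qed (use nullD(1)[OF s] nullD(1)[OF t] in auto)
  thus "s -[C] t:null_seqs R T" using C_minus null_cauchy s t by simp
 qed (auto simp: null_cauchy null_seqs_def op_closed)
 thus "subgroup (null_seqs R T) (add_monoid C)" by (rule additive_subgroup.a_subgroup)
 have m: "(%n. t n *. s n):null_seqs R T" if s: "s:null_seqs R T" and t: "t:cauchy_seqs R T" for s t unfolding null_seqs_def
 proof (intro CollectI conjI allI ballI)
  fix U assume U: "U:\<O>"
  obtain V where V: "V:\<O>" "ALL x:V. ALL y:V. x *. y:U" using open_mult[OF U] by blast
  obtain k where k: "ALL m>=k. ALL n>=k. t m -. t n:V" using cauchyD(2)[OF t V(1)] by blast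
  obtain V2 where V2: "V2:\<O>" "ALL y:V2. t k *. y:U" using open_smult[OF U cauchyD(1)[OF t]] by blast
  obtain n1 where n1: "ALL n>=n1. s n:V Int V2" using nullD(2)[OF s op_Int[OF V(1) V2(1)]] by blast
  have "t n *. s n:U" if "n >= max n1 k" for n
  proof -
   have "(t n -. t k) *. s n +. t k *. s n = ((t n -. t k) +. t k) *. s n"
    using cauchyD(1)[OF t, of n] cauchyD(1)[OF t, of k] nullD(1)[OF s, of n] by (simp add: l_distr)
   also have "(t n -. t k) +. t k = t n" using cauchyD(1)[OF t, of n] cauchyD(1)[OF t, of k] by (simp add: a_minus_def a_assoc l_neg)
   finally have "t n *. s n = (t n -. t k) *. s n +. t k *. s n" by simp
   moreover have "(t n -. t k) *. s n:U" using V n1 k that by auto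
   moreover have "t k *. s n:U" using V2 n1 that by auto
   ultimately show ?thesis using op_closed(2)[OF U] by auto
  qed
  thus "EX n0. ALL n>=n0. t n *. s n:U" by blast
 qed (use nullD(1)[OF s] cauchyD(1)[OF t] in auto)
 show "x *[C] a:null_seqs R T" if "a:null_seqs R T" "x :[C]" for a x using m that by auto
 thus "a *[C] x:null_seqs R T" if "a:null_seqs R T" "x :[C]" for a x
 proof -
  have "a *[C] x = x *[C] a" using that nullD(1)[of a] cauchyD(1)[of x] by (auto simp: m_comm)
  thus ?thesis using m[of a x] that by simp
 qed
qed

abbreviation "cls \<equiv> (%s. null_seqs R T +>\<^bsub>C\<^esub> s)"

lemma cring_Q: "cring (completion R T)" unfolding completion_def by (rule ideal.quotient_is_cring[OF null_ideal cring_C])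

lemma cls_hom: "ring_hom_cring C (completion R T) cls" unfolding completion_def by (rule ideal.rcos_ring_hom_cring[OF null_ideal cring_C])

lemma completion_map_hom: "completion_map R T:ring_hom R (completion R T)"
proof -
 have "completion_map R T = (%x. cls (%n. x))" by (auto simp: completion_map_def)
 moreover have "(%x n. x):ring_hom R C" by (rule ring_hom_memI) (auto simp: cauchy_const)
 moreover have "cls:ring_hom C (completion R T)" by (rule ring_hom_cring.homh[OF cls_hom])
 ultimately show ?thesis using ring_hom_trans[of "%x n. x" R C cls "completion R T"] by (simp add: comp_def)
qed

lemma completion_cases:
 assumes "c :[completion R T]"
 obtains s where "s:cauchy_seqs R T" "c = cls s" using assms unfolding completion_def FactRing_def A_RCOSETS_def' by auto

lemma cls_mem: "s:cauchy_seqs R T ==> t:cls s \<longleftrightarrow> t:cauchy_seqs R T & t -[C] s:null_seqs R T"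
 using ring.coset_iff[OF cring.axioms(1)[OF cring_C] ideal.axioms(1)[OF null_ideal], of s t] by simp

text \<open>An open subgroup absorbs null sequences, so the existential over representatives in
  \<open>completion_nbhd\<close> may be tested on any one of them.\<close>

lemma cls_nbhd:
 assumes s: "s:cauchy_seqs R T" and U: "U:\<O>"
 shows "cls s:completion_nbhd R T U \<longleftrightarrow> (EX n0. ALL n>=n0. s n:U)"
proof
 assume "cls s:completion_nbhd R T U"
 then obtain t n0 where t: "t:cls s" "ALL n>=n0. t n:U" unfolding completion_nbhd_def by blast
 hence "t:cauchy_seqs R T" "t -[C] s:null_seqs R T" using cls_mem[OF s] by auto
 hence tn: "(%n. t n -. s n):null_seqs R T" and tc: "t:cauchy_seqs R T" using C_minus s by auto
 obtain n1 where n1: "ALL n>=n1. t n -. s n:U" using nullD(2)[OF tn U] by blast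
 have "s n:U" if "n >= max n0 n1" for n
 proof -
  have "t n -. (t n -. s n):U" using t n1 that op_closed(4)[OF U, of "t n" "t n -. s n"] by simp
  moreover have "t n -. (t n -. s n) = s n" using cauchyD(1)[OF tc, of n] cauchyD(1)[OF s, of n] by algebra
  ultimately show ?thesis by simp
 qed
 thus "EX n0. ALL n>=n0. s n:U" by blast
next
 assume h: "EX n0. ALL n>=n0. s n:U"
 have "s -[C] s:null_seqs R T" using C_minus[OF s s] cauchyD(1)[OF s] op_closed(1) by (simp add: null_seqs_def r_neg a_minus_def)
 hence "s:cls s" using cls_mem[OF s, of s] s by simp
 moreover have "cls s :[completion R T]" using ring_hom_closed[OF ring_hom_cring.homh[OF cls_hom]] s by simp
 ultimately show "cls s:completion_nbhd R T U" unfolding completion_nbhd_def using h by blast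
qed

lemma nbhd_subgroup:
 assumes U: "U:\<O>" shows "additive_subgroup (completion_nbhd R T U) (completion R T)"
proof -
 interpret C: cring C by (rule cring_C)
 interpret Q: cring "completion R T" by (rule cring_Q)
 interpret cls: ring_hom_cring C "completion R T" cls by (rule cls_hom)
 show ?thesis
proof (rule Q.additive_subgroupI_minus)
 show "completion_nbhd R T U <= carrier (completion R T)" by (auto simp: completion_nbhd_def)
 show "\<zero>[completion R T]:completion_nbhd R T U" using cls_nbhd[OF cauchy_const[OF zero_closed] U] op_closed(1)[OF U] cls.hom_zero by auto
 fix x y assume x: "x:completion_nbhd R T U" and y: "y:completion_nbhd R T U"
 obtain s t where st: "s:cauchy_seqs R T" "x = cls s" "t:cauchy_seqs R T" "y = cls t"
 proof -
  have "x :[completion R T]" "y :[completion R T]" using x y by (auto simp: completion_nbhd_def)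
  thus ?thesis using completion_cases[of x] completion_cases[of y] that by metis
 qed
 obtain n1 n2 where "ALL n>=n1. s n:U" "ALL n>=n2. t n:U" using x y st cls_nbhd U by blast
 hence "EX n0. ALL n>=n0. (s -[C] t) n:U" unfolding C_minus[OF st(1,3)] by (intro exI[of _ "max n1 n2"] allI impI op_closed(4)[OF U]) auto
 hence "cls (s -[C] t):completion_nbhd R T U" using cls_nbhd[OF _ U, of "s -[C] t"] C.minus_closed st by auto
 moreover have "cls (s -[C] t) = x -[completion R T] y" unfolding st using st by (simp add: C_simps(1)[symmetric] C.minus_eq Q.minus_eq del: C_simps)
 ultimately show "x -[completion R T] y:completion_nbhd R T U" by simp
qed
qed

lemma openin_completion: "openin (completion_topology R T) Y \<longleftrightarrow>
  Y <= carrier (completion R T) &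
  (ALL x:Y. EX U:\<O>. ALL y:carrier (completion R T). y -[completion R T] x:completion_nbhd R T U --> y:Y)"
proof -
 have "EX W:completion_nbhd R T ` \<O>. W <= A Int B" if AB: "A:completion_nbhd R T ` \<O>" "B:completion_nbhd R T ` \<O>" for A B
 proof -
  obtain U V where UV: "U:\<O>" "A = completion_nbhd R T U" "V:\<O>" "B = completion_nbhd R T V" using AB by auto
  thus ?thesis by (intro bexI[of _ "completion_nbhd R T (U Int V)"] imageI op_Int) (auto simp: completion_nbhd_def)
 qed
 note dir = this
 have ne: "completion_nbhd R T ` \<O> ~= {}" using op_carrier by blast
 have sub: "additive_subgroup U (completion R T)" if "U:completion_nbhd R T ` \<O>" for U using nbhd_subgroup that by auto
 have "openin (subgroup_topology (completion R T) (completion_nbhd R T ` \<O>)) Y \<longleftrightarrow>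
  Y <= carrier (completion R T) &
  (ALL x:Y. EX U:completion_nbhd R T ` \<O>. ALL y:carrier (completion R T). y -[completion R T] x:U --> y:Y)"
  by (rule openin_subgroup_topology[OF cring.axioms(1)[OF cring_Q] ne sub dir])
 thus ?thesis unfolding completion_topology_def by (simp only: bex_simps)
qed

text \<open>The form in which the completion is used later: small values of the pulled-back norm and
  open subgroups of R control each other, and the image of R is dense.\<close>

lemma completion_normed:
 assumes "banach_ring (completion R T) N" "norm_topology (completion R T) N = completion_topology R T"
 shows "!!U. U:\<O> ==> EX e>0. ALL x:carrier R. N (completion_map R T x) <= e --> x:U"
  and "!!e. e > 0 ==> EX U:\<O>. ALL x:U. N (completion_map R T x) <= e"
  and "!!c e. c :[completion R T] ==> e > 0 ==>
    EX x:carrier R. N (c -[completion R T] completion_map R T x) <= e"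
proof -
 interpret C: cring C by (rule cring_C)
 interpret Q: cring "completion R T" by (rule cring_Q)
 interpret cls: ring_hom_cring C "completion R T" cls by (rule cls_hom)
 interpret B: banach "completion R T" N by unfold_locales fact
 interpret cm: ring_hom_cring R "completion R T" "completion_map R T" using completion_map_hom by unfold_locales auto
 have m0: "y -[completion R T] \<zero>[completion R T] = y" if "y :[completion R T]" for y using that by (simp add: Q.minus_eq)
 have nb: "EX U:\<O>. ALL y:completion_nbhd R T U. N y <= e" if e: "e > 0" for e
 proof -
  let ?W = "{y:carrier (completion R T). N (y -[completion R T] \<zero>[completion R T]) < e}"
  have op: "openin (completion_topology R T) ?W" unfolding assms(2)[symmetric] by (rule B.open_ball) auto
  have "N (\<zero>[completion R T] -[completion R T] \<zero>[completion R T]) = 0" by (subst m0) (auto simp: B.q_zero)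
  hence z: "\<zero>[completion R T]:?W" using e by simp
  have all: "ALL x:?W. EX U:\<O>. ALL y:carrier (completion R T). y -[completion R T] x:completion_nbhd R T U --> y:?W"
   by (rule conjunct2[OF iffD1[OF openin_completion op]])
  obtain U where U: "U:\<O>" "ALL y:carrier (completion R T). y -[completion R T] \<zero>[completion R T]:completion_nbhd R T U
     --> y:?W" using bspec[OF all z] by (elim bexE)
  have "completion_nbhd R T U <= carrier (completion R T)" by (auto simp: completion_nbhd_def)
  hence "ALL y:completion_nbhd R T U. N y <= e" using U(2) m0 by (auto simp: less_imp_le)
  thus ?thesis using U(1) by blast
 qed
 show "EX e>0. ALL x:carrier R. N (completion_map R T x) <= e --> x:U" if U: "U:\<O>" for U
 proof -
  have "openin (completion_topology R T) (completion_nbhd R T U)" unfolding openin_completion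
  proof (intro conjI ballI)
   show "completion_nbhd R T U <= carrier (completion R T)" by (auto simp: completion_nbhd_def)
   fix x assume x: "x:completion_nbhd R T U"
   have "y:completion_nbhd R T U" if y: "y :[completion R T]" "y -[completion R T] x:completion_nbhd R T U" for y
   proof -
    have xc: "x :[completion R T]" using x by (auto simp: completion_nbhd_def)
    have "(y -[completion R T] x) +[completion R T] x:completion_nbhd R T U" using additive_subgroup.a_closed[OF nbhd_subgroup[OF U]] x y by blast
    moreover have "(y -[completion R T] x) +[completion R T] x = y" using y xc by (simp add: Q.minus_eq Q.a_assoc Q.l_neg)
    ultimately show ?thesis by simp
   qed
   thus "EX V:\<O>. ALL y:carrier (completion R T). y -[completion R T] x:completion_nbhd R T V --> y:completion_nbhd R T U" using U by blast
  qed
  hence "openin (norm_topology (completion R T) N) (completion_nbhd R T U)" unfolding assms(2) .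
  then obtain e where e: "e > 0" "ALL y:carrier (completion R T). N (y -[completion R T] \<zero>[completion R T]) < e --> y:completion_nbhd R T U"
   unfolding B.openin_norm using additive_subgroup.zero_closed[OF nbhd_subgroup[OF U]] by meson
  have "x:U" if x: "x :[R]" "N (completion_map R T x) <= e/2" for x
  proof -
   have "completion_map R T x:completion_nbhd R T U" using e x m0 by auto
   hence "cls (%n. x):completion_nbhd R T U" by (simp add: completion_map_def)
   thus "x:U" using cls_nbhd[OF cauchy_const[OF x(1)] U] by blast
  qed
  thus ?thesis using e(1) by (intro exI[of _ "e/2"]) auto
 qed
 show "EX U:\<O>. ALL x:U. N (completion_map R T x) <= e" if e: "e > 0" for e
 proof -
  obtain U where U: "U:\<O>" "ALL y:completion_nbhd R T U. N y <= e" using nb[OF e] by blast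
  have "completion_map R T x:completion_nbhd R T U" if "x:U" for x
   using cls_nbhd[OF cauchy_const U(1), of x] that op_closed(3)[OF U(1)] by (auto simp: completion_map_def)
  thus ?thesis using U by blast
 qed
 show "EX x:carrier R. N (c -[completion R T] completion_map R T x) <= e"
  if c: "c :[completion R T]" and e: "e > 0" for c e
 proof -
  obtain U where U: "U:\<O>" "ALL y:completion_nbhd R T U. N y <= e" using nb[OF e] by blast
  obtain s where s: "s:cauchy_seqs R T" "c = cls s" using completion_cases[OF c] by blast
  obtain k where k: "ALL m>=k. ALL n>=k. s m -. s n:U" using cauchyD(2)[OF s(1) U(1)] by blast
  have kc: "(%n. s k):cauchy_seqs R T" using cauchy_const cauchyD(1)[OF s(1)] by blast
  have "c -[completion R T] completion_map R T (s k) = cls (s -[C] (%n. s k))"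
   unfolding s(2) completion_map_def using s(1) kc by (simp add: C_simps(1)[symmetric] C.minus_eq Q.minus_eq del: C_simps)
  moreover have "cls (s -[C] (%n. s k)):completion_nbhd R T U"
  proof (subst cls_nbhd[OF _ U(1)])
   show "s -[C] (%n. s k):cauchy_seqs R T" using C.minus_closed s kc by simp
   show "EX n0. ALL n>=n0. (s -[C] (%n. s k)) n:U" using k by (auto simp: C_minus s kc)
  qed
  ultimately have "N (c -[completion R T] completion_map R T (s k)) <= e" using U(2) by simp
  thus ?thesis using cauchyD(1)[OF s(1), of k] by blast
 qed
qed

end

section \<open>Huber rings\<close>

lemma (in abelian_group) aspanI: "x:S ==> x:aspan G S" using aspan_incl by (rule subsetD)

lemma (in cring) additive_subgroup_mult_preimage:
 assumes Z: "additive_subgroup Z R" and x: "x :[R]"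
 shows "additive_subgroup {z:carrier R. x *. z:Z} R"
proof (rule additive_subgroupI_minus)
 show "\<zero>:{z:carrier R. x *. z:Z}" using x additive_subgroup.zero_closed[OF Z] by simp
 fix a b assume "a:{z:carrier R. x *. z:Z}" "b:{z:carrier R. x *. z:Z}"
 hence ab: "a :[R]" "b :[R]" "x *. a:Z" "x *. b:Z" by auto
 have "x *. a -. x *. b:Z" using additive_subgroup_minus_closed[OF Z abelian_group_axioms ab(3,4)] .
 moreover have "x *. (a -. b) = x *. a -. x *. b" using x ab by (simp add: a_minus_def r_distr r_minus)
 ultimately show "a -. b:{z:carrier R. x *. z:Z}" using ab by simp
qed auto

lemma (in ring_hom_cring) hom_minus: "x :[R] ==> y :[R] ==> h (x -. y) = h x -[S] h y" by (simp add: a_minus_def)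

lemma (in ring_hom_cring) additive_subgroup_preimage:
 assumes Z: "additive_subgroup Z S"
 shows "additive_subgroup {x:carrier R. h x:Z} R"
proof (rule R.additive_subgroupI_minus)
 show "\<zero>:{x:carrier R. h x:Z}" using additive_subgroup.zero_closed[OF Z] by simp
 fix a b assume "a:{x:carrier R. h x:Z}" "b:{x:carrier R. h x:Z}"
 hence ab: "a :[R]" "b :[R]" "h a:Z" "h b:Z" by auto
 have "h a -[S] h b:Z" using additive_subgroup_minus_closed[OF Z S.abelian_group_axioms ab(3,4)] .
 thus "a -. b:{x:carrier R. h x:Z}" using ab by (simp add: hom_minus)
qed auto

lemma (in ring_hom_cring) additive_subgroup_image:
 assumes Z: "additive_subgroup Z R"
 shows "additive_subgroup (h ` Z) S"
proof (rule S.additive_subgroupI_minus)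
 show "h ` Z <= carrier S" using additive_subgroup.a_subset[OF Z] by auto
 show "\<zero>[S]:h ` Z" using additive_subgroup.zero_closed[OF Z] hom_zero by (metis image_eqI)
 fix a b assume "a:h ` Z" "b:h ` Z"
 then obtain x y where xy: "x:Z" "a = h x" "y:Z" "b = h y" by auto
 have c: "x :[R]" "y :[R]" using xy additive_subgroup.a_subset[OF Z] by auto
 have "x -. y:Z" using additive_subgroup_minus_closed[OF Z R.abelian_group_axioms xy(1,3)] .
 thus "a -[S] b:h ` Z" unfolding xy using hom_minus[OF c] by (metis image_eqI)
qed

locale topring = cring B for B :: "'a ring" (structure) and T +
 assumes tr: "topological_ring B T"
begin

lemma topspace_T: "topspace T = carrier B" using tr by (simp add: topological_ring_def)

lemma open_preimage_add:
 assumes "openin T U" "a :[B]"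
 shows "openin T {y:carrier B. y +. a:U}"
proof -
 have "continuous_map T (prod_topology T T) (%y. (y, a))" using assms(2) topspace_T by (intro continuous_map_pairedI) auto
 hence "continuous_map T T ((%(x, y). x +. y) \<circ> (%y. (y, a)))" using tr unfolding topological_ring_def by (intro continuous_map_compose) auto
 thus ?thesis using assms(1) unfolding continuous_map_def topspace_T by auto
qed

lemma open_preimage_mult:
 assumes "openin T U" "a :[B]"
 shows "openin T {y:carrier B. a *. y:U}"
proof -
 have "continuous_map T (prod_topology T T) (%y. (a, y))" using assms(2) topspace_T by (intro continuous_map_pairedI) auto
 hence "continuous_map T T ((%(x, y). x *. y) \<circ> (%y. (a, y)))" using tr unfolding topological_ring_def by (intro continuous_map_compose) auto
 thus ?thesis using assms(1) unfolding continuous_map_def topspace_T by auto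
qed

lemma open_subgroup:
 assumes U: "additive_subgroup U B" and W: "openin T W" "\<zero>:W" "W <= U"
 shows "openin T U"
proof -
 have "EX V. openin T V & x:V & V <= U" if x: "x:U" for x
 proof (intro exI conjI)
  have xc: "x :[B]" using additive_subgroup.a_Hcarr[OF U x] .
  show "openin T {y:carrier B. y +. -. x:W}" using open_preimage_add W(1) xc by simp
  show "x:{y:carrier B. y +. -. x:W}" using xc W(2) by (simp add: r_neg)
  show "{y:carrier B. y +. -. x:W} <= U"
  proof
   fix y assume "y:{y:carrier B. y +. -. x:W}"
   hence y: "y :[B]" "y +. -. x:U" using W(3) by auto
   have "(y +. -. x) +. x:U" using additive_subgroup.a_closed[OF U y(2) x] .
   thus "y:U" using y(1) xc by (simp add: a_assoc l_neg)
  qed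
 qed
 thus ?thesis by (subst openin_subopen) blast
qed

end

section \<open>Open subgroups of a Huber ring\<close>

locale hub = fixes B :: "'a ring" (structure) and T and P
 assumes hp: "huber_pair B T P"
begin

sublocale topring B T
proof -
 have t: "topological_ring B T" using hp by (simp add: huber_pair_def huber_ring_def)
 then interpret cring B by (simp add: topological_ring_def)
 show "topring B T" by unfold_locales (rule t)
qed

abbreviation "\<U> \<equiv> open_subgroups B T"

lemma UD: "U:\<U> ==> additive_subgroup U B" "U:\<U> ==> openin T U" by (simp_all add: open_subgroups_def)

lemma U_carr: "U:\<U> ==> U <= carrier B" by (rule additive_subgroup.a_subset[OF UD(1)])

lemma U_zero: "U:\<U> ==> \<zero>:U" by (rule additive_subgroup.zero_closed[OF UD(1)])

lemma U_Int: "U:\<U> ==> V:\<U> ==> U Int V:\<U>"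
proof -
 assume U: "U:\<U>" and V: "V:\<U>"
 have "additive_subgroup (U Int V) B" by (rule additive_subgroupI_minus)
    (use U_carr[OF U] U_zero[OF U] U_zero[OF V] additive_subgroup_minus_closed[OF UD(1)[OF U] abelian_group_axioms]
     additive_subgroup_minus_closed[OF UD(1)[OF V] abelian_group_axioms] in auto)
 thus ?thesis using UD(2)[OF U] UD(2)[OF V] by (simp add: open_subgroups_def openin_Int)
qed

lemma U_carrier: "carrier B:\<U>"
proof -
 have "additive_subgroup (carrier B) B" by (rule additive_subgroupI_minus) auto
 thus ?thesis using openin_topspace[of T] topspace_T by (simp add: open_subgroups_def)
qed

lemma U_superset: "additive_subgroup U B ==> V:\<U> ==> V <= U ==> U:\<U>" unfolding open_subgroups_def[of B T] mem_Collect_eq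
 using open_subgroup[of U V] additive_subgroup.zero_closed[of V B] by simp

text \<open>Of a ring of definition and an ideal of definition only the following two consequences are used.\<close>

lemma huber_basis:
 "(ALL W. openin T W & \<zero>:W --> (EX U:\<U>. U <= W)) &
  (ALL W:\<U>. EX S. finite S & S <= W & (ALL U:\<U>. EX V:\<U>. V <= aspan B {t *. u |t u. t:S & u:U}))"
proof -
 obtain A S where A: "subring A B" "openin T A" and S: "finite S" "S <= A"
  and ad: "adic_on B T A (genideal (B\<lparr>carrier := A\<rparr>) S)" using hp by (auto simp: huber_pair_def huber_ring_def)
 let ?A = "B\<lparr>carrier := A\<rparr>"
 let ?I = "genideal ?A S"
 have Ac: "A <= carrier B" using subringE(1)[OF A(1)] .
 interpret A: cring ?A by (rule subcring_iff[OF Ac, THEN iffD1]) (rule subcringI'[OF A(1)])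
 have idI: "ideal ?I ?A" using A.genideal_ideal S(2) by simp
 define J where "J n = ?I ^[ideals_set ?A] (n::nat)" for n
 have J0: "J 0 = A" by (simp add: J_def ideals_set_def)
 have JS: "J (Suc n) = ideal_prod ?A (J n) ?I" for n by (simp add: J_def ideals_set_def)
 have idJ: "ideal (J n) ?A" for n
 proof (induction n)
  case 0 show ?case unfolding J0 using A.oneideal by simp
 next
  case (Suc n) show ?case unfolding JS using A.ideal_prod_is_ideal[OF Suc idI] .
 qed
 have JA: "J n <= A" for n using additive_subgroup.a_subset[OF ideal.axioms(1)[OF idJ]] by simp
 have subJ: "additive_subgroup (J n) B" for n
 proof (rule additive_subgroupI_minus)
  show "J n <= carrier B" using JA Ac by blast
  show "\<zero>:J n" using additive_subgroup.zero_closed[OF ideal.axioms(1)[OF idJ]] by simp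
  fix x y assume x: "x:J n" and y: "y:J n"
  have "-. \<one>:A" using subringE(3,5)[OF A(1)] by blast
  hence "(-. \<one>) *. y:J n" using ideal.I_l_closed[OF idJ, of y n "-. \<one>"] y by simp
  moreover have "(-. \<one>) *. y = -. y" using y JA Ac by (auto simp: l_minus subset_eq)
  ultimately have "x +. (-. y):J n" using additive_subgroup.a_closed[OF ideal.axioms(1)[OF idJ[of n]], of x "-. y"] x by simp
  thus "x -. y:J n" by (simp add: a_minus_def)
 qed
 have JU: "J n:\<U>" for n using subJ ad by (simp add: open_subgroups_def adic_on_def J_def)
 have basis: "EX n. J n <= W" if "openin T W" "\<zero>:W" for W using ad that by (auto simp: adic_on_def J_def)
 have AJ: "a *. x:J n" if "a:A" "x:J n" for a x n using ideal.I_l_closed[OF idJ that(2), of a] that by simp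
 \<comment> \<open>The finitely many n-fold products of the generators of I, which generate its n-th
   power.\<close>
 define Sn where "Sn = rec_nat {\<one>} (%_ Q. {t *. s |t s. t:Q & s:S})"
 have Sn0: "Sn 0 = {\<one>}" and SnS: "Sn (Suc n) = {t *. s |t s. t:Sn n & s:S}" for n by (simp_all add: Sn_def)
 have finSn: "finite (Sn n)" for n
 proof (induction n)
  case (Suc n)
  have "Sn (Suc n) = (%(t,s). t *. s) ` (Sn n \<times> S)" unfolding SnS by auto
  thus ?case using Suc S(1) by simp
 qed (simp add: Sn0)
 have SI: "S <= ?I" using A.genideal_self S(2) by simp
 have SnJ: "Sn n <= J n" for n
 proof (induction n)
  case 0 thus ?case unfolding Sn0 J0 using subringE(3)[OF A(1)] by simp
 next
  case (Suc n) thus ?case unfolding SnS JS using SI ideal_prod.prod[of _ "J n" _ ?I ?A] by fastforce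
 qed
 have Snc: "Sn n <= carrier B" for n using SnJ JA Ac by blast
 let ?sp = "%Q U. aspan B {t *. u |t u. t:Q & u:U}"
 have spc: "{t *. u |t u. t:Q & u:U} <= carrier B" if "Q <= carrier B" "U <= carrier B" for Q U using that by auto
 have sps: "additive_subgroup (?sp Q U) B" if "Q <= carrier B" "U <= carrier B" for Q U by (rule aspan_subgroup[OF spc[OF that]])
 have spI: "t *. u:?sp Q U" if "t:Q" "u:U" for t u Q U by (rule aspanI) (use that in blast)
 have Jc: "J n <= carrier B" for n using JA Ac by blast
 have Sc: "S <= carrier B" using S(2) Ac by blast
 \<comment> \<open>The x in A with \<open>J k\<close> x inside the span form an ideal of A
   containing S, hence containing I. This trades coefficients in A for coefficients in the ideal
   \<open>J k\<close>.\<close>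
 have step: "J (Suc k) <= ?sp S (J k)" for k
 proof -
  let ?Z = "{x:A. ALL u:J k. u *. x:?sp S (J k)}"
  note sp = sps[OF Sc Jc[of k]]
  have "ideal ?Z ?A"
  proof (rule idealI)
   show "ring ?A" by (rule A.ring_axioms)
   have "additive_subgroup ?Z ?A"
   proof (rule A.additive_subgroupI_minus)
    show "?Z <= carrier ?A" by auto
    show "\<zero>[?A]:?Z" using subringE(2)[OF A(1)] additive_subgroup.zero_closed[OF sp] Jc[of k] by (auto simp: subset_eq)
    fix x y assume "x:?Z" "y:?Z"
    hence xy: "x:A" "y:A" "ALL u:J k. u *. x:?sp S (J k)" "ALL u:J k. u *. y:?sp S (J k)" by auto
    have ny: "-[?A] y = -. y"
    proof (rule A.minus_equality)
     show "-. y +[?A] y = \<zero>[?A]" using xy Ac by (auto simp: l_neg)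
     show "y :[?A]" "-. y :[?A]" using xy subringE(5)[OF A(1)] by auto
    qed
    have "u *. (x -. y):?sp S (J k)" if u: "u:J k" for u
    proof -
     have "u *. (x -. y) = u *. x -. u *. y" using u xy Jc Ac by (auto simp: a_minus_def r_distr r_minus subset_eq)
     thus ?thesis using additive_subgroup_minus_closed[OF sp abelian_group_axioms] xy u by simp
    qed
    moreover have "x -. y:A" using xy subringE(5,7)[OF A(1)] by (auto simp: a_minus_def)
    ultimately show "x -[?A] y:?Z" unfolding a_minus_def[of ?A] ny by (simp add: a_minus_def)
   qed
   thus "subgroup ?Z (add_monoid ?A)" by (rule additive_subgroup.a_subgroup)
   fix a x assume "a:?Z" "x :[?A]"
   hence ax: "a:A" "x:A" "ALL u:J k. u *. a:?sp S (J k)" by auto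
   have "u *. (x *. a):?sp S (J k)" if u: "u:J k" for u
   proof -
    have "(x *. u) *. a:?sp S (J k)" using ax AJ u by blast
    moreover have "(x *. u) *. a = u *. (x *. a)" using ax u Ac Jc[of k] by (simp add: m_ac subset_eq)
    ultimately show ?thesis by simp
   qed
   moreover have "x *. a:A" using ax subringE(6)[OF A(1)] by blast
   ultimately have xa: "x *. a:?Z" by blast
   thus "x *[?A] a:?Z" by simp
   have "a :[B]" "x :[B]" using ax(1,2) Ac by auto
   hence "a *. x = x *. a" by (rule m_comm)
   thus "a *[?A] x:?Z" using xa by simp
  qed
  moreover have "S <= ?Z"
  proof
   fix s assume s: "s:S"
   have "u *. s:?sp S (J k)" if u: "u:J k" for u
   proof -
    have "s *. u:?sp S (J k)" by (rule spI[OF s u])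
    thus ?thesis using m_comm[of u s] s u Sc Jc[of k] by (auto simp: subset_eq)
   qed
   thus "s:?Z" using s S(2) by auto
  qed
  ultimately have IZ: "?I <= ?Z" using A.genideal_minimal by blast
  show ?thesis
  proof
   fix x assume "x:J (Suc k)"
   thus "x:?sp S (J k)" unfolding JS
   proof (induction rule: ideal_prod.induct)
    case (prod i j) thus ?case using IZ by auto
   next
    case (sum s1 s2) thus ?case using additive_subgroup.a_closed[OF sp] by simp
   qed
  qed
 qed
 \<comment> \<open>With \<open>J n\<close> inside W and \<open>J k\<close> inside U this yields the
   second claim: finitely many elements of W whose multiples by U span a neighbourhood of 0.\<close>
 have main: "J (n + k) <= ?sp (Sn n) (J k)" for n k
 proof (induction n arbitrary: k)
  case 0
  show ?case
  proof
   fix x assume x: "x:J (0 + k)"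
   have "\<one> *. x:?sp (Sn 0) (J k)" using x by (intro spI) (simp_all add: Sn0)
   thus "x:?sp (Sn 0) (J k)" using x Jc by (auto simp: subset_eq)
  qed
 next
  case (Suc n)
  have "J (Suc n + k) <= ?sp (Sn n) (J (Suc k))" using Suc[of "Suc k"] by simp
  also have "... <= ?sp (Sn (Suc n)) (J k)"
  proof (rule aspan_least)
   note sp = sps[OF Snc[of "Suc n"] Jc[of k]]
   show "additive_subgroup (?sp (Sn (Suc n)) (J k)) B" by (rule sp)
   show "{t *. u |t u. t:Sn n & u:J (Suc k)} <= ?sp (Sn (Suc n)) (J k)"
   proof clarify
    fix t u assume t: "t:Sn n" and u: "u:J (Suc k)"
    have tc: "t :[B]" using t Snc by blast
    have "?sp S (J k) <= {z:carrier B. t *. z:?sp (Sn (Suc n)) (J k)}"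
    proof (rule aspan_least)
     show "additive_subgroup {z:carrier B. t *. z:?sp (Sn (Suc n)) (J k)} B" by (rule additive_subgroup_mult_preimage[OF sp tc])
     show "{t *. u |t u. t:S & u:J k} <= {z:carrier B. t *. z:?sp (Sn (Suc n)) (J k)}"
     proof clarify
      fix s v assume s: "s:S" and v: "v:J k"
      have c: "s :[B]" "v :[B]" using s v Sc Jc by auto
      have "t *. s:Sn (Suc n)" unfolding SnS using t s by blast
      hence "(t *. s) *. v:?sp (Sn (Suc n)) (J k)" using v by (rule spI)
      thus "s *. v :[B] & t *. (s *. v):?sp (Sn (Suc n)) (J k)" using tc c by (simp add: m_assoc)
     qed
    qed
    thus "t *. u:?sp (Sn (Suc n)) (J k)" using step u by blast
   qed
  qed
  finally show ?case .
 qed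
 show ?thesis
 proof (intro conjI allI impI ballI)
  fix W assume "openin T W & \<zero>:W" thus "EX U:\<U>. U <= W" using basis JU by blast
 next
  fix W assume W: "W:\<U>"
  then obtain n where n: "J n <= W" using basis UD(2) U_zero by blast
  show "EX S. finite S & S <= W & (ALL U:\<U>. EX V:\<U>. V <= aspan B {t *. u |t u. t:S & u:U})"
  proof (intro exI[of _ "Sn n"] conjI ballI finSn)
   show "Sn n <= W" using SnJ n by blast
   fix U assume U: "U:\<U>"
   then obtain k where k: "J k <= U" using basis UD(2) U_zero by blast
   have "J (n + k) <= ?sp (Sn n) (J k)" by (rule main)
   also have "... <= ?sp (Sn n) U" using k by (intro aspan_mono spc[OF Snc U_carr[OF U]]) auto
   finally show "EX V:\<U>. V <= aspan B {t *. u |t u. t:Sn n & u:U}" using JU by blast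
  qed
 qed
qed

lemma U_basis: "openin T W ==> \<zero>:W ==> EX U:\<U>. U <= W" by (rule conjunct1[OF huber_basis, rule_format, OF conjI])

lemma U_smult:
 assumes U: "U:\<U>" and a: "a :[B]" shows "EX V:\<U>. ALL v:V. a *. v:U"
proof -
 have "EX V:\<U>. V <= {y:carrier B. a *. y:U}" by (rule U_basis[OF open_preimage_mult[OF UD(2)[OF U] a]]) (use a U_zero[OF U] in auto)
 thus ?thesis by auto
qed

lemma U_mult:
 assumes U: "U:\<U>" shows "EX V:\<U>. ALL v:V. ALL w:V. v *. w:U"
proof -
 have "continuous_map (prod_topology T T) T (%(x, y). x *. y)" using tr by (simp add: topological_ring_def)
 hence o: "openin (prod_topology T T) {p:topspace (prod_topology T T). (case p of (x, y) => x *. y):U}"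
  using UD(2)[OF U] unfolding continuous_map_def by blast
 have z: "(\<zero>,\<zero>):{p:topspace (prod_topology T T). (case p of (x, y) => x *. y):U}" using U_zero[OF U] topspace_T by simp
 obtain W1 W2 where W: "openin T W1" "openin T W2" "\<zero>:W1" "\<zero>:W2"
  "W1 \<times> W2 <= {p:topspace (prod_topology T T). (case p of (x, y) => x *. y):U}"
  using iffD1[OF openin_prod_topology_alt o, rule_format, OF z] by (elim exE conjE)
 obtain V where V: "V:\<U>" "V <= W1 Int W2" using U_basis[of "W1 Int W2"] W by (auto simp: openin_Int)
 have "v *. w:U" if "v:V" "w:V" for v w
 proof -
  have "(v, w):W1 \<times> W2" using that V(2) by blast
  from subsetD[OF W(5) this] show ?thesis by simp
 qed
 thus ?thesis using V(1) by (intro bexI[of _ V]) auto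
qed

section \<open>The uncompleted localization \<open>B[1/g]\<close> and its neighbourhoods
  \<open>Mn D U\<close> of 0\<close>

definition okd :: "'a datum => bool" where
 "okd D \<longleftrightarrow> fst D <= carrier B & snd D :[B]"

definition L :: "'a datum => (nat => 'a) set ring" where "L D = loc_ring B (snd D)"
definition ph :: "'a datum => 'a => (nat => 'a) set" where "ph D b = loc_frac B (snd D) b 0"
definition fr :: "'a datum => 'a => (nat => 'a) set" where "fr D b = loc_frac B (snd D) b 1"
definition Mn :: "'a datum => 'a set => (nat => 'a) set set" where "Mn D U = loc_nbhd B (fst D) (snd D) U"

lemma loc: "okd D ==> localization B (L D) (ph D) (snd D)"
proof -
 assume "okd D"
 moreover have "ph D = (%a. loc_frac B (snd D) a 0)" by (auto simp: ph_def)
 ultimately show ?thesis using loc_ring_localization(1)[OF is_cring, of "snd D"] unfolding okd_def L_def by simp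
qed

lemma cring_L: "okd D ==> cring (L D)" by (rule localization.axioms(2)[OF loc])

lemma ph_hom: "okd D ==> ring_hom_cring B (L D) (ph D)" by (rule ring_hom_cringI[OF is_cring cring_L localization.phi[OF loc]])

lemma ph_closed: "okd D ==> b :[B] ==> ph D b :[L D]" by (rule ring_hom_closed[OF localization.phi[OF loc], where x = b])

lemma g_unit: "okd D ==> ph D (snd D):Units (L D)" by (rule localization.g_unit[OF loc])

lemma fr_carr: "okd D ==> b :[B] ==> fr D b :[L D]" using loc_ring_localization(3)[OF is_cring, of "snd D" b 1] by (simp add: okd_def fr_def L_def)

lemma fr_mult: "okd D ==> b :[B] ==> fr D b *[L D] ph D (snd D) = ph D b"
proof -
 assume D: "okd D" and b: "b :[B]"
 interpret L: cring "L D" by (rule cring_L[OF D])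
 have "fr D b *[L D] ph D (snd D) ^[L D] (1::nat) = ph D b"
  using loc_ring_localization(2)[OF is_cring, of "snd D" b 1] D b unfolding okd_def fr_def L_def ph_def by blast
 thus ?thesis using ph_closed[OF D] D by (simp add: okd_def)
qed

lemma fr_eq: "okd D ==> b :[B] ==> fr D b = ph D b *[L D] inv[L D] (ph D (snd D))"
proof -
 assume D: "okd D" and b: "b :[B]"
 interpret L: cring "L D" by (rule cring_L[OF D])
 have "ph D b *[L D] inv[L D] (ph D (snd D)) = (fr D b *[L D] ph D (snd D)) *[L D] inv[L D] (ph D (snd D))" by (simp only: fr_mult[OF D b])
 also have "... = fr D b" using fr_carr[OF D b] g_unit[OF D] by (simp add: L.m_assoc L.Units_closed)
 finally show ?thesis by simp
qed

definition gensM :: "'a datum => 'a set => (nat => 'a) set set" where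
 "gensM D U = {d *[L D] ph D u |d u. d:generate_ring (L D) (fr D ` fst D) & u:U}"

lemma Mn_aspan: "Mn D U = aspan (L D) (gensM D U)"
proof -
 have fr': "fr D = (%f. loc_frac B (snd D) f 1)" by (rule ext) (simp only: fr_def)
 show ?thesis unfolding Mn_def loc_nbhd_def aspan_def gensM_def L_def ph_def fr' by (rule refl)
qed

lemma gr_carr: "okd D ==> d:generate_ring (L D) (fr D ` fst D) ==> d :[L D]"
proof -
 assume D: "okd D" and d: "d:generate_ring (L D) (fr D ` fst D)"
 have "fr D ` fst D <= carrier (L D)" using fr_carr[OF D] D by (auto simp only: okd_def)
 thus ?thesis using ring.generate_ring_in_carrier[OF cring.axioms(1)[OF cring_L[OF D]] _ d] by blast
qed

lemma gensM_carr: "okd D ==> U <= carrier B ==> gensM D U <= carrier (L D)"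
proof -
 assume D: "okd D" and U: "U <= carrier B"
 interpret L: cring "L D" by (rule cring_L[OF D])
 interpret h: ring_hom_cring B "L D" "ph D" by (rule ph_hom[OF D])
 show ?thesis unfolding gensM_def using gr_carr[OF D] U by auto
qed

lemma Mn_subgroup: "okd D ==> U <= carrier B ==> additive_subgroup (Mn D U) (L D)"
 unfolding Mn_aspan using abelian_group.aspan_subgroup[OF ring.is_abelian_group[OF cring.axioms(1)[OF cring_L]] gensM_carr] .

lemma Mn_carr: "okd D ==> U <= carrier B ==> Mn D U <= carrier (L D)" using additive_subgroup.a_subset[OF Mn_subgroup] .

lemma Mn_ph: "okd D ==> U <= carrier B ==> u:U ==> ph D u:Mn D U"
proof -
 assume D: "okd D" and U: "U <= carrier B" "u:U"
 interpret L: cring "L D" by (rule cring_L[OF D])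
 interpret h: ring_hom_cring B "L D" "ph D" by (rule ph_hom[OF D])
 have "\<one>[L D] *[L D] ph D u:gensM D U" unfolding gensM_def using U generate_ring.one by blast
 thus ?thesis unfolding Mn_aspan using L.aspanI[of "\<one>[L D] *[L D] ph D u" "gensM D U"] U by (auto simp: subset_eq)
qed

lemma Mn_fr: assumes D: "okd D" and U: "U <= carrier B" and f: "f:fst D" and z: "z:Mn D U"
 shows "fr D f *[L D] z:Mn D U"
proof -
 interpret L: cring "L D" by (rule cring_L[OF D])
 interpret h: ring_hom_cring B "L D" "ph D" by (rule ph_hom[OF D])
 have fc: "fr D f :[L D]" using fr_carr[OF D] f D by (auto simp: okd_def)
 have "Mn D U <= {z:carrier (L D). fr D f *[L D] z:Mn D U}" unfolding Mn_aspan[of D U]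
 proof (rule L.aspan_least)
  show "additive_subgroup {z:carrier (L D). fr D f *[L D] z:aspan (L D) (gensM D U)} (L D)"
   using L.additive_subgroup_mult_preimage[OF Mn_subgroup[OF D U] fc] unfolding Mn_aspan .
  show "gensM D U <= {z:carrier (L D). fr D f *[L D] z:aspan (L D) (gensM D U)}"
  proof
   fix x assume x: "x:gensM D U"
   then obtain d u where du: "x = d *[L D] ph D u" "d:generate_ring (L D) (fr D ` fst D)" "u:U" unfolding gensM_def by blast
   have "fr D f:generate_ring (L D) (fr D ` fst D)" using f by (intro generate_ring.incl) auto
   hence "(fr D f *[L D] d) *[L D] ph D u:gensM D U" unfolding gensM_def using generate_ring.eng_mult[OF _ du(2)] du(3) by blast
   moreover have "(fr D f *[L D] d) *[L D] ph D u = fr D f *[L D] x"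
    unfolding du(1) using fc gr_carr[OF D du(2)] U du(3) by (simp add: L.m_assoc subset_eq)
   ultimately have "fr D f *[L D] x:gensM D U" by simp
   thus "x:{z:carrier (L D). fr D f *[L D] z:aspan (L D) (gensM D U)}" using L.aspanI gensM_carr[OF D U] x by auto
  qed
 qed
 thus ?thesis using z by blast
qed

text \<open>The induction principle for \<open>Mn D U\<close>: a subgroup need only contain the
  image of U and absorb multiplication by the fractions f/g, since every element of the ring they
  generate then preserves it.\<close>

lemma Mn_least: assumes D: "okd D" and U: "U <= carrier B" and Z: "additive_subgroup Z (L D)"
 and 1: "!!u. u:U ==> ph D u:Z" and 2: "!!f z. f:fst D ==> z:Z ==> fr D f *[L D] z:Z"
 shows "Mn D U <= Z"
proof -
 interpret L: cring "L D" by (rule cring_L[OF D])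
 interpret h: ring_hom_cring B "L D" "ph D" by (rule ph_hom[OF D])
 have Zc: "z :[L D]" if "z:Z" for z using additive_subgroup.a_Hcarr[OF Z that] .
 have dZ: "d :[L D] & (ALL z:Z. d *[L D] z:Z)" if "d:generate_ring (L D) (fr D ` fst D)" for d using that
 proof (induction rule: generate_ring.induct)
  case one thus ?case using Zc by simp
 next
  case (incl h) thus ?case using 2 fr_carr[OF D] D by (auto simp: okd_def)
 next
  case (a_inv h)
  hence "-[L D] h *[L D] z:Z" if "z:Z" for z
   using additive_subgroup_minus_closed[OF Z L.abelian_group_axioms additive_subgroup.zero_closed[OF Z], of "h *[L D] z"] that Zc[OF that]
   by (simp add: L.l_minus L.minus_eq)
  thus ?case using a_inv by simp
 next
  case (eng_add h1 h2)
  thus ?case using additive_subgroup.a_closed[OF Z] Zc by (simp add: L.l_distr)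
 next
  case (eng_mult h1 h2)
  thus ?case using Zc by (simp add: L.m_assoc)
 qed
 show ?thesis unfolding Mn_aspan
 proof (rule L.aspan_least[OF _ Z])
  show "gensM D U <= Z" unfolding gensM_def using dZ 1 by auto
 qed
qed

lemma Mn_mono: "okd D ==> U <= V ==> V <= carrier B ==> Mn D U <= Mn D V"
proof -
 assume D: "okd D" and UV: "U <= V" and V: "V <= carrier B"
 show ?thesis
 proof (rule Mn_least[OF D _ Mn_subgroup[OF D V]])
  show "U <= carrier B" using UV V by simp
  show "ph D u:Mn D V" if "u:U" for u by (rule Mn_ph[OF D V]) (use that UV in blast)
  show "fr D f *[L D] z:Mn D V" if "f:fst D" "z:Mn D V" for f z by (rule Mn_fr[OF D V that])
 qed
qed

lemma Mn_mult:
 assumes D: "okd D" and c: "U <= carrier B" "V <= carrier B" "W <= carrier B"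
  and m: "!!u v. u:U ==> v:V ==> u *. v:W" and z: "z:Mn D U" and w: "w:Mn D V"
 shows "z *[L D] w:Mn D W"
proof -
 interpret L: cring "L D" by (rule cring_L[OF D])
 interpret h: ring_hom_cring B "L D" "ph D" by (rule ph_hom[OF D])
 note W = Mn_subgroup[OF D c(3)]
 have frc: "f:fst D ==> fr D f :[L D]" for f using fr_carr[OF D] D by (auto simp: okd_def)
 have 1: "z *[L D] ph D v:Mn D W" if v: "v:V" for v
 proof -
  have vc: "ph D v :[L D]" using v c by auto
  have "Mn D U <= {z:carrier (L D). ph D v *[L D] z:Mn D W}"
  proof (rule Mn_least[OF D c(1) L.additive_subgroup_mult_preimage[OF W vc]])
   fix u assume u: "u:U"
   hence "ph D (u *. v):Mn D W" using m v Mn_ph[OF D c(3)] by blast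
   moreover have "u :[B]" "v :[B]" using u v c by auto
   ultimately show "ph D u:{z:carrier (L D). ph D v *[L D] z:Mn D W}" by (simp add: L.m_comm)
  next
   fix f z assume f: "f:fst D" and z: "z:{z:carrier (L D). ph D v *[L D] z:Mn D W}"
   thus "fr D f *[L D] z:{z:carrier (L D). ph D v *[L D] z:Mn D W}"
    using Mn_fr[OF D c(3) f, of "ph D v *[L D] z"] frc[OF f] vc by (simp add: L.m_lcomm)
  qed
  thus ?thesis using z vc by (auto simp: L.m_comm)
 qed
 have zc: "z :[L D]" using z Mn_carr[OF D c(1)] by auto
 have "Mn D V <= {w:carrier (L D). z *[L D] w:Mn D W}"
 proof (rule Mn_least[OF D c(2) L.additive_subgroup_mult_preimage[OF W zc]])
  fix v assume v: "v:V" thus "ph D v:{w:carrier (L D). z *[L D] w:Mn D W}" using 1 c by auto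
 next
  fix f w assume f: "f:fst D" and w: "w:{w:carrier (L D). z *[L D] w:Mn D W}"
  thus "fr D f *[L D] w:{w:carrier (L D). z *[L D] w:Mn D W}" using Mn_fr[OF D c(3) f, of "z *[L D] w"] frc[OF f] zc by (simp add: L.m_lcomm)
 qed
 thus ?thesis using w by blast
qed

end

lemma (in cring) Units_factor:
 "a *. b:Units R ==> a :[R] ==> b :[R] ==> a:Units R"
proof -
 assume u: "a *. b:Units R" and a: "a :[R]" and b: "b :[R]"
 have 1: "a *. (b *. inv (a *. b)) = \<one>" using u a b by (simp add: m_assoc[symmetric])
 have c: "b *. inv (a *. b) :[R]" using u a b by simp
 have "(b *. inv (a *. b)) *. a = \<one>" using 1 c a m_comm by simp
 thus ?thesis unfolding Units_def using 1 c a by blast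
qed

lemma (in ring_hom_cring) hom_Units: "x:Units R ==> h x:Units S"
proof -
 assume x: "x:Units R"
 have "h x *[S] h (inv x) = \<one>[S]" using x by (simp add: hom_mult[symmetric] R.Units_closed del: hom_mult)
 moreover have "h (inv x) *[S] h x = \<one>[S]" using x by (simp add: hom_mult[symmetric] R.Units_closed del: hom_mult)
 ultimately show ?thesis unfolding Units_def using x by (auto simp: R.Units_closed)
qed

lemma (in ring_hom_cring) hom_inv: "x:Units R ==> h (inv x) = inv[S] (h x)"
proof -
 assume x: "x:Units R"
 have "h x *[S] h (inv x) = \<one>[S]" using x by (simp add: hom_mult[symmetric] R.Units_closed del: hom_mult)
 thus ?thesis using x by (intro S.comm_inv_char[symmetric]) (auto simp: R.Units_closed)
qed

lemma seminorm_pullback: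
 assumes "seminormed_ring S q" "ring_hom_cring R S h"
 shows "seminormed_ring R (%x. q (h x))"
proof -
 interpret S: seminormed_ring S q by fact
 interpret h: ring_hom_cring R S h by fact
 show ?thesis by unfold_locales (auto simp: h.hom_minus S.q_nonneg S.q_zero S.q_diff S.q_mult)
qed

section \<open>Rational data and the topology of \<open>B[1/g]\<close>\<close>

context hub
begin

abbreviation "RD \<equiv> rational_data B T"

lemma RD_okd: "D:RD ==> okd D" by (auto simp: rational_data_def okd_def)

lemma RD_finite: "D:RD ==> finite (fst D)" by (auto simp: rational_data_def)

text \<open>Those x for which some open subgroup V has x V inside the span form an ideal that
  contains the numerators and g, hence an open subgroup. The latter contains a finite set S whose
  multiples by a common V already span a neighbourhood of 0.\<close>

lemma rational_span:
 assumes D: "D:RD" and U: "U:\<U>"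
 shows "EX V:\<U>. V <= aspan B {f *. u |f u. f:insert (snd D) (fst D) & u:U}"
proof -
 define F where "F = insert (snd D) (fst D)"
 define Sp where "Sp = aspan B {f *. u |f u. f:F & u:U}"
 have Fc: "F <= carrier B" using RD_okd[OF D] by (auto simp: F_def okd_def)
 have Uc: "U <= carrier B" by (rule U_carr[OF U])
 have Sps: "additive_subgroup Sp B" unfolding Sp_def by (rule aspan_subgroup) (use Fc Uc in auto)
 let ?Z = "{x:carrier B. EX V:\<U>. ALL v:V. x *. v:Sp}"
 have idZ: "ideal ?Z B"
 proof (rule idealI)
  show "ring B" by (rule ring_axioms)
  have "additive_subgroup ?Z B"
  proof (rule additive_subgroupI_minus)
   show "\<zero>:?Z" using additive_subgroup.zero_closed[OF Sps] U U_carr by (auto simp: subset_eq)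
   fix x y assume "x:?Z" "y:?Z"
   then obtain V W where VW: "x :[B]" "y :[B]" "V:\<U>" "W:\<U>" "ALL v:V. x *. v:Sp" "ALL v:W. y *. v:Sp" by auto
   have "(x -. y) *. v:Sp" if v: "v:V Int W" for v
   proof -
    have vc: "v :[B]" using v U_carr[OF VW(3)] by auto
    have "(x -. y) *. v = x *. v -. y *. v" using VW vc by (simp add: a_minus_def l_distr l_minus)
    moreover have "x *. v -. y *. v:Sp" by (rule additive_subgroup_minus_closed[OF Sps abelian_group_axioms]) (use VW v in auto)
    ultimately show ?thesis by simp
   qed
   hence "EX V:\<U>. ALL v:V. (x -. y) *. v:Sp" using U_Int[OF VW(3,4)] by (intro bexI[of _ "V Int W"]) auto
   thus "x -. y:?Z" using VW by simp
  qed auto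
  thus "subgroup ?Z (add_monoid B)" by (rule additive_subgroup.a_subgroup)
  fix a x assume "a:?Z" and x: "x :[B]"
  then obtain V where V: "a :[B]" "V:\<U>" "ALL v:V. a *. v:Sp" by auto
  obtain W where W: "W:\<U>" "ALL w:W. x *. w:V" using U_smult[OF V(2) x] by (elim bexE)
  have "(x *. a) *. w:Sp" if w: "w:W" for w
  proof -
   have "a *. (x *. w):Sp" using V W w by simp
   moreover have "w :[B]" using w U_carr[OF W(1)] by auto
   ultimately show ?thesis using x V(1) by (simp add: m_ac)
  qed
  thus xa: "x *. a:?Z" using x V(1) W(1) by auto
  thus "a *. x:?Z" using m_comm[OF V(1) x] by simp
 qed
 have FZ: "F <= ?Z"
 proof
  fix f assume f: "f:F"
  have "f *. v:Sp" if "v:U" for v unfolding Sp_def by (rule aspanI) (use f that in auto)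
  thus "f:?Z" using f Fc U by auto
 qed
 have op: "openin T (genideal B F)" using D by (auto simp: rational_data_def F_def)
 have GZ: "genideal B F <= ?Z" by (rule genideal_minimal[OF idZ FZ])
 have z: "\<zero>:genideal B F" using additive_subgroup.zero_closed[OF ideal.axioms(1)[OF genideal_ideal[OF Fc]]] .
 then obtain J where J: "J:\<U>" "J <= genideal B F" using U_basis[OF op z] by (elim bexE)
 obtain S where S: "finite S" "S <= J" "ALL U:\<U>. EX V:\<U>. V <= aspan B {t *. u |t u. t:S & u:U}"
  using bspec[OF conjunct2[OF huber_basis] J(1)] by (elim exE conjE)
 have SZ: "S <= ?Z" using S(2) J(2) GZ by blast
 have "EX V:\<U>. ALL t:S. ALL v:V. t *. v:Sp" using S(1) SZ
 proof (induction S rule: finite_induct)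
  case empty thus ?case using U by auto
 next
  case (insert t S)
  obtain V where V: "V:\<U>" "ALL t:S. ALL v:V. t *. v:Sp" using insert by auto
  obtain W where W: "W:\<U>" "ALL v:W. t *. v:Sp" using insert(4) by auto
  show ?case using V W U_Int[OF V(1) W(1)] by (intro bexI[of _ "V Int W"]) auto
 qed
 then obtain V where V: "V:\<U>" "ALL t:S. ALL v:V. t *. v:Sp" by (elim bexE)
 obtain W where W: "W:\<U>" "W <= aspan B {t *. u |t u. t:S & u:V}" using S(3) V(1) by auto
 have "aspan B {t *. u |t u. t:S & u:V} <= Sp" by (rule aspan_least[OF _ Sps]) (use V(2) in auto)
 thus ?thesis using W unfolding Sp_def F_def by (intro bexI[OF _ W(1)]) auto
qed

lemma span_rational:
 assumes D: "okd D" "finite (fst D)" and V: "V:\<U>"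
  "V <= aspan B {f *. u |f u. f:insert (snd D) (fst D) & u :[B]}"
 shows "D:RD"
proof -
 have Fc: "insert (snd D) (fst D) <= carrier B" using D(1) by (auto simp: okd_def)
 let ?J = "genideal B (insert (snd D) (fst D))"
 have id: "ideal ?J B" by (rule genideal_ideal[OF Fc])
 have "aspan B {f *. u |f u. f:insert (snd D) (fst D) & u :[B]} <= ?J"
 proof (rule aspan_least[OF _ ideal.axioms(1)[OF id]])
  show "{f *. u |f u. f:insert (snd D) (fst D) & u :[B]} <= ?J" using ideal.I_r_closed[OF id] genideal_self[OF Fc] by auto
 qed
 hence "openin T ?J" using open_subgroup[OF ideal.axioms(1)[OF id] UD(2)[OF V(1)] U_zero[OF V(1)]] V(2) by simp
 thus ?thesis using D unfolding rational_data_def okd_def by (cases D) auto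
qed

definition TL :: "'a datum => (nat => 'a) set topology" where
 "TL D = loc_topology B T (fst D) (snd D)"

abbreviation "OS D \<equiv> open_subgroups (L D) (TL D)"

lemma openin_TL:
 assumes D: "okd D"
 shows "openin (TL D) Y \<longleftrightarrow> Y <= carrier (L D) & (ALL x:Y. EX U:\<U>. ALL y:carrier (L D). y -[L D] x:Mn D U --> y:Y)"
proof -
 have ne: "Mn D ` \<U> ~= {}" using U_carrier by blast
 have sub: "additive_subgroup U (L D)" if "U:Mn D ` \<U>" for U using that Mn_subgroup[OF D U_carr] by auto
 have dir: "EX W:Mn D ` \<U>. W <= A Int A'" if AA: "A:Mn D ` \<U>" "A':Mn D ` \<U>" for A A'
 proof -
  obtain U V where UV: "U:\<U>" "A = Mn D U" "V:\<U>" "A' = Mn D V" using AA by auto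
  have "Mn D (U Int V) <= Mn D U" "Mn D (U Int V) <= Mn D V"
   using Mn_mono[OF D _ U_carr[OF UV(1)], of "U Int V"] Mn_mono[OF D _ U_carr[OF UV(3)], of "U Int V"] by auto
  thus ?thesis using UV U_Int[OF UV(1,3)] by (intro bexI[of _ "Mn D (U Int V)"] imageI) auto
 qed
 have "loc_nbhd B (fst D) (snd D) = Mn D" by (rule ext) (simp add: Mn_def)
 hence "TL D = subgroup_topology (L D) (Mn D ` \<U>)" by (simp add: TL_def loc_topology_def L_def)
 hence "openin (TL D) Y \<longleftrightarrow> Y <= carrier (L D) & (ALL x:Y. EX U:Mn D ` \<U>. ALL y:carrier (L D). y -[L D] x:U --> y:Y)"
  using openin_subgroup_topology[OF cring.axioms(1)[OF cring_L[OF D]] ne sub dir, of Y] by simp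
 thus ?thesis by (simp only: bex_simps)
qed

lemma OS_iff:
 assumes D: "okd D"
 shows "W:OS D \<longleftrightarrow> additive_subgroup W (L D) & (EX U:\<U>. Mn D U <= W)"
proof -
 interpret L: cring "L D" by (rule cring_L[OF D])
 have m0: "y -[L D] \<zero>[L D] = y" if "y :[L D]" for y using that by (simp add: L.minus_eq)
 show ?thesis
 proof
  assume W: "W:OS D"
  hence s: "additive_subgroup W (L D)" and o: "openin (TL D) W" by (simp_all add: open_subgroups_def)
  obtain U where U: "U:\<U>" "ALL y:carrier (L D). y -[L D] \<zero>[L D]:Mn D U --> y:W"
   using bspec[OF conjunct2[OF iffD1[OF openin_TL[OF D] o]] additive_subgroup.zero_closed[OF s]] by (elim bexE)
  have "Mn D U <= W" using U m0 Mn_carr[OF D U_carr[OF U(1)]] by (auto simp: subset_eq)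
  thus "additive_subgroup W (L D) & (EX U:\<U>. Mn D U <= W)" using s U(1) by auto
 next
  assume "additive_subgroup W (L D) & (EX U:\<U>. Mn D U <= W)"
  then obtain U where s: "additive_subgroup W (L D)" and U: "U:\<U>" "Mn D U <= W" by auto
  have "openin (TL D) W" unfolding openin_TL[OF D]
  proof (intro conjI ballI bexI[OF _ U(1)] impI)
   show "W <= carrier (L D)" by (rule additive_subgroup.a_subset[OF s])
   fix x y assume x: "x:W" and y: "y :[L D]" "y -[L D] x:Mn D U"
   have xc: "x :[L D]" by (rule additive_subgroup.a_Hcarr[OF s x])
   have "(y -[L D] x) +[L D] x:W" using additive_subgroup.a_closed[OF s _ x] y U(2) by auto
   thus "y:W" using xc y by (simp add: L.minus_eq L.a_assoc L.l_neg)
  qed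
  thus "W:OS D" using s by (simp add: open_subgroups_def)
 qed
qed

lemma Mn_OS: "okd D ==> U:\<U> ==> Mn D U:OS D" using OS_iff[of D "Mn D U"] Mn_subgroup[OF _ U_carr] by auto

text \<open>The critical factor is 1/g. By \<open>rational_span\<close> a small v is a sum of
  products f u with u in U, and (f/g) u lies in \<open>Mn D U\<close>; so openness of the ideal is
  what makes multiplication on \<open>B[1/g]\<close> continuous.\<close>

lemma L_smult:
 assumes D: "D:RD" and x: "x :[L D]" and U: "U:\<U>"
 shows "EX V:\<U>. ALL y:Mn D V. x *[L D] y:Mn D U"
proof -
 note ok = RD_okd[OF D]
 interpret L: cring "L D" by (rule cring_L[OF ok])
 interpret h: ring_hom_cring B "L D" "ph D" by (rule ph_hom[OF ok])
 let ?g = "ph D (snd D)"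
 let ?Q = "%x. ALL U:\<U>. EX V:\<U>. ALL y:Mn D V. x *[L D] y:Mn D U"
 have gU: "?g:Units (L D)" by (rule g_unit[OF ok])
 have gc: "snd D :[B]" using ok by (simp add: okd_def)
 have Q1: "?Q (ph D b)" if b: "b :[B]" for b
 proof
  fix U assume U: "U:\<U>"
  obtain V where V: "V:\<U>" "ALL v:V. b *. v:U" using U_smult[OF U b] by (elim bexE)
  have pb: "ph D b:Mn D {b}" by (rule Mn_ph[OF ok]) (use b in auto)
  show "EX V:\<U>. ALL y:Mn D V. ph D b *[L D] y:Mn D U"
  proof (intro bexI[OF _ V(1)] ballI)
   fix y assume "y:Mn D V"
   thus "ph D b *[L D] y:Mn D U" using Mn_mult[OF ok _ U_carr[OF V(1)] U_carr[OF U] _ pb, of y] b V(2) by auto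
  qed
 qed
 have Q2: "?Q (inv[L D] ?g)"
 proof
  fix U assume U: "U:\<U>"
  obtain V where V: "V:\<U>" "V <= aspan B {f *. u |f u. f:insert (snd D) (fst D) & u:U}" using rational_span[OF D U] by (elim bexE)
  note Uc = U_carr[OF U]
  have ic: "inv[L D] ?g :[L D]" using gU by simp
  let ?Z = "{z:carrier (L D). inv[L D] ?g *[L D] z:Mn D U}"
  have Zs: "additive_subgroup ?Z (L D)" by (rule L.additive_subgroup_mult_preimage[OF Mn_subgroup[OF ok Uc] ic])
  have frc: "f:fst D ==> f :[B]" for f using ok by (auto simp: okd_def)
  have asp: "aspan B {f *. u |f u. f:insert (snd D) (fst D) & u:U} <= {b:carrier B. ph D b:?Z}"
  proof (rule aspan_least[OF _ h.additive_subgroup_preimage[OF Zs]], clarify)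
   fix f u assume f: "f:insert (snd D) (fst D)" and u: "u:U"
   have c: "f :[B]" "u :[B]" using f u Uc gc frc by auto
   have "inv[L D] ?g *[L D] (ph D f *[L D] ph D u):Mn D U"
   proof (cases "f = snd D")
    case True
    hence "inv[L D] ?g *[L D] (ph D f *[L D] ph D u) = ph D u" using gU c by (simp add: L.m_assoc[symmetric] L.Units_closed)
    thus ?thesis using Mn_ph[OF ok Uc u] by simp
   next
    case False
    hence f': "f:fst D" using f by simp
    have "inv[L D] ?g *[L D] (ph D f *[L D] ph D u) = fr D f *[L D] ph D u" unfolding fr_eq[OF ok c(1)] using c ic by (simp add: L.m_ac)
    thus ?thesis using Mn_fr[OF ok Uc f' Mn_ph[OF ok Uc u]] by simp
   qed
   thus "f *. u :[B] & ph D (f *. u):?Z" using c by simp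
  qed
  have "Mn D V <= ?Z"
  proof (rule Mn_least[OF ok U_carr[OF V(1)] Zs])
   show "ph D v:?Z" if "v:V" for v using that V(2) asp by auto
   fix f z assume f: "f:fst D" and z: "z:?Z"
   have fc: "fr D f :[L D]" using fr_carr[OF ok frc[OF f]] .
   have "fr D f *[L D] (inv[L D] ?g *[L D] z):Mn D U" using Mn_fr[OF ok Uc f] z by simp
   thus "fr D f *[L D] z:?Z" using fc z ic by (simp add: L.m_lcomm)
  qed
  thus "EX V:\<U>. ALL y:Mn D V. inv[L D] ?g *[L D] y:Mn D U" using V(1) by (intro bexI[OF _ V(1)]) auto
 qed
 \<comment> \<open>Every element of \<open>B[1/g]\<close> is a product of some b and powers of 1/g,
   so closure under products finishes the argument.\<close>
 have Qm: "?Q (x *[L D] y)" if x: "x :[L D]" and y: "y :[L D]" and Qx: "?Q x" and Qy: "?Q y" for x y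
 proof
  fix U assume U: "U:\<U>"
  obtain V where V: "V:\<U>" "ALL z:Mn D V. x *[L D] z:Mn D U" using bspec[OF Qx U] by (elim bexE)
  obtain W where W: "W:\<U>" "ALL z:Mn D W. y *[L D] z:Mn D V" using bspec[OF Qy V(1)] by (elim bexE)
  have "(x *[L D] y) *[L D] z:Mn D U" if z: "z:Mn D W" for z
  proof -
   have "z :[L D]" using z Mn_carr[OF ok U_carr[OF W(1)]] by auto
   thus ?thesis using V W z x y by (simp add: L.m_assoc)
  qed
  thus "EX V:\<U>. ALL z:Mn D V. (x *[L D] y) *[L D] z:Mn D U" by (intro bexI[OF _ W(1)]) auto
 qed
 have Qp: "?Q ((inv[L D] ?g) ^[L D] (k::nat))" for k
 proof (induction k)
  case 0
  show ?case using Q1[OF one_closed] by simp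
 next
  case (Suc k)
  thus ?case using Qm[OF _ _ Suc Q2] gU by simp
 qed
 obtain b k where b: "b :[B]" and bk: "x *[L D] ?g ^[L D] (k::nat) = ph D b" using localization.frac[OF loc[OF ok] x] by (elim bexE exE)
 have "ph D b *[L D] (inv[L D] ?g) ^[L D] k = x *[L D] (?g *[L D] inv[L D] ?g) ^[L D] k"
  unfolding bk[symmetric] using x gU by (simp add: L.m_assoc L.nat_pow_distrib L.Units_closed del: L.Units_r_inv)
 also have "... = x" unfolding L.Units_r_inv[OF gU] using x by simp
 finally have "?Q x" using Qm[OF _ _ Q1[OF b] Qp[of k]] b gU by simp
 thus ?thesis using U by (rule bspec)
qed

lemma completable_L:
 assumes D: "D:RD" shows "completable (L D) (TL D)"
proof -
 note ok = RD_okd[OF D]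
 interpret L: cring "L D" by (rule cring_L[OF ok])
 show ?thesis
 proof unfold_locales
  have "additive_subgroup (carrier (L D)) (L D)" by (rule L.additive_subgroupI_minus) auto
  hence "carrier (L D):OS D" using OS_iff[OF ok] U_carrier Mn_carr[OF ok U_carr[OF U_carrier]] by auto
  thus "openin (TL D) (carrier (L D))" by (simp add: open_subgroups_def)
 next
  fix W assume "W:OS D"
  then obtain U where U: "U:\<U>" "Mn D U <= W" using OS_iff[OF ok] by auto
  obtain V where V: "V:\<U>" "ALL v:V. ALL w:V. v *. w:U" using U_mult[OF U(1)] by (elim bexE)
  have "x *[L D] y:W" if "x:Mn D V" "y:Mn D V" for x y using Mn_mult[OF ok U_carr[OF V(1)] U_carr[OF V(1)] U_carr[OF U(1)] _ that] V(2) U(2) by auto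
  thus "EX V:OS D. ALL x:V. ALL y:V. x *[L D] y:W" by (intro bexI[OF _ Mn_OS[OF ok V(1)]]) auto
 next
  fix W x assume "W:OS D" and x: "x :[L D]"
  then obtain U where U: "U:\<U>" "Mn D U <= W" using OS_iff[OF ok] by auto
  obtain V where V: "V:\<U>" "ALL y:Mn D V. x *[L D] y:Mn D U" using L_smult[OF D x U(1)] by (elim bexE)
  thus "EX V:OS D. ALL y:V. x *[L D] y:W" using U(2) by (intro bexI[OF _ Mn_OS[OF ok V(1)]]) auto
 qed
qed

abbreviation "CD \<equiv> rat_ring B T"

definition jD :: "'a datum => (nat => 'a) set => 'a rat_elt" where
 "jD D = completion_map (L D) (TL D)"

lemma CD_eq: "CD D = Defs.completion (L D) (TL D)" by (simp add: rat_ring_def L_def TL_def)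

lemma rat_map_eq: "rat_map B T D b = jD D (ph D b)" by (simp add: rat_map_def jD_def ph_def L_def TL_def)

lemma P_sub: "subring P B" and P_open: "openin T P" and P_pb: "P <= power_bounded B T" using hp by (auto simp: huber_pair_def)

lemma P_carr: "P <= carrier B" by (rule subringE(1)[OF P_sub])
lemma P_one: "\<one>:P" by (rule subringE(3)[OF P_sub])
lemma P_mult: "x:P ==> y:P ==> x *. y:P" by (rule subringE(6)[OF P_sub])

lemma P_U: "P:\<U>"
proof -
 have "additive_subgroup P B" by (rule additive_subgroupI_minus) (use P_carr subringE(2,5,7)[OF P_sub] in \<open>auto simp: a_minus_def\<close>)
 thus ?thesis using P_open by (simp add: open_subgroups_def)
qed

end

section \<open>Power-multiplicative norms on the rational localizations and on B\<close>

locale hub_su = hub +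
 assumes su: "stably_uniform B T"
begin

text \<open>One norm is fixed per datum. The choices are independent, so restriction maps are
  continuous but no inequality between the norms of two data is available.\<close>

definition ND :: "'a datum => 'a rat_elt => real" where
 "ND D = (SOME N. banach_ring (CD D) N & power_multiplicative (CD D) N & norm_topology (CD D) N = rat_topology B T D)"

lemma ND_spec:
 assumes "D:RD"
 shows "banach_ring (CD D) (ND D)" "power_multiplicative (CD D) (ND D)"
  "norm_topology (CD D) (ND D) = rat_topology B T D"
proof -
 have "EX N. banach_ring (CD D) N & power_multiplicative (CD D) N & norm_topology (CD D) N = rat_topology B T D"
  using su assms by (simp add: stably_uniform_def uniform_banach_def)
 from someI_ex[OF this] show "banach_ring (CD D) (ND D)" "power_multiplicative (CD D) (ND D)"
  "norm_topology (CD D) (ND D) = rat_topology B T D" unfolding ND_def by auto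
qed

lemma banach_CD: "D:RD ==> banach (CD D) (ND D)" by (rule banach.intro[OF ND_spec(1)])

lemma cring_CD: "D:RD ==> cring (CD D)" using ND_spec(1) by (simp add: banach_ring_def)

lemma jD_hom: "D:RD ==> ring_hom_cring (L D) (CD D) (jD D)"
 using completable.completion_map_hom[OF completable_L, of D] cring_L[OF RD_okd, of D] cring_CD[of D] by (simp add: jD_def CD_eq ring_hom_cringI)

lemma ND_normed:
 assumes D: "D:RD"
 shows "U:\<U> ==> EX e>0. ALL x:carrier (L D). ND D (jD D x) <= e --> x:Mn D U"
  and "e > 0 ==> EX U:\<U>. ALL x:Mn D U. ND D (jD D x) <= e"
  and "c :[CD D] ==> e > 0 ==> EX x:carrier (L D). ND D (c -[CD D] jD D x) <= e"
proof -
 note ok = RD_okd[OF D]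
 have 0: "norm_topology (CD D) (ND D) = completion_topology (L D) (TL D)" using ND_spec(3)[OF D] by (simp add: rat_topology_def L_def TL_def)
 note c = completable.completion_normed[OF completable_L[OF D] ND_spec(1)[OF D, unfolded CD_eq] 0[unfolded CD_eq]]
 show "U:\<U> ==> EX e>0. ALL x:carrier (L D). ND D (jD D x) <= e --> x:Mn D U" unfolding jD_def by (rule c(1)[OF Mn_OS[OF ok]])
 show "EX U:\<U>. ALL x:Mn D U. ND D (jD D x) <= e" if e: "e > 0"
 proof -
  obtain W where W: "W:OS D" "ALL x:W. ND D (jD D x) <= e" using c(2)[OF e] unfolding jD_def by (elim bexE)
  thus ?thesis using OS_iff[OF ok, of W] by auto
 qed
 show "c :[CD D] ==> e > 0 ==> EX x:carrier (L D). ND D (c -[CD D] jD D x) <= e" unfolding jD_def CD_eq by (rule c(3))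
qed

text \<open>The datum of the whole space. Stable uniformity speaks of localizations only; pulling
  the norm of \<open>CD D0\<close> back to B gives a power-multiplicative seminorm \<open>q0\<close>
  that defines the topology of B.\<close>

definition D0 :: "'a datum" where "D0 = ({}, \<one>)"

lemma D0_RD: "D0:RD"
proof -
 have "openin T (carrier B)" using openin_topspace[of T] topspace_T by simp
 thus ?thesis by (simp add: D0_def rational_data_def genideal_one)
qed

definition q0 :: "'a => real" where "q0 b = ND D0 (jD D0 (ph D0 b))"

lemma q0_seminorm: "seminormed_ring B q0"
proof -
 interpret C: banach "CD D0" "ND D0" by (rule banach_CD[OF D0_RD])
 have "seminormed_ring (L D0) (%x. ND D0 (jD D0 x))" by (rule seminorm_pullback[OF C.seminormed_ring_axioms jD_hom[OF D0_RD]])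
 from seminorm_pullback[OF this ph_hom[OF RD_okd[OF D0_RD]]]
 show ?thesis unfolding q0_def .
qed

sublocale q: seminormed_ring B q0 by (rule q0_seminorm)

lemma q0_pow: "b :[B] ==> 0 < n ==> q0 (b [^] (n::nat)) = q0 b ^ n"
proof -
 assume b: "b :[B]" and n: "0 < n"
 interpret h: ring_hom_cring B "L D0" "ph D0" by (rule ph_hom[OF RD_okd[OF D0_RD]])
 interpret j: ring_hom_cring "L D0" "CD D0" "jD D0" by (rule jD_hom[OF D0_RD])
 show ?thesis unfolding q0_def using ND_spec(2)[OF D0_RD] b n by (simp add: power_multiplicative_def)
qed

lemma q0_U:
 assumes U: "U:\<U>" shows "EX e>0. ALL b:carrier B. q0 b <= e --> b:U"
proof -
 note ok = RD_okd[OF D0_RD]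
 interpret h: ring_hom_cring B "L D0" "ph D0" by (rule ph_hom[OF ok])
 obtain e where e: "e > 0" "ALL x:carrier (L D0). ND D0 (jD D0 x) <= e --> x:Mn D0 U" using ND_normed(1)[OF D0_RD U] by (elim exE conjE)
 have M: "Mn D0 U <= ph D0 ` U" by (rule Mn_least[OF ok U_carr[OF U] h.additive_subgroup_image[OF UD(1)[OF U]]]) (auto simp: D0_def)
 have "b:U" if b: "b :[B]" "q0 b <= e" for b
 proof -
  have "ph D0 b:ph D0 ` U" using e b M unfolding q0_def by auto
  then obtain u where u: "u:U" "ph D0 b = ph D0 u" by auto
  have uc: "u :[B]" using u U_carr[OF U] by auto
  obtain m :: nat where "snd D0 [^] m *. b = snd D0 [^] m *. u" by (rule localization.phi_eqE[OF loc[OF ok] b(1) uc u(2)])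
  hence "b = u" using b uc by (simp add: D0_def)
  thus ?thesis using u by simp
 qed
 thus ?thesis using e(1) by auto
qed

lemma U_q0:
 assumes e: "e > 0" shows "EX U:\<U>. ALL b:U. q0 b <= e"
proof -
 obtain U where U: "U:\<U>" "ALL x:Mn D0 U. ND D0 (jD D0 x) <= e" using ND_normed(2)[OF D0_RD e] by (elim bexE)
 thus ?thesis using Mn_ph[OF RD_okd[OF D0_RD] U_carr[OF U(1)]] unfolding q0_def by (intro bexI[OF _ U(1)]) auto
qed

abbreviation "Ub \<equiv> q.qball"

lemma Ub_U: "e > 0 ==> Ub e:\<U>"
proof -
 assume e: "e > 0"
 obtain V where V: "V:\<U>" "ALL b:V. q0 b <= e" using U_q0[OF e] by (elim bexE)
 show ?thesis by (rule U_superset[OF q.qball_subgroup V(1)]) (use e V U_carr[OF V(1)] in \<open>auto simp: q.qball_def\<close>)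
qed

lemma Ub_small: "U:\<U> ==> EX e>0. e < 1 & Ub e <= U"
proof -
 assume U: "U:\<U>"
 obtain e where e: "e > 0" "ALL b:carrier B. q0 b <= e --> b:U" using q0_U[OF U] by (elim exE conjE)
 show ?thesis using e by (intro exI[of _ "min e (1/2)"]) (auto simp: q.qball_def)
qed

lemma Ub_carr: "Ub e <= carrier B" by (auto simp: q.qball_def)

lemma power_le_imp_le1: "r <= 1" if "!!n. n >= k ==> r ^ n <= C" for r C :: real and k :: nat
proof (rule ccontr)
 assume "~ r <= 1"
 then obtain n where n: "C < r ^ n" using real_arch_pow[of r C] by auto
 have "r ^ n <= r ^ max n k" using \<open>~ r <= 1\<close> by (intro power_increasing) auto
 thus False using that[of "max n k"] n by simp
qed

text \<open>Power-bounded elements act on the open unit ball by contractions, because the norm is power-multiplicative.\<close>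

lemma P_q0:
 assumes p: "p:P" and x: "x :[B]" and x1: "q0 x < 1"
 shows "q0 (p *. x) <= q0 x"
proof (cases "q0 x = 0")
 case True
 have pc: "p :[B]" using p P_carr by auto
 show ?thesis using q.q_mult[OF pc x] True by simp
next
 case False
 have pc: "p :[B]" using p P_carr by auto
 have q: "0 < q0 x" using False q.q_nonneg[OF x] by simp
 have "bounded_subset B T (range (%n::nat. p [^] n))" using P_pb p by (auto simp: power_bounded_def)
 moreover have "openin T (Ub 1)" "\<zero>:Ub 1" using UD(2)[OF Ub_U] U_zero[OF Ub_U] by auto
 ultimately obtain V where V: "openin T V" "\<zero>:V" "ALL v:V. ALL s:range (%n::nat. p [^] n). v *. s:Ub 1" unfolding bounded_subset_def by meson
 obtain U where U: "U:\<U>" "U <= V" using U_basis[OF V(1,2)] by (elim bexE)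
 obtain d where d: "d > 0" "ALL b:carrier B. q0 b <= d --> b:U" using q0_U[OF U(1)] by (elim exE conjE)
 obtain k0 where k0: "q0 x ^ k0 < d" using real_arch_pow_inv[OF d(1) x1] by auto
 \<comment> \<open>The successor makes the exponent positive, as \<open>q0_pow\<close> requires also
   when \<open>k0 = 0\<close>.\<close>
 define k where "k = Suc k0"
 have "q0 x * q0 x ^ k0 <= 1 * q0 x ^ k0" using q x1 by (intro mult_right_mono) auto
 hence kd: "q0 x ^ k <= d" using k0 by (simp add: k_def)
 have xk: "x [^] k:V" using d(2) U(2) q0_pow[OF x, of k] kd x by (auto simp: k_def)
 \<comment> \<open>In \<open>(p x)^n = x^(n-k) (x^k p^n)\<close> the second factor stays in the unit
   ball because \<open>x^k\<close> lies in V. The loss \<open>q0 x ^ k\<close> is independent of n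
   and disappears in the n-th root.\<close>
 have "(q0 (p *. x) / q0 x) ^ n <= 1 / q0 x ^ k" if n: "n >= Suc k" for n
 proof -
  have "(p *. x) [^] n = x [^] (n - k) *. (x [^] k *. p [^] n)"
  proof -
   have "x [^] n = x [^] (n - k) *. x [^] k" using n x by (simp add: nat_pow_mult)
   thus ?thesis using pc x by (simp add: nat_pow_distrib m_ac)
  qed
  hence "q0 ((p *. x) [^] n) <= q0 (x [^] (n - k)) * q0 (x [^] k *. p [^] n)" using q.q_mult[of "x [^] (n - k)" "x [^] k *. p [^] n"] pc x by simp
  also have "... <= q0 (x [^] (n - k)) * 1" using V(3) xk q.q_nonneg[of "x [^] (n - k)"] x by (intro mult_left_mono) (auto simp: q.qball_def)
  finally have "q0 (p *. x) ^ n <= q0 x ^ (n - k)" using q0_pow[of "p *. x" n] q0_pow[OF x, of "n - k"] n pc x by simp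
  hence "q0 (p *. x) ^ n / q0 x ^ n <= q0 x ^ (n - k) / q0 x ^ n" using q by (intro divide_right_mono) auto
  also have "... = 1 / q0 x ^ k"
  proof -
   have "q0 x ^ n = q0 x ^ (n - k) * q0 x ^ k" using n by (simp add: power_add[symmetric])
   thus ?thesis using q by simp
  qed
  finally show ?thesis by (simp add: power_divide)
 qed
 hence "q0 (p *. x) / q0 x <= 1" by (rule power_le_imp_le1)
 thus ?thesis using q by simp
qed

lemma P_Ub: "p:P ==> x:Ub e ==> e < 1 ==> p *. x:Ub e" using P_q0[of p x] P_carr by (auto simp: q.qball_def)

end

section \<open>Homogeneous expressions in two elements\<close>

context cring
begin

text \<open>Homogeneity avoids division: \<open>H^J l\<close> in \<open>hspan F H J M\<close> says
  that l is a polynomial expression in F/H with coefficients in the span of M, and the same with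
  \<open>F^J l\<close> is one in H/F.\<close>

definition hspan :: "'a => 'a => nat => 'a set => 'a set" where
 "hspan F H J M = aspan R {m *. (F [^] i *. H [^] j) |m i j. m:M & i + j = (J::nat)}"

context
 fixes F H assumes FH: "F :[R]" "H :[R]"
begin

lemma hspan_gens: "M <= carrier R ==> {m *. (F [^] i *. H [^] j) |m i j. m:M & i + j = (J::nat)} <= carrier R" using FH by auto

lemma hspan_sub: "M <= carrier R ==> additive_subgroup (hspan F H J M) R" unfolding hspan_def by (rule aspan_subgroup[OF hspan_gens])

lemma hspan_carr: "M <= carrier R ==> hspan F H J M <= carrier R" by (rule additive_subgroup.a_subset[OF hspan_sub])

lemma hspan_mult:
 assumes M: "M <= carrier R" "M' <= carrier R" and c: "c :[R]" and x: "x:hspan F H J M"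
  and m: "!!m. m:M ==> c *. m:M'" and J: "J' = J + i + j"
 shows "(c *. (F [^] (i::nat) *. H [^] (j::nat))) *. x:hspan F H J' M'"
proof -
 let ?c = "c *. (F [^] i *. H [^] j)"
 have cc: "?c :[R]" using c FH by simp
 have "hspan F H J M <= {x:carrier R. ?c *. x:hspan F H J' M'}" unfolding hspan_def[of F H J M]
 proof (rule aspan_least[OF _ additive_subgroup_mult_preimage[OF hspan_sub[OF M(2)] cc]], clarify)
  fix m k l assume ml: "m:M" "J = k + (l::nat)"
  have mc: "m :[R]" using ml M by auto
  have "(c *. m) *. (F [^] (i + k) *. H [^] (j + l)):hspan F H J' M'" unfolding hspan_def by (rule aspanI) (use m[OF ml(1)] ml(2) J in force)
  moreover have "(c *. m) *. (F [^] (i + k) *. H [^] (j + l)) = ?c *. (m *. (F [^] k *. H [^] l))"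
   using c mc FH by (simp add: nat_pow_mult[symmetric] m_ac)
  ultimately show "m *. (F [^] k *. H [^] l) :[R] & ?c *. (m *. (F [^] k *. H [^] l)):hspan F H J' M'" using mc FH by simp
 qed
 thus ?thesis using x by blast
qed

lemma hspan_Hpow: "M <= carrier R ==> x:hspan F H J M ==> H [^] (n::nat) *. x:hspan F H (J + n) M"
 using hspan_mult[of M M \<one> x J "J + n" 0 n] FH by (auto simp: subset_eq)

lemma hspan_swap: "M <= carrier R ==> hspan H F J M <= hspan F H J M" unfolding hspan_def[of H F]
proof (rule aspan_least[OF _ hspan_sub], clarify)
 fix m i j assume M: "M <= carrier R" and m: "m:M" and J: "J = i + (j::nat)"
 have mc: "m :[R]" using m M by auto
 have "m *. (F [^] j *. H [^] i):hspan F H J M" unfolding J hspan_def by (rule aspanI) (use m in force)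
 thus "m *. (H [^] i *. F [^] j):hspan F H (i + j) M" using FH mc J by (simp add: m_comm)
qed

text \<open>Degree 2K is chosen because each monomial \<open>F^i H^j\<close> then has i >= K or j >=
  K, so that l can be multiplied into \<open>F^K\<close> or \<open>H^K\<close> and the result has
  the same degree.\<close>

lemma hspan_absorb:
 assumes M: "M <= carrier R" "M' <= carrier R" "M'' <= carrier R" and l: "l :[R]"
  and h: "H [^] K *. l:hspan F H K M" and f: "F [^] K *. l:hspan F H K M"
  and m: "!!m m'. m:M ==> m':M' ==> m' *. m:M''" and x: "x:hspan F H (2 * K) M'"
 shows "l *. x:hspan F H (2 * K) M''"
proof -
 have "hspan F H (2 * K) M' <= {x:carrier R. l *. x:hspan F H (2 * K) M''}" unfolding hspan_def[of F H "2 * K" M']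
 proof (rule aspan_least[OF _ additive_subgroup_mult_preimage[OF hspan_sub[OF M(3)] l]], clarify)
  fix m i j assume mm: "m:M'" and ij: "i + j = 2 * K"
  have mc: "m :[R]" using mm M by auto
  have "l *. (m *. (F [^] i *. H [^] j)):hspan F H (2 * K) M''"
  proof (cases "K <= i")
   case True
   have "(m *. (F [^] (i - K) *. H [^] j)) *. (F [^] K *. l):hspan F H (2 * K) M''"
    by (rule hspan_mult[OF M(1,3) mc f m[OF _ mm]]) (use True ij in auto)
   moreover have "F [^] i = F [^] (i - K) *. F [^] K" using True FH by (simp add: nat_pow_mult)
   ultimately show ?thesis using l mc FH by (simp add: m_ac)
  next
   case False
   hence j: "K <= j" using ij by simp
   have "(m *. (F [^] i *. H [^] (j - K))) *. (H [^] K *. l):hspan F H (2 * K) M''" by (rule hspan_mult[OF M(1,3) mc h m[OF _ mm]]) (use j ij in auto)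
   moreover have "H [^] j = H [^] (j - K) *. H [^] K" using j FH by (simp add: nat_pow_mult)
   ultimately show ?thesis using l mc FH by (simp add: m_ac)
  qed
  thus "m *. (F [^] i *. H [^] j) :[R] & l *. (m *. (F [^] i *. H [^] j)):hspan F H (2 * K) M''" using mc FH by simp
 qed
 thus ?thesis using x by blast
qed

end

end

lemma power_le_mult_imp_le:
 fixes r e C :: real
 assumes "0 <= r" "0 <= e" "!!n. 0 < n ==> r ^ n <= C * e ^ n"
 shows "r <= e"
proof (cases "e = 0")
 case True thus ?thesis using assms(3)[of 1] by simp
next
 case False
 hence e: "e > 0" using assms(2) by simp
 show ?thesis
 proof (rule ccontr)
  assume "~ r <= e"
  hence "1 < r / e" using e by simp
  then obtain n where n: "C < (r / e) ^ n" using real_arch_pow by blast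
  have "(r / e) ^ Suc n <= C" using assms(3)[of "Suc n"] e by (simp add: power_divide pos_divide_le_eq del: power_Suc)
  moreover have "(r / e) ^ n <= (r / e) ^ Suc n" using \<open>1 < r / e\<close> by (intro power_increasing) auto
  ultimately show False using n by linarith
 qed
qed

context seminormed_ring
begin

lemma qball_carr: "qball e <= carrier R" by (auto simp: qball_def)

lemma qball_mult: "x:qball d ==> y:qball e ==> 0 <= d ==> x *. y:qball (d * e)"
proof -
 assume x: "x:qball d" and y: "y:qball e" and d: "0 <= d"
 have "q (x *. y) <= q x * q y" using q_mult x y by (simp add: qball_def)
 also have "... <= d * e" using x y d q_nonneg by (intro mult_mono) (auto simp: qball_def)
 finally show ?thesis using x y by (simp add: qball_def)
qed

text \<open>If \<open>l\<close> is given by expressions with coefficients of size \<open>e\<close> in \<open>F/H\<close> as well as in \<open>H/F\<close>,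
 then the span of the monomials of a large degree in \<open>F, H\<close> with small coefficients is mapped by \<open>l\<close>
 to itself with coefficients multiplied by \<open>e\<close>. It contains 1, hence all powers of \<open>l\<close> are controlled.\<close>

lemma two_sided_bound:
 assumes pow: "!!x n. x :[R] ==> 0 < (n::nat) ==> q (x [^] n) = q x ^ n"
  and F: "F :[R]" and H: "H :[R]" and ab: "al :[R]" "be :[R]"
  and one: "al *. F +. be *. H = \<one>" and l: "l :[R]" and e: "0 <= e"
  and h: "H [^] K *. l:hspan F H K (qball e)" and f: "F [^] K *. l:hspan F H K (qball e)"
 shows "q l <= e"
proof -
 \<comment> \<open>Multiplying 1 by \<open>al F + be H = 1\<close> raises the degree by one. The
   coefficient bound c depends on J, but J is fixed as 2K afterwards.\<close>
 have one_in: "EX c>=0. \<one>:hspan F H J (qball c)" for J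
 proof (induction J)
  case 0
  have "\<one> *. (F [^] (0::nat) *. H [^] (0::nat)):hspan F H 0 (qball (q \<one>))" unfolding hspan_def by (rule aspanI) (force simp: qball_def)
  thus ?case using q_nonneg[of \<one>] F H by (intro exI[of _ "q \<one>"]) simp
 next
  case (Suc J)
  then obtain c where c: "c >= 0" "\<one>:hspan F H J (qball c)" by auto
  define d where "d = max (q al) (q be)"
  have d: "q al <= d" "q be <= d" "0 <= d" using q_nonneg[OF ab(1)] by (auto simp: d_def)
  have "(al *. (F [^] (1::nat) *. H [^] (0::nat))) *. \<one>:hspan F H (Suc J) (qball (d * c))"
   by (rule hspan_mult[OF F H qball_carr qball_carr ab(1) c(2)])
     (use d ab qball_mult[of al d _ c] in \<open>auto simp: qball_def\<close>)
  moreover have "(be *. (F [^] (0::nat) *. H [^] (1::nat))) *. \<one>:hspan F H (Suc J) (qball (d * c))"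
   by (rule hspan_mult[OF F H qball_carr qball_carr ab(2) c(2)])
     (use d ab qball_mult[of be d _ c] in \<open>auto simp: qball_def\<close>)
  ultimately have "al *. F +. be *. H:hspan F H (Suc J) (qball (d * c))"
   using additive_subgroup.a_closed[OF hspan_sub[OF F H qball_carr]] ab F H by simp
  thus ?case using one c d by (intro exI[of _ "d * c"]) simp
 qed
 obtain c where c: "c >= 0" "\<one>:hspan F H (2 * K) (qball c)" using one_in by blast
 \<comment> \<open>Each factor l costs exactly one factor e; the degree and the constant c stay the
   same.\<close>
 have ln: "l [^] (n::nat):hspan F H (2 * K) (qball (c * e ^ n))" for n
 proof (induction n)
  case 0 thus ?case using c by simp
 next
  case (Suc n)
  have "l *. (l [^] n):hspan F H (2 * K) (qball (c * e ^ Suc n))"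
  proof (rule hspan_absorb[OF F H qball_carr[of e] qball_carr qball_carr l h f _ Suc])
   fix m m' assume "m:qball e" "m':qball (c * e ^ n)"
   thus "m' *. m:qball (c * e ^ Suc n)" using qball_mult[of m' "c * e ^ n" m e] c(1) e by (simp add: ac_simps)
  qed
  thus ?case using l by (simp add: m_comm)
 qed
 define C where "C = (\<Sum>i\<le>2*K. \<Sum>j\<le>2*K. q (F [^] i *. H [^] j))"
 have qp: "q (F [^] i *. H [^] j) <= C" if "i + j = 2 * K" for i j
 proof -
  have n: "0 <= q (F [^] i *. H [^] j)" for i j :: nat using q_nonneg F H by simp
  have "q (F [^] i *. H [^] j) <= (\<Sum>j\<le>2*K. q (F [^] i *. H [^] j))" by (rule member_le_sum) (use n that in auto)
  also have "... <= C" unfolding C_def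
   by (rule member_le_sum[of i "{..2*K}" "%i. \<Sum>j\<le>2*K. q (F [^] i *. H [^] j)"]) (use n that in \<open>auto intro: sum_nonneg\<close>)
  finally show ?thesis .
 qed
 have C0: "0 <= C" unfolding C_def by (intro sum_nonneg q_nonneg) (use F H in auto)
 have hb: "hspan F H (2 * K) (qball d) <= qball (d * C)" if d: "d >= 0" for d unfolding hspan_def
 proof (rule aspan_least[OF _ qball_subgroup], clarify)
  fix m i j assume m: "m:qball d" and ij: "i + j = 2 * K"
  have "F [^] i *. H [^] j:qball C" using qp[OF ij] F H by (simp add: qball_def)
  thus "m *. (F [^] i *. H [^] j):qball (d * C)" by (rule qball_mult[OF m _ d])
 qed (use d C0 in simp)
 show ?thesis
 proof (rule power_le_mult_imp_le[OF q_nonneg[OF l] e, of "c * C"])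
  fix n :: nat assume n: "0 < n"
  have "l [^] n:qball (c * e ^ n * C)" using hb[of "c * e ^ n"] ln[of n] c(1) e by auto
  thus "q l ^ n <= c * C * e ^ n" using pow[OF l n] by (simp add: qball_def ac_simps)
 qed
qed

end

section \<open>Inequalities forced by a rational datum\<close>

context hub_su
begin

text \<open>Since P is a subring, this is the subring P[F/g] of \<open>B[1/g]\<close>.\<close>

abbreviation "RR D \<equiv> Mn D P"

lemma RR_sub: "okd D ==> additive_subgroup (RR D) (L D)" by (rule Mn_subgroup[OF _ P_carr])
lemma RR_carr: "okd D ==> RR D <= carrier (L D)" by (rule Mn_carr[OF _ P_carr])
lemma RR_ph: "okd D ==> p:P ==> ph D p:RR D" by (rule Mn_ph[OF _ P_carr])
lemma RR_mult: "okd D ==> x:RR D ==> y:RR D ==> x *[L D] y:RR D" by (rule Mn_mult[OF _ P_carr P_carr P_carr P_mult])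

lemma RR_one: "okd D ==> \<one>[L D]:RR D"
proof -
 assume D: "okd D"
 interpret h: ring_hom_cring B "L D" "ph D" by (rule ph_hom[OF D])
 show ?thesis using RR_ph[OF D P_one] by simp
qed

lemma RR_fr: "okd D ==> f:fst D ==> fr D f:RR D"
proof -
 assume D: "okd D" and f: "f:fst D"
 interpret L: cring "L D" by (rule cring_L[OF D])
 have "fr D f :[L D]" using fr_carr[OF D] f D by (auto simp: okd_def)
 thus ?thesis using Mn_fr[OF D P_carr f RR_one[OF D]] by simp
qed

text \<open>For such U the group \<open>Mn D U\<close> is a module over \<open>RR D\<close>
  (\<open>RR_Mn\<close>). The balls \<open>Ub e\<close> with e < 1 qualify by \<open>P_q0\<close>,
  so there is a basis of stable neighbourhoods of 0.\<close>

definition pstable :: "'a set => bool" where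
 "pstable U \<longleftrightarrow> U <= carrier B & (ALL p:P. ALL u:U. p *. u:U)"

lemma pstable_P: "pstable P" using P_carr P_mult by (auto simp: pstable_def)
lemma pstable_Ub: "e < 1 ==> pstable (Ub e)" using Ub_carr P_Ub by (auto simp: pstable_def)

lemma RR_Mn: "okd D ==> pstable U ==> x:RR D ==> y:Mn D U ==> x *[L D] y:Mn D U" by (rule Mn_mult[OF _ P_carr, of _ U U]) (auto simp: pstable_def)

text \<open>A certificate, independent of points, that \<open>v(a) <= v(b)\<close> and
  \<open>v(b)\<close> is nonzero on the rational subset of D: a/b lies in P[F/g]. It implies the
  inequality at all points (\<open>forces_point\<close>); the converse is recovered only after
  splitting D.\<close>

definition forces :: "'a datum => 'a => 'a => bool" where
 "forces D a b \<longleftrightarrow> a :[B] & b :[B] & ph D b:Units (L D) & ph D a *[L D] inv[L D] (ph D b):RR D"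

lemma forces_carr: "forces D a b ==> a :[B]" "forces D a b ==> b :[B]"
 and forces_unit: "forces D a b ==> ph D b:Units (L D)"
 and forces_RR: "forces D a b ==> ph D a *[L D] inv[L D] (ph D b):RR D" by (auto simp: forces_def)

context
 fixes D assumes D: "okd D"
begin

interpretation L: cring "L D" by (rule cring_L[OF D])
interpretation h: ring_hom_cring B "L D" "ph D" by (rule ph_hom[OF D])

lemma forces_trans: "forces D a b ==> forces D b c ==> forces D a c"
proof -
 assume ab: "forces D a b" and bc: "forces D b c"
 have u: "ph D b:Units (L D)" "ph D c:Units (L D)" and c: "ph D a :[L D]" using ab bc by (auto simp: forces_def)
 have "(ph D a *[L D] inv[L D] (ph D b)) *[L D] (ph D b *[L D] inv[L D] (ph D c)):RR D" by (rule RR_mult[OF D forces_RR[OF ab] forces_RR[OF bc]])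
 also have "(ph D a *[L D] inv[L D] (ph D b)) *[L D] (ph D b *[L D] inv[L D] (ph D c)) =
   ph D a *[L D] (inv[L D] (ph D b) *[L D] ph D b) *[L D] inv[L D] (ph D c)" using u c by (simp add: L.m_assoc L.Units_closed del: L.Units_l_inv)
 also have "... = ph D a *[L D] inv[L D] (ph D c)" using u c by simp
 finally show ?thesis using ab bc by (simp add: forces_def)
qed

lemma forces_add: "forces D a c ==> forces D b c ==> forces D (a +. b) c"
proof -
 assume a: "forces D a c" and b: "forces D b c"
 have "(ph D a *[L D] inv[L D] (ph D c)) +[L D] (ph D b *[L D] inv[L D] (ph D c)):RR D"
  using a b by (intro additive_subgroup.a_closed[OF RR_sub[OF D]]) (auto simp: forces_def)
 thus ?thesis using a b by (auto simp: forces_def L.l_distr)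
qed

lemma forces_mult: "forces D a b ==> forces D c d ==> forces D (a *. c) (b *. d)"
proof -
 assume a: "forces D a b" and b: "forces D c d"
 have u: "ph D b:Units (L D)" "ph D d:Units (L D)" and c: "ph D a :[L D]" "ph D c :[L D]" using a b by (auto simp: forces_def)
 have "(ph D a *[L D] inv[L D] (ph D b)) *[L D] (ph D c *[L D] inv[L D] (ph D d)):RR D" by (rule RR_mult[OF D forces_RR[OF a] forces_RR[OF b]])
 moreover have "inv[L D] (ph D b *[L D] ph D d) = inv[L D] (ph D b) *[L D] inv[L D] (ph D d)"
 proof (rule L.comm_inv_char)
  have "(ph D b *[L D] ph D d) *[L D] (inv[L D] (ph D b) *[L D] inv[L D] (ph D d)) =
   (ph D b *[L D] inv[L D] (ph D b)) *[L D] (ph D d *[L D] inv[L D] (ph D d))" using u by (simp add: L.m_ac L.Units_closed del: L.Units_r_inv)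
  thus "(ph D b *[L D] ph D d) *[L D] (inv[L D] (ph D b) *[L D] inv[L D] (ph D d)) = \<one>[L D]" using u by simp
 qed (use u in auto)
 ultimately show ?thesis using a b u c unfolding forces_def by (auto simp: L.m_ac)
qed

lemma forces_refl: "b :[B] ==> ph D b:Units (L D) ==> forces D b b" using RR_one[OF D] by (simp add: forces_def)

lemma forces_zero: "b :[B] ==> ph D b:Units (L D) ==> forces D \<zero> b"
 using additive_subgroup.zero_closed[OF RR_sub[OF D]] by (simp add: forces_def)

lemma forces_P: "p:P ==> forces D p \<one>" using RR_ph[OF D, of p] P_carr by (auto simp: forces_def)

lemma forces_snd: "forces D (snd D) (snd D)" by (rule forces_refl) (use D g_unit[OF D] in \<open>auto simp: okd_def\<close>)

lemma forces_fst: "f:fst D ==> forces D f (snd D)"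
proof -
 assume f: "f:fst D"
 have c: "f :[B]" "snd D :[B]" using f D by (auto simp: okd_def)
 show ?thesis using RR_fr[OF D f] g_unit[OF D] c by (simp add: fr_eq[OF D c(1)] forces_def)
qed

lemma forces_unitD: "forces D (a *. c) (b *. c) ==> b :[B] ==> c :[B] ==> ph D b:Units (L D) & ph D c:Units (L D)"
proof -
 assume f: "forces D (a *. c) (b *. c)" and b: "b :[B]" and c: "c :[B]"
 have "ph D b *[L D] ph D c:Units (L D)" using forces_unit[OF f] b c by simp
 thus ?thesis using L.Units_factor[of "ph D b" "ph D c"] L.Units_factor[of "ph D c" "ph D b"] b c L.m_comm[of "ph D b" "ph D c"] by auto
qed

lemma forces_cancel: "forces D (a *. c) (b *. c) ==> a :[B] ==> b :[B] ==> c :[B] ==> forces D a b"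
proof -
 assume f: "forces D (a *. c) (b *. c)" and abc: "a :[B]" "b :[B]" "c :[B]"
 have u: "ph D b:Units (L D)" "ph D c:Units (L D)" using forces_unitD[OF f abc(2,3)] by auto
 have bc: "ph D b *[L D] ph D c:Units (L D)" using u by simp
 have i: "inv[L D] (ph D b *[L D] ph D c) :[L D]" using bc by (rule L.Units_inv_closed)
 have "ph D a *[L D] inv[L D] (ph D b) = (ph D a *[L D] inv[L D] (ph D b)) *[L D]
   ((ph D b *[L D] ph D c) *[L D] inv[L D] (ph D b *[L D] ph D c))" unfolding L.Units_r_inv[OF bc] using u abc by simp
 also have "... = (inv[L D] (ph D b) *[L D] ph D b) *[L D] ((ph D a *[L D] ph D c) *[L D] inv[L D] (ph D b *[L D] ph D c))"
  using u i abc by (simp add: L.m_ac L.Units_closed del: L.Units_l_inv L.Units_r_inv)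
 also have "... = ph D (a *. c) *[L D] inv[L D] (ph D (b *. c))" unfolding L.Units_l_inv[OF u(1)] using i abc by simp
 finally show ?thesis using f u abc by (simp add: forces_def)
qed

end

text \<open>Multiplication by 1/b is continuous on \<open>B[1/g]\<close>, so t/b lies in the open
  subring \<open>RR D\<close> for small t.\<close>

lemma forces_small:
 assumes D: "D:RD" and b: "b :[B]" "ph D b:Units (L D)"
 shows "EX e>0. ALL t:Ub e. forces D t b"
proof -
 note ok = RD_okd[OF D]
 interpret L: cring "L D" by (rule cring_L[OF ok])
 obtain V where V: "V:\<U>" "ALL y:Mn D V. inv[L D] (ph D b) *[L D] y:RR D" using L_smult[OF D L.Units_inv_closed[OF b(2)] P_U] by (elim bexE)
 obtain e where e: "e > 0" "Ub e <= V" using Ub_small[OF V(1)] by (elim exE conjE)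
 have "forces D t b" if t: "t:Ub e" for t
 proof -
  have tc: "t :[B]" using t Ub_carr by auto
  have "inv[L D] (ph D b) *[L D] ph D t:RR D" using V(2) Mn_ph[OF ok U_carr[OF V(1)]] t e(2) by auto
  thus ?thesis using b tc ph_closed[OF ok tc] L.Units_inv_closed[OF b(2)] by (simp add: forces_def L.m_comm)
 qed
 thus ?thesis using e(1) by auto
qed

lemma L_hom_unique:
 assumes D: "okd D" and S: "cring S" and h: "h:ring_hom (L D) S" "k:ring_hom (L D) S"
  and eq: "!!b. b :[B] ==> h (ph D b) = k (ph D b)" and x: "x :[L D]"
 shows "h x = k x"
proof -
 interpret L: cring "L D" by (rule cring_L[OF D])
 interpret S: cring S by (rule S)
 interpret h: ring_hom_cring "L D" S h using h by unfold_locales auto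
 interpret k: ring_hom_cring "L D" S k using h by unfold_locales auto
 have gc: "snd D :[B]" using D by (simp add: okd_def)
 obtain b n where b: "b :[B]" and bn: "x *[L D] ph D (snd D) ^[L D] (n::nat) = ph D b" using localization.frac[OF loc[OF D] x] by (elim bexE exE)
 have gl: "ph D (snd D) :[L D]" by (rule ph_closed[OF D gc])
 have u: "h (ph D (snd D)) ^[S] n:Units S" using h.hom_Units[OF g_unit[OF D]] S.Units_pow_closed' by blast
 have "h x *[S] h (ph D (snd D)) ^[S] n = h (x *[L D] ph D (snd D) ^[L D] n)" using x gl by simp
 also have "... = k (x *[L D] ph D (snd D) ^[L D] n)" unfolding bn by (rule eq[OF b])
 also have "... = k x *[S] k (ph D (snd D)) ^[S] n" using x gl by simp
 also have "k (ph D (snd D)) = h (ph D (snd D))" using eq[OF gc] by simp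
 finally show ?thesis using S.Units_r_cancel[OF u] x by simp
qed

section \<open>Refinement and intersection of rational data\<close>

definition lm :: "'a datum => 'a datum => (nat => 'a) set => (nat => 'a) set" where
 "lm D E = (SOME ps. ps:ring_hom (L D) (L E) & (ALL b:carrier B. ps (ph D b) = ph E b))"

lemma lm_spec:
 assumes D: "okd D" and E: "okd E" and u: "ph E (snd D):Units (L E)"
 shows "ring_hom_cring (L D) (L E) (lm D E)" "b :[B] ==> lm D E (ph D b) = ph E b"
proof -
 have "EX ps. ps:ring_hom (L D) (L E) & (ALL b:carrier B. ps (ph D b) = ph E b)"
  using localization.lift[OF loc[OF D] cring_L[OF E] localization.phi[OF loc[OF E]] u] by auto
 from someI_ex[OF this] have 1: "lm D E:ring_hom (L D) (L E)" and 2: "ALL b:carrier B. lm D E (ph D b) = ph E b" unfolding lm_def by auto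
 show "ring_hom_cring (L D) (L E) (lm D E)" by (rule ring_hom_cringI[OF cring_L[OF D] cring_L[OF E] 1])
 show "b :[B] ==> lm D E (ph D b) = ph E b" using 2 by simp
qed

text \<open>The certified form of the inclusion of rational subsets. The denominator is included
  among the f so that it becomes a unit also when \<open>fst D\<close> is empty.\<close>

definition refines :: "'a datum => 'a datum => bool" where
 "refines E D \<longleftrightarrow> (ALL f:insert (snd D) (fst D). forces E f (snd D))"

lemma refines_unit: "refines E D ==> ph E (snd D):Units (L E)" by (auto simp: refines_def forces_def)

text \<open>A fraction f/g of D maps into \<open>RR E\<close>, not into the ring generated by the
  fractions of E alone; hence U has to be stable under P.\<close>

lemma refines_Mn:
 assumes D: "okd D" and E: "okd E" and r: "refines E D" and U: "pstable U" and x: "x:Mn D U"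
 shows "lm D E x:Mn E U"
proof -
 interpret LD: cring "L D" by (rule cring_L[OF D])
 interpret LE: cring "L E" by (rule cring_L[OF E])
 note u = refines_unit[OF r]
 interpret l: ring_hom_cring "L D" "L E" "lm D E" by (rule lm_spec(1)[OF D E u])
 have Uc: "U <= carrier B" using U by (simp add: pstable_def)
 have "Mn D U <= {x:carrier (L D). lm D E x:Mn E U}"
 proof (rule Mn_least[OF D Uc l.additive_subgroup_preimage[OF Mn_subgroup[OF E Uc]]])
  fix v assume v: "v:U"
  hence vc: "v :[B]" using Uc by auto
  show "ph D v:{x:carrier (L D). lm D E x:Mn E U}" using lm_spec(2)[OF D E u vc] Mn_ph[OF E Uc v] ph_closed[OF D vc] by simp
 next
  fix f z assume f: "f:fst D" and z: "z:{x:carrier (L D). lm D E x:Mn E U}"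
  have fc: "f :[B]" and gc: "snd D :[B]" using f D by (auto simp: okd_def)
  have "lm D E (fr D f) = ph E f *[L E] inv[L E] (ph E (snd D))"
   unfolding fr_eq[OF D fc] using l.hom_inv[OF g_unit[OF D]] lm_spec(2)[OF D E u] fc gc g_unit[OF D] ph_closed[OF D fc] by simp
  moreover have "ph E f *[L E] inv[L E] (ph E (snd D)):RR E" using r f by (auto simp: refines_def forces_def)
  ultimately have "lm D E (fr D f) *[L E] lm D E z:Mn E U" using RR_Mn[OF E U] z by auto
  thus "fr D f *[L D] z:{x:carrier (L D). lm D E x:Mn E U}" using z fr_carr[OF D fc] by simp
 qed
 thus ?thesis using x by blast
qed

lemma lm_Units: "okd D ==> okd E ==> refines E D ==> b :[B] ==> ph D b:Units (L D) ==> ph E b:Units (L E)"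
 using ring_hom_cring.hom_Units[OF lm_spec(1)[OF _ _ refines_unit], of D E "ph D b"] lm_spec(2)[OF _ _ refines_unit, of D E b] by simp

lemma forces_mono:
 assumes D: "okd D" and E: "okd E" and r: "refines E D" and f: "forces D a b"
 shows "forces E a b"
proof -
 note u = refines_unit[OF r]
 interpret LD: cring "L D" by (rule cring_L[OF D])
 interpret l: ring_hom_cring "L D" "L E" "lm D E" by (rule lm_spec(1)[OF D E u])
 have ab: "a :[B]" "b :[B]" "ph D b:Units (L D)" using f by (auto simp: forces_def)
 have "lm D E (ph D a *[L D] inv[L D] (ph D b)):RR E" by (rule refines_Mn[OF D E r pstable_P]) (use f in \<open>simp add: forces_def\<close>)
 hence "ph E a *[L E] inv[L E] (ph E b):RR E" using ab lm_spec(2)[OF D E u] l.hom_inv[OF ab(3)] ph_closed[OF D] by simp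
 thus ?thesis using ab lm_Units[OF D E r ab(2,3)] by (simp add: forces_def)
qed

lemma refines_refl: "okd D ==> refines D D" using forces_fst forces_snd by (auto simp: refines_def)

lemma refines_trans: "okd D ==> okd E ==> okd G ==> refines G E ==> refines E D ==> refines G D"
 using forces_mono[of E G] unfolding refines_def[of E D] refines_def[of G D] by blast

text \<open>Each denominator is put among its own numerators, so that f/g = (f g')/(g g') is again
  one of the fractions of the product datum.\<close>

definition meet :: "'a datum => 'a datum => 'a datum" where
 "meet D E = ((%(x, y). x *. y) ` (insert (snd D) (fst D) \<times> insert (snd E) (fst E)), snd D *. snd E)"

lemma meet_ok: "okd D ==> okd E ==> okd (meet D E)" by (auto simp: okd_def meet_def)

text \<open>\<open>rational_span\<close> is applied to D with coefficients in B, and then to E with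
  coefficients in the neighbourhood so obtained.\<close>

lemma meet_RD:
 assumes D: "D:RD" and E: "E:RD" shows "meet D E:RD"
proof -
 have ok: "okd D" "okd E" using D E RD_okd by auto
 have c: "insert (snd D) (fst D) <= carrier B" "insert (snd E) (fst E) <= carrier B" using ok by (auto simp: okd_def)
 obtain V where V: "V:\<U>" "V <= aspan B {f *. u |f u. f:insert (snd D) (fst D) & u :[B]}" using rational_span[OF D U_carrier] by (elim bexE)
 obtain W where W: "W:\<U>" "W <= aspan B {f *. u |f u. f:insert (snd E) (fst E) & u:V}" using rational_span[OF E V(1)] by (elim bexE)
 let ?A = "aspan B {f *. u |f u. f:insert (snd (meet D E)) (fst (meet D E)) & u :[B]}"
 have As: "additive_subgroup ?A B" by (rule aspan_subgroup) (use c in \<open>auto simp: meet_def\<close>)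
 have "aspan B {f *. u |f u. f:insert (snd E) (fst E) & u:V} <= ?A"
 proof (rule aspan_least[OF _ As], clarify)
  fix y v assume y: "y:insert (snd E) (fst E)" and v: "v:V"
  have yc: "y :[B]" using y c by auto
  have "aspan B {f *. u |f u. f:insert (snd D) (fst D) & u :[B]} <= {z:carrier B. y *. z:?A}"
  proof (rule aspan_least[OF _ additive_subgroup_mult_preimage[OF As yc]], clarify)
   fix x u assume x: "x:insert (snd D) (fst D)" and u: "u :[B]"
   have xc: "x :[B]" using x c by auto
   have "(x *. y) *. u:?A"
    by (rule aspanI, rule CollectI, rule exI[of _ "x *. y"], rule exI[of _ u]) (use x y u in \<open>auto simp: meet_def\<close>)
   thus "x *. u :[B] & y *. (x *. u):?A" using xc yc u by (simp add: m_ac)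
  qed
  thus "y *. v:?A" using v V(2) by blast
 qed
 hence WA: "W <= ?A" using W(2) by simp
 have fin: "finite (fst (meet D E))" using RD_finite[OF D] RD_finite[OF E] by (simp add: meet_def)
 show ?thesis by (rule span_rational[OF meet_ok[OF ok] fin W(1) WA])
qed

lemma meet_refines:
 assumes D: "okd D" and E: "okd E" shows "refines (meet D E) D" "refines (meet D E) E"
proof -
 note ok = meet_ok[OF D E]
 have c: "x :[B]" if "x:insert (snd D) (fst D) Un insert (snd E) (fst E)" for x using that D E by (auto simp: okd_def)
 have fo: "forces (meet D E) (x *. y) (snd D *. snd E)" if "x:insert (snd D) (fst D)" "y:insert (snd E) (fst E)" for x y
  using forces_fst[OF ok, of "x *. y"] that by (force simp: meet_def)
 show "refines (meet D E) D" unfolding refines_def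
 proof
  fix f assume f: "f:insert (snd D) (fst D)"
  show "forces (meet D E) f (snd D)" by (rule forces_cancel[OF ok fo[OF f]]) (use f c in auto)
 qed
 show "refines (meet D E) E" unfolding refines_def
 proof
  fix f assume f: "f:insert (snd E) (fst E)"
  have "forces (meet D E) (f *. snd D) (snd E *. snd D)" using fo[of "snd D" f] f c m_comm[of "snd D"] by auto
  thus "forces (meet D E) f (snd E)" by (rule forces_cancel[OF ok]) (use f c in auto)
 qed
qed

lemma refines_meet:
 assumes D: "okd D" and E: "okd E" and G: "okd G" and r: "refines G D" "refines G E"
 shows "refines G (meet D E)" unfolding refines_def
proof
 fix x assume "x:insert (snd (meet D E)) (fst (meet D E))"
 then obtain a b where "x = a *. b" "a:insert (snd D) (fst D)" "b:insert (snd E) (fst E)" by (auto simp: meet_def)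
 thus "forces G x (snd (meet D E))" using forces_mult[OF G] r unfolding refines_def by (auto simp: meet_def)
qed

end

section \<open>Binary coverings: uncompleted exactness\<close>

lemma (in cring) coprime_powers:
 assumes c: "F :[R]" "H :[R]" "al :[R]" "be :[R]" and one: "al *. F +. be *. H = \<one>"
 shows "EX a:carrier R. EX b:carrier R. a *. F [^] (m::nat) +. b *. H [^] (n::nat) = \<one>"
proof -
 have step: "EX a:carrier R. EX b:carrier R. a *. F [^] m +. b *. H = \<one>"
  if c: "F :[R]" "H :[R]" "al :[R]" "be :[R]" and one: "al *. F +. be *. H = \<one>" for F H al be and m :: nat
 proof (induction m)
  case 0 show ?case by (rule bexI[of _ \<one>], rule bexI[of _ \<zero>]) (use c in auto)
 next
  case (Suc m)
  then obtain a b where ab: "a :[R]" "b :[R]" "a *. F [^] m +. b *. H = \<one>" by auto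
  have "(a *. F [^] m +. b *. H) *. (al *. F +. be *. H) = \<one>" using ab one by simp
  moreover have "(a *. F [^] m +. b *. H) *. (al *. F +. be *. H) =
    (a *. al) *. F [^] Suc m +. (a *. F [^] m *. be +. b *. (al *. F +. be *. H)) *. H"
  proof -
   let ?x = "F [^] m"
   have xc: "?x :[R]" using c by simp
   have "(a *. ?x +. b *. H) *. (al *. F +. be *. H) = a *. ?x *. (al *. F) +. (a *. ?x *. (be *. H) +. b *. H *. (al *. F +. be *. H))"
    using ab(1,2) c xc by (simp add: l_distr r_distr a_ac m_assoc)
   also have "... = (a *. al) *. (?x *. F) +. (a *. ?x *. be +. b *. (al *. F +. be *. H)) *. H"
    using ab(1,2) c xc by (simp add: l_distr r_distr m_ac)
   finally show ?thesis by simp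
  qed
  ultimately have e: "(a *. al) *. F [^] Suc m +. (a *. F [^] m *. be +. b *. (al *. F +. be *. H)) *. H = \<one>" by simp
  show ?case by (rule bexI[of _ "a *. al"], rule bexI[of _ "a *. F [^] m *. be +. b *. (al *. F +. be *. H)"])
     (rule e, use ab c in auto)
 qed
 obtain a b where ab: "a :[R]" "b :[R]" "a *. F [^] m +. b *. H = \<one>" using step[OF c one, of m] by auto
 have "b *. H +. a *. F [^] m = \<one>" using ab c a_comm by simp
 then obtain a' b' where ab': "a' :[R]" "b' :[R]" "a' *. H [^] n +. b' *. F [^] m = \<one>" using step[of H "F [^] m" b a n] c ab by auto
 hence "b' *. F [^] m +. a' *. H [^] n = \<one>" using c a_comm by simp
 thus ?thesis using ab' by auto
qed

lemma (in cring) inv_mult_Units: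
 assumes "x:Units R" "y:Units R" shows "inv (x *. y) = inv x *. inv y"
proof (rule comm_inv_char)
 have "(x *. y) *. (inv x *. inv y) = (x *. inv x) *. (y *. inv y)" using assms by (simp add: m_ac Units_closed del: Units_r_inv)
 thus "(x *. y) *. (inv x *. inv y) = \<one>" using assms by simp
qed (use assms in auto)

lemma (in cring) Units_div_mult:
 "x :[R] ==> u:Units R ==> u *. (x *. inv u) = x"
proof -
 assume x: "x :[R]" and u: "u:Units R"
 have "u *. (x *. inv u) = x *. (u *. inv u)" using x u by (simp add: m_ac Units_closed del: Units_r_inv)
 thus ?thesis using x u by simp
qed

context hub_su
begin

definition qt :: "'a datum => 'a => 'a => (nat => 'a) set" where
 "qt D x y = ph D x *[L D] inv[L D] (ph D y)"

lemma qt_carr: "okd D ==> x :[B] ==> ph D y:Units (L D) ==> qt D x y :[L D]"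
proof -
 assume D: "okd D" and x: "x :[B]" and y: "ph D y:Units (L D)"
 interpret L: cring "L D" by (rule cring_L[OF D])
 show ?thesis unfolding qt_def using ph_closed[OF D x] y by simp
qed

lemma qt_mult:
 assumes D: "okd D" and x: "x :[B]" "y :[B]" "z :[B]" "w :[B]"
  and u: "ph D z:Units (L D)" "ph D w:Units (L D)"
 shows "qt D (x *. y) (z *. w) = qt D x z *[L D] qt D y w"
proof -
 interpret L: cring "L D" by (rule cring_L[OF D])
 interpret h: ring_hom_cring B "L D" "ph D" by (rule ph_hom[OF D])
 show ?thesis unfolding qt_def using x u by (simp add: L.inv_mult_Units L.m_ac)
qed

lemma lm_qt:
 assumes D: "okd D" and E: "okd E" and r: "refines E D" and x: "x :[B]" "y :[B]" and u: "ph D y:Units (L D)"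
 shows "lm D E (qt D x y) = qt E x y"
proof -
 interpret LD: cring "L D" by (rule cring_L[OF D])
 interpret l: ring_hom_cring "L D" "L E" "lm D E" by (rule lm_spec(1)[OF D E refines_unit[OF r]])
 show ?thesis unfolding qt_def using u ph_closed[OF D x(1)] lm_spec(2)[OF D E refines_unit[OF r]] x l.hom_inv[OF u] by simp
qed

lemma fr_meet:
 assumes D: "okd D" and E: "okd E" and x: "x:insert (snd D) (fst D)" and y: "y:insert (snd E) (fst E)"
 shows "fr (meet D E) (x *. y) = qt (meet D E) x (snd D) *[L (meet D E)] qt (meet D E) y (snd E)"
proof -
 have c: "x :[B]" "y :[B]" "snd D :[B]" "snd E :[B]" using assms by (auto simp: okd_def)
 have "fr (meet D E) (x *. y) = qt (meet D E) (x *. y) (snd D *. snd E)" using fr_eq[OF meet_ok[OF D E], of "x *. y"] c by (simp add: qt_def meet_def)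
 thus ?thesis using qt_mult[OF meet_ok[OF D E] c refines_unit refines_unit] meet_refines[OF D E] by simp
qed

context
 fixes D E w and i :: nat
 assumes D: "okd D" and E: "okd E" and r: "refines E D" and w: "w :[B]" and sE: "snd E = snd D [^] i *. w"
begin

interpretation LD: cring "L D" by (rule cring_L[OF D])
interpretation LE: cring "L E" by (rule cring_L[OF E])
interpretation hD: ring_hom_cring B "L D" "ph D" by (rule ph_hom[OF D])
interpretation hE: ring_hom_cring B "L E" "ph E" by (rule ph_hom[OF E])
interpretation l: ring_hom_cring "L D" "L E" "lm D E" by (rule lm_spec(1)[OF D E refines_unit[OF r]])

text \<open>Since \<open>snd D\<close> is already a unit in \<open>L D\<close>, the ring
  \<open>L E\<close> is \<open>L D\<close> localized at w. In use, i is 1 with w = h or w = f for a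
  half, and 2 with w = f h for the overlap.\<close>

lemma lm_ker:
 assumes x: "x :[L D]" and z: "lm D E x = \<zero>[L E]"
 shows "EX m::nat. ph D w ^[L D] m *[L D] x = \<zero>[L D]"
proof -
 have gc: "snd D :[B]" using D by (simp add: okd_def)
 let ?g = "ph D (snd D)"
 have gU: "?g ^[L D] (n::nat):Units (L D)" for n using LD.Units_pow_closed'[OF g_unit[OF D]] .
 obtain b k where b: "b :[B]" and bk: "x *[L D] ?g ^[L D] (k::nat) = ph D b" using localization.frac[OF loc[OF D] x] by (elim bexE exE)
 have "ph E b = lm D E (x *[L D] ?g ^[L D] k)" unfolding bk using lm_spec(2)[OF D E refines_unit[OF r] b] by simp
 also have "... = \<zero>[L E]" using x gc z by simp
 finally have z0: "ph E b = \<zero>[L E]" .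
 obtain m :: nat where m: "snd E [^] m *. b = \<zero>" using localization.ker[OF loc[OF E] b z0] by (elim exE)
 have "ph D (snd E [^] m *. b) = \<zero>[L D]" unfolding m by simp
 hence "(?g ^[L D] i) ^[L D] m *[L D] (ph D w ^[L D] m *[L D] (x *[L D] ?g ^[L D] k)) = \<zero>[L D]"
  unfolding sE bk using gc w b by (simp add: LD.nat_pow_distrib LD.m_assoc)
 hence "((?g ^[L D] i) ^[L D] m *[L D] ?g ^[L D] k) *[L D] (ph D w ^[L D] m *[L D] x) =
   ((?g ^[L D] i) ^[L D] m *[L D] ?g ^[L D] k) *[L D] \<zero>[L D]" using gc w x by (simp add: LD.m_ac)
 moreover have "(?g ^[L D] i) ^[L D] m *[L D] ?g ^[L D] k:Units (L D)" using gU LD.Units_pow_closed'[OF gU] by simp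
 ultimately have "ph D w ^[L D] m *[L D] x = \<zero>[L D]" using x w by (subst (asm) LD.Units_l_cancel) auto
 thus ?thesis by blast
qed

lemma lm_surj:
 assumes y: "y :[L E]"
 shows "EX m::nat. EX x:carrier (L D). ph E w ^[L E] m *[L E] y = lm D E x"
proof -
 have gc: "snd D :[B]" using D by (simp add: okd_def)
 let ?g = "ph D (snd D)" and ?g' = "ph E (snd D)"
 obtain b k where b: "b :[B]" and bk: "y *[L E] ph E (snd E) ^[L E] (k::nat) = ph E b" using localization.frac[OF loc[OF E] y] by (elim bexE exE)
 define d where "d = (?g ^[L D] i) ^[L D] k"
 have dU: "d:Units (L D)" unfolding d_def by (intro LD.Units_pow_closed' g_unit[OF D])
 define x where "x = ph D b *[L D] inv[L D] d"
 have xc: "x :[L D]" unfolding x_def using b dU by simp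
 have dE: "lm D E d = (?g' ^[L E] i) ^[L E] k" unfolding d_def using gc lm_spec(2)[OF D E refines_unit[OF r] gc] by simp
 have dEU: "lm D E d:Units (L E)" using l.hom_Units[OF dU] .
 have "lm D E d *[L E] lm D E x = lm D E (d *[L D] x)" using dU xc by (simp add: LD.Units_closed)
 also have "d *[L D] x = ph D b" unfolding x_def using LD.Units_div_mult[OF _ dU] b by simp
 also have "lm D E (ph D b) = y *[L E] ph E (snd E) ^[L E] k" unfolding bk using lm_spec(2)[OF D E refines_unit[OF r] b] by simp
 also have "... = lm D E d *[L E] (ph E w ^[L E] k *[L E] y)" unfolding sE dE using gc w y by (simp add: LE.nat_pow_distrib LE.m_ac)
 finally have "ph E w ^[L E] k *[L E] y = lm D E x" using LE.Units_l_cancel[OF dEU] xc y w by simp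
 thus ?thesis using xc by blast
qed

end

end

text \<open>The half \<open>f <= h\<close> of a binary splitting. The ideal generated by f and h in
  B need not be open, so generators S of an open ideal are added to the numerators.
  \<open>Sa\<close> and \<open>Sb\<close> keep this harmless: s = (s al) f + (s be) h bounds s by
  the larger of f and h on D.\<close>

locale half = hub_su +
 fixes D f h S al be
 assumes D: "D:RD" and fh: "f :[B]" "h :[B]" and S: "finite S" "S <= carrier B"
  and gen: "EX V:\<U>. V <= aspan B {s *. u |s u. s:S & u :[B]}"
  and ab: "al :[L D]" "be :[L D]" and one: "al *[L D] ph D f +[L D] be *[L D] ph D h = \<one>[L D]"
  and Sa: "!!s. s:S ==> ph D s *[L D] al:RR D" and Sb: "!!s. s:S ==> ph D s *[L D] be:RR D"
begin

abbreviation "E \<equiv> (insert f S, h)"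
abbreviation "D1 \<equiv> meet D E"
abbreviation "ps \<equiv> lm D D1"
abbreviation "F \<equiv> ph D f"
abbreviation "H \<equiv> ph D h"

lemma okD: "okd D" by (rule RD_okd[OF D])

lemma E_RD: "E:RD"
proof -
 obtain V where V: "V:\<U>" "V <= aspan B {s *. u |s u. s:S & u :[B]}" using gen by (elim bexE)
 have "aspan B {s *. u |s u. s:S & u :[B]} <= aspan B {s *. u |s u. s:insert (snd E) (fst E) & u :[B]}" by (rule aspan_mono) (use fh S in auto)
 hence VV: "V <= aspan B {s *. u |s u. s:insert (snd E) (fst E) & u :[B]}" using V(2) by simp
 show ?thesis by (rule span_rational[OF _ _ V(1) VV]) (use fh S in \<open>auto simp: okd_def\<close>)
qed

lemma okE: "okd E" by (rule RD_okd[OF E_RD])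
lemma D1: "D1:RD" by (rule meet_RD[OF D E_RD])
lemma okD1: "okd D1" by (rule RD_okd[OF D1])
lemma ref1: "refines D1 D" and ref2: "refines D1 E" using meet_refines[OF okD okE] by auto

sublocale LD: cring "L D" by (rule cring_L[OF okD])
sublocale L1: cring "L D1" by (rule cring_L[OF okD1])
sublocale hD: ring_hom_cring B "L D" "ph D" by (rule ph_hom[OF okD])
sublocale h1: ring_hom_cring B "L D1" "ph D1" by (rule ph_hom[OF okD1])
sublocale psi: ring_hom_cring "L D" "L D1" ps by (rule lm_spec(1)[OF okD okD1 refines_unit[OF ref1]])

lemma psi_ph: "b :[B] ==> ps (ph D b) = ph D1 b" by (rule lm_spec(2)[OF okD okD1 refines_unit[OF ref1]])

lemma gc: "snd D :[B]" using okD by (simp add: okd_def)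

lemma FHc: "F :[L D]" "H :[L D]" using fh by auto

lemma psiH: "ps H = ph D1 h" "ps F = ph D1 f" using psi_ph fh by auto
lemma psiH_unit: "ps H:Units (L D1)" using refines_unit[OF ref2] psiH by simp

lemma snd_D1: "snd D1 = snd D [^] (1::nat) *. h" using gc by (simp add: meet_def)

lemma mem_D1: "y:fst D1 \<longleftrightarrow> (EX x:insert (snd D) (fst D). EX z:insert h (insert f S). y = x *. z)" by (auto simp: meet_def)

text \<open>For numerators from S multiply by \<open>al F + be H = 1\<close>; the others are
  multiples of F or H at once. Thus a fraction of D1 contributes exactly one degree to the forms in
  \<open>Mn1_form\<close>.\<close>

lemma gen_form:
 assumes y: "y:fst D1"
 shows "EX r1:RR D. EX r2:RR D. ps H *[L D1] fr D1 y = ps (r1 *[L D] F +[L D] r2 *[L D] H)"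
proof -
 obtain x z where xz: "y = x *. z" "x:insert (snd D) (fst D)" "z:insert h (insert f S)" using y mem_D1 by auto
 have c: "x :[B]" "z :[B]" using xz okD fh S by (auto simp: okd_def)
 have z': "z:insert (snd E) (fst E)" using xz by simp
 define r where "r = qt D x (snd D)"
 have "forces D x (snd D)" using xz(2) forces_fst[OF okD, of x] forces_snd[OF okD] by auto
 hence rR: "r:RR D" unfolding r_def qt_def by (rule forces_RR)
 have rc: "r :[L D]" using rR RR_carr[OF okD] by auto
 have e1: "fr D1 y = ps r *[L D1] (ph D1 z *[L D1] inv[L D1] (ps H))"
  unfolding xz(1) fr_meet[OF okD okE xz(2) z'] r_def lm_qt[OF okD okD1 ref1 c(1) gc g_unit[OF okD]] by (simp add: qt_def psiH)
 have "ps H *[L D1] fr D1 y = ps r *[L D1] (ps H *[L D1] (ph D1 z *[L D1] inv[L D1] (ps H)))"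
  unfolding e1 by (rule L1.m_lcomm) (use rc c FHc psiH_unit in auto)
 also have "... = ps r *[L D1] ph D1 z" using L1.Units_div_mult[OF _ psiH_unit] c by simp
 also have "... = ps (r *[L D] ph D z)" using rc c psi_ph by simp
 finally have eq: "ps H *[L D1] fr D1 y = ps (r *[L D] ph D z)" .
 have z0: "\<zero>[L D]:RR D" by (rule additive_subgroup.zero_closed[OF RR_sub[OF okD]])
 have "EX r1:RR D. EX r2:RR D. r *[L D] ph D z = r1 *[L D] F +[L D] r2 *[L D] H"
 proof -
  consider "z = h" | "z = f" | "z:S" using xz by auto
  thus ?thesis
  proof cases
   case 1 thus ?thesis using rR z0 rc FHc by (intro bexI[of _ "\<zero>[L D]"] bexI[of _ r]) auto
  next
   case 2 thus ?thesis using rR z0 rc FHc by (intro bexI[of _ r] bexI[of _ "\<zero>[L D]"]) auto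
  next
   case 3
   have "r *[L D] ph D z = r *[L D] ph D z *[L D] (al *[L D] F +[L D] be *[L D] H)" unfolding one using rc c by simp
   also have "... = (r *[L D] (ph D z *[L D] al)) *[L D] F +[L D] (r *[L D] (ph D z *[L D] be)) *[L D] H"
    using rc c ab FHc by (simp add: LD.r_distr LD.m_assoc)
   finally have e: "r *[L D] ph D z = (r *[L D] (ph D z *[L D] al)) *[L D] F +[L D] (r *[L D] (ph D z *[L D] be)) *[L D] H" .
   show ?thesis by (rule bexI[OF _ RR_mult[OF okD rR Sa[OF 3]]], rule bexI[OF _ RR_mult[OF okD rR Sb[OF 3]]], rule e)
  qed
 qed
 then obtain r1 r2 where r: "r1:RR D" "r2:RR D" "r *[L D] ph D z = r1 *[L D] F +[L D] r2 *[L D] H" by (elim bexE)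
 show ?thesis unfolding eq r(3) by (rule bexI[OF _ r(1)], rule bexI[OF _ r(2)], rule refl)
qed

text \<open>Induction by \<open>Mn_least\<close>: a further fraction of D1 raises K by one, by
  \<open>gen_form\<close>, and the coefficients stay in \<open>Mn D U\<close> because U is stable
  under P.\<close>

lemma Mn1_form:
 assumes U: "pstable U" and y: "y:Mn D1 U"
 shows "EX K. EX s:LD.hspan F H K (Mn D U). ps H ^[L D1] K *[L D1] y = ps s"
proof -
 have Uc: "U <= carrier B" using U by (simp add: pstable_def)
 note Mc = Mn_carr[OF okD Uc]
 note hc = LD.hspan_carr[OF FHc Mc]
 note hs = LD.hspan_sub[OF FHc Mc]
 let ?Q = "%y. EX K. EX s:LD.hspan F H K (Mn D U). ps H ^[L D1] K *[L D1] y = ps s"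
 let ?Z = "{y:carrier (L D1). ?Q y}"
 have pc: "ps H :[L D1]" using FHc by simp
 \<comment> \<open>Forms of different degrees are brought to a common degree by powers of H before
   they are subtracted.\<close>
 have up: "EX s':LD.hspan F H (K + n) (Mn D U). ps H ^[L D1] (K + n) *[L D1] y = ps s'"
  if s: "s:LD.hspan F H K (Mn D U)" and e: "ps H ^[L D1] K *[L D1] y = ps s" and y: "y :[L D1]" for K n s y
 proof (intro bexI)
  show "H ^[L D] n *[L D] s:LD.hspan F H (K + n) (Mn D U)" by (rule LD.hspan_Hpow[OF FHc Mc s])
  have "ps H ^[L D1] (K + n) *[L D1] y = ps H ^[L D1] n *[L D1] (ps H ^[L D1] K *[L D1] y)"
   using pc y by (simp add: L1.nat_pow_mult[symmetric] L1.m_ac)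
  thus "ps H ^[L D1] (K + n) *[L D1] y = ps (H ^[L D] n *[L D] s)" unfolding e using FHc s hc by (auto simp: subset_eq)
 qed
 have Zs: "additive_subgroup ?Z (L D1)"
 proof (rule L1.additive_subgroupI_minus)
  have "?Q \<zero>[L D1]" by (rule exI[of _ 0], rule bexI[OF _ additive_subgroup.zero_closed[OF hs]]) simp
  thus "\<zero>[L D1]:?Z" by simp
  fix y y' assume "y:?Z" "y':?Z"
  then obtain K s K' s' where ys: "y :[L D1]" "y' :[L D1]"
   "s:LD.hspan F H K (Mn D U)" "ps H ^[L D1] K *[L D1] y = ps s"
   "s':LD.hspan F H K' (Mn D U)" "ps H ^[L D1] K' *[L D1] y' = ps s'" by auto
  obtain t where t: "t:LD.hspan F H (K + K') (Mn D U)" "ps H ^[L D1] (K + K') *[L D1] y = ps t" using up[OF ys(3,4,1), of K'] by (elim bexE)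
  obtain t' where t': "t':LD.hspan F H (K' + K) (Mn D U)" "ps H ^[L D1] (K' + K) *[L D1] y' = ps t'" using up[OF ys(5,6,2), of K] by (elim bexE)
  have tc: "t :[L D]" "t' :[L D]" using t t' hc by auto
  have "t -[L D] t':LD.hspan F H (K + K') (Mn D U)"
   using additive_subgroup_minus_closed[OF hs LD.abelian_group_axioms] t(1) t'(1) by (simp add: add.commute)
  moreover have "ps H ^[L D1] (K + K') *[L D1] (y -[L D1] y') = ps (t -[L D] t')" using t(2) t'(2) ys(1,2) tc pc
   by (simp add: psi.hom_minus L1.minus_eq L1.r_distr L1.r_minus add.commute)
  ultimately show "y -[L D1] y':?Z" using ys by auto
 qed auto
 have "Mn D1 U <= ?Z"
 proof (rule Mn_least[OF okD1 Uc Zs])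
  fix u assume u: "u:U"
  have uc: "u :[B]" using u Uc by auto
  have "ph D u *[L D] (F ^[L D] (0::nat) *[L D] H ^[L D] (0::nat)):LD.hspan F H 0 (Mn D U)"
   unfolding LD.hspan_def by (rule LD.aspanI) (use Mn_ph[OF okD Uc u] in blast)
  hence "ph D u:LD.hspan F H 0 (Mn D U)" using uc by simp
  moreover have "ps H ^[L D1] (0::nat) *[L D1] ph D1 u = ps (ph D u)" using uc psi_ph by simp
  ultimately have "?Q (ph D1 u)" by (intro exI[of _ 0] bexI[of _ "ph D u"])
  thus "ph D1 u:?Z" using uc by simp
 next
  fix y z assume y: "y:fst D1" and "z:?Z"
  then obtain K s where z: "z :[L D1]" "s:LD.hspan F H K (Mn D U)" "ps H ^[L D1] K *[L D1] z = ps s" by auto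
  obtain r1 r2 where r: "r1:RR D" "r2:RR D" "ps H *[L D1] fr D1 y = ps (r1 *[L D] F +[L D] r2 *[L D] H)" using gen_form[OF y] by (elim bexE)
  have rc: "r1 :[L D]" "r2 :[L D]" using r RR_carr[OF okD] by auto
  have sc: "s :[L D]" using z hc by auto
  have fc: "fr D1 y :[L D1]" using fr_carr[OF okD1] y okD1 by (auto simp: okd_def)
  let ?s = "(r1 *[L D] F +[L D] r2 *[L D] H) *[L D] s"
  have "(r1 *[L D] (F ^[L D] (1::nat) *[L D] H ^[L D] (0::nat))) *[L D] s:LD.hspan F H (Suc K) (Mn D U)"
   by (rule LD.hspan_mult[OF FHc Mc Mc rc(1) z(2) RR_Mn[OF okD U r(1)]]) auto
  moreover have "(r2 *[L D] (F ^[L D] (0::nat) *[L D] H ^[L D] (1::nat))) *[L D] s:LD.hspan F H (Suc K) (Mn D U)"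
   by (rule LD.hspan_mult[OF FHc Mc Mc rc(2) z(2) RR_Mn[OF okD U r(2)]]) auto
  ultimately have "(r1 *[L D] F) *[L D] s +[L D] (r2 *[L D] H) *[L D] s:LD.hspan F H (Suc K) (Mn D U)"
   using additive_subgroup.a_closed[OF hs] rc FHc by simp
  hence "?s:LD.hspan F H (Suc K) (Mn D U)" using rc FHc sc by (simp add: LD.l_distr)
  moreover have "ps H ^[L D1] Suc K *[L D1] (fr D1 y *[L D1] z) = ps ?s"
  proof -
   have "ps H ^[L D1] Suc K *[L D1] (fr D1 y *[L D1] z) = (ps H *[L D1] fr D1 y) *[L D1] (ps H ^[L D1] K *[L D1] z)"
    using pc fc z(1) by (simp add: L1.m_ac)
   thus ?thesis unfolding r(3) z(3) using rc FHc sc by simp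
  qed
  ultimately have "?Q (fr D1 y *[L D1] z)" by blast
  thus "fr D1 y *[L D1] z:?Z" using fc z(1) by simp
 qed
 thus ?thesis using y by blast
qed

text \<open>The identity of \<open>Mn1_form\<close> holds in the localization; a power of H removes
  the kernel and turns it into one in \<open>L D\<close>. All large n are claimed so that both
  halves can later use the same exponent.\<close>

lemma Mn1_pull:
 assumes U: "pstable U" and x: "x :[L D]" and y: "ps x:Mn D1 U"
 shows "EX K. ALL n>=K. H ^[L D] n *[L D] x:LD.hspan F H n (Mn D U)"
proof -
 have Uc: "U <= carrier B" using U by (simp add: pstable_def)
 note Mc = Mn_carr[OF okD Uc]
 obtain K s where s: "s:LD.hspan F H K (Mn D U)" "ps H ^[L D1] K *[L D1] ps x = ps s" using Mn1_form[OF U y] by (elim exE bexE)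
 have sc: "s :[L D]" using s LD.hspan_carr[OF FHc Mc] by auto
 have "ps (H ^[L D] K *[L D] x -[L D] s) = \<zero>[L D1]" using s(2) sc x FHc by (simp add: psi.hom_minus L1.minus_eq L1.r_neg)
 then obtain m :: nat where m: "H ^[L D] m *[L D] (H ^[L D] K *[L D] x -[L D] s) = \<zero>[L D]"
  using lm_ker[OF okD okD1 ref1 fh(2) snd_D1, of "H ^[L D] K *[L D] x -[L D] s"] sc x FHc by auto
 hence "H ^[L D] m *[L D] (H ^[L D] K *[L D] x) -[L D] H ^[L D] m *[L D] s = \<zero>[L D]"
  using sc x FHc by (simp add: LD.minus_eq LD.r_distr LD.r_minus)
 hence eq: "H ^[L D] m *[L D] (H ^[L D] K *[L D] x) = H ^[L D] m *[L D] s" using sc x FHc LD.r_right_minus_eq by simp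
 have "H ^[L D] n *[L D] x:LD.hspan F H n (Mn D U)" if n: "n >= K + m" for n
 proof -
  have 1: "H ^[L D] (n - K) *[L D] s:LD.hspan F H (K + (n - K)) (Mn D U)" by (rule LD.hspan_Hpow[OF FHc Mc s(1)])
  have "H ^[L D] n = H ^[L D] (n - K - m) *[L D] (H ^[L D] m *[L D] H ^[L D] K)" using n FHc by (simp add: LD.nat_pow_mult)
  hence "H ^[L D] n *[L D] x = H ^[L D] (n - K - m) *[L D] (H ^[L D] m *[L D] (H ^[L D] K *[L D] x))" using x FHc by (simp add: LD.m_assoc)
  also have "... = H ^[L D] (n - K - m) *[L D] (H ^[L D] m *[L D] s)" unfolding eq ..
  also have "... = H ^[L D] (n - K) *[L D] s" using n sc FHc by (simp add: LD.m_assoc[symmetric] LD.nat_pow_mult)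
  finally show ?thesis using 1 n by simp
 qed
 thus ?thesis by blast
qed

text \<open>f/h occurs among the fractions of D1 as (g f)/(g h), since \<open>meet\<close> keeps the
  denominator g among the numerators.\<close>

lemma Mn1_ratio:
 assumes Uc: "U <= carrier B" and y: "y:Mn D1 U"
 shows "(ps F *[L D1] inv[L D1] (ps H)) *[L D1] y:Mn D1 U"
proof -
 have m: "snd D *. f:fst D1" using mem_D1 by auto
 have gU: "ph D1 (snd D):Units (L D1)" by (rule refines_unit[OF ref1])
 have "fr D1 (snd D *. f) = qt D1 (snd D) (snd D) *[L D1] qt D1 f h" using fr_meet[OF okD okE, of "snd D" f] by simp
 also have "qt D1 (snd D) (snd D) = \<one>[L D1]" unfolding qt_def using gU by simp
 also have "\<one>[L D1] *[L D1] qt D1 f h = ps F *[L D1] inv[L D1] (ps H)" using qt_carr[OF okD1 fh(1), of h] psiH_unit by (simp add: qt_def psiH)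
 finally show ?thesis using Mn_fr[OF okD1 Uc m y] by simp
qed

end

section \<open>Extension to completions\<close>

lemma (in seminormed_ring) mult_close:
 assumes x: "x :[R]" and y: "y :[R]" and e: "e > 0"
 shows "EX d>0. ALL x':carrier R. ALL y':carrier R. q (x -. x') <= d --> q (y -. y') <= d --> q (x *. y -. x' *. y') <= e"
proof -
 define C where "C = 1 + q x + q y"
 have C: "C >= 1" "q x <= C" "q y <= C" using q_nonneg[OF x] q_nonneg[OF y] by (auto simp: C_def)
 define d where "d = min 1 (e / C)"
 have d: "d > 0" "d <= 1" using e C by (auto simp: d_def)
 have "d * C <= e / C * C" using C by (intro mult_right_mono) (auto simp: d_def)
 hence dC: "d * C <= e" using C by simp
 show ?thesis
 proof (intro exI[of _ d] conjI ballI impI)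
  fix x' y' assume c: "x' :[R]" "y' :[R]" and xx: "q (x -. x') <= d" and yy: "q (y -. y') <= d"
  have x'C: "q x' <= C"
  proof -
   have "q x' <= max (q (x' -. x)) (q x)" using q_diff_trans[of x' x \<zero>] c x by (simp add: minus_eq)
   thus ?thesis using xx q_minus_comm[OF x c(1)] d C by auto
  qed
  have eq: "x *. y -. x' *. y' = (x -. x') *. y +. x' *. (y -. y')" using x y c by (simp add: minus_eq l_distr r_distr l_minus r_minus a_assoc r_neg1)
  have "q ((x -. x') *. y) <= d * C"
  proof -
   have "q ((x -. x') *. y) <= q (x -. x') * q y" using q_mult x y c by simp
   also have "... <= d * C" using xx C d q_nonneg x y c by (intro mult_mono) auto
   finally show ?thesis .
  qed
  moreover have "q (x' *. (y -. y')) <= d * C"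
  proof -
   have "q (x' *. (y -. y')) <= q x' * q (y -. y')" using q_mult x y c by simp
   also have "... <= C * d" using yy C x'C d q_nonneg x y c by (intro mult_mono) auto
   finally show ?thesis by (simp add: mult.commute)
  qed
  ultimately have "q ((x -. x') *. y) <= e" "q (x' *. (y -. y')) <= e" using dC by linarith+
  thus "q (x *. y -. x' *. y') <= e" unfolding eq using q_add[of "(x -. x') *. y" "x' *. (y -. y')"] x y c by simp
 qed (use d in auto)
qed

text \<open>The rate 1/(n+1) is not summable; that it suffices is due to the ultrametric
  inequality.\<close>

lemma (in banach) cauchy_steps:
 assumes s: "!!n. s n :[R]" and st: "!!n. N (s (Suc n) -. s n) <= 1 / (real n + 1)"
 shows "EX l:carrier R. ALL e>0. EX n0. ALL n>=n0. N (s n -. l) < e"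
proof (rule complete[OF s])
 fix e :: real assume e: "e > 0"
 obtain k :: nat where k: "1 / (real k + 1) < e" using reals_Archimedean[OF e] by (auto simp: inverse_eq_divide add.commute)
 have kn: "N (s n -. s k) <= 1 / (real k + 1)" if "n >= k" for n using that
 proof (induction n rule: dec_induct)
  case base show ?case using s[of k] by (simp add: minus_eq r_neg q_zero)
 next
  case (step n)
  have "N (s (Suc n) -. s n) <= 1 / (real k + 1)" using st[of n] step(1) by (smt (verit) frac_le of_nat_mono of_nat_0_le_iff)
  thus ?case using q_diff_trans[OF s[of "Suc n"] s[of n] s[of k]] step by simp
 qed
 show "EX n0. ALL m>=n0. ALL n>=n0. N (s m -. s n) < e"
 proof (intro exI[of _ k] allI impI)
  fix m n assume mn: "k <= m" "k <= n"
  have "N (s m -. s n) <= max (N (s m -. s k)) (N (s k -. s n))" by (rule q_diff_trans[OF s s s])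
  thus "N (s m -. s n) < e" using kn[OF mn(1)] kn[OF mn(2)] q_minus_comm[OF s[of k] s[of n]] k by simp
 qed
qed

lemma extend_dense:
 assumes j: "ring_hom_cring L C j" and C: "banach C N" and dense: "!!c e. c :[C] ==> e > 0 ==> EX x:carrier L. N (c -[C] j x) <= e"
  and C': "banach C' N'" and th: "ring_hom_cring L C' th"
  and cont: "!!e. e > 0 ==> EX d>0. ALL x:carrier L. N (j x) <= d --> N' (th x) <= e"
 shows "EX fi:ring_hom C C'. (ALL x:carrier L. fi (j x) = th x) & (ALL e>0. EX d>0. ALL c:carrier C. N c <= d --> N' (fi c) <= e)"
proof -
 interpret C: banach C N by fact
 interpret C': banach C' N' by fact
 interpret j: ring_hom_cring L C j by fact
 interpret th: ring_hom_cring L C' th by fact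
 have jm: "j x -[C] j x' = j (x -[L] x')" "th x -[C'] th x' = th (x -[L] x')"
  if "x :[L]" "x' :[L]" for x x' using that by (simp_all add: j.hom_minus th.hom_minus)
 \<comment> \<open>The value at c is described by all close approximations from L rather than by a
   sequence; a sequence occurs only in the existence proof.\<close>
 define lim where "lim c y \<longleftrightarrow> y :[C'] & (ALL e>0. EX d>0. ALL x:carrier L. N (c -[C] j x) <= d --> N' (y -[C'] th x) <= e)" for c y
 have ex: "EX y. lim c y" if c: "c :[C]" for c
 proof -
  have "EX x:carrier L. N (c -[C] j x) <= 1 / (real n + 1)" for n :: nat by (rule dense[OF c]) simp
  then obtain x where x: "!!n. x n :[L]" "!!n. N (c -[C] j (x n)) <= 1 / (real n + 1)" by metis
  have near: "EX k. ALL n>=k. N (c -[C] j (x n)) <= d" if d: "d > 0" for d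
  proof -
   obtain k :: nat where k: "1 / (real k + 1) < d" using reals_Archimedean[OF d] by (auto simp: inverse_eq_divide add.commute)
   have "N (c -[C] j (x n)) <= d" if "n >= k" for n
   proof -
    have "1 / (real n + 1) <= 1 / (real k + 1)" using that by (intro divide_left_mono) auto
    thus ?thesis using x(2)[of n] k by linarith
   qed
   thus ?thesis by blast
  qed
  have close: "N (j (u -[L] v)) <= d" if "u :[L]" "v :[L]" "N (c -[C] j u) <= d" "N (c -[C] j v) <= d" for u v d
  proof -
   have "N (j u -[C] j v) <= max (N (j u -[C] c)) (N (c -[C] j v))" by (rule C.q_diff_trans) (use that c in auto)
   moreover have "N (j u -[C] c) = N (c -[C] j u)" by (rule C.q_minus_comm) (use that c in auto)
   ultimately have "N (j u -[C] j v) <= d" using that(3,4) by linarith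
   thus ?thesis unfolding jm(1)[OF that(1,2)] .
  qed
  have "EX y:carrier C'. ALL e>0. EX n0. ALL n>=n0. N' (th (x n) -[C'] y) < e"
  proof (rule C'.complete)
   fix e :: real assume e: "e > 0"
   obtain d where d: "d > 0" "ALL x:carrier L. N (j x) <= d --> N' (th x) <= e/2" using cont[of "e/2"] e by auto
   obtain k where k: "ALL n>=k. N (c -[C] j (x n)) <= d" using near[OF d(1)] by blast
   show "EX n0. ALL m>=n0. ALL n>=n0. N' (th (x m) -[C'] th (x n)) < e"
   proof (intro exI[of _ k] allI impI)
    fix m n assume "k <= m" "k <= n"
    hence "N (j (x m -[L] x n)) <= d" using k x(1) by (intro close) auto
    hence "N' (th (x m -[L] x n)) <= e/2" by (intro d(2)[rule_format]) (use x(1) in auto)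
    thus "N' (th (x m) -[C'] th (x n)) < e" unfolding jm(2)[OF x(1) x(1)] using e by linarith
   qed
  qed (use x in auto)
  then obtain y where y: "y :[C']" "ALL e>0. EX n0. ALL n>=n0. N' (th (x n) -[C'] y) < e" by (elim bexE)
  have "lim c y" unfolding lim_def
  proof (intro conjI y(1) allI impI)
   fix e :: real assume e: "e > 0"
   obtain d where d: "d > 0" "ALL x:carrier L. N (j x) <= d --> N' (th x) <= e" using cont[OF e] by auto
   obtain k where k: "ALL n>=k. N (c -[C] j (x n)) <= d" using near[OF d(1)] by blast
   obtain k' where k': "ALL n>=k'. N' (th (x n) -[C'] y) < e" using y(2) e by auto
   define n where "n = max k k'"
   have n: "N (c -[C] j (x n)) <= d" "N' (th (x n) -[C'] y) < e" using k k' by (auto simp: n_def)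
   have "N' (y -[C'] th u) <= e" if u: "u :[L]" "N (c -[C] j u) <= d" for u
   proof -
    have "N (j (x n -[L] u)) <= d" using n u x(1) by (intro close) auto
    hence "N' (th (x n -[L] u)) <= e" by (intro d(2)[rule_format]) (use x(1) u in auto)
    hence 1: "N' (th (x n) -[C'] th u) <= e" unfolding jm(2)[OF x(1) u(1)] .
    have "N' (y -[C'] th u) <= max (N' (y -[C'] th (x n))) (N' (th (x n) -[C'] th u))" by (rule C'.q_diff_trans) (use y x u in auto)
    moreover have "N' (y -[C'] th (x n)) = N' (th (x n) -[C'] y)" by (rule C'.q_minus_comm) (use y x in auto)
    ultimately show ?thesis using 1 n(2) by linarith
   qed
   thus "EX d>0. ALL x:carrier L. N (c -[C] j x) <= d --> N' (y -[C'] th x) <= e" using d(1) by auto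
  qed
  thus ?thesis by blast
 qed
 define fi where "fi c = (SOME y. lim c y)" for c
 have lim: "lim c (fi c)" if "c :[C]" for c unfolding fi_def by (rule someI_ex[OF ex[OF that]])
 have phc: "fi c :[C']" if "c :[C]" for c using lim[OF that] by (simp add: lim_def)
 have app: "EX x:carrier L. N (c -[C] j x) <= d & N' (fi c -[C'] th x) <= e" if c: "c :[C]" and e: "e > 0" and d: "d > 0" for c d e
 proof -
  obtain d' where d': "d' > 0" "ALL x:carrier L. N (c -[C] j x) <= d' --> N' (fi c -[C'] th x) <= e" using lim[OF c] e by (auto simp: lim_def)
  obtain x where x: "x :[L]" "N (c -[C] j x) <= min d d'" using dense[OF c, of "min d d'"] d d' by auto
  thus ?thesis using d' by auto
 qed
 \<comment> \<open>To identify \<open>fi c\<close> with y it suffices to approximate c and y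
   simultaneously from L; products, sums and 1 are treated this way.\<close>
 have char: "fi c = y" if c: "c :[C]" and y: "y :[C']"
  and h: "!!d e. d > 0 ==> e > 0 ==> EX x:carrier L. N (c -[C] j x) <= d & N' (y -[C'] th x) <= e" for c y
 proof (rule C'.N_small_eq[OF phc[OF c] y])
  fix e :: real assume e: "e > 0"
  obtain d where d: "d > 0" "ALL x:carrier L. N (c -[C] j x) <= d --> N' (fi c -[C'] th x) <= e" using lim[OF c] e by (auto simp: lim_def)
  obtain x where x: "x :[L]" "N (c -[C] j x) <= d" "N' (y -[C'] th x) <= e" using h[OF d(1) e] by auto
  have "N' (fi c -[C'] y) <= max (N' (fi c -[C'] th x)) (N' (th x -[C'] y))" by (rule C'.q_diff_trans) (use phc c y x in auto)
  moreover have "N' (fi c -[C'] th x) <= e" using d(2) x(1,2) by simp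
  moreover have "N' (th x -[C'] y) = N' (y -[C'] th x)" by (rule C'.q_minus_comm) (use y x in auto)
  ultimately show "N' (fi c -[C'] y) <= e" using x(3) by linarith
 qed
 have "fi:ring_hom C C'"
 proof (rule ring_hom_memI)
  fix c c' assume c: "c :[C]" and c': "c' :[C]"
  show "fi c :[C']" by (rule phc[OF c])
  show "fi (c *[C] c') = fi c *[C'] fi c'"
  proof (rule char)
   fix d e :: real assume d: "d > 0" and e: "e > 0"
   obtain d1 where d1: "d1 > 0" "ALL x':carrier C. ALL y':carrier C. N (c -[C] x') <= d1 --> N (c' -[C] y') <= d1 --> N (c *[C] c' -[C] x' *[C] y') <= d"
    using C.mult_close[OF c c' d] by (elim exE conjE)
   obtain e1 where e1: "e1 > 0" "ALL x':carrier C'. ALL y':carrier C'. N' (fi c -[C'] x') <= e1 --> N' (fi c' -[C'] y') <= e1 --> N' (fi c *[C'] fi c' -[C'] x' *[C'] y') <= e"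
    using C'.mult_close[OF phc[OF c] phc[OF c'] e] by (elim exE conjE)
   obtain x where x: "x :[L]" "N (c -[C] j x) <= d1" "N' (fi c -[C'] th x) <= e1" using app[OF c e1(1) d1(1)] by auto
   obtain x' where x': "x' :[L]" "N (c' -[C] j x') <= d1" "N' (fi c' -[C'] th x') <= e1" using app[OF c' e1(1) d1(1)] by auto
   show "EX x:carrier L. N (c *[C] c' -[C] j x) <= d & N' (fi c *[C'] fi c' -[C'] th x) <= e"
   proof (rule bexI[of _ "x *[L] x'"], intro conjI)
    show "N (c *[C] c' -[C] j (x *[L] x')) <= d" using d1(2) x x' by simp
    show "N' (fi c *[C'] fi c' -[C'] th (x *[L] x')) <= e" using e1(2) x x' by simp
   qed (use x x' in simp)
  qed (use c c' phc in auto)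
  show "fi (c +[C] c') = fi c +[C'] fi c'"
  proof (rule char)
   fix d e :: real assume d: "d > 0" and e: "e > 0"
   obtain x where x: "x :[L]" "N (c -[C] j x) <= d" "N' (fi c -[C'] th x) <= e" using app[OF c e d] by auto
   obtain x' where x': "x' :[L]" "N (c' -[C] j x') <= d" "N' (fi c' -[C'] th x') <= e" using app[OF c' e d] by auto
   have "(c +[C] c') -[C] j (x +[L] x') = (c -[C] j x) +[C] (c' -[C] j x')" using c c' x x' by (simp add: C.minus_eq C.minus_add C.a_ac)
   moreover have "(fi c +[C'] fi c') -[C'] th (x +[L] x') = (fi c -[C'] th x) +[C'] (fi c' -[C'] th x')"
    using phc[OF c] phc[OF c'] x x' by (simp add: C'.minus_eq C'.minus_add C'.a_ac)
   ultimately have "N ((c +[C] c') -[C] j (x +[L] x')) <= d" "N' ((fi c +[C'] fi c') -[C'] th (x +[L] x')) <= e"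
    using C.q_add[of "c -[C] j x" "c' -[C] j x'"] C'.q_add[of "fi c -[C'] th x" "fi c' -[C'] th x'"] c c' x x' phc by auto
   thus "EX x:carrier L. N (c +[C] c' -[C] j x) <= d & N' (fi c +[C'] fi c' -[C'] th x) <= e" using x x' by (intro bexI[of _ "x +[L] x'"]) auto
  qed (use c c' phc in auto)
 next
  show "fi \<one>[C] = \<one>[C']"
   by (rule char, simp, simp, rule bexI[of _ "\<one>[L]"]) (auto simp: C.minus_eq C'.minus_eq C.r_neg C'.r_neg C.q_zero C'.q_zero)
 qed
 moreover have "fi (j x) = th x" if x: "x :[L]" for x by (rule char, simp add: x, simp add: x, rule bexI[of _ x])
    (use x in \<open>auto simp: C.minus_eq C'.minus_eq C.r_neg C'.r_neg C.q_zero C'.q_zero\<close>)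
 moreover have "EX d>0. ALL c:carrier C. N c <= d --> N' (fi c) <= e" if e: "e > 0" for e
 proof -
  obtain d where d: "d > 0" "ALL x:carrier L. N (j x) <= d --> N' (th x) <= e" using cont[OF e] by auto
  have "N' (fi c) <= e" if c: "c :[C]" "N c <= d" for c
  proof -
   obtain x where x: "x :[L]" "N (c -[C] j x) <= d" "N' (fi c -[C'] th x) <= e" using app[OF c(1) e d(1)] by auto
   have "N (j x) <= d" by (rule C.q_le_of_diff[of "j x" c]) (use c x C.q_minus_comm[of c "j x"] in auto)
   hence "N' (th x) <= e" using d x by auto
   thus ?thesis by (intro C'.q_le_of_diff[OF phc[OF c(1)] _ x(3)]) (use x in auto)
  qed
  thus ?thesis using d(1) by auto
 qed
 ultimately show ?thesis by blast
qed

section \<open>Continuous B-algebra homomorphisms between rational localizations\<close>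

context hub_su
begin

definition chom :: "'a datum => 'a datum => ('a rat_elt => 'a rat_elt) => bool" where
 "chom D E fi \<longleftrightarrow> fi:ring_hom (CD D) (CD E) & (ALL e>0. EX d>0. ALL x:carrier (CD D). ND D x <= d --> ND E (fi x) <= e) &
   (ALL b:carrier B. fi (rat_map B T D b) = rat_map B T E b)"

lemma chomD:
 assumes "chom D E fi"
 shows "fi:ring_hom (CD D) (CD E)" "e > 0 ==> EX d>0. ALL x:carrier (CD D). ND D x <= d --> ND E (fi x) <= e"
  "b :[B] ==> fi (jD D (ph D b)) = jD E (ph E b)" using assms by (auto simp: chom_def rat_map_eq)

text \<open>Both maps agree on the image of \<open>L D\<close> because they agree on B, and this
  image is dense.\<close>

lemma chom_unique:
 assumes D: "D:RD" and E: "E:RD" and c: "chom D E fi" "chom D E fi'" and x: "x :[CD D]"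
 shows "fi x = fi' x"
proof -
 interpret CDD: banach "CD D" "ND D" by (rule banach_CD[OF D])
 interpret CE: banach "CD E" "ND E" by (rule banach_CD[OF E])
 interpret j: ring_hom_cring "L D" "CD D" "jD D" by (rule jD_hom[OF D])
 interpret f: ring_hom_cring "CD D" "CD E" fi using chomD(1)[OF c(1)] by unfold_locales auto
 interpret f': ring_hom_cring "CD D" "CD E" fi' using chomD(1)[OF c(2)] by unfold_locales auto
 have jl: "fi (jD D l) = fi' (jD D l)" if l: "l :[L D]" for l
 proof -
  have h: "(%l. fi (jD D l)):ring_hom (L D) (CD E)" "(%l. fi' (jD D l)):ring_hom (L D) (CD E)" by (auto intro!: ring_hom_memI)
  show ?thesis by (rule L_hom_unique[OF RD_okd[OF D] cring_CD[OF E] h _ l]) (use chomD(3)[OF c(1)] chomD(3)[OF c(2)] in auto)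
 qed
 show ?thesis
 proof (rule CE.N_small_eq)
  fix e :: real assume e: "e > 0"
  obtain d where d: "d > 0" "ALL x:carrier (CD D). ND D x <= d --> ND E (fi x) <= e" using chomD(2)[OF c(1) e] by auto
  obtain d' where d': "d' > 0" "ALL x:carrier (CD D). ND D x <= d' --> ND E (fi' x) <= e" using chomD(2)[OF c(2) e] by auto
  obtain l where l: "l :[L D]" "ND D (x -[CD D] jD D l) <= min d d'" using ND_normed(3)[OF D x, of "min d d'"] d d' by auto
  have "ND E (fi (x -[CD D] jD D l)) <= e" "ND E (fi' (x -[CD D] jD D l)) <= e" using d d' l x by auto
  hence 1: "ND E (fi x -[CD E] fi (jD D l)) <= e" "ND E (fi' x -[CD E] fi (jD D l)) <= e"
   using x l jl[OF l(1)] by (simp_all add: f.hom_minus f'.hom_minus)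
  have "ND E (fi x -[CD E] fi' x) <= max (ND E (fi x -[CD E] fi (jD D l))) (ND E (fi (jD D l) -[CD E] fi' x))"
   by (rule CE.q_diff_trans) (use x l in auto)
  thus "ND E (fi x -[CD E] fi' x) <= e" using 1 CE.q_minus_comm[of "fi' x" "fi (jD D l)"] x l by auto
 qed (use x in auto)
qed

abbreviation "rs \<equiv> rat_restr B T"

text \<open>Uniqueness is automatic by density, so any continuous B-homomorphism makes the definite
  description in \<open>rat_restr\<close> meaningful. Restricting it to the carrier meets the
  extensionality clause.\<close>

lemma rs_chom:
 assumes D: "D:RD" and E: "E:RD" and ex: "EX fi. chom D E fi"
 shows "chom D E (rs D E)"
proof -
 obtain fi where fi: "chom D E fi" using ex by blast
 let ?Q = "%fi. fi:extensional (carrier (CD D)) & fi:ring_hom (CD D) (CD E) &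
    continuous_map (rat_topology B T D) (rat_topology B T E) fi &
    (ALL b:carrier B. fi (rat_map B T D b) = rat_map B T E b)"
 have eq: "?Q fi \<longleftrightarrow> fi:extensional (carrier (CD D)) & chom D E fi" for fi
  unfolding chom_def ND_spec(3)[OF D, symmetric] ND_spec(3)[OF E, symmetric]
  using continuous_map_norm_hom[OF banach_CD[OF D] banach_CD[OF E], of fi] by auto
 interpret CDD: cring "CD D" by (rule cring_CD[OF D])
 interpret j: ring_hom_cring "L D" "CD D" "jD D" by (rule jD_hom[OF D])
 have rc: "chom D E (restrict fi (carrier (CD D)))" unfolding chom_def
 proof (intro conjI ballI)
  show "restrict fi (carrier (CD D)):ring_hom (CD D) (CD E)" using chomD(1)[OF fi] unfolding ring_hom_def by auto
  show "ALL e>0. EX d>0. ALL x:carrier (CD D). ND D x <= d --> ND E (restrict fi (carrier (CD D)) x) <= e" using chomD(2)[OF fi] by auto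
  fix b assume b: "b :[B]"
  show "restrict fi (carrier (CD D)) (rat_map B T D b) = rat_map B T E b"
   using chomD(3)[OF fi b] ph_closed[OF RD_okd[OF D] b] by (simp add: rat_map_eq)
 qed
 have "?Q (THE fi. ?Q fi)"
 proof (rule theI[of ?Q "restrict fi (carrier (CD D))"])
  show "?Q (restrict fi (carrier (CD D)))" unfolding eq using rc by simp
  fix fi' assume "?Q fi'"
  hence "fi':extensional (carrier (CD D))" "chom D E fi'" unfolding eq by auto
  thus "fi' = restrict fi (carrier (CD D))" using chom_unique[OF D E _ rc] by (intro extensionalityI[of _ "carrier (CD D)"]) auto
 qed
 thus ?thesis unfolding eq rat_restr_def by simp
qed

lemma chom_comp:
 assumes D: "D:RD" and E: "E:RD" and G: "G:RD" and c: "chom D E fi" "chom E G fi'"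
 shows "chom D G (%x. fi' (fi x))" unfolding chom_def
proof (intro conjI ballI allI impI)
 have "fi' \<circ> fi:ring_hom (CD D) (CD G)" by (rule ring_hom_trans[OF chomD(1)[OF c(1)] chomD(1)[OF c(2)]])
 thus "(%x. fi' (fi x)):ring_hom (CD D) (CD G)" by (simp add: comp_def)
 fix e :: real assume e: "e > 0"
 obtain d where d: "d > 0" "ALL x:carrier (CD E). ND E x <= d --> ND G (fi' x) <= e" using chomD(2)[OF c(2) e] by auto
 obtain d' where d': "d' > 0" "ALL x:carrier (CD D). ND D x <= d' --> ND E (fi x) <= d" using chomD(2)[OF c(1) d(1)] by auto
 show "EX d>0. ALL x:carrier (CD D). ND D x <= d --> ND G (fi' (fi x)) <= e"
  using d d' ring_hom_closed[OF chomD(1)[OF c(1)]] by (intro exI[of _ d']) auto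
next
 fix b assume "b :[B]"
 thus "fi' (fi (rat_map B T D b)) = rat_map B T G b" using chomD(3)[OF c(1)] chomD(3)[OF c(2)] by (simp add: rat_map_eq)
qed

text \<open>That a restriction map exists whenever \<open>RS E <= RS D\<close> is proved only in
  \<open>RS_adm\<close>, by gluing; until then existence is carried along as a hypothesis.\<close>

definition adm :: "'a datum => 'a datum => bool" where
 "adm D E \<longleftrightarrow> D:RD & E:RD & (EX fi. chom D E fi)"

lemma adm_RD: "adm D E ==> D:RD" "adm D E ==> E:RD" by (auto simp: adm_def)
lemma adm_chom: "adm D E ==> chom D E (rs D E)" using rs_chom by (auto simp: adm_def)
lemma rs_hom: "adm D E ==> ring_hom_cring (CD D) (CD E) (rs D E)"
 by (rule ring_hom_cringI[OF cring_CD[OF adm_RD(1)] cring_CD[OF adm_RD(2)] chomD(1)[OF adm_chom]])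
lemma rs_cont: "adm D E ==> e > 0 ==> EX d>0. ALL x:carrier (CD D). ND D x <= d --> ND E (rs D E x) <= e" by (rule chomD(2)[OF adm_chom])
lemma adm_trans: "adm D E ==> adm E G ==> adm D G" using chom_comp unfolding adm_def by blast

lemma rs_comp: "adm D E ==> adm E G ==> x :[CD D] ==> rs E G (rs D E x) = rs D G x"
 using chom_unique[OF adm_RD(1) adm_RD(2) chom_comp[OF adm_RD(1) adm_RD(1) adm_RD(2) adm_chom adm_chom] adm_chom[OF adm_trans]] by blast

lemma rs_unique: "D:RD ==> E:RD ==> chom D E fi ==> x :[CD D] ==> rs D E x = fi x"
 using chom_unique[OF _ _ adm_chom, of D E fi x] by (auto simp: adm_def)

lemma chom_id: "D:RD ==> chom D D (%x. x)" unfolding chom_def by (auto intro!: ring_hom_memI)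

lemma rs_id: "D:RD ==> x :[CD D] ==> rs D D x = x" by (rule rs_unique[OF _ _ chom_id])

text \<open>The neighbourhood is first shrunk to a ball of radius below 1, because
  \<open>refines_Mn\<close> asks for stability under P.\<close>

lemma lm_cont:
 assumes D: "D:RD" and E: "E:RD" and r: "refines E D" and e: "e > 0"
 shows "EX d>0. ALL x:carrier (L D). ND D (jD D x) <= d --> ND E (jD E (lm D E x)) <= e"
proof -
 obtain U where U: "U:\<U>" "ALL x:Mn E U. ND E (jD E x) <= e" using ND_normed(2)[OF E e] by (elim bexE)
 obtain v where v: "v > 0" "v < 1" "Ub v <= U" using Ub_small[OF U(1)] by (elim exE conjE)
 obtain d where d: "d > 0" "ALL x:carrier (L D). ND D (jD D x) <= d --> x:Mn D (Ub v)" using ND_normed(1)[OF D Ub_U[OF v(1)]] by (elim exE conjE)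
 have "ND E (jD E (lm D E x)) <= e" if x: "x :[L D]" "ND D (jD D x) <= d" for x
 proof -
  have "lm D E x:Mn E (Ub v)" by (rule refines_Mn[OF RD_okd[OF D] RD_okd[OF E] r pstable_Ub[OF v(2)]]) (use d x in auto)
  thus ?thesis using U(2) Mn_mono[OF RD_okd[OF E] v(3) U_carr[OF U(1)]] by auto
 qed
 thus ?thesis using d(1) by auto
qed

lemma refines_chom:
 assumes D: "D:RD" and E: "E:RD" and r: "refines E D"
 shows "EX fi. chom D E fi & (ALL l:carrier (L D). fi (jD D l) = jD E (lm D E l))"
proof -
 note ok = RD_okd[OF D] RD_okd[OF E]
 note u = refines_unit[OF r]
 interpret l: ring_hom_cring "L D" "L E" "lm D E" by (rule lm_spec(1)[OF ok u])
 interpret jE: ring_hom_cring "L E" "CD E" "jD E" by (rule jD_hom[OF E])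
 have "(%x. jD E (lm D E x)):ring_hom (L D) (CD E)" by (auto intro!: ring_hom_memI)
 hence th: "ring_hom_cring (L D) (CD E) (%x. jD E (lm D E x))" by (rule ring_hom_cringI[OF cring_L[OF ok(1)] cring_CD[OF E]])
 have "EX fi:ring_hom (CD D) (CD E). (ALL x:carrier (L D). fi (jD D x) = jD E (lm D E x)) &
  (ALL e>0. EX d>0. ALL c:carrier (CD D). ND D c <= d --> ND E (fi c) <= e)"
  by (rule extend_dense[OF jD_hom[OF D] banach_CD[OF D] _ banach_CD[OF E] th])
    (erule ND_normed(3)[OF D], assumption, rule lm_cont[OF D E r], assumption)
 then obtain fi where fi: "fi:ring_hom (CD D) (CD E)" "ALL x:carrier (L D). fi (jD D x) = jD E (lm D E x)"
  "ALL e>0. EX d>0. ALL c:carrier (CD D). ND D c <= d --> ND E (fi c) <= e" by (elim bexE conjE)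
 have "chom D E fi" unfolding chom_def rat_map_eq using fi ph_closed[OF ok(1)] lm_spec(2)[OF ok u] by auto
 thus ?thesis using fi(2) by blast
qed

lemma refines_adm: "D:RD ==> E:RD ==> refines E D ==> adm D E" using refines_chom unfolding adm_def by blast

lemma rs_jD:
 assumes D: "D:RD" and E: "E:RD" and r: "refines E D" and l: "l :[L D]"
 shows "rs D E (jD D l) = jD E (lm D E l)"
proof -
 obtain fi where fi: "chom D E fi" "ALL l:carrier (L D). fi (jD D l) = jD E (lm D E l)" using refines_chom[OF D E r] by (elim exE conjE)
 show ?thesis using rs_unique[OF D E fi(1)] fi(2) l ring_hom_closed[OF ring_hom_cring.homh[OF jD_hom[OF D]] l] by simp
qed

lemma lm_comp:
 assumes D: "okd D" and E: "okd E" and G: "okd G" and r: "refines E D" "refines G E" and x: "x :[L D]"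
 shows "lm E G (lm D E x) = lm D G x"
proof -
 have r': "refines G D" by (rule refines_trans[OF D E G r(2,1)])
 interpret l1: ring_hom_cring "L D" "L E" "lm D E" by (rule lm_spec(1)[OF D E refines_unit[OF r(1)]])
 interpret l2: ring_hom_cring "L E" "L G" "lm E G" by (rule lm_spec(1)[OF E G refines_unit[OF r(2)]])
 interpret l3: ring_hom_cring "L D" "L G" "lm D G" by (rule lm_spec(1)[OF D G refines_unit[OF r']])
 have h: "(%x. lm E G (lm D E x)):ring_hom (L D) (L G)" by (auto intro!: ring_hom_memI)
 show ?thesis by (rule L_hom_unique[OF D cring_L[OF G] h l3.homh _ x])
    (use lm_spec(2)[OF D E refines_unit[OF r(1)]] lm_spec(2)[OF E G refines_unit[OF r(2)]] lm_spec(2)[OF D G refines_unit[OF r']] in auto)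
qed

end

section \<open>Binary coverings: exactness\<close>

lemma (in abelian_group) add_minus_cancel:
 "x :[G] ==> y :[G] ==> (x +. y) -. x = y" using a_comm[of x y] by (simp add: minus_eq a_assoc r_neg)

lemma (in abelian_group) minus_split_add:
 assumes "y :[G]" "p :[G]" "q :[G]" "a :[G]" "b :[G]"
 shows "y -. (a +. b) = (y -. (p +. q)) +. ((p -. a) +. (q -. b))"
proof -
 have 1: "(p -. a) +. (q -. b) = (p +. q) -. (a +. b)" using assms by (simp add: minus_eq minus_add a_ac)
 have "(y -. s) +. (s -. t) = y -. t" if "s :[G]" "t :[G]" for s t using assms(1) that by (simp add: minus_eq a_assoc r_neg1)
 thus ?thesis unfolding 1 using assms by simp
qed

context hub_su
begin

text \<open>The hypotheses of \<open>half\<close> expressed inside B: al = a/u and be = b/u for the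
  unit u = a f + b h. In this form a splitting of D is also one of every refinement of D
  (\<open>bin_refines\<close>).\<close>

definition bin :: "'a datum => 'a => 'a => 'a set => bool" where
 "bin D f h S \<longleftrightarrow> f :[B] & h :[B] & finite S & S <= carrier B &
   (EX V:\<U>. V <= aspan B {s *. u |s u. s:S & u :[B]}) &
   (EX a:carrier B. EX b:carrier B. ph D (a *. f +. b *. h):Units (L D) &
    (ALL s:S. forces D (s *. a) (a *. f +. b *. h) & forces D (s *. b) (a *. f +. b *. h)))"

definition Dl :: "'a datum => 'a => 'a => 'a set => 'a datum" where
 "Dl D f h S = meet D (insert f S, h)"

lemma bin_swap: "bin D f h S ==> bin D h f S"
proof -
 assume b: "bin D f h S"
 then obtain a c where ac: "a :[B]" "c :[B]" "ph D (a *. f +. c *. h):Units (L D)"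
  "ALL s:S. forces D (s *. a) (a *. f +. c *. h) & forces D (s *. c) (a *. f +. c *. h)" unfolding bin_def by auto
 have eq: "a *. f +. c *. h = c *. h +. a *. f" using b ac by (auto simp: bin_def intro: a_comm)
 have "ph D (c *. h +. a *. f):Units (L D)"
  "ALL s:S. forces D (s *. c) (c *. h +. a *. f) & forces D (s *. a) (c *. h +. a *. f)" using ac(3,4) unfolding eq by auto
 thus ?thesis using b ac(1,2) unfolding bin_def by (simp only: conj_assoc[symmetric]) blast
qed

lemma bin_half:
 assumes D: "D:RD" and b: "bin D f h S"
 shows "EX al be. half B T P D f h S al be"
proof -
 note ok = RD_okd[OF D]
 interpret L: cring "L D" by (rule cring_L[OF ok])
 interpret p: ring_hom_cring B "L D" "ph D" by (rule ph_hom[OF ok])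
 have fh: "f :[B]" "h :[B]" "finite S" "S <= carrier B"
  and gen: "EX V:\<U>. V <= aspan B {s *. u |s u. s:S & u :[B]}" using b by (auto simp: bin_def)
 obtain a c where ac: "a :[B]" "c :[B]" and u: "ph D (a *. f +. c *. h):Units (L D)"
  and fo: "ALL s:S. forces D (s *. a) (a *. f +. c *. h) & forces D (s *. c) (a *. f +. c *. h)" using b unfolding bin_def by auto
 let ?u = "ph D (a *. f +. c *. h)"
 let ?al = "ph D a *[L D] inv[L D] ?u" and ?be = "ph D c *[L D] inv[L D] ?u"
 have i: "inv[L D] ?u :[L D]" using L.Units_inv_closed[OF u] .
 have pc: "ph D a :[L D]" "ph D c :[L D]" "ph D f :[L D]" "ph D h :[L D]" using ph_closed[OF ok] ac fh by auto
 have "half B T P D f h S ?al ?be"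
 proof unfold_locales
  show "D:RD" "f :[B]" "h :[B]" "finite S" "S <= carrier B"
   "EX V:\<U>. V <= aspan B {s *. u |s u. s:S & u :[B]}" using D fh gen by auto
  show "?al :[L D]" "?be :[L D]" using i pc by auto
  have "?al *[L D] ph D f +[L D] ?be *[L D] ph D h = (ph D a *[L D] ph D f +[L D] ph D c *[L D] ph D h) *[L D] inv[L D] ?u"
   using i pc by (simp add: L.l_distr L.r_distr L.m_ac)
  also have "ph D a *[L D] ph D f +[L D] ph D c *[L D] ph D h = ?u" using ac fh by simp
  also have "?u *[L D] inv[L D] ?u = \<one>[L D]" by (rule L.Units_r_inv[OF u])
  finally show "?al *[L D] ph D f +[L D] ?be *[L D] ph D h = \<one>[L D]" .
  fix s assume s: "s:S"
  hence sc: "s :[B]" "ph D s :[L D]" using fh ph_closed[OF ok] by auto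
  have "ph D (s *. a) *[L D] inv[L D] ?u:RR D" "ph D (s *. c) *[L D] inv[L D] ?u:RR D" using forces_RR fo s by blast+
  thus "ph D s *[L D] ?al:RR D" "ph D s *[L D] ?be:RR D" using sc ac pc i by (simp_all add: L.m_assoc)
 qed
 thus ?thesis by blast
qed

end

context half
begin

context
 fixes G assumes G: "okd G" and rG: "refines G D1"
begin

lemma refGD: "refines G D" by (rule refines_trans[OF okD okD1 G rG ref1])

text \<open>With t = F/H on a datum G refining the half D1, the fractions of D1 become linear
  polynomials in t over \<open>RR D\<close>, and conversely m t^n comes from \<open>Mn D1 U\<close>.
  Both directions serve to take apart \<open>Mn\<close> of the overlap in
  \<open>split_Mn\<close>.\<close>

lemma side:
 shows side_unit: "lm D G H:Units (L G)"
  and side_qt: "x:insert (snd D1) (fst D1) ==> EX r1:RR D. EX r2:RR D.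
   qt G x (snd D1) = lm D G r1 *[L G] (lm D G F *[L G] inv[L G] (lm D G H)) +[L G] lm D G r2"
  and side_pow: "pstable U ==> m:Mn D U ==>
   EX y:Mn D1 U. lm D1 G y = lm D G m *[L G] (lm D G F *[L G] inv[L G] (lm D G H)) ^[L G] (n::nat)"
proof -
 interpret g: cring "L G" by (rule cring_L[OF G])
 interpret k: ring_hom_cring "L D" "L G" "lm D G" by (rule lm_spec(1)[OF okD G refines_unit[OF refGD]])
 interpret c: ring_hom_cring "L D1" "L G" "lm D1 G" by (rule lm_spec(1)[OF okD1 G refines_unit[OF rG]])
 let ?k = "lm D G" and ?c = "lm D1 G"
 have ch: "?c (ps x) = ?k x" if "x :[L D]" for x by (rule lm_comp[OF okD okD1 G ref1 rG that])
 show u: "?k H:Units (L G)" using c.hom_Units[OF psiH_unit] ch[OF FHc(2)] by simp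
 define t where "t = ?k F *[L G] inv[L G] (?k H)"
 have tc: "t :[L G]" unfolding t_def using u FHc by auto
 have rr: "r :[L D]" if "r:RR D" for r using that RR_carr[OF okD] by auto
 show "EX r1:RR D. EX r2:RR D. qt G x (snd D1) = ?k r1 *[L G] (?k F *[L G] inv[L G] (?k H)) +[L G] ?k r2"
  if x: "x:insert (snd D1) (fst D1)" unfolding t_def[symmetric]
 proof (cases "x = snd D1")
  case True
  have "qt G x (snd D1) = \<one>[L G]" unfolding True qt_def by (rule g.Units_r_inv[OF refines_unit[OF rG]])
  hence "qt G x (snd D1) = ?k \<zero>[L D] *[L G] t +[L G] ?k \<one>[L D]" using tc by simp
  thus "EX r1:RR D. EX r2:RR D. qt G x (snd D1) = ?k r1 *[L G] t +[L G] ?k r2"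
   using additive_subgroup.zero_closed[OF RR_sub[OF okD]] RR_one[OF okD] by blast
 next
  case False
  hence xf: "x:fst D1" using x by simp
  have c: "x :[B]" "snd D1 :[B]" using xf okD1 by (auto simp: okd_def)
  have q: "qt G x (snd D1) = ?c (fr D1 x)" using lm_qt[OF okD1 G rG c g_unit[OF okD1]] fr_eq[OF okD1 c(1)] by (simp add: qt_def)
  obtain ra rb where r: "ra:RR D" "rb:RR D" "ps H *[L D1] fr D1 x = ps (ra *[L D] F +[L D] rb *[L D] H)" using gen_form[OF xf] by (elim bexE)
  note rc = rr[OF r(1)] rr[OF r(2)] and frc = fr_carr[OF okD1 c(1)]
  have "?k H *[L G] ?c (fr D1 x) = ?k ra *[L G] ?k F +[L G] ?k rb *[L G] ?k H" using arg_cong[OF r(3), of ?c] rc frc FHc ch by simp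
  also have "... = ?k H *[L G] (?k ra *[L G] t +[L G] ?k rb)"
  proof -
   have "?k H *[L G] t = ?k F" unfolding t_def using g.Units_div_mult[OF _ u] FHc by simp
   hence "?k H *[L G] (?k ra *[L G] t) = ?k ra *[L G] ?k F" using rc tc FHc g.m_lcomm[of "?k H" "?k ra" t] by simp
   thus ?thesis using rc tc FHc by (simp add: g.r_distr g.m_comm)
  qed
  finally have "?c (fr D1 x) = ?k ra *[L G] t +[L G] ?k rb"
   using g.Units_l_cancel[OF u, of "?c (fr D1 x)" "?k ra *[L G] t +[L G] ?k rb"] frc rc tc by simp
  thus "EX r1:RR D. EX r2:RR D. qt G x (snd D1) = ?k r1 *[L G] t +[L G] ?k r2" unfolding q using r(1,2) by blast
 qed
 show "EX y:Mn D1 U. ?c y = ?k m *[L G] (?k F *[L G] inv[L G] (?k H)) ^[L G] (n::nat)" if U: "pstable U" and m: "m:Mn D U" unfolding t_def[symmetric]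
 proof (induction n)
  have Uc: "U <= carrier B" using U by (simp add: pstable_def)
  have mc: "m :[L D]" using m Mn_carr[OF okD Uc] by auto
  { case 0 show ?case by (rule bexI[OF _ refines_Mn[OF okD okD1 ref1 U m]]) (use mc ch in simp) }
  case (Suc n)
  then obtain y where y: "y:Mn D1 U" "?c y = ?k m *[L G] t ^[L G] n" by auto
  let ?t = "ps F *[L D1] inv[L D1] (ps H)"
  have yc: "y :[L D1]" using y(1) Mn_carr[OF okD1 Uc] by auto
  have "?c ?t = t" unfolding t_def using FHc psiH_unit ch c.hom_inv[OF psiH_unit] by simp
  moreover have "?t :[L D1]" using FHc psiH_unit by simp
  ultimately have "?c (?t *[L D1] y) = t *[L G] (?k m *[L G] t ^[L G] n)" using yc y(2) by (simp only: c.hom_mult)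
  also have "... = ?k m *[L G] t ^[L G] Suc n" using mc tc by (simp add: g.m_ac)
  finally show ?case using Mn1_ratio[OF Uc y(1)] by (rule bexI)
 qed
qed

end

end

context hub_su
begin

lemma rs_close:
 assumes a: "adm D E" and x: "x :[CD D]" "x' :[CD D]" and y: "y :[CD E]"
  and d: "ND E (y -[CD E] rs D E x) <= d" "ND E (y -[CD E] rs D E x') <= d"
 shows "ND E (rs D E (x -[CD D] x')) <= d"
proof -
 interpret h: ring_hom_cring "CD D" "CD E" "rs D E" by (rule rs_hom[OF a])
 interpret E: banach "CD E" "ND E" by (rule banach_CD[OF adm_RD(2)[OF a]])
 have c: "rs D E x :[CD E]" "rs D E x' :[CD E]" using x by auto
 show ?thesis unfolding h.hom_minus[OF x] using E.q_diff_trans[OF c(1) y c(2)] E.q_minus_comm[OF c(1) y] d by linarith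
qed

lemma rs_limit:
 assumes a: "adm D E" and x: "x :[CD D]" and s: "!!n. s n :[CD D]" and y: "y :[CD E]"
  and lim: "ALL e>0. EX n0. ALL n>=(n0::nat). ND D (s n -[CD D] x) < e" and near: "!!d. d > 0 ==> EX k. ALL n>=k. ND E (y -[CD E] rs D E (s n)) <= d"
 shows "rs D E x = y"
proof -
 interpret h: ring_hom_cring "CD D" "CD E" "rs D E" by (rule rs_hom[OF a])
 interpret E: banach "CD E" "ND E" by (rule banach_CD[OF adm_RD(2)[OF a]])
 show ?thesis
 proof (rule E.N_small_eq[OF h.hom_closed[OF x] y])
  fix e :: real assume e: "e > 0"
  obtain d where d: "d > 0" "ALL x:carrier (CD D). ND D x <= d --> ND E (rs D E x) <= e" using rs_cont[OF a e] by (elim exE conjE)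
  obtain k where k: "ALL n>=k. ND E (y -[CD E] rs D E (s n)) <= e" using near[OF e] by (elim exE)
  obtain k' where k': "ALL n>=k'. ND D (s n -[CD D] x) < d" using lim d(1) by auto
  let ?z = "s (max k k')"
  have b: "ND E (rs D E (?z -[CD D] x)) <= e"
   by (rule d(2)[rule_format, OF h.R.minus_closed[OF s x]]) (use k' in \<open>simp add: less_imp_le\<close>)
  have c: "rs D E ?z :[CD E]" "rs D E x :[CD E]" using s x by auto
  have "ND E (y -[CD E] rs D E ?z) <= e" using k by simp
  thus "ND E (rs D E x -[CD E] y) <= e" using b[unfolded h.hom_minus[OF s x]] E.q_diff_trans[OF y c] E.q_minus_comm[OF c(2) y] by linarith
 qed
qed

end

section \<open>The two halves of a splitting and their overlap\<close>

locale cov = one: half B T P D f h S al be + two: half B T P D h f S be al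
 for B :: "'a ring" (structure) and T P D f h S al be
begin

abbreviation "D1 \<equiv> one.Dl D f h S"
abbreviation "D2 \<equiv> one.Dl D h f S"
abbreviation "D12 \<equiv> one.meet D1 D2"

lemma D1_RD: "D1:one.RD" and D2_RD: "D2:one.RD" using one.D1 two.D1 by (auto simp: one.Dl_def)
lemma D12_RD: "D12:one.RD" by (rule one.meet_RD[OF D1_RD D2_RD])
lemmas okD = one.okD
lemma ok1: "one.okd D1" and ok2: "one.okd D2" and ok12: "one.okd D12" using one.RD_okd D1_RD D2_RD D12_RD by auto
lemma r1: "one.refines D1 D" and r2: "one.refines D2 D" using one.ref1 two.ref1 by (auto simp: one.Dl_def)
lemma r12_1: "one.refines D12 D1" and r12_2: "one.refines D12 D2" using one.meet_refines[OF ok1 ok2] by auto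
lemma r12: "one.refines D12 D" by (rule one.refines_trans[OF okD ok1 ok12 r12_1 r1])

abbreviation "ps1 \<equiv> one.lm D D1"
abbreviation "ps2 \<equiv> one.lm D D2"
abbreviation "ps12 \<equiv> one.lm D D12"
abbreviation "ci1 \<equiv> one.lm D1 D12"
abbreviation "ci2 \<equiv> one.lm D2 D12"
abbreviation "LD \<equiv> one.L D"
abbreviation "L1 \<equiv> one.L D1"
abbreviation "L2 \<equiv> one.L D2"
abbreviation "L12 \<equiv> one.L D12"
abbreviation "F \<equiv> one.ph D f"
abbreviation "H \<equiv> one.ph D h"

sublocale R: cring LD by (rule one.cring_L[OF okD])
sublocale R1: cring L1 by (rule one.cring_L[OF ok1])
sublocale R2: cring L2 by (rule one.cring_L[OF ok2])
sublocale R12: cring L12 by (rule one.cring_L[OF ok12])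
sublocale s1: ring_hom_cring LD L1 ps1 by (rule one.lm_spec(1)[OF okD ok1 one.refines_unit[OF r1]])
sublocale s2: ring_hom_cring LD L2 ps2 by (rule one.lm_spec(1)[OF okD ok2 one.refines_unit[OF r2]])
sublocale s12: ring_hom_cring LD L12 ps12 by (rule one.lm_spec(1)[OF okD ok12 one.refines_unit[OF r12]])
sublocale c1: ring_hom_cring L1 L12 ci1 by (rule one.lm_spec(1)[OF ok1 ok12 one.refines_unit[OF r12_1]])
sublocale c2: ring_hom_cring L2 L12 ci2 by (rule one.lm_spec(1)[OF ok2 ok12 one.refines_unit[OF r12_2]])

lemma chi1: "x :[LD] ==> ci1 (ps1 x) = ps12 x" by (rule one.lm_comp[OF okD ok1 ok12 r1 r12_1])
lemma chi2: "x :[LD] ==> ci2 (ps2 x) = ps12 x" by (rule one.lm_comp[OF okD ok2 ok12 r2 r12_2])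

lemma FH: "F :[LD]" "H :[LD]" using one.FHc by auto
lemma fhc: "f :[B]" "h :[B]" using one.fh by auto
lemma gc: "snd D :[B]" by (rule one.gc)
lemma U1: "ps1 H:Units L1" using one.psiH_unit by (simp add: one.Dl_def)
lemma U2: "ps2 F:Units L2" using two.psiH_unit by (simp add: one.Dl_def)
lemma U12: "ps12 H:Units L12" "ps12 F:Units L12" using c1.hom_Units[OF U1] c2.hom_Units[OF U2] chi1[OF FH(2)] chi2[OF FH(1)] by auto

lemma sndD1: "snd D1 = snd D [^] (1::nat) *. h" using one.snd_D1 by (simp add: one.Dl_def)
lemma sndD2: "snd D2 = snd D [^] (1::nat) *. f" using two.snd_D1 by (simp add: one.Dl_def)
lemma sndD12: "snd D12 = snd D [^] (2::nat) *. (f *. h)"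
proof -
 have "snd D12 = snd D1 *. snd D2" by (simp add: one.meet_def)
 also have "... = snd D [^] (2::nat) *. (f *. h)" unfolding sndD1 sndD2 using gc fhc by (simp add: one.m_ac numeral_2_eq_2)
 finally show ?thesis .
qed

lemma ph_fh: "one.ph D (f *. h) = F *[LD] H" using one.hD.hom_mult[OF fhc] .

lemma unit_pow1: "ps1 H ^[L1] (n::nat):Units L1" by (rule R1.Units_pow_closed'[OF U1])
lemma unit_pow2: "ps2 F ^[L2] (n::nat):Units L2" by (rule R2.Units_pow_closed'[OF U2])
lemma part: "EX a:carrier LD. EX b:carrier LD. a *[LD] F ^[LD] (m::nat) +[LD] b *[LD] H ^[LD] (n::nat) = \<one>[LD]"
 by (rule one.LD.coprime_powers[OF FH one.ab one.one])

lemma lift1: "y :[L1] ==> EX m::nat. EX x:carrier LD. ps1 H ^[L1] m *[L1] y = ps1 x"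
 using one.lm_surj[OF okD ok1 r1 fhc(2) sndD1, of y] one.lm_spec(2)[OF okD ok1 one.refines_unit[OF r1] fhc(2)] by simp
lemma lift2: "y :[L2] ==> EX m::nat. EX x:carrier LD. ps2 F ^[L2] m *[L2] y = ps2 x"
 using one.lm_surj[OF okD ok2 r2 fhc(1) sndD2, of y] one.lm_spec(2)[OF okD ok2 one.refines_unit[OF r2] fhc(1)] by simp
lemma lift12: "y :[L12] ==> EX m::nat. EX x:carrier LD. ps12 (F *[LD] H) ^[L12] m *[L12] y = ps12 x"
 using one.lm_surj[OF okD ok12 r12 _ sndD12, of y] one.lm_spec(2)[OF okD ok12 one.refines_unit[OF r12], of "f *. h"] fhc ph_fh by simp
lemma ker12: "x :[LD] ==> ps12 x = \<zero>[L12] ==> EX m::nat. (F *[LD] H) ^[LD] m *[LD] x = \<zero>[LD]"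
 using one.lm_ker[OF okD ok12 r12 _ sndD12, of x] fhc ph_fh by simp

lemma solve1:
 assumes x: "x :[LD]" shows "EX z:carrier L1. ps1 H ^[L1] (n::nat) *[L1] z = ps1 x" by (rule bexI[of _ "ps1 x *[L1] inv[L1] (ps1 H ^[L1] n)"])
   (use R1.Units_div_mult[OF _ unit_pow1] x unit_pow1 in auto)
lemma solve2:
 assumes x: "x :[LD]" shows "EX z:carrier L2. ps2 F ^[L2] (n::nat) *[L2] z = ps2 x" by (rule bexI[of _ "ps2 x *[L2] inv[L2] (ps2 F ^[L2] n)"])
   (use R2.Units_div_mult[OF _ unit_pow2] x unit_pow2 in auto)

text \<open>Gluing for the localizations of \<open>L D\<close> at H and at F: with y1 = z1/H^m, y2 =
  z2/F^n and 1 = a F^n + b H^m, the element a z2 + b z1 restricts to both.\<close>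

lemma glue_alg:
 assumes y1: "y1 :[L1]" and y2: "y2 :[L2]" and eq: "ci1 y1 = ci2 y2"
 shows "EX x:carrier LD. ps1 x = y1 & ps2 x = y2"
proof -
 obtain m1 x1 where x1: "x1 :[LD]" "ps1 H ^[L1] (m1::nat) *[L1] y1 = ps1 x1" using lift1[OF y1] by auto
 obtain m2 x2 where x2: "x2 :[LD]" "ps2 F ^[L2] (m2::nat) *[L2] y2 = ps2 x2" using lift2[OF y2] by auto
 have e1: "ps12 H ^[L12] m1 *[L12] ci1 y1 = ps12 x1" using arg_cong[OF x1(2), of ci1] y1 x1(1) FH chi1 by simp
 have e2: "ps12 F ^[L12] m2 *[L12] ci1 y1 = ps12 x2" unfolding eq using arg_cong[OF x2(2), of ci2] y2 x2(1) FH chi2 by simp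
 have "ps12 (F ^[LD] m2 *[LD] x1) = ps12 (H ^[LD] m1 *[LD] x2)" using x1(1) x2(1) FH y1 by (simp add: e1[symmetric] e2[symmetric] R12.m_lcomm)
 hence "ps12 (F ^[LD] m2 *[LD] x1 -[LD] H ^[LD] m1 *[LD] x2) = \<zero>[L12]" using x1(1) x2(1) FH by (simp add: s12.hom_minus R12.minus_eq R12.r_neg)
 \<comment> \<open>Agreement on the overlap gives the cross relation only up to a power of FH, which
   is absorbed into the numerators z1 and z2 below.\<close>
 then obtain k :: nat where "(F *[LD] H) ^[LD] k *[LD] (F ^[LD] m2 *[LD] x1 -[LD] H ^[LD] m1 *[LD] x2) = \<zero>[LD]"
  using ker12[of "F ^[LD] m2 *[LD] x1 -[LD] H ^[LD] m1 *[LD] x2"] x1(1) x2(1) FH by auto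
 hence "(F *[LD] H) ^[LD] k *[LD] (F ^[LD] m2 *[LD] x1) -[LD] (F *[LD] H) ^[LD] k *[LD] (H ^[LD] m1 *[LD] x2) = \<zero>[LD]"
  using x1(1) x2(1) FH by (simp add: one.LD.minus_eq one.LD.r_distr one.LD.r_minus)
 hence k: "(F *[LD] H) ^[LD] k *[LD] (F ^[LD] m2 *[LD] x1) = (F *[LD] H) ^[LD] k *[LD] (H ^[LD] m1 *[LD] x2)"
  using x1(1) x2(1) FH one.LD.r_right_minus_eq by simp
 define z1 where "z1 = H ^[LD] k *[LD] x1"
 define z2 where "z2 = F ^[LD] k *[LD] x2"
 let ?m = "m1 + k" and ?n = "m2 + k"
 have zc: "z1 :[LD]" "z2 :[LD]" unfolding z1_def z2_def using x1(1) x2(1) FH by auto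
 have f1: "ps1 H ^[L1] ?m *[L1] y1 = ps1 z1" unfolding z1_def using x1 y1 FH by (simp add: R1.nat_pow_mult[symmetric] R1.m_ac x1(2)[symmetric])
 have f2: "ps2 F ^[L2] ?n *[L2] y2 = ps2 z2" unfolding z2_def using x2 y2 FH by (simp add: R2.nat_pow_mult[symmetric] R2.m_ac x2(2)[symmetric])
 have cross: "F ^[LD] ?n *[LD] z1 = H ^[LD] ?m *[LD] z2"
 proof -
  have "F ^[LD] ?n *[LD] z1 = (F *[LD] H) ^[LD] k *[LD] (F ^[LD] m2 *[LD] x1)"
   unfolding z1_def using x1(1) FH by (simp add: one.LD.nat_pow_mult[symmetric] one.LD.nat_pow_distrib one.LD.m_ac)
  also have "... = (F *[LD] H) ^[LD] k *[LD] (H ^[LD] m1 *[LD] x2)" by (rule k)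
  also have "... = H ^[LD] ?m *[LD] z2"
   unfolding z2_def using x2(1) FH by (simp add: one.LD.nat_pow_mult[symmetric] one.LD.nat_pow_distrib one.LD.m_ac)
  finally show ?thesis .
 qed
 obtain a b where ab: "a :[LD]" "b :[LD]" "a *[LD] F ^[LD] ?n +[LD] b *[LD] H ^[LD] ?m = \<one>[LD]" using part[of ?n ?m] by auto
 let ?A = "F ^[LD] ?n" and ?C = "H ^[LD] ?m"
 have ACc: "?A :[LD]" "?C :[LD]" using FH by auto
 define x where "x = a *[LD] z2 +[LD] b *[LD] z1"
 have xc: "x :[LD]" unfolding x_def using ab zc by simp
 have h1: "?C *[LD] x = z1"
 proof -
  have "?C *[LD] x = a *[LD] (?C *[LD] z2) +[LD] b *[LD] (?C *[LD] z1)"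
   unfolding x_def using ab(1,2) zc ACc by (simp add: one.LD.r_distr one.LD.m_lcomm)
  also have "... = (a *[LD] ?A +[LD] b *[LD] ?C) *[LD] z1"
   unfolding cross[symmetric] using ab(1,2) zc ACc by (simp add: one.LD.l_distr one.LD.m_assoc)
  finally show ?thesis unfolding ab(3) using zc by simp
 qed
 have h2: "?A *[LD] x = z2"
 proof -
  have "?A *[LD] x = a *[LD] (?A *[LD] z2) +[LD] b *[LD] (?A *[LD] z1)"
   unfolding x_def using ab(1,2) zc ACc by (simp add: one.LD.r_distr one.LD.m_lcomm)
  also have "... = (a *[LD] ?A +[LD] b *[LD] ?C) *[LD] z2" unfolding cross using ab(1,2) zc ACc by (simp add: one.LD.l_distr one.LD.m_assoc)
  finally show ?thesis unfolding ab(3) using zc by simp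
 qed
 have "ps1 H ^[L1] ?m *[L1] ps1 x = ps1 H ^[L1] ?m *[L1] y1" using arg_cong[OF h1, of ps1] f1 xc FH by simp
 hence "ps1 x = y1" using R1.Units_l_cancel[OF unit_pow1[of ?m], of "ps1 x" y1] xc y1 by simp
 moreover have "ps2 F ^[L2] ?n *[L2] ps2 x = ps2 F ^[L2] ?n *[L2] y2" using arg_cong[OF h2, of ps2] f2 xc FH by simp
 hence "ps2 x = y2" using R2.Units_l_cancel[OF unit_pow2[of ?n], of "ps2 x" y2] xc y2 by simp
 ultimately show ?thesis using xc by blast
qed

text \<open>If y = x/(FH)^m and 1 = a F^m + b H^m, then y = a x/H^m + b x/F^m.\<close>

lemma split_alg:
 assumes y: "y :[L12]"
 shows "EX y1:carrier L1. EX y2:carrier L2. y = ci1 y1 +[L12] ci2 y2"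
proof -
 obtain m x where x: "x :[LD]" "ps12 (F *[LD] H) ^[L12] (m::nat) *[L12] y = ps12 x" using lift12[OF y] by auto
 have x': "ps12 F ^[L12] m *[L12] (ps12 H ^[L12] m *[L12] y) = ps12 x" using x y FH by (simp add: R12.nat_pow_distrib R12.m_assoc)
 obtain a b where ab: "a :[LD]" "b :[LD]" "a *[LD] F ^[LD] m +[LD] b *[LD] H ^[LD] m = \<one>[LD]" using part[of m m] by auto
 obtain z1 where z1: "z1 :[L1]" "ps1 H ^[L1] m *[L1] z1 = ps1 x" using solve1[OF x(1), of m] by auto
 obtain z2 where z2: "z2 :[L2]" "ps2 F ^[L2] m *[L2] z2 = ps2 x" using solve2[OF x(1), of m] by auto
 have c1': "ps12 H ^[L12] m *[L12] ci1 z1 = ps12 x" using arg_cong[OF z1(2), of ci1] z1(1) x(1) FH chi1 by simp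
 have c2': "ps12 F ^[L12] m *[L12] ci2 z2 = ps12 x" using arg_cong[OF z2(2), of ci2] z2(1) x(1) FH chi2 by simp
 have uH: "ps12 H ^[L12] m:Units L12" and uF: "ps12 F ^[L12] m:Units L12"
  using R12.Units_pow_closed'[OF U12(1)] R12.Units_pow_closed'[OF U12(2)] by auto
 have "ps12 H ^[L12] m *[L12] ci1 z1 = ps12 H ^[L12] m *[L12] (ps12 F ^[L12] m *[L12] y)"
  unfolding c1' x'[symmetric] using y FH by (simp add: R12.m_lcomm)
 hence g1: "ci1 z1 = ps12 F ^[L12] m *[L12] y" using R12.Units_l_cancel[OF uH, of "ci1 z1" "ps12 F ^[L12] m *[L12] y"] z1 y FH by simp
 have "ps12 F ^[L12] m *[L12] ci2 z2 = ps12 F ^[L12] m *[L12] (ps12 H ^[L12] m *[L12] y)" unfolding c2' x' ..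
 hence g2: "ci2 z2 = ps12 H ^[L12] m *[L12] y" using R12.Units_l_cancel[OF uF, of "ci2 z2" "ps12 H ^[L12] m *[L12] y"] z2 y FH by simp
 have "ci1 (ps1 a *[L1] z1) +[L12] ci2 (ps2 b *[L2] z2) = ps12 (a *[LD] F ^[LD] m +[LD] b *[LD] H ^[LD] m) *[L12] y"
  using ab(1,2) z1(1) z2(1) y FH chi1 chi2 by (simp add: g1 g2 R12.l_distr R12.m_assoc)
 also have "... = y" unfolding ab(3) using y by simp
 finally show ?thesis using ab(1,2) z1(1) z2(1) by (metis s1.hom_closed s2.hom_closed R1.m_closed R2.m_closed)
qed

text \<open>On the overlap t = F/H and t' = H/F are mutually inverse, so the spanning monomials m
  t^i t'^j cancel to a power of only one of them and belong to one half. The splitting therefore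
  loses no smallness.\<close>

lemma split_Mn:
 assumes U: "one.pstable U" and y: "y:one.Mn D12 U"
 shows "EX y1:one.Mn D1 U. EX y2:one.Mn D2 U. y = ci1 y1 +[L12] ci2 y2"
proof -
 have Uc: "U <= carrier B" using U by (simp add: one.pstable_def)
 note Mc = one.Mn_carr[OF okD Uc]
 define t where "t = ps12 F *[L12] inv[L12] (ps12 H)"
 define t' where "t' = ps12 H *[L12] inv[L12] (ps12 F)"
 note s1 = one.side_qt[of D12, folded one.Dl_def, OF ok12 r12_1, folded t_def]
  one.side_pow[of D12, folded one.Dl_def, OF ok12 r12_1 U, folded t_def]
 note s2 = two.side_qt[of D12, folded one.Dl_def, OF ok12 r12_2, folded t'_def]
  two.side_pow[of D12, folded one.Dl_def, OF ok12 r12_2 U, folded t'_def]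
 have tc: "t :[L12]" "t' :[L12]" unfolding t_def t'_def using U12 FH by auto
 have tt: "t *[L12] t' = \<one>[L12]"
 proof -
  have "t *[L12] t' = (ps12 F *[L12] inv[L12] (ps12 F)) *[L12] (ps12 H *[L12] inv[L12] (ps12 H))"
   unfolding t_def t'_def using U12 FH by (simp add: R12.m_ac del: R12.Units_r_inv)
  thus ?thesis using U12 by simp
 qed
 let ?G = "{ps12 m *[L12] (t ^[L12] i *[L12] t' ^[L12] j) |m (i::nat) (j::nat). m:one.Mn D U}"
 let ?W = "aspan L12 ?G"
 have Gc: "?G <= carrier L12" using Mc tc by auto
 note Ws = R12.aspan_subgroup[OF Gc]
 have G1: "ps12 m *[L12] (t ^[L12] i *[L12] t' ^[L12] j):?W" if "m:one.Mn D U" for m and i j :: nat by (rule R12.aspanI) (use that in blast)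
 have cl: "c *[L12] w:?W" if c: "c :[L12]" and w: "w:?W"
  and h: "!!m i j. m:one.Mn D U ==> c *[L12] (ps12 m *[L12] (t ^[L12] (i::nat) *[L12] t' ^[L12] (j::nat))):?W" for c w
 proof -
  have "?W <= {w:carrier L12. c *[L12] w:?W}"
   by (rule R12.aspan_least[OF _ R12.additive_subgroup_mult_preimage[OF Ws c]], rule subsetI) (use subsetD[OF Gc] h in auto)
  thus ?thesis using w by blast
 qed
 have cl_r: "ps12 r *[L12] w:?W" if r: "r:one.RR D" and w: "w:?W" for r w
 proof (rule cl[OF _ w])
  have rc: "r :[LD]" using r one.RR_carr[OF okD] by auto
  thus "ps12 r :[L12]" by simp
  fix m and i j :: nat assume m: "m:one.Mn D U"
  have mc: "m :[LD]" using m Mc by auto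
  show "ps12 r *[L12] (ps12 m *[L12] (t ^[L12] i *[L12] t' ^[L12] j)):?W"
   using G1[OF one.RR_Mn[OF okD U r m], of i j] rc mc tc by (simp add: R12.m_assoc)
 qed
 have cl_t: "t *[L12] w:?W" if w: "w:?W" for w
 proof (rule cl[OF tc(1) w])
  fix m and i j :: nat assume m: "m:one.Mn D U"
  show "t *[L12] (ps12 m *[L12] (t ^[L12] i *[L12] t' ^[L12] j)):?W" using G1[OF m, of "Suc i" j] subsetD[OF Mc m] tc by (simp add: R12.m_ac)
 qed
 have cl_t': "t' *[L12] w:?W" if w: "w:?W" for w
 proof (rule cl[OF tc(2) w])
  fix m and i j :: nat assume m: "m:one.Mn D U"
  show "t' *[L12] (ps12 m *[L12] (t ^[L12] i *[L12] t' ^[L12] j)):?W" using G1[OF m, of i "Suc j"] subsetD[OF Mc m] tc by (simp add: R12.m_ac)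
 qed
 have cl_gen: "(ps12 r1 *[L12] s +[L12] ps12 r2) *[L12] w:?W"
  if s: "s :[L12]" "!!w. w:?W ==> s *[L12] w:?W" and r: "r1:one.RR D" "r2:one.RR D" and w: "w:?W" for s r1 r2 w
 proof -
  have rc: "ps12 r1 :[L12]" "ps12 r2 :[L12]" using r one.RR_carr[OF okD] by auto
  have "ps12 r1 *[L12] (s *[L12] w) +[L12] ps12 r2 *[L12] w:?W" by (rule additive_subgroup.a_closed[OF Ws cl_r[OF r(1) s(2)[OF w]] cl_r[OF r(2) w]])
  thus ?thesis using rc additive_subgroup.a_Hcarr[OF Ws w] s(1) by (simp add: R12.l_distr R12.m_assoc)
 qed
 have MW: "one.Mn D12 U <= ?W"
 proof (rule one.Mn_least[OF ok12 Uc Ws])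
  fix u assume u: "u:U"
  hence uc: "u :[B]" using Uc by auto
  show "one.ph D12 u:?W"
   using G1[OF one.Mn_ph[OF okD Uc u], of 0 0] one.lm_spec(2)[OF okD ok12 one.refines_unit[OF r12] uc] one.ph_closed[OF ok12 uc] by simp
 next
  fix e w assume e: "e:fst D12" and w: "w:?W"
  then obtain x x' where xx: "e = x *. x'" "x:insert (snd D1) (fst D1)" "x':insert (snd D2) (fst D2)" by (auto simp: one.meet_def)
  have wc: "w :[L12]" using additive_subgroup.a_Hcarr[OF Ws w] .
  obtain ra rb where r: "ra:one.RR D" "rb:one.RR D" "one.qt D12 x (snd D1) = ps12 ra *[L12] t +[L12] ps12 rb" using s1(1)[OF xx(2)] by auto
  obtain rc rd where r': "rc:one.RR D" "rd:one.RR D" "one.qt D12 x' (snd D2) = ps12 rc *[L12] t' +[L12] ps12 rd" using s2(1)[OF xx(3)] by auto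
  have cc: "ps12 ra :[L12]" "ps12 rb :[L12]" "ps12 rc :[L12]" "ps12 rd :[L12]" using r r' one.RR_carr[OF okD] by auto
  have "one.fr D12 e *[L12] w = (ps12 ra *[L12] t +[L12] ps12 rb) *[L12] ((ps12 rc *[L12] t' +[L12] ps12 rd) *[L12] w)"
   unfolding xx(1) one.fr_meet[OF ok1 ok2 xx(2,3)] r(3) r'(3) using cc tc wc by (intro R12.m_assoc) auto
  thus "one.fr D12 e *[L12] w:?W" using cl_gen[OF tc(1) cl_t r(1,2) cl_gen[OF tc(2) cl_t' r'(1,2) w]] by simp
 qed
 let ?V = "{y. EX y1:one.Mn D1 U. EX y2:one.Mn D2 U. y = ci1 y1 +[L12] ci2 y2}"
 note M1s = one.Mn_subgroup[OF ok1 Uc] and M2s = one.Mn_subgroup[OF ok2 Uc]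
 note z1 = additive_subgroup.zero_closed[OF M1s] and z2 = additive_subgroup.zero_closed[OF M2s]
 note M1c = subsetD[OF one.Mn_carr[OF ok1 Uc]] and M2c = subsetD[OF one.Mn_carr[OF ok2 Uc]]
 have Vs: "additive_subgroup ?V L12"
 proof (rule R12.additive_subgroupI_minus)
  show "?V <= carrier L12" using M1c M2c by auto
  show "\<zero>[L12]:?V" by (rule CollectI, rule bexI[OF _ z1], rule bexI[OF _ z2]) simp
  fix v w assume "v:?V" "w:?V"
  then obtain v1 v2 w1 w2 where vw: "v1:one.Mn D1 U" "v2:one.Mn D2 U" "v = ci1 v1 +[L12] ci2 v2"
   "w1:one.Mn D1 U" "w2:one.Mn D2 U" "w = ci1 w1 +[L12] ci2 w2" by auto
  have c: "v1 :[L1]" "w1 :[L1]" "v2 :[L2]" "w2 :[L2]" using vw M1c M2c by auto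
  have "v -[L12] w = ci1 (v1 -[L1] w1) +[L12] ci2 (v2 -[L2] w2)" unfolding vw(3,6) c1.hom_minus[OF c(1,2)] c2.hom_minus[OF c(3,4)]
   using c by (simp add: R12.minus_eq R12.minus_add R12.a_ac)
  moreover have "v1 -[L1] w1:one.Mn D1 U" by (rule additive_subgroup_minus_closed[OF M1s R1.abelian_group_axioms vw(1,4)])
  moreover have "v2 -[L2] w2:one.Mn D2 U" by (rule additive_subgroup_minus_closed[OF M2s R2.abelian_group_axioms vw(2,5)])
  ultimately show "v -[L12] w:?V" by blast
 qed
 have cancel: "a ^[L12] (k + j) *[L12] b ^[L12] j = a ^[L12] k"
  if "a :[L12]" "b :[L12]" "a *[L12] b = \<one>[L12]" for a b and k j :: nat
 proof -
  have "a ^[L12] j *[L12] b ^[L12] j = \<one>[L12]" using R12.nat_pow_distrib[OF that(1,2), of j] that(3) by simp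
  thus ?thesis using that(1,2) by (simp add: R12.nat_pow_mult[symmetric] R12.m_assoc)
 qed
 have "?W <= ?V"
 proof (rule R12.aspan_least[OF _ Vs], clarify)
  fix m and i j :: nat assume m: "m:one.Mn D U"
  show "EX y1:one.Mn D1 U. EX y2:one.Mn D2 U. ps12 m *[L12] (t ^[L12] i *[L12] t' ^[L12] j) = ci1 y1 +[L12] ci2 y2"
  proof (cases "j <= i")
   case True
   obtain y where y: "y:one.Mn D1 U" "ci1 y = ps12 m *[L12] t ^[L12] (i - j)" using s1(2)[OF m, of "i - j"] by (elim bexE)
   have "t ^[L12] i *[L12] t' ^[L12] j = t ^[L12] (i - j)" using cancel[OF tc tt, of "i - j" j] True by simp
   thus ?thesis by (intro bexI[OF _ y(1)] bexI[OF _ z2]) (use y(2) M1c[OF y(1)] c1.hom_closed[of y] in simp)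
  next
   case False
   obtain y where y: "y:one.Mn D2 U" "ci2 y = ps12 m *[L12] t' ^[L12] (j - i)" using s2(2)[OF m, of "j - i"] by (elim bexE)
   have "t ^[L12] i *[L12] t' ^[L12] j = t' ^[L12] (j - i)" using cancel[OF tc(2,1), of "j - i" i] tt tc False by (simp add: R12.m_comm)
   thus ?thesis by (intro bexI[OF _ z1] bexI[OF _ y(1)]) (use y(2) M2c[OF y(1)] c2.hom_closed[of y] in simp)
  qed
 qed
 thus ?thesis using MW y by blast
qed

text \<open>Smallness on the halves makes \<open>H^K l\<close> and \<open>F^K l\<close> forms with
  coefficients of size e, by \<open>Mn1_pull\<close>; \<open>two_sided_bound\<close> then removes
  the powers, using that the norm of D is power-multiplicative.\<close>

lemma emb:
 assumes e: "e > 0"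
 shows "EX d>0. ALL l:carrier LD. one.ND D1 (one.jD D1 (ps1 l)) <= d --> one.ND D2 (one.jD D2 (ps2 l)) <= d --> one.ND D (one.jD D l) <= e"
proof -
 have DR: "D:one.RD" by (rule one.D)
 interpret C: banach "one.CD D" "one.ND D" by (rule one.banach_CD[OF DR])
 interpret j: ring_hom_cring LD "one.CD D" "one.jD D" by (rule one.jD_hom[OF DR])
 interpret Q: seminormed_ring LD "%l. one.ND D (one.jD D l)" by (rule seminorm_pullback[OF C.seminormed_ring_axioms one.jD_hom[OF DR]])
 obtain U where U: "U:one.\<U>" "ALL x:one.Mn D U. one.ND D (one.jD D x) <= e" using one.ND_normed(2)[OF DR e] by (elim bexE)
 obtain v where v: "v > 0" "v < 1" "one.Ub v <= U" using one.Ub_small[OF U(1)] by (elim exE conjE)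
 let ?V = "one.Ub v"
 have pV: "one.pstable ?V" by (rule one.pstable_Ub[OF v(2)])
 have Mq: "one.Mn D ?V <= Q.qball e"
  using U(2) one.Mn_mono[OF okD v(3) one.U_carr[OF U(1)]] one.Mn_carr[OF okD one.Ub_carr] by (auto simp: Q.qball_def)
 obtain d1 where d1: "d1 > 0" "ALL x:carrier L1. one.ND D1 (one.jD D1 x) <= d1 --> x:one.Mn D1 ?V"
  using one.ND_normed(1)[OF D1_RD one.Ub_U[OF v(1)]] by (elim exE conjE)
 obtain d2 where d2: "d2 > 0" "ALL x:carrier L2. one.ND D2 (one.jD D2 x) <= d2 --> x:one.Mn D2 ?V"
  using one.ND_normed(1)[OF D2_RD one.Ub_U[OF v(1)]] by (elim exE conjE)
 have pow: "one.ND D (one.jD D (x ^[LD] n)) = one.ND D (one.jD D x) ^ n" if "x :[LD]" "0 < n" for x and n :: nat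
  using one.ND_spec(2)[OF DR] that by (simp add: power_multiplicative_def)
 have mono: "one.LD.hspan F H n (one.Mn D ?V) <= one.LD.hspan F H n (Q.qball e)" for n unfolding one.LD.hspan_def
  by (rule one.LD.aspan_mono[OF _ one.LD.hspan_gens[OF FH Q.qball_carr]]) (use Mq in blast)
 have "one.ND D (one.jD D l) <= e"
  if l: "l :[LD]" "one.ND D1 (one.jD D1 (ps1 l)) <= min d1 d2" "one.ND D2 (one.jD D2 (ps2 l)) <= min d1 d2" for l
 proof -
  have m1: "ps1 l:one.Mn D1 ?V" using d1(2) l by simp
  have m2: "ps2 l:one.Mn D2 ?V" using d2(2) l by simp
  obtain K1 where K1: "ALL n>=K1. H ^[LD] n *[LD] l:one.LD.hspan F H n (one.Mn D ?V)"
   using one.Mn1_pull[OF pV l(1) m1[unfolded one.Dl_def]] by (elim exE)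
  obtain K2 where K2: "ALL n>=K2. F ^[LD] n *[LD] l:one.LD.hspan H F n (one.Mn D ?V)"
   using two.Mn1_pull[OF pV l(1) m2[unfolded one.Dl_def]] by (elim exE)
  define K where "K = max K1 K2"
  have h: "H ^[LD] K *[LD] l:one.LD.hspan F H K (Q.qball e)" using K1 mono[of K] by (auto simp: K_def)
  have "F ^[LD] K *[LD] l:one.LD.hspan H F K (one.Mn D ?V)" using K2 by (auto simp: K_def)
  hence f: "F ^[LD] K *[LD] l:one.LD.hspan F H K (Q.qball e)" using one.LD.hspan_swap[OF FH one.Mn_carr[OF okD one.Ub_carr]] mono[of K] by blast
  show ?thesis by (rule Q.two_sided_bound[OF pow FH one.ab one.one l(1) _ h f]) (use e in auto)
 qed
 thus ?thesis using d1(1) d2(1) by (intro exI[of _ "min d1 d2"]) auto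
qed

section \<open>Exactness after completion\<close>

abbreviation "C \<equiv> one.CD D"
abbreviation "C1 \<equiv> one.CD D1"
abbreviation "C2 \<equiv> one.CD D2"
abbreviation "C12 \<equiv> one.CD D12"
abbreviation "N \<equiv> one.ND D"
abbreviation "N1 \<equiv> one.ND D1"
abbreviation "N2 \<equiv> one.ND D2"
abbreviation "N12 \<equiv> one.ND D12"
abbreviation "rh1 \<equiv> one.rs D D1"
abbreviation "rh2 \<equiv> one.rs D D2"
abbreviation "si1 \<equiv> one.rs D1 D12"
abbreviation "si2 \<equiv> one.rs D2 D12"

lemma adm: "one.adm D D1" "one.adm D D2" "one.adm D1 D12" "one.adm D2 D12" using one.refines_adm D1_RD D2_RD D12_RD one.D r1 r2 r12_1 r12_2 by auto

sublocale BC: banach C N by (rule one.banach_CD[OF one.D])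
sublocale BC1: banach C1 N1 by (rule one.banach_CD[OF D1_RD])
sublocale BC2: banach C2 N2 by (rule one.banach_CD[OF D2_RD])
sublocale BC12: banach C12 N12 by (rule one.banach_CD[OF D12_RD])
sublocale q1: ring_hom_cring C C1 rh1 by (rule one.rs_hom[OF adm(1)])
sublocale q2: ring_hom_cring C C2 rh2 by (rule one.rs_hom[OF adm(2)])
sublocale p1: ring_hom_cring C1 C12 si1 by (rule one.rs_hom[OF adm(3)])
sublocale p2: ring_hom_cring C2 C12 si2 by (rule one.rs_hom[OF adm(4)])
sublocale jj: ring_hom_cring LD C "one.jD D" by (rule one.jD_hom[OF one.D])
sublocale jj1: ring_hom_cring L1 C1 "one.jD D1" by (rule one.jD_hom[OF D1_RD])
sublocale jj2: ring_hom_cring L2 C2 "one.jD D2" by (rule one.jD_hom[OF D2_RD])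
sublocale jj12: ring_hom_cring L12 C12 "one.jD D12" by (rule one.jD_hom[OF D12_RD])

lemma rho_j: "l :[LD] ==> rh1 (one.jD D l) = one.jD D1 (ps1 l)" "l :[LD] ==> rh2 (one.jD D l) = one.jD D2 (ps2 l)"
 "l1 :[L1] ==> si1 (one.jD D1 l1) = one.jD D12 (ci1 l1)" "l2 :[L2] ==> si2 (one.jD D2 l2) = one.jD D12 (ci2 l2)"
 using one.rs_jD[OF one.D D1_RD r1] one.rs_jD[OF one.D D2_RD r2] one.rs_jD[OF D1_RD D12_RD r12_1] one.rs_jD[OF D2_RD D12_RD r12_2] by auto

lemma binary_embedding:
 assumes e: "e > 0"
 shows "EX d>0. ALL x:carrier C. N1 (rh1 x) <= d --> N2 (rh2 x) <= d --> N x <= e"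
proof -
 obtain d where d: "d > 0" "ALL l:carrier LD. N1 (one.jD D1 (ps1 l)) <= d --> N2 (one.jD D2 (ps2 l)) <= d --> N (one.jD D l) <= e"
  using emb[OF e] by (elim exE conjE)
 obtain c1 where c1: "c1 > 0" "ALL x:carrier C. N x <= c1 --> N1 (rh1 x) <= d" using one.rs_cont[OF adm(1) d(1)] by (elim exE conjE)
 obtain c2 where c2: "c2 > 0" "ALL x:carrier C. N x <= c2 --> N2 (rh2 x) <= d" using one.rs_cont[OF adm(2) d(1)] by (elim exE conjE)
 \<comment> \<open>An approximation this close changes each of the two restrictions by at most d and
   x itself by at most e.\<close>
 define et where "et = min e (min c1 c2)"
 have et: "et > 0" "et <= e" "et <= c1" "et <= c2" using e c1 c2 by (auto simp: et_def)
 have "N x <= e" if x: "x :[C]" "N1 (rh1 x) <= d" "N2 (rh2 x) <= d" for x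
 proof -
  obtain l where l: "l :[LD]" "N (x -[C] one.jD D l) <= et" using one.ND_normed(3)[OF one.D x(1) et(1)] by auto
  let ?j = "one.jD D l"
  have jc: "?j :[C]" using l by simp
  have xl: "x -[C] ?j :[C]" using x jc by simp
  have xj: "N (?j -[C] x) <= et" using l(2) BC.q_minus_comm[OF x(1) jc] by linarith
  have "N1 (rh1 (?j -[C] x)) <= d" by (rule c1(2)[rule_format, OF BC.minus_closed[OF jc x(1)]]) (use xj et in linarith)
  hence a1: "N1 (rh1 ?j -[C1] rh1 x) <= d" using q1.hom_minus[OF jc x(1)] by simp
  have "N2 (rh2 (?j -[C] x)) <= d" by (rule c2(2)[rule_format, OF BC.minus_closed[OF jc x(1)]]) (use xj et in linarith)
  hence a2: "N2 (rh2 ?j -[C2] rh2 x) <= d" using q2.hom_minus[OF jc x(1)] by simp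
  have "N1 (rh1 ?j) <= d" by (rule BC1.q_le_of_diff[OF _ _ a1 x(2)]) (use x jc in auto)
  moreover have "N2 (rh2 ?j) <= d" by (rule BC2.q_le_of_diff[OF _ _ a2 x(3)]) (use x jc in auto)
  ultimately have "N ?j <= e" using d(2) l(1) rho_j(1,2)[OF l(1)] by simp
  thus ?thesis using BC.q_le_of_diff[OF x(1) jc, of e] l(2) et by simp
 qed
 thus ?thesis using d(1) by auto
qed

lemma split_small:
 assumes e: "e > 0"
 shows "EX d>0. ALL l:carrier L12. N12 (one.jD D12 l) <= d -->
  (EX l1:carrier L1. EX l2:carrier L2. l = ci1 l1 +[L12] ci2 l2 & N1 (one.jD D1 l1) <= e & N2 (one.jD D2 l2) <= e)"
proof -
 obtain U1 where U1: "U1:one.\<U>" "ALL x:one.Mn D1 U1. N1 (one.jD D1 x) <= e" using one.ND_normed(2)[OF D1_RD e] by (elim bexE)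
 obtain U2 where U2: "U2:one.\<U>" "ALL x:one.Mn D2 U2. N2 (one.jD D2 x) <= e" using one.ND_normed(2)[OF D2_RD e] by (elim bexE)
 obtain v where v: "v > 0" "v < 1" "one.Ub v <= U1 Int U2" using one.Ub_small[OF one.U_Int[OF U1(1) U2(1)]] by (elim exE conjE)
 obtain d where d: "d > 0" "ALL x:carrier L12. N12 (one.jD D12 x) <= d --> x:one.Mn D12 (one.Ub v)"
  using one.ND_normed(1)[OF D12_RD one.Ub_U[OF v(1)]] by (elim exE conjE)
 have s: "one.Mn D1 (one.Ub v) <= one.Mn D1 U1" "one.Mn D2 (one.Ub v) <= one.Mn D2 U2"
  using one.Mn_mono[OF ok1 _ one.U_carr[OF U1(1)], of "one.Ub v"] one.Mn_mono[OF ok2 _ one.U_carr[OF U2(1)], of "one.Ub v"] v(3) by auto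
 have c: "one.Mn D1 U1 <= carrier L1" "one.Mn D2 U2 <= carrier L2"
  using one.Mn_carr[OF ok1 one.U_carr[OF U1(1)]] one.Mn_carr[OF ok2 one.U_carr[OF U2(1)]] by auto
 have "EX l1:carrier L1. EX l2:carrier L2. l = ci1 l1 +[L12] ci2 l2 & N1 (one.jD D1 l1) <= e & N2 (one.jD D2 l2) <= e"
  if l: "l :[L12]" "N12 (one.jD D12 l) <= d" for l
 proof -
  have lm: "l:one.Mn D12 (one.Ub v)" using d(2) l by simp
  obtain l1 l2 where ll: "l1:one.Mn D1 (one.Ub v)" "l2:one.Mn D2 (one.Ub v)" "l = ci1 l1 +[L12] ci2 l2"
   using split_Mn[OF one.pstable_Ub[OF v(2)] lm] by (elim bexE)
  have m: "l1:one.Mn D1 U1" "l2:one.Mn D2 U2" using ll s by auto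
  hence "l1 :[L1]" "l2 :[L2]" "N1 (one.jD D1 l1) <= e" "N2 (one.jD D2 l2) <= e" using c U1(2) U2(2) by auto
  thus ?thesis using ll(3) by blast
 qed
 thus ?thesis using d(1) by auto
qed

text \<open>Approximants of y1 and y2 from the uncompleted rings agree on the overlap only up to
  something small; \<open>split_small\<close> corrects them by small terms to an exactly matching
  pair, which \<open>glue_alg\<close> glues. \<open>binary_embedding\<close> makes the glued
  elements a Cauchy sequence.\<close>

lemma binary_glue:
 assumes y1: "y1 :[C1]" and y2: "y2 :[C2]" and eq: "si1 y1 = si2 y2"
 shows "EX x:carrier C. rh1 x = y1 & rh2 x = y2"
proof -
 have approx: "EX l:carrier LD. N1 (y1 -[C1] one.jD D1 (ps1 l)) <= e & N2 (y2 -[C2] one.jD D2 (ps2 l)) <= e" if e: "e > 0" for e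
 proof -
  obtain d where d: "d > 0" "ALL l:carrier L12. N12 (one.jD D12 l) <= d -->
   (EX l1:carrier L1. EX l2:carrier L2. l = ci1 l1 +[L12] ci2 l2 & N1 (one.jD D1 l1) <= e & N2 (one.jD D2 l2) <= e)"
   using split_small[OF e] by (elim exE conjE)
  obtain c1 where c1: "c1 > 0" "ALL x:carrier C1. N1 x <= c1 --> N12 (si1 x) <= d" using one.rs_cont[OF adm(3) d(1)] by (elim exE conjE)
  obtain c2 where c2: "c2 > 0" "ALL x:carrier C2. N2 x <= c2 --> N12 (si2 x) <= d" using one.rs_cont[OF adm(4) d(1)] by (elim exE conjE)
  obtain a where a: "a :[L1]" "N1 (y1 -[C1] one.jD D1 a) <= min e c1" using one.ND_normed(3)[OF D1_RD y1, of "min e c1"] e c1 by auto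
  obtain b where b: "b :[L2]" "N2 (y2 -[C2] one.jD D2 b) <= min e c2" using one.ND_normed(3)[OF D2_RD y2, of "min e c2"] e c2 by auto
  let ?ja = "one.jD D1 a" and ?jb = "one.jD D2 b"
  have jc: "?ja :[C1]" "?jb :[C2]" using a b by auto
  have "N12 (si1 (y1 -[C1] ?ja)) <= d" by (rule c1(2)[rule_format, OF BC1.minus_closed[OF y1 jc(1)]]) (use a in linarith)
  hence A: "N12 (si1 y1 -[C12] si1 ?ja) <= d" using p1.hom_minus[OF y1 jc(1)] by simp
  have "N12 (si2 (y2 -[C2] ?jb)) <= d" by (rule c2(2)[rule_format, OF BC2.minus_closed[OF y2 jc(2)]]) (use b in linarith)
  hence Bb: "N12 (si2 y2 -[C12] si2 ?jb) <= d" using p2.hom_minus[OF y2 jc(2)] by simp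
  let ?l = "ci1 a -[L12] ci2 b"
  have lc: "?l :[L12]" using a b by simp
  have "N12 (si1 ?ja -[C12] si2 ?jb) <= max (N12 (si1 ?ja -[C12] si1 y1)) (N12 (si1 y1 -[C12] si2 ?jb))"
   by (rule BC12.q_diff_trans) (use y1 jc in auto)
  moreover have "N12 (si1 ?ja -[C12] si1 y1) = N12 (si1 y1 -[C12] si1 ?ja)" by (rule BC12.q_minus_comm) (use y1 jc in auto)
  ultimately have "N12 (si1 ?ja -[C12] si2 ?jb) <= d" using A Bb unfolding eq by linarith
  hence "N12 (one.jD D12 ?l) <= d" using rho_j(3)[OF a(1)] rho_j(4)[OF b(1)] a b by (simp add: jj12.hom_minus)
  then obtain l1 l2 where ll: "l1 :[L1]" "l2 :[L2]" "?l = ci1 l1 +[L12] ci2 l2"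
   "N1 (one.jD D1 l1) <= e" "N2 (one.jD D2 l2) <= e" using d(2) lc by auto
  have "ci1 (a -[L1] l1) = ci2 (b +[L2] l2)"
  proof -
   have "ci1 a = ?l +[L12] ci2 b" using a b by (simp add: R12.minus_eq R12.a_assoc R12.l_neg)
   hence "ci1 a = ci1 l1 +[L12] (ci2 b +[L12] ci2 l2)" unfolding ll(3) using ll(1,2) a b by (simp add: R12.a_ac)
   hence "ci1 a -[L12] ci1 l1 = ci2 b +[L12] ci2 l2"
    using ll(1,2) a b R12.r_neg2[of "ci1 l1" "ci2 b +[L12] ci2 l2"] by (simp add: R12.minus_eq R12.a_ac R12.r_neg1 R12.r_neg2)
   thus ?thesis using ll(1,2) a b by (simp add: c1.hom_minus)
  qed
  then obtain l where l: "l :[LD]" "ps1 l = a -[L1] l1" "ps2 l = b +[L2] l2" using glue_alg[of "a -[L1] l1" "b +[L2] l2"] a b ll(1,2) by auto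
  have "N1 (y1 -[C1] one.jD D1 (ps1 l)) <= e"
  proof -
   have "y1 -[C1] one.jD D1 (ps1 l) = (y1 -[C1] ?ja) +[C1] one.jD D1 l1"
    unfolding l(2) using y1 a ll(1) by (simp add: BC1.minus_eq R1.minus_eq BC1.minus_add BC1.a_assoc)
   thus ?thesis using BC1.q_add[of "y1 -[C1] ?ja" "one.jD D1 l1"] a ll y1 by auto
  qed
  moreover have "N2 (y2 -[C2] one.jD D2 (ps2 l)) <= e"
  proof -
   have "y2 -[C2] one.jD D2 (ps2 l) = (y2 -[C2] ?jb) -[C2] one.jD D2 l2"
    unfolding l(3) using y2 b ll(2) by (simp add: BC2.minus_eq BC2.minus_add BC2.a_assoc)
   thus ?thesis using BC2.q_diff[of "y2 -[C2] ?jb" "one.jD D2 l2"] b ll y2 by auto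
  qed
  ultimately show ?thesis using l(1) by blast
 qed
 have "EX l. l :[LD] & N1 (y1 -[C1] one.jD D1 (ps1 l)) <= 1 / (real n + 1) & N2 (y2 -[C2] one.jD D2 (ps2 l)) <= 1 / (real n + 1)" for n :: nat
  using approx[of "1 / (real n + 1)"] by auto
 then obtain l where l: "!!n. l n :[LD]" "!!n. N1 (y1 -[C1] one.jD D1 (ps1 (l n))) <= 1 / (real n + 1)"
  "!!n. N2 (y2 -[C2] one.jD D2 (ps2 (l n))) <= 1 / (real n + 1)" by metis
 let ?s = "%n. one.jD D (l n)"
 have sc: "?s n :[C]" for n using l(1) by simp
 have near: "EX k. ALL n>=k. N1 (y1 -[C1] rh1 (?s n)) <= d & N2 (y2 -[C2] rh2 (?s n)) <= d" if d: "d > 0" for d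
 proof -
  obtain k :: nat where k: "1 / (real k + 1) < d" using reals_Archimedean[OF d] by (auto simp: inverse_eq_divide add.commute)
  have "N1 (y1 -[C1] rh1 (?s n)) <= d & N2 (y2 -[C2] rh2 (?s n)) <= d" if "n >= k" for n
  proof -
   have "1 / (real n + 1) <= 1 / (real k + 1)" using that by (intro divide_left_mono) auto
   thus ?thesis using l(2)[of n] l(3)[of n] k unfolding rho_j(1)[OF l(1)] rho_j(2)[OF l(1)] by linarith
  qed
  thus ?thesis by blast
 qed
 have "EX x:carrier C. ALL e>0. EX n0. ALL n>=n0. N (?s n -[C] x) < e"
 proof (rule BC.complete[OF sc])
  fix e :: real assume e: "e > 0"
  hence e2: "e/2 > 0" by simp
  obtain d where d: "d > 0" "ALL x:carrier C. N1 (rh1 x) <= d --> N2 (rh2 x) <= d --> N x <= e/2" using binary_embedding[OF e2] by (elim exE conjE)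
  obtain k where k: "ALL n>=k. N1 (y1 -[C1] rh1 (?s n)) <= d & N2 (y2 -[C2] rh2 (?s n)) <= d" using near[OF d(1)] by (elim exE)
  show "EX n0. ALL m>=n0. ALL n>=n0. N (?s m -[C] ?s n) < e"
  proof (intro exI[of _ k] allI impI)
   fix m n assume mn: "k <= m" "k <= n"
   have km: "N1 (y1 -[C1] rh1 (?s m)) <= d" "N2 (y2 -[C2] rh2 (?s m)) <= d" using k mn(1) by auto
   have kn: "N1 (y1 -[C1] rh1 (?s n)) <= d" "N2 (y2 -[C2] rh2 (?s n)) <= d" using k mn(2) by auto
   note 1 = one.rs_close[OF adm(1) sc sc y1 km(1) kn(1)] and 2 = one.rs_close[OF adm(2) sc sc y2 km(2) kn(2)]
   have "N (?s m -[C] ?s n) <= e/2" by (rule d(2)[rule_format, OF BC.minus_closed[OF sc sc] 1 2])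
   thus "N (?s m -[C] ?s n) < e" using e by linarith
  qed
 qed
 then obtain x where x: "x :[C]" "ALL e>0. EX n0. ALL n>=n0. N (?s n -[C] x) < e" by (elim bexE)
 have "rh1 x = y1" by (rule one.rs_limit[OF adm(1) x(1) sc y1 x(2)]) (use near in blast)
 moreover have "rh2 x = y2" by (rule one.rs_limit[OF adm(2) x(1) sc y2 x(2)]) (use near in blast)
 ultimately show ?thesis using x(1) by blast
qed

text \<open>Successive approximation: the residual is split into small parts at every step.\<close>

lemma binary_surj:
 assumes y: "y :[C12]"
 shows "EX y1:carrier C1. EX y2:carrier C2. y = si1 y1 +[C12] si2 y2"
proof -
 let ?e = "%n::nat. 1 / (real n + 1)"
 have "EX d>0. ALL l:carrier L12. N12 (one.jD D12 l) <= d -->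
  (EX l1:carrier L1. EX l2:carrier L2. l = ci1 l1 +[L12] ci2 l2 & N1 (one.jD D1 l1) <= ?e n & N2 (one.jD D2 l2) <= ?e n)" for n
  by (rule split_small) simp
 then obtain et where et: "!!n. et n > 0" "!!n. ALL l:carrier L12. N12 (one.jD D12 l) <= et n -->
  (EX l1:carrier L1. EX l2:carrier L2. l = ci1 l1 +[L12] ci2 l2 & N1 (one.jD D1 l1) <= ?e n & N2 (one.jD D2 l2) <= ?e n)" by metis
 \<comment> \<open>Staying below \<open>et n\<close> allows the residual to be split into parts of
   size \<open>?e n\<close>; staying below \<open>?e n\<close> forces it to 0.\<close>
 let ?t = "%n. min (et n) (?e n)"
 have t: "?t n > 0" for n using et(1)[of n] by simp
 let ?r = "%p. y -[C12] (si1 (fst p) +[C12] si2 (snd p))"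
 let ?I = "%n p. fst p :[C1] & snd p :[C2] & N12 (?r p) <= ?t n"
 have close: "EX l:carrier L12. N12 (z -[C12] one.jD D12 l) <= e" if "z :[C12]" "e > 0" for z e by (rule one.ND_normed(3)[OF D12_RD that])
 have init: "EX p. ?I 0 p"
 proof -
  obtain l where l: "l :[L12]" "N12 (y -[C12] one.jD D12 l) <= ?t 0" using close[OF y t[of 0]] by (elim bexE)
  obtain l1 l2 where ll: "l1 :[L1]" "l2 :[L2]" "l = ci1 l1 +[L12] ci2 l2" using split_alg[OF l(1)] by (elim bexE)
  have "one.jD D12 l = si1 (one.jD D1 l1) +[C12] si2 (one.jD D2 l2)" unfolding ll(3) rho_j(3)[OF ll(1)] rho_j(4)[OF ll(2)] using ll by simp
  thus ?thesis using l ll by (intro exI[of _ "(one.jD D1 l1, one.jD D2 l2)"]) simp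
 qed
 have step: "EX p'. ?I (Suc n) p' & N1 (fst p' -[C1] fst p) <= ?e n & N2 (snd p' -[C2] snd p) <= ?e n" if p: "?I n p" for p n
 proof -
  obtain p1 p2 where pp: "p = (p1, p2)" by (cases p)
  have pc: "p1 :[C1]" "p2 :[C2]" and pr: "N12 (y -[C12] (si1 p1 +[C12] si2 p2)) <= ?t n" using p by (auto simp: pp)
  let ?z = "y -[C12] (si1 p1 +[C12] si2 p2)"
  have zc: "?z :[C12]" using y pc by simp
  \<comment> \<open>The bound at \<open>Suc n\<close> controls the next residual, the bound at n
    makes l itself small enough to be split.\<close>
  obtain l where l: "l :[L12]" "N12 (?z -[C12] one.jD D12 l) <= min (?t (Suc n)) (?t n)" using close[OF zc, of "min (?t (Suc n)) (?t n)"] t by auto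
  have jl: "one.jD D12 l :[C12]" using l by simp
  have "N12 (one.jD D12 l -[C12] ?z) = N12 (?z -[C12] one.jD D12 l)" by (rule BC12.q_minus_comm[OF jl zc])
  hence "N12 (one.jD D12 l) <= ?t n" using BC12.q_le_of_diff[OF jl zc, of "?t n"] l(2) pr by simp
  then obtain l1 l2 where ll: "l1 :[L1]" "l2 :[L2]" "l = ci1 l1 +[L12] ci2 l2"
   "N1 (one.jD D1 l1) <= ?e n" "N2 (one.jD D2 l2) <= ?e n" using et(2)[of n] l(1) by auto
  let ?p' = "(p1 +[C1] one.jD D1 l1, p2 +[C2] one.jD D2 l2)"
  have jl': "one.jD D12 l = si1 (one.jD D1 l1) +[C12] si2 (one.jD D2 l2)" unfolding ll(3) rho_j(3)[OF ll(1)] rho_j(4)[OF ll(2)] using ll by simp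
  have sc: "si1 p1 :[C12]" "si2 p2 :[C12]" "si1 (one.jD D1 l1) :[C12]" "si2 (one.jD D2 l2) :[C12]" using pc ll by auto
  have "?r ?p' = ?z -[C12] one.jD D12 l" unfolding jl' using pc ll(1,2) y sc by (simp add: BC12.minus_eq BC12.minus_add BC12.a_ac)
  moreover have "(p1 +[C1] one.jD D1 l1) -[C1] p1 = one.jD D1 l1" "(p2 +[C2] one.jD D2 l2) -[C2] p2 = one.jD D2 l2"
   using pc ll BC1.add_minus_cancel BC2.add_minus_cancel by auto
  ultimately show ?thesis using pc ll l(2) by (intro exI[of _ ?p']) (simp add: pp)
 qed
 obtain p where p: "!!n. ?I n (p n)" "!!n. N1 (fst (p (Suc n)) -[C1] fst (p n)) <= ?e n & N2 (snd (p (Suc n)) -[C2] snd (p n)) <= ?e n"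
  using dependent_nat_choice[of ?I "%n p p'. N1 (fst p' -[C1] fst p) <= ?e n & N2 (snd p' -[C2] snd p) <= ?e n", OF init step] by blast
 have pc: "fst (p n) :[C1]" "snd (p n) :[C2]" for n using p(1)[of n] by auto
 obtain y1 where y1: "y1 :[C1]" "ALL e>0. EX n0. ALL n>=n0. N1 (fst (p n) -[C1] y1) < e"
  using BC1.cauchy_steps[of "%n. fst (p n)", OF pc(1) conjunct1[OF p(2)]] by (elim bexE)
 obtain y2 where y2: "y2 :[C2]" "ALL e>0. EX n0. ALL n>=n0. N2 (snd (p n) -[C2] y2) < e"
  using BC2.cauchy_steps[of "%n. snd (p n)", OF pc(2) conjunct2[OF p(2)]] by (elim bexE)
 have "y = si1 y1 +[C12] si2 y2"
 proof (rule BC12.N_small_eq[OF y])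
  fix e :: real assume e: "e > 0"
  obtain d1 where d1: "d1 > 0" "ALL x:carrier C1. N1 x <= d1 --> N12 (si1 x) <= e" using one.rs_cont[OF adm(3) e] by (elim exE conjE)
  obtain d2 where d2: "d2 > 0" "ALL x:carrier C2. N2 x <= d2 --> N12 (si2 x) <= e" using one.rs_cont[OF adm(4) e] by (elim exE conjE)
  obtain k1 where k1: "ALL n>=k1. N1 (fst (p n) -[C1] y1) < d1" using y1(2) d1(1) by auto
  obtain k2 where k2: "ALL n>=k2. N2 (snd (p n) -[C2] y2) < d2" using y2(2) d2(1) by auto
  obtain k :: nat where k: "1 / (real k + 1) < e" using reals_Archimedean[OF e] by (auto simp: inverse_eq_divide add.commute)
  define n where "n = max k (max k1 k2)"
  have n1: "N1 (fst (p n) -[C1] y1) <= d1" "N2 (snd (p n) -[C2] y2) <= d2" using k1 k2 by (auto simp: n_def less_imp_le)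
  have "N12 (si1 (fst (p n) -[C1] y1)) <= e" by (rule d1(2)[rule_format, OF BC1.minus_closed[OF pc(1) y1(1)] n1(1)])
  hence a: "N12 (si1 (fst (p n)) -[C12] si1 y1) <= e" unfolding p1.hom_minus[OF pc(1) y1(1)] .
  have "N12 (si2 (snd (p n) -[C2] y2)) <= e" by (rule d2(2)[rule_format, OF BC2.minus_closed[OF pc(2) y2(1)] n1(2)])
  hence b: "N12 (si2 (snd (p n)) -[C12] si2 y2) <= e" unfolding p2.hom_minus[OF pc(2) y2(1)] .
  have "?e n <= 1 / (real k + 1)" by (intro divide_left_mono) (auto simp: n_def)
  hence r: "N12 (?r (p n)) <= e" using p(1)[of n] k by auto
  have sc: "si1 (fst (p n)) :[C12]" "si2 (snd (p n)) :[C12]" "si1 y1 :[C12]" "si2 y2 :[C12]" using pc y1 y2 by auto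
  have "y -[C12] (si1 y1 +[C12] si2 y2) = ?r (p n) +[C12] ((si1 (fst (p n)) -[C12] si1 y1) +[C12] (si2 (snd (p n)) -[C12] si2 y2))"
   by (rule BC12.minus_split_add[OF y sc])
  moreover have "N12 (?r (p n) +[C12] ((si1 (fst (p n)) -[C12] si1 y1) +[C12] (si2 (snd (p n)) -[C12] si2 y2))) <= e"
  proof -
   have "N12 ((si1 (fst (p n)) -[C12] si1 y1) +[C12] (si2 (snd (p n)) -[C12] si2 y2)) <= e"
    using BC12.q_add[of "si1 (fst (p n)) -[C12] si1 y1" "si2 (snd (p n)) -[C12] si2 y2"] a b sc by simp
   thus ?thesis using BC12.q_add[of "?r (p n)" "(si1 (fst (p n)) -[C12] si1 y1) +[C12] (si2 (snd (p n)) -[C12] si2 y2)"] r sc y by simp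
  qed
  ultimately show "N12 (y -[C12] (si1 y1 +[C12] si2 y2)) <= e" by simp
 qed (use y1 y2 in simp)
 thus ?thesis using y1(1) y2(1) by blast
qed

end


context hub_su
begin

lemma half_swap:
 assumes h: "half B T P D f h S al be"
 shows "half B T P D h f S be al"
proof -
 note fs = half.D[OF h] half.fh[OF h] half.S[OF h] half.gen[OF h] half.ab[OF h] half.Sa[OF h] half.Sb[OF h]
 interpret L: cring "L D" by (rule cring_L[OF half.okD[OF h]])
 interpret p: ring_hom_cring B "L D" "ph D" by (rule ph_hom[OF half.okD[OF h]])
 have "be *[L D] ph D h +[L D] al *[L D] ph D f = \<one>[L D]" using half.one[OF h] fs by (simp add: L.a_comm)
 thus ?thesis by unfold_locales (use fs in auto)
qed

lemma bin_cov:
 assumes "D:RD" "bin D f h S"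
 shows "EX al be. cov B T P D f h S al be"
proof -
 obtain al be where h: "half B T P D f h S al be" using bin_half[OF assms] by (elim exE)
 show ?thesis by (rule exI, rule exI, rule cov.intro[OF h half_swap[OF h]])
qed

lemma bin_data:
 assumes D: "D:RD" and b: "bin D f h S"
 shows "Dl D f h S:RD" "Dl D h f S:RD" "refines (Dl D f h S) D" "refines (Dl D h f S) D"
  "adm D (Dl D f h S)" "adm D (Dl D h f S)"
  "adm (Dl D f h S) (meet (Dl D f h S) (Dl D h f S))" "adm (Dl D h f S) (meet (Dl D f h S) (Dl D h f S))"
proof -
 obtain al be where c: "cov B T P D f h S al be" using bin_cov[OF assms] by (elim exE)
 show "Dl D f h S:RD" "Dl D h f S:RD" "refines (Dl D f h S) D" "refines (Dl D h f S) D"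
  "adm D (Dl D f h S)" "adm D (Dl D h f S)"
  "adm (Dl D f h S) (meet (Dl D f h S) (Dl D h f S))" "adm (Dl D h f S) (meet (Dl D f h S) (Dl D h f S))"
  using cov.D1_RD[OF c] cov.D2_RD[OF c] cov.r1[OF c] cov.r2[OF c] cov.adm[OF c] by simp_all
qed

lemma bin_embedding:
 assumes D: "D:RD" and b: "bin D f h S" and e: "e > 0"
 shows "EX d>0. ALL x:carrier (CD D). ND (Dl D f h S) (rs D (Dl D f h S) x) <= d -->
  ND (Dl D h f S) (rs D (Dl D h f S) x) <= d --> ND D x <= e"
proof -
 obtain al be where c: "cov B T P D f h S al be" using bin_cov[OF D b] by (elim exE)
 show ?thesis by (rule cov.binary_embedding[OF c e])
qed

lemma bin_glue:
 assumes D: "D:RD" and b: "bin D f h S"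
  and y: "y1 :[CD (Dl D f h S)]" "y2 :[CD (Dl D h f S)]"
  and eq: "rs (Dl D f h S) (meet (Dl D f h S) (Dl D h f S)) y1 = rs (Dl D h f S) (meet (Dl D f h S) (Dl D h f S)) y2"
 shows "EX x:carrier (CD D). rs D (Dl D f h S) x = y1 & rs D (Dl D h f S) x = y2"
proof -
 obtain al be where c: "cov B T P D f h S al be" using bin_cov[OF D b] by (elim exE)
 show ?thesis by (rule cov.binary_glue[OF c y eq])
qed

lemma bin_surj:
 assumes D: "D:RD" and b: "bin D f h S"
  and y: "y :[CD (meet (Dl D f h S) (Dl D h f S))]"
 shows "EX y1:carrier (CD (Dl D f h S)). EX y2:carrier (CD (Dl D h f S)).
  y = rs (Dl D f h S) (meet (Dl D f h S) (Dl D h f S)) y1 +[CD (meet (Dl D f h S) (Dl D h f S))]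
    rs (Dl D h f S) (meet (Dl D f h S) (Dl D h f S)) y2"
proof -
 obtain al be where c: "cov B T P D f h S al be" using bin_cov[OF D b] by (elim exE)
 show ?thesis by (rule cov.binary_surj[OF c y])
qed

end

section \<open>Points of the adic spectrum as relations\<close>

text \<open>The axioms of a relation \<open>v(a) <= v(b)\<close> coming from a valuation v, so that
  points of the spectrum can be handled without value groups. Cancellation is asked outside the
  support, the set of c with \<open>(c, \<zero>)\<close> in p.\<close>

locale vrel = cring B for B :: "'a ring" (structure) +
 fixes p :: "('a \<times> 'a) set"
 assumes v_sub: "p <= carrier B \<times> carrier B"
  and v_tot: "a :[B] ==> b :[B] ==> (a, b):p | (b, a):p"
  and v_trans: "(a, b):p ==> (b, c):p ==> (a, c):p"
  and v_add: "(a, c):p ==> (b, c):p ==> (a +. b, c):p"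
  and v_mult: "(a, b):p ==> (c, d):p ==> (a *. c, b *. d):p"
  and v_cancel: "(a *. c, b *. c):p ==> a :[B] ==> b :[B] ==> c :[B] ==> (c, \<zero>) ~: p ==> (a, b):p"
  and v_zero: "b :[B] ==> (\<zero>, b):p"
  and v_one: "(\<one>, \<zero>) ~: p"
begin

lemma v_carr: "(a, b):p ==> a :[B]" "(a, b):p ==> b :[B]" using v_sub by auto

lemma v_refl: "a :[B] ==> (a, a):p" using v_tot[of a a] by simp

lemma v_prime: "(a *. b, \<zero>):p ==> a :[B] ==> b :[B] ==> (a, \<zero>):p | (b, \<zero>):p" using v_cancel[of a b \<zero>] by auto

lemma v_neg: "(a, b):p ==> (-. a, b):p"
proof -
 assume ab: "(a, b):p"
 have m: "(-. \<one>, \<one>):p"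
 proof (cases "(-. \<one>, \<one>):p")
  case False
  hence "(\<one>, -. \<one>):p" using v_tot[of "-. \<one>" \<one>] by simp
  hence "(\<one> *. -. \<one>, -. \<one> *. -. \<one>):p" using v_refl[of "-. \<one>"] by (intro v_mult) simp_all
  thus ?thesis by (simp add: l_minus)
 qed
 show ?thesis using v_mult[OF m ab] v_carr[OF ab] by (simp add: l_minus)
qed

lemma v_subgroup: "c :[B] ==> additive_subgroup {a. (a, c):p} B"
 by (rule additive_subgroupI_minus) (use v_carr v_zero v_add v_neg in \<open>auto simp: minus_eq\<close>)

lemma v_pow: "(a, b):p ==> (a [^] (n::nat), b [^] n):p" by (induction n) (auto intro: v_mult v_refl)

lemma v_nonzero_pow: "a :[B] ==> (a, \<zero>) ~: p ==> (a [^] (n::nat), \<zero>) ~: p" by (induction n) (use v_one v_prime in auto)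

section \<open>The value group of a relation\<close>

definition vX :: "('a \<times> 'a) set" where
 "vX = {(a, b). a :[B] & b :[B] & (a, \<zero>) ~: p & (b, \<zero>) ~: p}"
definition vle :: "'a \<times> 'a => 'a \<times> 'a => bool" where
 "vle x y \<longleftrightarrow> (fst x *. snd y, fst y *. snd x):p"
definition vm :: "'a \<times> 'a => 'a \<times> 'a => 'a \<times> 'a" where
 "vm x y = (fst x *. fst y, snd x *. snd y)"
text \<open>A pair (a, b) stands for the quotient v(a)/v(b); its class is an element of the type
  that \<open>Spa\<close> prescribes for value groups.\<close>

definition vcl :: "'a \<times> 'a => ('a \<times> 'a) set" where
 "vcl x = {y:vX. vle x y & vle y x}"
definition vrep :: "('a \<times> 'a) set => 'a \<times> 'a" where "vrep M = (SOME x. x:M)"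
definition vG :: "('a \<times> 'a) set monoid" where
 "vG = \<lparr>carrier = vcl ` vX, monoid.mult = (%M N. vcl (vm (vrep M) (vrep N))), monoid.one = vcl (\<one>, \<one>)\<rparr>"
definition vleq :: "('a \<times> 'a) set => ('a \<times> 'a) set => bool" where
 "vleq M N \<longleftrightarrow> vle (vrep M) (vrep N)"
definition vv :: "'a => ('a \<times> 'a) set option" where
 "vv a = (if (a, \<zero>):p then None else Some (vcl (a, \<one>)))"

lemma vX_carr: "x:vX ==> fst x :[B]" "x:vX ==> snd x :[B]"
 "x:vX ==> (fst x, \<zero>) ~: p" "x:vX ==> (snd x, \<zero>) ~: p" by (auto simp: vX_def)

lemma vle_refl: "x:vX ==> vle x x" using vX_carr[of x] by (auto simp: vle_def intro: v_refl)
lemma vle_tot: "x:vX ==> y:vX ==> vle x y | vle y x" using vX_carr[of x] vX_carr[of y] v_tot by (auto simp: vle_def)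

lemma vle_trans:
 assumes x: "x:vX" and y: "y:vX" and z: "z:vX" and l: "vle x y" "vle y z"
 shows "vle x z"
proof -
 note c = vX_carr[OF x] vX_carr[OF y] vX_carr[OF z]
 have "(fst x *. snd y *. snd z, fst y *. snd x *. snd z):p" by (rule v_mult[OF l(1)[unfolded vle_def] v_refl[OF c(10)]])
 moreover have "(fst y *. snd z *. snd x, fst z *. snd y *. snd x):p" by (rule v_mult[OF l(2)[unfolded vle_def] v_refl[OF c(2)]])
 moreover have "fst y *. snd x *. snd z = fst y *. snd z *. snd x" using c by (simp add: m_ac)
 ultimately have "(fst x *. snd y *. snd z, fst z *. snd y *. snd x):p" using v_trans by metis
 moreover have "fst x *. snd y *. snd z = fst x *. snd z *. snd y" "fst z *. snd y *. snd x = fst z *. snd x *. snd y" using c by (simp_all add: m_ac)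
 ultimately show ?thesis unfolding vle_def using v_cancel[of "fst x *. snd z" "snd y" "fst z *. snd x"] c by simp
qed

lemma vm_X: "x:vX ==> y:vX ==> vm x y:vX"
 using vX_carr[of x] vX_carr[of y] v_prime[of "fst x" "fst y"] v_prime[of "snd x" "snd y"] by (auto simp: vX_def vm_def)

lemma vle_mult:
 assumes x: "x:vX" and y: "y:vX" and z: "z:vX" "w:vX" and l: "vle x y" "vle z w"
 shows "vle (vm x z) (vm y w)"
proof -
 note c = vX_carr[OF x] vX_carr[OF y] vX_carr[OF z(1)] vX_carr[OF z(2)]
 have "((fst x *. snd y) *. (fst z *. snd w), (fst y *. snd x) *. (fst w *. snd z)):p" by (rule v_mult[OF l[unfolded vle_def]])
 moreover have "(fst x *. snd y) *. (fst z *. snd w) = fst x *. fst z *. (snd y *. snd w)"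
  "(fst y *. snd x) *. (fst w *. snd z) = fst y *. fst w *. (snd x *. snd z)" using c by (simp_all add: m_ac)
 ultimately show ?thesis by (simp add: vle_def vm_def)
qed

lemma vrep: assumes "x:vX" shows "vrep (vcl x):vX" "vle x (vrep (vcl x))" "vle (vrep (vcl x)) x"
proof -
 have "x:vcl x" using assms vle_refl by (simp add: vcl_def)
 hence "vrep (vcl x):vcl x" unfolding vrep_def by (rule someI)
 thus "vrep (vcl x):vX" "vle x (vrep (vcl x))" "vle (vrep (vcl x)) x" by (auto simp: vcl_def)
qed

lemma vcl_eq: assumes "x:vX" "y:vX" shows "vcl x = vcl y \<longleftrightarrow> vle x y & vle y x"
proof
 assume "vcl x = vcl y"
 moreover have "x:vcl x" using assms vle_refl by (simp add: vcl_def)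
 ultimately show "vle x y & vle y x" by (simp add: vcl_def)
next
 assume h: "vle x y & vle y x"
 show "vcl x = vcl y" unfolding vcl_def
  using h vle_trans[OF assms(1,2)] vle_trans[OF assms(2,1)] vle_trans[OF _ assms(1,2)] vle_trans[OF _ assms(2,1)] by blast
qed

lemma vleq_cl: assumes x: "x:vX" and y: "y:vX" shows "vleq (vcl x) (vcl y) \<longleftrightarrow> vle x y"
proof
 note r = vrep[OF x] vrep[OF y]
 show "vle x y" if "vleq (vcl x) (vcl y)" using vle_trans[OF x r(1) y r(2)] vle_trans[OF r(1) r(4) y _ r(6)] that by (simp add: vleq_def)
 show "vleq (vcl x) (vcl y)" if "vle x y" unfolding vleq_def using vle_trans[OF r(1) x r(4) r(3)] vle_trans[OF x y r(4) that r(5)] by simp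
qed

lemma vmult_cl: assumes x: "x:vX" and y: "y:vX" shows "vcl x *[vG] vcl y = vcl (vm x y)"
proof -
 note r = vrep[OF x] vrep[OF y]
 have "vcl (vm (vrep (vcl x)) (vrep (vcl y))) = vcl (vm x y)"
  using vcl_eq[OF vm_X[OF r(1,4)] vm_X[OF x y]] vle_mult[OF r(1) x r(4) y r(3,6)] vle_mult[OF x r(1) y r(4) r(2,5)] by simp
 thus ?thesis by (simp add: vG_def)
qed

lemma vG_carr: "M :[vG] \<longleftrightarrow> (EX x:vX. M = vcl x)" by (auto simp: vG_def)
lemma one_X: "(\<one>, \<one>):vX" using v_one by (auto simp: vX_def)
lemma vG_one: "\<one>[vG] = vcl (\<one>, \<one>)" by (simp add: vG_def)

lemma vG_group: "comm_group vG"
proof (rule comm_groupI)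
 show "\<one>[vG] :[vG]" using one_X by (auto simp: vG_def)
next
 fix M N assume "M :[vG]" "N :[vG]"
 then obtain x y where xy: "x:vX" "y:vX" "M = vcl x" "N = vcl y" unfolding vG_carr by auto
 show "M *[vG] N :[vG]" unfolding xy(3,4) vmult_cl[OF xy(1,2)] using vm_X[OF xy(1,2)] by (auto simp: vG_def)
 have "vm x y = vm y x" using vX_carr[OF xy(1)] vX_carr[OF xy(2)] by (simp add: vm_def m_comm)
 thus "M *[vG] N = N *[vG] M" unfolding xy(3,4) vmult_cl[OF xy(1,2)] vmult_cl[OF xy(2,1)] by simp
 fix K assume "K :[vG]"
 then obtain z where z: "z:vX" "K = vcl z" unfolding vG_carr by auto
 have "vm (vm x y) z = vm x (vm y z)" using vX_carr[OF xy(1)] vX_carr[OF xy(2)] vX_carr[OF z(1)] by (simp add: vm_def m_assoc)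
 thus "M *[vG] N *[vG] K = M *[vG] (N *[vG] K)" unfolding xy(3,4) z(2)
  using vmult_cl[OF xy(1,2)] vmult_cl[OF vm_X[OF xy(1,2)] z(1)] vmult_cl[OF xy(2) z(1)] vmult_cl[OF xy(1) vm_X[OF xy(2) z(1)]] by simp
next
 fix M assume "M :[vG]"
 then obtain x where x: "x:vX" "M = vcl x" unfolding vG_carr by auto
 have "vm (\<one>, \<one>) x = x" using vX_carr[OF x(1)] by (simp add: vm_def)
 thus "\<one>[vG] *[vG] M = M" unfolding x(2) vG_one vmult_cl[OF one_X x(1)] by simp
 let ?y = "(snd x, fst x)"
 have y: "?y:vX" using vX_carr[OF x(1)] by (auto simp: vX_def)
 have "vcl (vm ?y x) = vcl (\<one>, \<one>)" using vcl_eq[OF vm_X[OF y x(1)] one_X] vX_carr[OF x(1)]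
  by (auto simp: vle_def vm_def m_comm intro!: v_refl)
 hence "vcl ?y *[vG] M = \<one>[vG]" unfolding x(2) vG_one vmult_cl[OF y x(1)] .
 thus "EX y:carrier vG. y *[vG] M = \<one>[vG]" by (rule bexI) (use y in \<open>auto simp: vG_carr\<close>)
qed

lemma vG_ordered: "ordered_comm_group vG vleq"
proof -
 have car: "carrier vG = vcl ` vX" by (simp add: vG_def)
 show ?thesis unfolding ordered_comm_group_def car
 proof (intro conjI vG_group ballI impI; elim imageE; hypsubst)
  fix x y z assume c: "x:vX" "y:vX" "z:vX"
  show "vleq (vcl x) (vcl z)" if "vleq (vcl x) (vcl y) & vleq (vcl y) (vcl z)" using that vle_trans[OF c] by (simp add: vleq_cl c)
  show "vleq (vcl x *[vG] vcl z) (vcl y *[vG] vcl z)" if "vleq (vcl x) (vcl y)"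
   using that vle_mult[OF c(1,2,3,3) _ vle_refl[OF c(3)]] by (simp add: vleq_cl vmult_cl vm_X c)
 qed (simp_all add: vleq_cl vle_refl vle_tot vcl_eq)
qed

lemma a1_X: "a :[B] ==> (a, \<zero>) ~: p ==> (a, \<one>):vX" using v_one by (auto simp: vX_def)

lemma vv_le: assumes "a :[B]" "b :[B]" shows "val_le vleq (vv a) (vv b) \<longleftrightarrow> (a, b):p"
proof (cases "(a, \<zero>):p")
 case True
 thus ?thesis using v_trans[OF True v_zero[OF assms(2)]] by (simp add: vv_def)
next
 case a: False
 show ?thesis
 proof (cases "(b, \<zero>):p")
  case True
  thus ?thesis using a v_trans[of a b \<zero>] by (auto simp: vv_def)
 next
  case False
  thus ?thesis using a assms vleq_cl[OF a1_X a1_X, of a b] by (simp add: vv_def vle_def)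
 qed
qed

lemma vv_valuation: "valuation B vG vleq vv" unfolding valuation_def
proof (intro conjI ballI vG_ordered)
 show "vv \<zero> = None" using v_zero by (simp add: vv_def)
 show "vv \<one> = Some \<one>[vG]" using v_one by (simp add: vv_def vG_one)
next
 fix x assume "x :[B]"
 thus "set_option (vv x) <= carrier vG" using a1_X[of x] by (auto simp: vv_def vG_def)
next
 fix x y assume xy: "x :[B]" "y :[B]"
 show "vv (x *. y) = val_mult vG (vv x) (vv y)"
 proof (cases "(x, \<zero>):p | (y, \<zero>):p")
  case True
  hence "(x *. y, \<zero>):p" using v_mult[of x \<zero> y y] v_mult[of x x y \<zero>] v_refl xy by auto
  moreover have "val_mult vG (vv x) (vv y) = None" using True by (cases "vv x") (auto simp: vv_def)
  ultimately show ?thesis by (simp add: vv_def)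
 next
  case False
  hence "(x *. y, \<zero>) ~: p" using v_prime[OF _ xy] by auto
  thus ?thesis using False vmult_cl[OF a1_X[OF xy(1)] a1_X[OF xy(2)]] by (simp add: vv_def vm_def)
 qed
 have "(x +. y, x):p | (x +. y, y):p" using v_tot[OF xy] v_add[of x x y] v_add[of x y y] v_refl xy by auto
 thus "val_le vleq (vv (x +. y)) (vv x) | val_le vleq (vv (x +. y)) (vv y)" using xy vv_le by simp
qed

lemma vv_class: "valuation_class B vleq vv = p" unfolding valuation_class_def using vv_le v_sub by auto

end

lemma vrel_of_valuation:
 fixes B :: "'a ring" (structure) and v :: "'a => 'g option"
 assumes "cring B" and v: "valuation B \<Gamma> leq v"
 shows "vrel B (valuation_class B leq v)"
proof -
 interpret B: cring B by fact
 have og: "ordered_comm_group \<Gamma> leq" and vc: "!!x. x :[B] ==> set_option (v x) <= carrier \<Gamma>"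
  and v0: "v \<zero> = None" and v1: "v \<one> = Some \<one>[\<Gamma>]"
  and vm: "!!x y. x :[B] ==> y :[B] ==> v (x *. y) = val_mult \<Gamma> (v x) (v y)"
  and va: "!!x y. x :[B] ==> y :[B] ==> val_le leq (v (x +. y)) (v x) | val_le leq (v (x +. y)) (v y)" using v unfolding valuation_def by auto
 interpret G: comm_group \<Gamma> using og by (simp add: ordered_comm_group_def)
 have tot: "!!x y. x :[\<Gamma>] ==> y :[\<Gamma>] ==> leq x y | leq y x"
  and tr: "!!x y z. x :[\<Gamma>] ==> y :[\<Gamma>] ==> z :[\<Gamma>] ==> leq x y ==> leq y z ==> leq x z"
  and mono: "!!x y z. x :[\<Gamma>] ==> y :[\<Gamma>] ==> z :[\<Gamma>] ==> leq x y ==> leq (x *[\<Gamma>] z) (y *[\<Gamma>] z)"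
  using og unfolding ordered_comm_group_def by blast+
 have mono2: "leq (x *[\<Gamma>] z) (y *[\<Gamma>] w)" if "leq x y" "leq z w" "x :[\<Gamma>]" "y :[\<Gamma>]" "z :[\<Gamma>]" "w :[\<Gamma>]" for x y z w
  using tr[OF _ _ _ mono[OF that(3,4,5,1)], of "y *[\<Gamma>] w"] mono[OF that(5,6,4,2)] that by (simp add: G.m_comm)
 have canc: "leq x y" if "leq (x *[\<Gamma>] z) (y *[\<Gamma>] z)" "x :[\<Gamma>]" "y :[\<Gamma>]" "z :[\<Gamma>]" for x y z
  using mono[OF _ _ G.inv_closed[OF that(4)] that(1)] that by (simp add: G.m_assoc)
 define le where "le a b = val_le leq (v a) (v b)" for a b
 have le_tot: "le a b | le b a" if "a :[B]" "b :[B]" for a b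
  using tot[of "the (v a)" "the (v b)"] vc[OF that(1)] vc[OF that(2)] by (cases "v a"; cases "v b") (auto simp: le_def)
 have le_tr: "le a c" if "a :[B]" "b :[B]" "c :[B]" "le a b" "le b c" for a b c
  using tr[of "the (v a)" "the (v b)" "the (v c)"] vc[OF that(1)] vc[OF that(2)] vc[OF that(3)] that(4,5) by (cases "v a"; cases "v b"; cases "v c") (auto simp: le_def)
 have le_add: "le (a +. b) c" if c: "a :[B]" "b :[B]" "c :[B]" and l: "le a c" "le b c" for a b c
 proof -
  have "le (a +. b) a | le (a +. b) b" using va[OF c(1,2)] by (simp add: le_def)
  thus ?thesis
  proof
   assume "le (a +. b) a" show ?thesis by (rule le_tr[OF _ c(1,3) _ l(1)]) (use c \<open>le (a +. b) a\<close> in auto)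
  next
   assume "le (a +. b) b" show ?thesis by (rule le_tr[OF _ c(2,3) _ l(2)]) (use c \<open>le (a +. b) b\<close> in auto)
  qed
 qed
 have le_mult: "le (a *. c) (b *. d)" if "a :[B]" "b :[B]" "c :[B]" "d :[B]" "le a b" "le c d" for a b c d
  using mono2[of "the (v a)" "the (v b)" "the (v c)" "the (v d)"] vc[OF that(1)] vc[OF that(2)] vc[OF that(3)] vc[OF that(4)] that
  by (cases "v a"; cases "v b"; cases "v c"; cases "v d") (auto simp: le_def vm)
 have le_cancel: "le a b" if "a :[B]" "b :[B]" "c :[B]" "le (a *. c) (b *. c)" "~ le c \<zero>" for a b c
  using canc[of "the (v a)" "the (v c)" "the (v b)"] vc[OF that(1)] vc[OF that(2)] vc[OF that(3)] that
  by (cases "v a"; cases "v b"; cases "v c") (auto simp: le_def vm v0)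
 let ?V = "{(a, b). (a, b):carrier B \<times> carrier B & le a b}"
 show ?thesis unfolding valuation_class_def le_def[symmetric]
 proof unfold_locales
  show "(\<one>, \<zero>) ~: ?V" by (simp add: le_def v0 v1)
  fix b assume "b :[B]"
  thus "(\<zero>, b):?V" by (simp add: le_def v0)
 next
  fix a b assume "a :[B]" "b :[B]"
  thus "(a, b):?V | (b, a):?V" using le_tot[of a b] by simp
 next
  fix a b c assume "(a, b):?V" "(b, c):?V"
  thus "(a, c):?V" using le_tr[of a b c] by simp
 next
  fix a b c assume "(a, c):?V" "(b, c):?V"
  thus "(a +. b, c):?V" using le_add[of a b c] by simp
 next
  fix a b c d assume "(a, b):?V" "(c, d):?V"
  thus "(a *. c, b *. d):?V" using le_mult[of a b c d] by simp
 next
  fix a b c assume "(a *. c, b *. c):?V" "a :[B]" "b :[B]" "c :[B]"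
   "(c, \<zero>) ~: ?V"
  thus "(a, b):?V" using le_cancel[of a b c] by simp
 qed auto
qed

context hub
begin

text \<open>Continuity has to be tested at the values v(a) only: for a quotient v(a)/v(b)
  multiplication by b is continuous, and the ultrametric inequality carries a neighbourhood of 0 to
  the other points.\<close>

lemma Spa_iff: "p:Spa B T P \<longleftrightarrow>
 vrel B p & (ALL x:P. (x, \<one>):p) & (ALL a:carrier B. (a, \<zero>) ~: p --> (EX U:\<U>. ALL t:U. (a, t) ~: p))"
proof
 assume "p:Spa B T P"
 then obtain \<Gamma> :: "('a \<times> 'a) set monoid" and leq v where p: "p = valuation_class B leq v" and cv: "continuous_valuation B T \<Gamma> leq v"
  and vP: "ALL x:P. val_le leq (v x) (Some \<one>[\<Gamma>])" unfolding Spa_def by auto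
 have v: "valuation B \<Gamma> leq v" using cv by (simp add: continuous_valuation_def)
 have 1: "vrel B p" unfolding p by (rule vrel_of_valuation[OF cring_axioms v])
 have v01: "v \<zero> = None" "v \<one> = Some \<one>[\<Gamma>]" using v by (auto simp: valuation_def)
 have 2: "ALL x:P. (x, \<one>):p" using vP P_sub by (auto simp: p valuation_class_def v01 dest: subringE(1))
 have "EX U:\<U>. ALL t:U. (a, t) ~: p" if a: "a :[B]" "(a, \<zero>) ~: p" for a
 proof -
  have "v a ~= None" using a by (cases "v a") (auto simp: p valuation_class_def v01)
  then obtain ga where g: "v a = Some ga" by auto
  have "ga:value_group B \<Gamma> v" unfolding value_group_def by (rule generate.incl) (use a g in auto)
  hence "openin T {x:carrier B. ~ val_le leq (Some ga) (v x)}" using cv by (simp add: continuous_valuation_def)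
  then obtain U where "U:\<U>" "U <= {x:carrier B. ~ val_le leq (Some ga) (v x)}"
   using U_basis[of "{x:carrier B. ~ val_le leq (Some ga) (v x)}"] by (auto simp: v01)
  thus ?thesis by (intro bexI[of _ U]) (auto simp: p valuation_class_def g)
 qed
 thus "vrel B p & (ALL x:P. (x, \<one>):p) & (ALL a:carrier B. (a, \<zero>) ~: p --> (EX U:\<U>. ALL t:U. (a, t) ~: p))" using 1 2 by blast
next
 assume h: "vrel B p & (ALL x:P. (x, \<one>):p) & (ALL a:carrier B. (a, \<zero>) ~: p --> (EX U:\<U>. ALL t:U. (a, t) ~: p))"
 interpret v: vrel B p using h by simp
 have PB: "P <= carrier B" using P_sub by (rule subringE(1))
 have cont: "openin T {x:carrier B. ~ val_le v.vleq (Some ga) (v.vv x)}" if g: "ga:value_group B v.vG v.vv" for ga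
 proof -
  have "value_group B v.vG v.vv <= carrier v.vG" unfolding value_group_def
  proof (rule group.generate_in_carrier[THEN subsetI])
   show "group v.vG" using v.vG_group by (simp add: comm_group_def)
   show "{ga. EX x:carrier B. v.vv x = Some ga} <= carrier v.vG" using v.vv_valuation unfolding valuation_def by fastforce
  qed
  then obtain x where x: "x:v.vX" "ga = v.vcl x" using g v.vG_carr by blast
  note xc = v.vX_carr[OF x(1)]
  let ?W = "{y:carrier B. (fst x, y *. snd x) ~: p}"
  have eq: "{y:carrier B. ~ val_le v.vleq (Some ga) (v.vv y)} = ?W"
  proof -
   have "val_le v.vleq (Some ga) (v.vv y) \<longleftrightarrow> (fst x, y *. snd x):p" if y: "y :[B]" for y
   proof (cases "(y, \<zero>):p")
    case True
    hence "(y *. snd x, \<zero> *. snd x):p" by (intro v.v_mult v.v_refl xc)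
    thus ?thesis using True v.v_trans[of "fst x" "y *. snd x" \<zero>] xc by (auto simp: v.vv_def)
   next
    case False
    thus ?thesis using v.vleq_cl[OF x(1) v.a1_X[OF y False]] xc y by (simp add: v.vv_def x(2) v.vle_def)
   qed
   thus ?thesis by auto
  qed
  obtain U0 where U0: "U0:\<U>" "ALL t:U0. (fst x, t) ~: p" using h xc by blast
  obtain U where U: "U:\<U>" "ALL y:U. snd x *. y:U0" using U_smult[OF U0(1) xc(2)] by (elim bexE)
  show ?thesis unfolding eq
  proof (subst openin_subopen, intro ballI)
   fix y assume y: "y:?W"
   hence yc: "y :[B]" by simp
   let ?N = "{z:carrier B. z +. -. y:U}"
   have "openin T ?N" by (rule open_preimage_add[OF UD(2)[OF U(1)]]) (use yc in simp)
   moreover have "y:?N" using yc U_zero[OF U(1)] by (simp add: r_neg)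
   moreover have "?N <= ?W"
   proof
    fix z assume z: "z:?N"
    hence zc: "z :[B]" by simp
    let ?t = "snd x *. (z +. -. y)"
    have t: "(fst x, ?t) ~: p" using z U(2) U0(2) by auto
    have tc: "?t :[B]" using zc yc xc by simp
    have yx: "y *. snd x :[B]" using yc xc by simp
    have "?t = z *. snd x +. -. (y *. snd x)" using zc yc xc by (simp add: r_distr r_minus m_comm)
    hence eq: "z *. snd x = y *. snd x +. ?t" using zc yx xc a_comm[of "y *. snd x" ?t] tc by (simp add: a_assoc l_neg)
    have "(fst x, z *. snd x) ~: p"
    proof
     assume a: "(fst x, z *. snd x):p"
     show False
     proof (cases "(y *. snd x, ?t):p")
      case True
      hence "(z *. snd x, ?t):p" unfolding eq by (rule v.v_add) (rule v.v_refl[OF tc])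
      thus False using t v.v_trans[OF a] by blast
     next
      case False
      hence "(?t, y *. snd x):p" using v.v_tot[OF yx tc] by blast
      hence "(z *. snd x, y *. snd x):p" unfolding eq by (intro v.v_add v.v_refl[OF yx])
      thus False using y v.v_trans[OF a] by blast
     qed
    qed
    thus "z:?W" using zc by simp
   qed
   ultimately show "EX N. openin T N & y:N & N <= ?W" by blast
  qed
 qed
 have "continuous_valuation B T v.vG v.vleq v.vv" unfolding continuous_valuation_def using v.vv_valuation cont by blast
 moreover have "ALL x:P. val_le v.vleq (v.vv x) (Some \<one>[v.vG])"
 proof
  fix x assume x: "x:P"
  have "v.vv \<one> = Some \<one>[v.vG]" using v.vv_valuation by (simp add: valuation_def)
  thus "val_le v.vleq (v.vv x) (Some \<one>[v.vG])" using v.vv_le[of x \<one>] x h PB by auto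
 qed
 ultimately show "p:Spa B T P" unfolding Spa_def using v.vv_class by (intro CollectI exI conjI) auto
qed

end

section \<open>Quasi-compactness of rational subsets\<close>

lemma (in ring_hom_cring) hom_npow: "x :[R] ==> h (x [^] (n::nat)) = h x ^[S] n" by (induction n) auto

context hub_su
begin

abbreviation "SP \<equiv> Spa B T P"
abbreviation "RS \<equiv> rational_subset B T P"

lemma Spa_vrel: "p:SP ==> vrel B p" by (simp add: Spa_iff)

lemma Spa_cont:
 assumes p: "p:SP" and b: "b :[B]" "(b, \<zero>) ~: p"
 shows "EX U:\<U>. ALL t:U. (t, b):p & (b, t) ~: p"
proof -
 interpret v: vrel B p by (rule Spa_vrel[OF p])
 obtain U where U: "U:\<U>" "ALL t:U. (b, t) ~: p" using p b unfolding Spa_iff by blast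
 have "(t, b):p" if "t:U" for t using v.v_tot[of t b] U that U_carr[OF U(1)] b by auto
 thus ?thesis using U by blast
qed

text \<open>The fractions c/g^k with v(c) <= v(g^k) form a subgroup containing P and stable under
  multiplication by f/g, so they contain \<open>RR D\<close> by \<open>Mn_least\<close>. As for v(b)
  being nonzero, the inverse of b is a fraction, hence b divides a power of g.\<close>

lemma forces_point:
 assumes D: "okd D" and p: "p:RS D" and f: "forces D a b"
 shows "(a, b):p" "(b, \<zero>) ~: p"
proof -
 have pS: "p:SP" and pf: "!!f. f:fst D ==> (f, snd D):p" and pg: "(snd D, \<zero>) ~: p" using p by (auto simp: rational_subset_def)
 interpret v: vrel B p by (rule Spa_vrel[OF pS])
 interpret c: cring "L D" by (rule cring_L[OF D])
 interpret l: localization B "L D" "ph D" "snd D" by (rule loc[OF D])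
 have g: "snd D :[B]" using D by (simp add: okd_def)
 have gn: "(snd D [^] (n::nat), \<zero>) ~: p" for n by (rule v.v_nonzero_pow[OF g pg])
 note ab = forces_carr[OF f] and bu = forces_unit[OF f]
 let ?G = "ph D (snd D)"
 have Gc: "?G :[L D]" using g by simp
 have pw: "?G ^[L D] (k::nat) = ph D (snd D [^] k)" for k using g by (simp add: l.H.hom_npow)
 have hm: "ph D x *[L D] ph D y = ph D (x *. y)" if "x :[B]" "y :[B]" for x y using that by simp
 show b0: "(b, \<zero>) ~: p"
 proof
  assume b0: "(b, \<zero>):p"
  have ic: "inv[L D] (ph D b) :[L D]" using bu by simp
  obtain c k where c: "c :[B]" "inv[L D] (ph D b) *[L D] ?G ^[L D] (k::nat) = ph D c" using l.frac[OF ic] by (elim bexE exE)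
  have "ph D (b *. c) = ph D (snd D [^] k)"
  proof -
   have "ph D (b *. c) = ph D b *[L D] (inv[L D] (ph D b) *[L D] ?G ^[L D] k)" using ab c by simp
   also have "... = ?G ^[L D] k" using bu ic Gc ab by (simp add: c.m_assoc[symmetric])
   finally show ?thesis unfolding pw .
  qed
  then obtain m :: nat where m: "snd D [^] m *. (b *. c) = snd D [^] m *. snd D [^] k" using l.phi_eqE[of "b *. c" "snd D [^] k"] ab c g by auto
  have "(b *. (snd D [^] m *. c), \<zero> *. (snd D [^] m *. c)):p" by (rule v.v_mult[OF b0 v.v_refl]) (use c g in auto)
  moreover have "b *. (snd D [^] m *. c) = snd D [^] (m + k)" using m ab c g by (simp add: m_ac nat_pow_mult add.commute)
  ultimately show False using gn[of "m + k"] c g by simp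
 qed
 let ?Z = "{y:carrier (L D). EX k c. y *[L D] ?G ^[L D] (k::nat) = ph D c & (c, snd D [^] k):p}"
 have "RR D <= ?Z"
 proof (rule Mn_least[OF D P_carr])
  show "additive_subgroup ?Z (L D)"
  proof (rule c.additive_subgroupI_minus)
   show "\<zero>[L D]:?Z" using v.v_zero[of \<one>] by (intro CollectI conjI exI[of _ "0::nat"] exI[of _ \<zero>]) auto
   fix x y assume "x:?Z" "y:?Z"
   then obtain k c k' c' where x: "x :[L D]" "x *[L D] ?G ^[L D] (k::nat) = ph D c" "(c, snd D [^] k):p"
    and y: "y :[L D]" "y *[L D] ?G ^[L D] (k'::nat) = ph D c'" "(c', snd D [^] k'):p" by auto
   note cc = v.v_carr(1)[OF x(3)] v.v_carr(1)[OF y(3)]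
   have gk: "snd D [^] k :[B]" "snd D [^] k' :[B]" using g by auto
   have s: "(c *. snd D [^] k', snd D [^] k *. snd D [^] k'):p" by (rule v.v_mult[OF x(3) v.v_refl[OF gk(2)]])
   have t: "(c' *. snd D [^] k, snd D [^] k' *. snd D [^] k):p" by (rule v.v_mult[OF y(3) v.v_refl[OF gk(1)]])
   have st: "(c *. snd D [^] k' -. c' *. snd D [^] k, snd D [^] (k + k')):p"
    unfolding minus_eq by (rule v.v_add[OF _ v.v_neg]) (use s t g in \<open>simp_all add: nat_pow_mult add.commute\<close>)
   have "(x -[L D] y) *[L D] ?G ^[L D] (k + k') = (x *[L D] ?G ^[L D] k) *[L D] ?G ^[L D] k' -[L D] (y *[L D] ?G ^[L D] k') *[L D] ?G ^[L D] k"
    using x(1) y(1) Gc by (simp add: c.minus_eq c.l_distr c.l_minus c.m_assoc c.nat_pow_mult add.commute)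
   also have "... = ph D (c *. snd D [^] k' -. c' *. snd D [^] k)" unfolding pw x(2)[unfolded pw] y(2)[unfolded pw] using cc gk by (simp add: l.H.hom_minus)
   finally show "x -[L D] y:?Z" using st x(1) y(1) by (intro CollectI conjI exI[of _ "k + k'"] exI[of _ "c *. snd D [^] k' -. c' *. snd D [^] k"]) auto
  qed auto
 next
  fix u assume u: "u:P"
  have "(u, \<one>):p" using pS u by (auto simp: Spa_iff)
  thus "ph D u:?Z" using u P_carr by (intro CollectI conjI exI[of _ "0::nat"] exI[of _ u]) auto
 next
  fix f z assume f: "f:fst D" and "z:?Z"
  then obtain k c where z: "z :[L D]" "z *[L D] ?G ^[L D] (k::nat) = ph D c" "(c, snd D [^] k):p" by auto
  have fc: "f :[B]" using f D by (auto simp: okd_def)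
  have ff: "fr D f :[L D]" by (rule fr_carr[OF D fc])
  have "fr D f *[L D] z *[L D] ?G ^[L D] (Suc k) = (fr D f *[L D] ?G) *[L D] (z *[L D] ?G ^[L D] k)" using ff z(1) Gc by (simp add: c.m_ac)
  also have "... = ph D (f *. c)" unfolding z(2) fr_mult[OF D fc] using fc v.v_carr(1)[OF z(3)] by simp
  finally have 1: "fr D f *[L D] z *[L D] ?G ^[L D] (Suc k) = ph D (f *. c)" .
  have "(f *. c, snd D *. snd D [^] k):p" by (rule v.v_mult[OF pf[OF f] z(3)])
  hence "(f *. c, snd D [^] Suc k):p" using g by (simp add: m_comm)
  thus "fr D f *[L D] z:?Z" using 1 ff z(1) by (intro CollectI conjI exI[of _ "Suc k"] exI[of _ "f *. c"]) auto
 qed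
 hence "ph D a *[L D] inv[L D] (ph D b):?Z" using forces_RR[OF f] by (rule subsetD)
 then obtain k c where c: "ph D a *[L D] inv[L D] (ph D b) *[L D] ?G ^[L D] (k::nat) = ph D c" "(c, snd D [^] k):p" by auto
 have cc: "c :[B]" by (rule v.v_carr(1)[OF c(2)])
 have ic: "inv[L D] (ph D b) :[L D]" using bu by simp
 have "ph D (b *. c) = ph D b *[L D] (ph D a *[L D] inv[L D] (ph D b) *[L D] ?G ^[L D] k)" using ab cc c(1) by simp
 also have "... = (ph D b *[L D] inv[L D] (ph D b)) *[L D] (ph D a *[L D] ?G ^[L D] k)" using ab ic Gc by (simp add: c.m_ac)
 also have "... = ph D (a *. snd D [^] k)" unfolding pw using bu ab g by simp
 finally obtain m :: nat where m: "snd D [^] m *. (b *. c) = snd D [^] m *. (a *. snd D [^] k)"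
  using l.phi_eqE[of "b *. c" "a *. snd D [^] k"] ab cc g by auto
 have "(b *. snd D [^] m *. c, b *. snd D [^] m *. snd D [^] k):p" by (rule v.v_mult[OF v.v_refl c(2)]) (use ab g in auto)
 moreover have "b *. snd D [^] m *. c = a *. snd D [^] (m + k)" using m ab cc g by (simp add: m_ac nat_pow_mult[symmetric])
 moreover have "b *. snd D [^] m *. snd D [^] k = b *. snd D [^] (m + k)" using ab g by (simp add: m_assoc nat_pow_mult)
 ultimately have "(a *. snd D [^] (m + k), b *. snd D [^] (m + k)):p" by simp
 thus "(a, b):p" by (rule v.v_cancel) (use ab g gn in auto)
qed

section \<open>Rational subsets and binary splittings\<close>

lemma RS_I: "p:SP ==> (!!f. f:fst D ==> (f, snd D):p) ==> (snd D, \<zero>) ~: p ==> p:RS D" by (auto simp: rational_subset_def)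

lemma RS_D: "p:RS D ==> p:SP" "p:RS D ==> f:fst D ==> (f, snd D):p" "p:RS D ==> (snd D, \<zero>) ~: p" by (auto simp: rational_subset_def)

lemma refines_RS:
 assumes E: "okd E" and r: "refines E D" shows "RS E <= RS D"
proof
 fix p assume p: "p:RS E"
 show "p:RS D"
 proof (rule RS_I[OF RS_D(1)[OF p]])
  show "(f, snd D):p" if "f:fst D" for f by (rule forces_point(1)[OF E p]) (use r that in \<open>simp add: refines_def\<close>)
  show "(snd D, \<zero>) ~: p" by (rule forces_point(2)[OF E p, of "snd D"]) (use r in \<open>simp add: refines_def\<close>)
 qed
qed

lemma RS_meet:
 assumes D: "okd D" and E: "okd E"
 shows "RS (meet D E) = RS D Int RS E"
proof
 show "RS (meet D E) <= RS D Int RS E" using refines_RS[OF meet_ok[OF D E]] meet_refines[OF D E] by blast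
 show "RS D Int RS E <= RS (meet D E)"
 proof
  fix p assume "p:RS D Int RS E"
  hence pD: "p:RS D" and pE: "p:RS E" by auto
  interpret v: vrel B p by (rule Spa_vrel[OF RS_D(1)[OF pD]])
  have c: "snd D :[B]" "snd E :[B]" using D E by (auto simp: okd_def)
  have 1: "(f, snd D):p" if "f:insert (snd D) (fst D)" for f using that RS_D(2)[OF pD] v.v_refl[OF c(1)] by auto
  have 2: "(f, snd E):p" if "f:insert (snd E) (fst E)" for f using that RS_D(2)[OF pE] v.v_refl[OF c(2)] by auto
  show "p:RS (meet D E)"
  proof (rule RS_I[OF RS_D(1)[OF pD]])
   fix f assume "f:fst (meet D E)"
   then obtain x y where "x:insert (snd D) (fst D)" "y:insert (snd E) (fst E)" "f = x *. y" by (auto simp: meet_def)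
   thus "(f, snd (meet D E)):p" using v.v_mult[OF 1 2] by (simp add: meet_def)
  next
   show "(snd (meet D E), \<zero>) ~: p" using v.v_prime[of "snd D" "snd E"] RS_D(3)[OF pD] RS_D(3)[OF pE] c by (auto simp: meet_def)
  qed
 qed
qed

lemma bin_carr: assumes "bin D f h S" shows "f :[B]" "h :[B]" "S <= carrier B" "okd (insert f S, h)" using assms by (auto simp: bin_def okd_def)

text \<open>The numerators from S cut out nothing: with u = a f + d h and v(f) <= v(h) one has v(s
  u) <= v(u) v(h), because \<open>s a\<close> and \<open>s d\<close> are forced below u.\<close>

lemma bin_cover:
 assumes D: "D:RD" and b: "bin D f h S"
 shows "RS D = RS (Dl D f h S) Un RS (Dl D h f S)"
proof
 note ok = RD_okd[OF D]
 show "RS (Dl D f h S) Un RS (Dl D h f S) <= RS D" using refines_RS[OF RD_okd] bin_data(1-4)[OF D b] by blast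
 note c = bin_carr[OF b] and c' = bin_carr[OF bin_swap[OF b]]
 have half: "p:RS (Dl D f h S)" if b: "bin D f h S" and p: "p:RS D" and fh: "(f, h):p" for p f h
 proof -
  interpret v: vrel B p by (rule Spa_vrel[OF RS_D(1)[OF p]])
  note c = bin_carr[OF b]
  obtain a d where u: "a :[B]" "d :[B]" "ph D (a *. f +. d *. h):Units (L D)"
    "ALL s:S. forces D (s *. a) (a *. f +. d *. h) & forces D (s *. d) (a *. f +. d *. h)" using b unfolding bin_def by (elim conjE bexE)
  let ?u = "a *. f +. d *. h"
  have uc: "?u :[B]" using u c by simp
  have u0: "(?u, \<zero>) ~: p" by (rule forces_point(2)[OF ok p forces_refl[OF ok uc u(3)]])
  \<comment> \<open>If h vanished at p, so would f and with them the unit u.\<close>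
  have h0: "(h, \<zero>) ~: p"
  proof
   assume h: "(h, \<zero>):p"
   have "(a *. f, a *. \<zero>):p" by (rule v.v_mult[OF v.v_refl[OF u(1)] v.v_trans[OF fh h]])
   moreover have "(d *. h, d *. \<zero>):p" by (rule v.v_mult[OF v.v_refl[OF u(2)] h])
   ultimately show False using v.v_add[of "a *. f" \<zero> "d *. h"] u0 u by simp
  qed
  have "(s, h):p" if s: "s:S" for s
  proof -
   have sc: "s :[B]" using s c by auto
   have 1: "(s *. a, ?u):p" by (rule forces_point(1)[OF ok p]) (use u(4) s in blast)
   have 2: "(s *. d, ?u):p" by (rule forces_point(1)[OF ok p]) (use u(4) s in blast)
   have "(s *. a *. f, ?u *. h):p" by (rule v.v_mult[OF 1 fh])
   moreover have "(s *. d *. h, ?u *. h):p" by (rule v.v_mult[OF 2 v.v_refl[OF c(2)]])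
   moreover have "s *. ?u = s *. a *. f +. s *. d *. h" using sc u c by (simp add: r_distr m_assoc)
   ultimately have "(s *. ?u, ?u *. h):p" using v.v_add by simp
   hence "(s *. ?u, h *. ?u):p" using m_comm[OF uc c(2)] by simp
   thus ?thesis by (rule v.v_cancel) (use sc c uc u0 in auto)
  qed
  hence "p:RS (insert f S, h)" by (intro RS_I RS_D(1)[OF p]) (use fh h0 in auto)
  thus ?thesis unfolding Dl_def RS_meet[OF ok c(4)] using p by simp
 qed
 show "RS D <= RS (Dl D f h S) Un RS (Dl D h f S)"
 proof
  fix p assume p: "p:RS D"
  interpret v: vrel B p by (rule Spa_vrel[OF RS_D(1)[OF p]])
  show "p:RS (Dl D f h S) Un RS (Dl D h f S)" using v.v_tot[OF c(1,2)] half[OF b p] half[OF bin_swap[OF b] p] by blast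
 qed
qed

lemma bin_refines:
 assumes D: "okd D" and E: "okd E" and r: "refines E D" and b: "bin D f h S"
 shows "bin E f h S"
proof -
 obtain a d where u: "a :[B]" "d :[B]" "ph D (a *. f +. d *. h):Units (L D)"
   "ALL s:S. forces D (s *. a) (a *. f +. d *. h) & forces D (s *. d) (a *. f +. d *. h)" using b unfolding bin_def by (elim conjE bexE)
 have "ph E (a *. f +. d *. h):Units (L E)" by (rule lm_Units[OF D E r _ u(3)]) (use u bin_carr[OF b] in simp)
 moreover have "ALL s:S. forces E (s *. a) (a *. f +. d *. h) & forces E (s *. d) (a *. f +. d *. h)" using u(4) forces_mono[OF D E r] by blast
 ultimately have "EX a:carrier B. EX b:carrier B. ph E (a *. f +. b *. h):Units (L E) &
    (ALL s:S. forces E (s *. a) (a *. f +. b *. h) & forces E (s *. b) (a *. f +. b *. h))" using u(1,2) by blast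
 thus ?thesis using b by (simp add: bin_def)
qed

text \<open>Elements s close to 0 have s a/u and s d/u in \<open>RR D\<close>; since B is a Huber
  ring, finitely many elements this small generate an open ideal.\<close>

lemma bin_exists:
 assumes D: "D:RD" and c: "f :[B]" "h :[B]" "a :[B]" "d :[B]"
  and u: "ph D (a *. f +. d *. h):Units (L D)"
 shows "EX S. bin D f h S"
proof -
 let ?u = "a *. f +. d *. h"
 obtain e where e: "e > 0" "ALL t:Ub e. forces D t ?u" using forces_small[OF D _ u] c by auto
 obtain V where V: "V:\<U>" "ALL v:V. a *. v:Ub e" using U_smult[OF Ub_U[OF e(1)] c(3)] by (elim bexE)
 obtain W where W: "W:\<U>" "ALL v:W. d *. v:Ub e" using U_smult[OF Ub_U[OF e(1)] c(4)] by (elim bexE)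
 obtain S where S: "finite S" "S <= V Int W" "ALL U:\<U>. EX V':\<U>. V' <= aspan B {t *. u |t u. t:S & u:U}"
  using bspec[OF conjunct2[OF huber_basis] U_Int[OF V(1) W(1)]] by (elim exE conjE)
 have Sc: "S <= carrier B" using S(2) U_carr[OF V(1)] by blast
 have "forces D (s *. a) ?u & forces D (s *. d) ?u" if s: "s:S" for s
 proof -
  have "s :[B]" "a *. s:Ub e" "d *. s:Ub e" using s S(2) Sc V(2) W(2) by auto
  thus ?thesis using e(2) c m_comm[of s a] m_comm[of s d] by simp
 qed
 hence "bin D f h S" unfolding bin_def using c u S(1,3) Sc U_carrier by blast
 thus ?thesis by blast
qed

text \<open>A finite tree of binary splittings, taking the place of finite subcovers. The rule
  \<open>good_empty\<close> is the certificate for an empty rational subset: a topologically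
  nilpotent t with 1 <= t.\<close>

inductive good :: "('a datum => bool) => 'a datum => bool" for leaf where
 good_leaf: "leaf D ==> good leaf D"
| good_empty: "t :[B] ==> q0 t < 1 ==> forces D \<one> t ==> good leaf D"
| good_bin: "bin D f h S ==> good leaf (Dl D f h S) ==> good leaf (Dl D h f S) ==> good leaf D"

lemma Dl_mono:
 assumes D: "D:RD" and E: "E:RD" and r: "refines E D" and b: "bin D f h S"
 shows "refines (Dl E f h S) (Dl D f h S)"
proof -
 note oD = RD_okd[OF D] and oE = RD_okd[OF E] and oX = bin_carr(4)[OF b]
 note m = meet_refines[OF oE oX]
 show ?thesis unfolding Dl_def by (rule refines_meet[OF oD oX meet_ok[OF oE oX] refines_trans[OF oD oE meet_ok[OF oE oX] m(1) r] m(2)])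
qed

lemma good_mono:
 assumes "good leaf D" and "D:RD" and "E:RD" and "refines E D"
  and leaf: "!!D E. D:RD ==> E:RD ==> refines E D ==> leaf D ==> leaf E"
 shows "good leaf E" using assms(1-4)
proof (induction arbitrary: E)
 case (good_leaf D)
 thus ?case using leaf by (blast intro: good.good_leaf)
next
 case (good_empty t D)
 thus ?case using good.good_empty[of t E] forces_mono[OF RD_okd RD_okd] by blast
next
 case (good_bin D f h S)
 note D = good_bin.prems(1) and E = good_bin.prems(2) and r = good_bin.prems(3) and b = good_bin.hyps(1)
 have bE: "bin E f h S" by (rule bin_refines[OF RD_okd[OF D] RD_okd[OF E] r b])
 show ?case by (rule good.good_bin[OF bE good_bin.IH(1)[OF bin_data(1)[OF D b] bin_data(1)[OF E bE] Dl_mono[OF D E r b]]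
    good_bin.IH(2)[OF bin_data(2)[OF D b] bin_data(2)[OF E bE] Dl_mono[OF D E r bin_swap[OF b]]]])
qed

text \<open>At a point one would have 1 <= v(t)^n for all n, while t^n tends to 0 and v is
  continuous.\<close>

lemma forces_one_RS:
 assumes D: "D:RD" and t: "t :[B]" "q0 t < 1" and f: "forces D \<one> t"
 shows "RS D = {}"
proof (rule ccontr)
 assume "RS D ~= {}"
 then obtain p where p: "p:RS D" by auto
 interpret v: vrel B p by (rule Spa_vrel[OF RS_D(1)[OF p]])
 have "(\<one>, t):p" by (rule forces_point(1)[OF RD_okd[OF D] p f])
 hence le: "(\<one>, t [^] n):p" for n :: nat using v.v_pow[of \<one> t n] by simp
 obtain U where U: "U:\<U>" "ALL t:U. (t, \<one>):p & (\<one>, t) ~: p" using Spa_cont[OF RS_D(1)[OF p] one_closed v.v_one] by (elim bexE)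
 obtain e where e: "e > 0" "ALL b:carrier B. q0 b <= e --> b:U" using q0_U[OF U(1)] by (elim exE conjE)
 obtain n where n: "q0 t ^ n < e" using real_arch_pow_inv[OF e(1) t(2)] by (elim exE)
 have "q0 t ^ Suc n <= q0 t ^ n" by (rule power_decreasing) (use t q.q_nonneg[OF t(1)] in auto)
 hence "q0 (t [^] Suc n) <= e" using q0_pow[OF t(1), of "Suc n"] n by linarith
 hence "t [^] Suc n:U" using e(2) nat_pow_closed[OF t(1), of "Suc n"] by blast
 thus False using U(2) le[of "Suc n"] by blast
qed

text \<open>1 = t^(-n) t^n with t^(-n) in \<open>RR D\<close> and t^n tending to 0, so 1 is
  arbitrarily small.\<close>

lemma forces_one_zero:
 assumes D: "D:RD" and t: "t :[B]" "q0 t < 1" and f: "forces D \<one> t"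
 shows "carrier (CD D) = {\<zero>[CD D]}"
proof -
 note ok = RD_okd[OF D]
 interpret c: cring "L D" by (rule cring_L[OF ok])
 interpret C: banach "CD D" "ND D" by (rule banach_CD[OF D])
 interpret h: ring_hom_cring B "L D" "ph D" by (rule ph_hom[OF ok])
 interpret j: ring_hom_cring "L D" "CD D" "jD D" by (rule jD_hom[OF D])
 note u = forces_unit[OF f]
 let ?i = "inv[L D] (ph D t)"
 have ic: "?i :[L D]" using u by simp
 have tc: "ph D t :[L D]" using t by simp
 have i: "?i:RR D" using forces_RR[OF f] ic by simp
 have pw: "?i ^[L D] (n::nat):RR D" for n by (induction n) (use RR_one[OF ok] RR_mult[OF ok _ i] in auto)
 have one: "?i ^[L D] n *[L D] ph D (t [^] n) = \<one>[L D]" for n :: nat using ic tc u t c.nat_pow_distrib[OF ic tc, of n] by (simp add: h.hom_npow)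
 have "\<one>[CD D] = \<zero>[CD D]"
 proof (rule C.N_small_eq)
  fix e :: real assume e: "e > 0"
  obtain U where U: "U:\<U>" "ALL x:Mn D U. ND D (jD D x) <= e" using ND_normed(2)[OF D e] by (elim bexE)
  obtain v where v: "v > 0" "v < 1" "Ub v <= U" using Ub_small[OF U(1)] by (elim exE conjE)
  obtain n where n: "q0 t ^ n < v" using real_arch_pow_inv[OF v(1) t(2)] by (elim exE)
  have "q0 t ^ Suc n <= q0 t ^ n" by (rule power_decreasing) (use t q.q_nonneg[OF t(1)] in auto)
  hence "q0 (t [^] Suc n) <= v" using q0_pow[OF t(1), of "Suc n"] n by linarith
  hence "t [^] Suc n:Ub v" using t by (simp add: q.qball_def)
  hence "ph D (t [^] Suc n):Mn D (Ub v)" by (rule Mn_ph[OF ok Ub_carr])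
  hence "?i ^[L D] Suc n *[L D] ph D (t [^] Suc n):Mn D (Ub v)" by (rule RR_Mn[OF ok pstable_Ub[OF v(2)] pw])
  hence "\<one>[L D]:Mn D U" unfolding one using Mn_mono[OF ok v(3) U_carr[OF U(1)]] by blast
  hence "ND D (jD D \<one>[L D]) <= e" using U(2) by blast
  thus "ND D (\<one>[CD D] -[CD D] \<zero>[CD D]) <= e" by (simp add: C.minus_eq)
 qed auto
 thus ?thesis using C.one_zeroD by auto
qed

end

text \<open>A prime filter of nonempty rational data is a point: \<open>v a <= v b\<close> holds at the point
 iff some member of the filter forces it, or \<open>a\<close> and \<open>b\<close> are both never invertible on the filter.\<close>

locale prime_filter = hub_su +
 fixes F
 assumes F_RD: "G:F ==> G:RD" and F_ne: "F ~= {}"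
  and F_meet: "G:F ==> H:F ==> meet G H:F"
  and F_up: "G:F ==> H:RD ==> refines G H ==> H:F"
  and F_proper: "G:F ==> t :[B] ==> q0 t < 1 ==> ~ forces G \<one> t"
  and F_prime: "G:F ==> bin G f h S ==> Dl G f h S:F | Dl G h f S:F"
begin

definition fo :: "'a => 'a => bool" where "fo a b \<longleftrightarrow> (EX G:F. forces G a b)"
definition un :: "'a => bool" where "un b \<longleftrightarrow> b :[B] & (EX G:F. ph G b:Units (L G))"
definition pt :: "('a \<times> 'a) set" where
 "pt = {(a, b). a :[B] & b :[B] & (fo a b | ~ un a & ~ un b)}"

lemma F_ok: "G:F ==> okd G" by (rule RD_okd[OF F_RD])

lemma fo_un: "fo a b ==> un b" unfolding fo_def un_def by (elim bexE) (rule conjI, erule forces_carr(2), erule bexI[rotated], erule forces_unit)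

lemma common:
 assumes G: "G:F" and H: "H:F"
 shows "EX K:F. (ALL a b. forces G a b --> forces K a b) & (ALL a b. forces H a b --> forces K a b) &
  (ALL b:carrier B. ph G b:Units (L G) --> ph K b:Units (L K)) & (ALL b:carrier B. ph H b:Units (L H) --> ph K b:Units (L K))"
proof -
 note K = F_meet[OF G H] and r = meet_refines[OF F_ok[OF G] F_ok[OF H]]
 show ?thesis by (rule bexI[OF _ K], intro conjI allI ballI impI)
   (rule forces_mono[OF F_ok[OF G] F_ok[OF K] r(1)], assumption,
    rule forces_mono[OF F_ok[OF H] F_ok[OF K] r(2)], assumption,
    rule lm_Units[OF F_ok[OF G] F_ok[OF K] r(1)], assumption, assumption,
    rule lm_Units[OF F_ok[OF H] F_ok[OF K] r(2)], assumption, assumption)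
qed

lemma common_fo: "fo a b ==> fo c d ==> EX K:F. forces K a b & forces K c d"
proof -
 assume "fo a b" "fo c d"
 then obtain G H where G: "G:F" "forces G a b" and H: "H:F" "forces H c d" unfolding fo_def by (elim bexE)
 show ?thesis using common[OF G(1) H(1)] G(2) H(2) by blast
qed

lemma fo_trans: "fo a b ==> fo b c ==> fo a c" using common_fo[of a b b c] forces_trans[OF F_ok] unfolding fo_def by blast
lemma fo_add: "fo a c ==> fo b c ==> fo (a +. b) c" using common_fo[of a c b c] forces_add[OF F_ok] unfolding fo_def by blast
lemma fo_mult: "fo a b ==> fo c d ==> fo (a *. c) (b *. d)" using common_fo[of a b c d] forces_mult[OF F_ok] unfolding fo_def by blast
lemma fo_refl: "un b ==> fo b b" unfolding un_def fo_def using forces_refl[OF F_ok] by blast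
lemma fo_zero: "un b ==> fo \<zero> b" unfolding un_def fo_def using forces_zero[OF F_ok] by blast

lemma un_one: "un \<one>"
proof -
 obtain G where G: "G:F" using F_ne by blast
 interpret h: ring_hom_cring B "L G" "ph G" by (rule ph_hom[OF F_ok[OF G]])
 have "ph G \<one>:Units (L G)" by simp
 thus ?thesis unfolding un_def using G by blast
qed

text \<open>Otherwise \<open>L G\<close> is the zero ring and 1 is forced below 0, against
  \<open>F_proper\<close> with t = 0.\<close>

lemma not_un_zero: "~ un \<zero>"
proof
 assume "un \<zero>"
 then obtain G where G: "G:F" "ph G \<zero>:Units (L G)" unfolding un_def by (elim conjE bexE)
 interpret c: cring "L G" by (rule cring_L[OF F_ok[OF G(1)]])
 interpret h: ring_hom_cring B "L G" "ph G" by (rule ph_hom[OF F_ok[OF G(1)]])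
 have "\<zero>[L G]:Units (L G)" using G(2) by simp
 hence "\<zero>[L G] *[L G] inv[L G] \<zero>[L G] = \<one>[L G]" "inv[L G] \<zero>[L G] :[L G]" by simp_all
 hence z: "\<one>[L G] = \<zero>[L G]" by simp
 hence "carrier (L G) = {\<zero>[L G]}" by (rule c.one_zeroD)
 hence "ph G \<one> *[L G] inv[L G] (ph G \<zero>) = \<zero>[L G]" using G(2) by auto
 hence "forces G \<one> \<zero>" using G(2) additive_subgroup.zero_closed[OF RR_sub[OF F_ok[OF G(1)]]] by (simp add: forces_def)
 moreover have "q0 \<zero> < 1" by (simp add: q.q_zero)
 ultimately show False using F_proper[OF G(1) zero_closed] by blast
qed

lemma un_mult: "a :[B] ==> b :[B] ==> un (a *. b) \<longleftrightarrow> un a & un b"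
proof
 assume c: "a :[B]" "b :[B]"
 show "un a & un b" if "un (a *. b)"
 proof -
  obtain G where G: "G:F" "ph G (a *. b):Units (L G)" using \<open>un (a *. b)\<close> unfolding un_def by (elim conjE bexE)
  interpret c: cring "L G" by (rule cring_L[OF F_ok[OF G(1)]])
  interpret h: ring_hom_cring B "L G" "ph G" by (rule ph_hom[OF F_ok[OF G(1)]])
  have "ph G a:Units (L G)" by (rule c.Units_factor[of _ "ph G b"]) (use G(2) c in auto)
  moreover have "ph G b:Units (L G)" by (rule c.Units_factor[of _ "ph G a"]) (use G(2) c in \<open>auto simp: c.m_comm\<close>)
  ultimately show ?thesis using G(1) c by (auto simp: un_def)
 qed
 show "un (a *. b)" if "un a & un b" using fo_un[OF fo_mult[OF fo_refl fo_refl]] that by blast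
qed

text \<open>When a f + b h is invertible on a member G of the filter, \<open>bin_exists\<close>
  makes f, h a splitting of G, and primeness selects a side. Totality of \<open>pt\<close> uses the
  coefficients 0 and 1, additivity of its support the coefficients 1 and 1.\<close>

lemma fo_tot:
 assumes c: "a :[B]" "b :[B]" "f :[B]" "h :[B]" and u: "un (a *. f +. b *. h)"
 shows "fo f h | fo h f"
proof -
 obtain G where G: "G:F" "ph G (a *. f +. b *. h):Units (L G)" using u unfolding un_def by (elim conjE bexE)
 obtain S where S: "bin G f h S" using bin_exists[OF F_RD[OF G(1)] c(3,4,1,2) G(2)] by (elim exE)
 have sub: "forces (Dl G f h S) f h" if S: "bin G f h S" for f h
  using meet_refines(2)[OF F_ok[OF G(1)] bin_carr(4)[OF S]] by (simp add: refines_def Dl_def)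
 show ?thesis using F_prime[OF G(1) S] sub[OF S] sub[OF bin_swap[OF S]] by (auto simp: fo_def)
qed

lemma un_tot: "a :[B] ==> b :[B] ==> un b ==> fo a b | fo b a" using fo_tot[of \<zero> \<one> a b] by simp

lemma pt_iff: "a :[B] ==> b :[B] ==> (a, b):pt \<longleftrightarrow> (if un b then fo a b else ~ un a)" using fo_un[of a b] by (auto simp: pt_def)

lemma not_un_fo: "a :[B] ==> un b ==> ~ un a ==> fo a b" using un_tot[of a b] fo_un[of b a] by (auto simp: un_def)

lemma pt_zero_iff: "a :[B] ==> (a, \<zero>):pt \<longleftrightarrow> ~ un a" using pt_iff[of a \<zero>] not_un_zero by simp

lemma pt_carr: "(a, b):pt ==> a :[B] & b :[B]" by (auto simp: pt_def)

lemma pt_vrel: "vrel B pt"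
proof unfold_locales
 show "pt <= carrier B \<times> carrier B" by (auto simp: pt_def)
 show "(\<one>, \<zero>) ~: pt" using pt_zero_iff[of \<one>] un_one by simp
next
 fix a b assume "a :[B]" "b :[B]"
 thus "(a, b):pt | (b, a):pt" using un_tot[of a b] un_tot[of b a] by (auto simp: pt_def)
next
 fix b assume "b :[B]" thus "(\<zero>, b):pt" using fo_zero[of b] not_un_zero by (auto simp: pt_def)
next
 fix a b c assume h: "(a, b):pt" "(b, c):pt"
 note c = pt_carr[OF h(1)] pt_carr[OF h(2)]
 have x: "if un b then fo a b else ~ un a" using pt_iff[of a b] h(1) c by blast
 have y: "if un c then fo b c else ~ un b" using pt_iff[of b c] h(2) c by blast
 have "if un c then fo a c else ~ un a" using x y fo_trans[of a b c] not_un_fo[of a c] c by (auto split: if_splits)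
 thus "(a, c):pt" using pt_iff[of a c] c by blast
next
 fix a b c assume h: "(a, c):pt" "(b, c):pt"
 note c = pt_carr[OF h(1)] pt_carr[OF h(2)]
 have x: "if un c then fo a c else ~ un a" using pt_iff[of a c] h(1) c by blast
 have y: "if un c then fo b c else ~ un b" using pt_iff[of b c] h(2) c by blast
 have "un a | un b" if "un (a +. b)" using fo_tot[of \<one> \<one> a b] fo_un that c by auto
 hence "if un c then fo (a +. b) c else ~ un (a +. b)" using x y fo_add[of a c b] by (auto split: if_splits)
 thus "(a +. b, c):pt" using pt_iff[of "a +. b" c] c by simp
next
 fix a b c d assume h: "(a, b):pt" "(c, d):pt"
 note c = pt_carr[OF h(1)] pt_carr[OF h(2)]
 have x: "if un b then fo a b else ~ un a" using pt_iff[of a b] h(1) c by blast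
 have y: "if un d then fo c d else ~ un c" using pt_iff[of c d] h(2) c by blast
 have "if un (b *. d) then fo (a *. c) (b *. d) else ~ un (a *. c)"
  using x y fo_mult[of a b c d] un_mult[of b d] un_mult[of a c] c by (auto split: if_splits)
 thus "(a *. c, b *. d):pt" using pt_iff[of "a *. c" "b *. d"] c by simp
next
 fix a b c assume h: "(a *. c, b *. c):pt" and c: "a :[B]" "b :[B]" "c :[B]" and c0: "(c, \<zero>) ~: pt"
 have u: "un c" using c0 pt_zero_iff[OF c(3)] by blast
 have x: "if un (b *. c) then fo (a *. c) (b *. c) else ~ un (a *. c)" using pt_iff[of "a *. c" "b *. c"] h c by simp
 have "fo a b" if "fo (a *. c) (b *. c)" using that forces_cancel[OF F_ok _ c] unfolding fo_def by blast
 hence "if un b then fo a b else ~ un a" using x u un_mult[of b c] un_mult[of a c] c by (auto split: if_splits)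
 thus "(a, b):pt" using pt_iff[of a b] c by blast
qed

text \<open>For continuity at b take finitely many topologically nilpotent s whose multiples by a
  ball \<open>Ub e\<close> of elements forced below b span a neighbourhood V. The largest value m on
  S is below 1 because the filter is proper, so on V the values stay below v(b).\<close>

lemma pt_Spa: "pt:SP" unfolding Spa_iff
proof (intro conjI pt_vrel ballI impI)
 interpret v: vrel B pt by (rule pt_vrel)
 obtain G0 where G0: "G0:F" using F_ne by blast
 show "(x, \<one>):pt" if "x:P" for x using forces_P[OF F_ok[OF G0] that] G0 that P_carr by (auto simp: pt_def fo_def)
 fix b assume b: "b :[B]" "(b, \<zero>) ~: pt"
 hence "un b" using pt_zero_iff by blast
 then obtain G where G: "G:F" "ph G b:Units (L G)" unfolding un_def by (elim conjE bexE)
 obtain e where e: "e > 0" "ALL t:Ub e. forces G t b" using forces_small[OF F_RD[OF G(1)] b(1) G(2)] by (elim exE conjE)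
 \<comment> \<open>Any radius below 1 serves; it ensures that the elements of S have
   \<open>q0\<close> below 1.\<close>
 have half: "(1/2::real) > 0" by simp
 obtain S where S: "finite S" "S <= Ub (1/2)" "ALL U:\<U>. EX V:\<U>. V <= aspan B {t *. u |t u. t:S & u:U}"
  using bspec[OF conjunct2[OF huber_basis] Ub_U[OF half]] by (elim exE conjE)
 obtain V where V: "V:\<U>" "V <= aspan B {t *. u |t u. t:S & u:Ub e}" using bspec[OF S(3) Ub_U[OF e(1)]] by (elim bexE)
 have Sc: "S <= carrier B" using S(2) Ub_carr by blast
 have "EX m:carrier B. q0 m < 1 & (ALL s:S. (s, m):pt)" using S(1,2) Sc
 proof (induction S rule: finite_induct)
  case empty thus ?case by (intro bexI[of _ \<zero>]) (auto simp: q.q_zero)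
 next
  case (insert s S)
  then obtain m where m: "m :[B]" "q0 m < 1" "ALL s:S. (s, m):pt" by auto
  have s: "s :[B]" "q0 s < 1" using insert.prems by (auto simp: q.qball_def)
  show ?case
  proof (cases "(s, m):pt")
   case True thus ?thesis using m by (intro bexI[of _ m]) auto
  next
   case False
   hence ms: "(m, s):pt" using v.v_tot[OF s(1) m(1)] by blast
   show ?thesis by (rule bexI[OF _ s(1)]) (use s v.v_refl[OF s(1)] v.v_trans[OF _ ms] m(3) in auto)
  qed
 qed
 then obtain m where m: "m :[B]" "q0 m < 1" "ALL s:S. (s, m):pt" by (elim bexE conjE)
 have Vm: "V <= {a. (a, m *. b):pt}"
 proof (rule order_trans[OF V(2)], rule aspan_least[OF _ v.v_subgroup])
  show "{t *. u |t u. t:S & u:Ub e} <= {a. (a, m *. b):pt}"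
  proof clarify
   fix t u assume t: "t:S" and u: "u:Ub e"
   have "(u, b):pt" using e(2) u G(1) b(1) Ub_carr by (auto simp: pt_def fo_def)
   thus "(t *. u, m *. b):pt" using m(3) t by (intro v.v_mult) auto
  qed
 qed (use m b in simp)
 have "(b, t) ~: pt" if t: "t:V" for t
 proof
  assume "(b, t):pt"
  hence "(b, m *. b):pt" using v.v_trans[of b t "m *. b"] Vm t by blast
  hence "(\<one> *. b, m *. b):pt" using b by simp
  hence "(\<one>, m):pt" by (rule v.v_cancel) (use m b in auto)
  hence "fo \<one> m" using un_one by (auto simp: pt_def)
  thus False unfolding fo_def using F_proper m by blast
 qed
 thus "EX U:\<U>. ALL t:U. (b, t) ~: pt" using V(1) by blast
qed

text \<open>Finitely many inequalities that hold at the point are forced by one common member of F;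
  this member refines E, and F is closed upwards.\<close>

lemma pt_RS: "E:RD ==> pt:RS E \<longleftrightarrow> E:F"
proof
 assume E: "E:RD"
 note ok = RD_okd[OF E]
 have c: "fst E <= carrier B" "snd E :[B]" using ok by (auto simp: okd_def)
 show "pt:RS E" if "E:F"
 proof (rule RS_I[OF pt_Spa])
  fix f assume "f:fst E"
  thus "(f, snd E):pt" using forces_fst[OF ok] that c by (auto simp: pt_def fo_def)
 next
  have "fo (snd E) (snd E)" using forces_snd[OF ok] that by (auto simp: fo_def)
  thus "(snd E, \<zero>) ~: pt" using fo_un pt_zero_iff[OF c(2)] by blast
 qed
 show "E:F" if p: "pt:RS E"
 proof -
  have g: "un (snd E)" using RS_D(3)[OF p] pt_zero_iff[OF c(2)] by blast
  have all: "fo f (snd E)" if "f:insert (snd E) (fst E)" for f using RS_D(2)[OF p] g fo_refl[OF g] that by (auto simp: pt_def)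
  have "EX G:F. ALL f:A. forces G f (snd E)" if "finite A" "A <= insert (snd E) (fst E)" for A using that
  proof (induction A rule: finite_induct)
   case empty thus ?case using F_ne by auto
  next
   case (insert f A)
   then obtain G where G: "G:F" "ALL f:A. forces G f (snd E)" by auto
   have "fo f (snd E)" using all insert.prems by simp
   then obtain H where H: "H:F" "forces H f (snd E)" unfolding fo_def by (elim bexE)
   show ?case using common[OF G(1) H(1)] G(2) H(2) by blast
  qed
  then obtain G where "G:F" "refines G E" using RD_finite[OF E] unfolding refines_def by blast
  thus ?thesis using F_up E by blast
 qed
qed

end

context hub_su
begin

text \<open>\<open>leaf\<close> may be any property of data that passes to refinements and holds
  near every point; the conclusion is an induction principle along splittings. The rules
  \<open>good_bin\<close> and \<open>good_empty\<close> are exactly what makes a maximal filter of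
  data that are not good prime and proper.\<close>

theorem rational_compact:
 assumes D: "D:RD"
  and leaf: "!!D E. D:RD ==> E:RD ==> refines E D ==> leaf D ==> leaf E"
  and cov: "!!p. p:RS D ==> EX G:RD. p:RS G & leaf G"
 shows "good leaf D"
proof (rule ccontr)
 assume ng: "~ good leaf D"
 have gm: "good leaf G" if "good leaf E" "E:RD" "G:RD" "refines G E" for E G by (rule good_mono[OF that leaf])
 define fil where "fil F \<longleftrightarrow> F <= {G:RD. ~ good leaf G} & D:F & (ALL E:F. ALL G:F. meet E G:F) &
  (ALL E:F. ALL G:RD. refines E G --> G:F)" for F
 note okD = RD_okd[OF D]
 \<comment> \<open>The principal filter at D is the start for Zorn's lemma; it contains no good
   datum, since D would inherit goodness.\<close>
 have "fil {G:RD. refines D G}" unfolding fil_def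
 proof (intro conjI ballI impI)
  show "{G:RD. refines D G} <= {G:RD. ~ good leaf G}" using gm[of _ D] ng D by blast
  show "D:{G:RD. refines D G}" using D refines_refl[OF okD] by simp
 next
  fix E G assume "E:{G:RD. refines D G}" "G:{G:RD. refines D G}"
  thus "meet E G:{G:RD. refines D G}" using meet_RD refines_meet[OF RD_okd RD_okd okD] by simp
 next
  fix E G assume "E:{G:RD. refines D G}" "G:RD" "refines E G"
  thus "G:{G:RD. refines D G}" using refines_trans[OF RD_okd RD_okd okD, of G E] by simp
 qed
 hence ne: "{F. fil F} ~= {}" by blast
 have "EX M:{F. fil F}. ALL N:{F. fil F}. M <= N --> N = M"
 proof (rule subset_Zorn_nonempty[OF ne])
  fix C assume C: "C ~= {}" "subset.chain {F. fil F} C"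
  have f: "fil K" if "K:C" for K using C(2) that by (auto simp: subset.chain_def)
  have ch: "K <= Y | Y <= K" if "K:C" "Y:C" for K Y using C(2) that by (auto simp: subset_chain_def)
  have "fil (\<Union>C)" unfolding fil_def
  proof (intro conjI ballI impI)
   show "\<Union>C <= {G:RD. ~ good leaf G}" using f unfolding fil_def by blast
   show "D:\<Union>C" using f C(1) unfolding fil_def by blast
  next
   fix E G assume "E:\<Union>C" "G:\<Union>C"
   then obtain K Y where XY: "K:C" "E:K" "Y:C" "G:Y" by auto
   then obtain Z where "Z:C" "E:Z" "G:Z" using ch[OF XY(1,3)] by blast
   thus "meet E G:\<Union>C" using f[of Z] unfolding fil_def by blast
  next
   fix E G assume "E:\<Union>C" "G:RD" "refines E G"
   thus "G:\<Union>C" using f unfolding fil_def by blast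
  qed
  thus "\<Union>C\<in> {F. fil F}" by simp
 qed
 then obtain F where F: "fil F" "!!K. fil K ==> F <= K ==> K = F" by auto
 have FR: "G:RD" "~ good leaf G" if "G:F" for G using F(1) that by (auto simp: fil_def)
 have Fm: "meet E G:F" if "E:F" "G:F" for E G using F(1) that by (auto simp: fil_def)
 have DF: "D:F" using F(1) by (simp add: fil_def)
 have Fu: "G:F" if "E:F" "G:RD" "refines E G" for E G using F(1) that unfolding fil_def by blast
 \<comment> \<open>By maximality the filter \<open>?F\<close> generated by F and E must contain a
   good datum, and goodness passes down to some \<open>meet E G\<close>.\<close>
 have max: "EX G:F. good leaf (meet E G)" if E: "E:RD" "E ~: F" for E
 proof (rule ccontr)
  assume n: "~ (EX G:F. good leaf (meet E G))"
  let ?F = "{H:RD. EX G:F. refines (meet E G) H}"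
  have mR: "meet E G:RD" if "G:F" for G using meet_RD[OF E(1) FR(1)[OF that]] .
  have mr: "refines (meet E G) E" "refines (meet E G) G" if "G:F" for G using meet_refines[OF RD_okd[OF E(1)] RD_okd[OF FR(1)[OF that]]] by auto
  have sub: "F <= ?F" using FR mr by blast
  have "fil ?F" unfolding fil_def
  proof (intro conjI ballI impI)
   show "?F <= {G:RD. ~ good leaf G}" using gm mR n by blast
   show "D:?F" using DF sub by blast
  next
   fix H1 H2 assume "H1:?F" "H2:?F"
   then obtain G1 G2 where H: "H1:RD" "H2:RD" and G: "G1:F" "refines (meet E G1) H1" "G2:F" "refines (meet E G2) H2" by auto
   note G12 = Fm[OF G(1,3)]
   note o = RD_okd[OF E(1)] RD_okd[OF FR(1)[OF G(1)]] RD_okd[OF FR(1)[OF G(3)]] RD_okd[OF mR[OF G12]]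
   note r = meet_refines[OF o(2,3)]
   have og: "okd (meet G1 G2)" by (rule RD_okd[OF FR(1)[OF G12]])
   have a: "refines (meet E (meet G1 G2)) (meet E G1)"
    by (rule refines_meet[OF o(1,2,4) mr(1)[OF G12] refines_trans[OF o(2) og o(4) mr(2)[OF G12] r(1)]])
   have b: "refines (meet E (meet G1 G2)) (meet E G2)"
    by (rule refines_meet[OF o(1,3,4) mr(1)[OF G12] refines_trans[OF o(3) og o(4) mr(2)[OF G12] r(2)]])
   have a': "refines (meet E (meet G1 G2)) H1" by (rule refines_trans[OF RD_okd[OF H(1)] RD_okd[OF mR[OF G(1)]] o(4) a G(2)])
   have b': "refines (meet E (meet G1 G2)) H2" by (rule refines_trans[OF RD_okd[OF H(2)] RD_okd[OF mR[OF G(3)]] o(4) b G(4)])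
   have "refines (meet E (meet G1 G2)) (meet H1 H2)" by (rule refines_meet[OF RD_okd[OF H(1)] RD_okd[OF H(2)] o(4) a' b'])
   thus "meet H1 H2:?F" using meet_RD[OF H] G12 by blast
  next
   fix H1 H2 assume "H1:?F" "H2:RD" "refines H1 H2"
   thus "H2:?F" using refines_trans[OF RD_okd RD_okd RD_okd[OF mR]] by blast
  qed
  hence eq: "?F = F" by (rule F(2)[OF _ sub])
  have "E:?F" using E(1) mr(1)[OF DF] DF by blast
  thus False using E(2) unfolding eq by blast
 qed
 interpret u: prime_filter B T P F
 proof unfold_locales
  show "G:RD" if "G:F" for G using FR that by blast
  show "F ~= {}" using DF by blast
  show "meet G H:F" if "G:F" "H:F" for G H by (rule Fm[OF that])
  show "H:F" if "G:F" "H:RD" "refines G H" for G H by (rule Fu[OF that])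
  show "~ forces G \<one> t" if "G:F" "t :[B]" "q0 t < 1" for G t using good_empty[OF that(2,3)] FR(2)[OF that(1)] by blast
  fix G f h S assume G: "G:F" and b: "bin G f h S"
  show "Dl G f h S:F | Dl G h f S:F"
  proof (rule ccontr)
   assume "~ (Dl G f h S:F | Dl G h f S:F)"
   then obtain G1 G2 where G1: "G1:F" "good leaf (meet (Dl G f h S) G1)" and G2: "G2:F" "good leaf (meet (Dl G h f S) G2)"
    using max[OF bin_data(1)[OF FR(1)[OF G] b]] max[OF bin_data(2)[OF FR(1)[OF G] b]] by blast
   \<comment> \<open>If both halves were missing from F, this member of F would split into two good
     halves and hence be good.\<close>
   define G' where "G' = meet G (meet G1 G2)"
   note G12 = Fm[OF G1(1) G2(1)]
   have G': "G':F" unfolding G'_def by (rule Fm[OF G G12])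
   note R = FR(1)[OF G] FR(1)[OF G1(1)] FR(1)[OF G2(1)] FR(1)[OF G'] FR(1)[OF G12]
   note ok = RD_okd[OF R(1)] RD_okd[OF R(2)] RD_okd[OF R(3)] RD_okd[OF R(4)] RD_okd[OF R(5)]
   note r = meet_refines[OF ok(1,5), folded G'_def] and r12 = meet_refines[OF ok(2,3)]
   have r1: "refines G' G1" by (rule refines_trans[OF ok(2,5,4) r(2) r12(1)])
   have r2: "refines G' G2" by (rule refines_trans[OF ok(3,5,4) r(2) r12(2)])
   have b': "bin G' f h S" by (rule bin_refines[OF ok(1,4) r(1) b])
   have step: "good leaf (Dl G' f h S)" if b: "bin G f h S" and H: "H:RD" "good leaf (meet (Dl G f h S) H)" "refines G' H" for f h H
   proof -
    have b': "bin G' f h S" by (rule bin_refines[OF ok(1,4) r(1) b])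
    note d = bin_data(1)[OF R(1) b] and d' = bin_data(1)[OF R(4) b']
    have "refines (Dl G' f h S) (meet (Dl G f h S) H)" by (rule refines_meet[OF RD_okd[OF d] RD_okd[OF H(1)] RD_okd[OF d'] Dl_mono[OF R(1,4) r(1) b]
      refines_trans[OF RD_okd[OF H(1)] ok(4) RD_okd[OF d'] bin_data(3)[OF R(4) b'] H(3)]])
    thus ?thesis by (rule gm[OF H(2) meet_RD[OF d H(1)] d'])
   qed
   have "good leaf G'" by (rule good_bin[OF b' step[OF b R(2) G1(2) r1] step[OF bin_swap[OF b] R(3) G2(2) r2]])
   thus False using FR(2)[OF G'] by blast
  qed
 qed
 have "u.pt:RS D" using u.pt_RS[OF D] DF by blast
 then obtain G where G: "G:RD" "u.pt:RS G" "leaf G" using cov by blast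
 hence "G:F" using u.pt_RS[OF G(1)] by blast
 thus False using FR(2) good_leaf[of leaf G, OF G(3)] by blast
qed

section \<open>The topology of the adic spectrum\<close>

abbreviation "TS \<equiv> spa_topology B T P"

lemma RS_Spa: "RS D <= SP" by (auto simp: rational_subset_def)

lemma openin_RS:
 assumes D: "D:RD" shows "openin TS (RS D)"
proof -
 have c: "fst D <= carrier B" "snd D :[B]" using RD_okd[OF D] by (auto simp: okd_def)
 have o: "openin TS (RS ({f}, snd D))" if "f :[B]" for f unfolding spa_topology_def by (rule topology_generated_by_Basis) (use that c in auto)
 \<comment> \<open>The denominator is inserted so that the intersection is not over an empty family
   when \<open>fst D\<close> is empty.\<close>
 have "RS D = (\<Inter>f\<in>insert (snd D) (fst D). RS ({f}, snd D))"
 proof (intro equalityI subsetI)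
  fix p assume p: "p:RS D"
  interpret v: vrel B p by (rule Spa_vrel[OF RS_D(1)[OF p]])
  show "p:(\<Inter>f\<in>insert (snd D) (fst D). RS ({f}, snd D))" using p v.v_refl[OF c(2)] by (auto simp: rational_subset_def)
 next
  fix p assume "p:(\<Inter>f\<in>insert (snd D) (fst D). RS ({f}, snd D))"
  thus "p:RS D" by (auto simp: rational_subset_def)
 qed
 also have "openin TS ..." by (rule openin_INT2) (use RD_finite[OF D] o c in auto)
 finally show ?thesis .
qed

text \<open>A generating set comes from a single f, whose ideal with g need not be open. Near a
  given point small elements S lie below g by continuity, and adding them to the numerators gives a
  rational datum.\<close>

lemma openin_TS: "openin TS V \<longleftrightarrow> V <= SP & (ALL p:V. EX D:RD. p:RS D & RS D <= V)"
proof
 let ?B = "{RS ({f}, g) |f g. f :[B] & g :[B]}"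
 assume "openin TS V"
 hence "generate_topology_on ?B V" by (simp add: spa_topology_def openin_topology_generated_by_iff)
 thus "V <= SP & (ALL p:V. EX D:RD. p:RS D & RS D <= V)"
 proof (induction)
  case Empty thus ?case by simp
 next
  case (Int a b)
  have "EX D:RD. p:RS D & RS D <= a Int b" if p: "p:a Int b" for p
  proof -
   obtain D where D: "D:RD" "p:RS D" "RS D <= a" using Int.IH(1) p by blast
   obtain E where E: "E:RD" "p:RS E" "RS E <= b" using Int.IH(2) p by blast
   show ?thesis by (rule bexI[OF _ meet_RD[OF D(1) E(1)]]) (use RS_meet[OF RD_okd RD_okd, OF D(1) E(1)] D E in auto)
  qed
  thus ?case using Int.IH by blast
 next
  case (UN K)
  have "EX D:RD. p:RS D & RS D <= \<Union>K" if pk: "p:\<Union>K" for p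
  proof -
   obtain k where k: "k:K" "p:k" using pk by (elim UnionE)
   obtain D where D: "D:RD" "p:RS D" "RS D <= k" using bspec[OF conjunct2[OF UN.IH[OF k(1)]] k(2)] by (elim bexE conjE)
   show ?thesis by (rule bexI[OF _ D(1)]) (use D k in auto)
  qed
  moreover have "\<Union>K <= SP" using UN.IH by (intro Union_least) simp
  ultimately show ?case by simp
 next
  case (Basis s)
  then obtain f g where s: "s = RS ({f}, g)" "f :[B]" "g :[B]" by blast
  have "EX D:RD. p:RS D & RS D <= s" if p: "p:s" for p
  proof -
   have p': "p:SP" "(f, g):p" "(g, \<zero>) ~: p" using p by (auto simp: s rational_subset_def)
   obtain U where U: "U:\<U>" "ALL t:U. (t, g):p & (g, t) ~: p" using Spa_cont[OF p'(1) s(3) p'(3)] by (elim bexE)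
   obtain S where S: "finite S" "S <= U" "ALL W:\<U>. EX V:\<U>. V <= aspan B {t *. u |t u. t:S & u:W}"
    using bspec[OF conjunct2[OF huber_basis] U(1)] by (elim exE conjE)
   obtain V where V: "V:\<U>" "V <= aspan B {t *. u |t u. t:S & u :[B]}" using bspec[OF S(3) U_carrier] by (elim bexE)
   have Sc: "S <= carrier B" using S(2) U_carr[OF U(1)] by blast
   let ?D = "(insert f S, g)"
   have "aspan B {t *. u |t u. t:S & u :[B]} <= aspan B {f *. u |f u. f:insert (snd ?D) (fst ?D) & u :[B]}" by (rule aspan_mono) (use s Sc in auto)
   hence VV: "V <= aspan B {f *. u |f u. f:insert (snd ?D) (fst ?D) & u :[B]}" using V(2) by blast
   have "?D:RD" by (rule span_rational[OF _ _ V(1) VV]) (use s Sc S in \<open>auto simp: okd_def\<close>)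
   moreover have "p:RS ?D" by (rule RS_I) (use p' S U in auto)
   moreover have "RS ?D <= s" by (auto simp: s rational_subset_def)
   ultimately show ?thesis by blast
  qed
  thus ?case using s RS_Spa by blast
 qed
next
 assume h: "V <= SP & (ALL p:V. EX D:RD. p:RS D & RS D <= V)"
 show "openin TS V"
 proof (subst openin_subopen, intro ballI)
  fix p assume "p:V"
  then obtain D where "D:RD" "p:RS D" "RS D <= V" using h by blast
  thus "EX W. openin TS W & p:W & W <= V" using openin_RS by blast
 qed
qed

end

section \<open>The structure sheaf\<close>

context hub_su
begin

lemma bin_ok: assumes "D:RD" "bin D f h S"
 shows "meet (Dl D f h S) (Dl D h f S):RD"
  "refines (meet (Dl D f h S) (Dl D h f S)) (Dl D f h S)" "refines (meet (Dl D f h S) (Dl D h f S)) (Dl D h f S)"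
 using meet_RD[OF bin_data(1,2)[OF assms]] meet_refines[OF RD_okd RD_okd, OF bin_data(1,2)[OF assms]] by auto

text \<open>The binary embedding composed along the tree. That K is finite and independent of e is
  what later yields a topological embedding into the product over a covering.\<close>

lemma good_bound:
 assumes "good leaf D" "D:RD"
 shows "EX K. finite K & (ALL E:K. E:RD & refines E D & leaf E) &
  (ALL e>0. EX d>0. ALL x:carrier (CD D). (ALL E:K. ND E (rs D E x) <= d) --> ND D x <= e)" using assms
proof (induction)
 case (good_leaf D)
 thus ?case using refines_refl[OF RD_okd] rs_id by (intro exI[of _ "{D}"]) auto
next
 case (good_empty t D)
 note D = good_empty.prems
 interpret C: banach "CD D" "ND D" by (rule banach_CD[OF D])
 have "carrier (CD D) = {\<zero>[CD D]}" by (rule forces_one_zero[OF D good_empty.hyps])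
 thus ?case by (intro exI[of _ "{}"]) (auto simp: C.q_zero intro: exI[of _ 1])
next
 case (good_bin D f h S)
 note D = good_bin.prems and b = good_bin.hyps(1)
 let ?D1 = "Dl D f h S" and ?D2 = "Dl D h f S"
 note d = bin_data[OF D b]
 obtain K1 where K1: "finite K1" "ALL E:K1. E:RD & refines E ?D1 & leaf E"
  "ALL e>0. EX d>0. ALL x:carrier (CD ?D1). (ALL E:K1. ND E (rs ?D1 E x) <= d) --> ND ?D1 x <= e" using good_bin.IH(1)[OF d(1)] by (elim exE conjE)
 obtain K2 where K2: "finite K2" "ALL E:K2. E:RD & refines E ?D2 & leaf E"
  "ALL e>0. EX d>0. ALL x:carrier (CD ?D2). (ALL E:K2. ND E (rs ?D2 E x) <= d) --> ND ?D2 x <= e" using good_bin.IH(2)[OF d(2)] by (elim exE conjE)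
 interpret h1: ring_hom_cring "CD D" "CD ?D1" "rs D ?D1" by (rule rs_hom[OF d(5)])
 interpret h2: ring_hom_cring "CD D" "CD ?D2" "rs D ?D2" by (rule rs_hom[OF d(6)])
 have "EX d>0. ALL x:carrier (CD D). (ALL E:K1 Un K2. ND E (rs D E x) <= d) --> ND D x <= e" if e: "e > 0" for e
 proof -
  obtain d0 where d0: "d0 > 0" "ALL x:carrier (CD D). ND ?D1 (rs D ?D1 x) <= d0 --> ND ?D2 (rs D ?D2 x) <= d0 --> ND D x <= e"
   using bin_embedding[OF D b e] by (elim exE conjE)
  obtain d1 where d1: "d1 > 0" "ALL x:carrier (CD ?D1). (ALL E:K1. ND E (rs ?D1 E x) <= d1) --> ND ?D1 x <= d0"
   using K1(3)[rule_format, OF d0(1)] by (elim exE conjE)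
  obtain d2 where d2: "d2 > 0" "ALL x:carrier (CD ?D2). (ALL E:K2. ND E (rs ?D2 E x) <= d2) --> ND ?D2 x <= d0"
   using K2(3)[rule_format, OF d0(1)] by (elim exE conjE)
  have "ND D x <= e" if x: "x :[CD D]" "ALL E:K1 Un K2. ND E (rs D E x) <= min d1 d2" for x
  proof -
   have "ND ?D1 (rs D ?D1 x) <= d0"
   proof (rule d1(2)[rule_format])
    fix E assume E: "E:K1"
    hence "adm ?D1 E" using K1(2) refines_adm d(1) by blast
    thus "ND E (rs ?D1 E (rs D ?D1 x)) <= d1" using x E rs_comp[OF d(5) _ x(1)] by simp
   qed (use x in simp)
   moreover have "ND ?D2 (rs D ?D2 x) <= d0"
   proof (rule d2(2)[rule_format])
    fix E assume E: "E:K2"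
    hence "adm ?D2 E" using K2(2) refines_adm d(2) by blast
    thus "ND E (rs ?D2 E (rs D ?D2 x)) <= d2" using x E rs_comp[OF d(6) _ x(1)] by simp
   qed (use x in simp)
   ultimately show ?thesis using d0(2) x(1) by blast
  qed
  thus ?thesis using d1(1) d2(1) by (intro exI[of _ "min d1 d2"]) simp
 qed
 moreover have "ALL E:K1 Un K2. E:RD & refines E D & leaf E"
 proof
  fix E assume E: "E:K1 Un K2"
  hence "E:RD" "leaf E" "refines E ?D1 | refines E ?D2" using K1(2) K2(2) by auto
  thus "E:RD & refines E D & leaf E"
   using refines_trans[OF RD_okd[OF D] RD_okd[OF d(1)] RD_okd _ d(3)] refines_trans[OF RD_okd[OF D] RD_okd[OF d(2)] RD_okd _ d(4)] by blast
 qed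
 ultimately show ?case using K1(1) K2(1) by (intro exI[of _ "K1 Un K2"]) simp
qed

lemma good_sep:
 assumes g: "good leaf D" and D: "D:RD" and x: "x :[CD D]" and y: "y :[CD D]"
  and eq: "!!E. E:RD ==> refines E D ==> leaf E ==> rs D E x = rs D E y"
 shows "x = y"
proof -
 interpret C: banach "CD D" "ND D" by (rule banach_CD[OF D])
 obtain K where K: "ALL E:K. E:RD & refines E D & leaf E"
  "ALL e>0. EX d>0. ALL x:carrier (CD D). (ALL E:K. ND E (rs D E x) <= d) --> ND D x <= e" using good_bound[OF g D] by (elim exE conjE)
 show ?thesis
 proof (rule C.N_small_eq[OF x y])
  fix e :: real assume "e > 0"
  then obtain d where d: "d > 0" "ALL x:carrier (CD D). (ALL E:K. ND E (rs D E x) <= d) --> ND D x <= e" using K(2) by blast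
  show "ND D (x -[CD D] y) <= e"
  proof (rule d(2)[rule_format])
   fix E assume "E:K"
   hence E: "E:RD" "refines E D" "leaf E" using K(1) by auto
   interpret h: ring_hom_cring "CD D" "CD E" "rs D E" by (rule rs_hom[OF refines_adm[OF D E(1,2)]])
   interpret E: banach "CD E" "ND E" by (rule banach_CD[OF E(1)])
   have "rs D E (x -[CD D] y) = \<zero>[CD E]" using eq[OF E] x y by (simp add: h.hom_minus h.S.minus_eq h.S.r_neg)
   thus "ND E (rs D E (x -[CD D] y)) <= d" using d(1) E.q_zero by simp
  qed (use x y in simp)
 qed
qed

lemma rat_map_closed: "D:RD ==> b :[B] ==> rat_map B T D b :[CD D]"
 unfolding rat_map_eq using ring_hom_closed[OF ring_hom_cring.homh[OF jD_hom]] ph_closed[OF RD_okd] by blast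

text \<open>Restriction maps to the two halves of E agree on the overlap by uniqueness and are glued
  by \<open>bin_glue\<close>; where the tree ends in a zero ring, the zero map serves.\<close>

lemma good_adm:
 assumes "good (%G. G:RD & refines G D) E" "E:RD" "D:RD"
 shows "adm D E" using assms
proof (induction)
 case (good_leaf E)
 thus ?case using refines_adm by blast
next
 case (good_empty t E)
 note E = good_empty.prems(1) and D = good_empty.prems(2)
 have z: "carrier (CD E) = {\<zero>[CD E]}" by (rule forces_one_zero[OF E good_empty.hyps])
 interpret E: banach "CD E" "ND E" by (rule banach_CD[OF E])
 have o: "\<one>[CD E] = \<zero>[CD E]" using z E.one_closed by auto
 have "chom D E (%_. \<zero>[CD E])" unfolding chom_def
 proof (intro conjI allI impI ballI)
  show "(%_. \<zero>[CD E]):ring_hom (CD D) (CD E)" by (rule ring_hom_memI) (use o in auto)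
  show "EX d>0. ALL x:carrier (CD D). ND D x <= d --> ND E \<zero>[CD E] <= e" if "e > 0" for e using that by (intro exI[of _ 1]) (simp add: E.q_zero)
  show "\<zero>[CD E] = rat_map B T E b" if "b :[B]" for b using rat_map_closed[OF E that] z by simp
 qed
 thus ?case using D E by (auto simp: adm_def)
next
 case (good_bin E f h S)
 note E = good_bin.prems(1) and D = good_bin.prems(2) and b = good_bin.hyps(1)
 let ?E1 = "Dl E f h S" and ?E2 = "Dl E h f S" let ?E12 = "meet ?E1 ?E2"
 note d = bin_data[OF E b]
 note a = good_bin.IH(1)[OF d(1) D] good_bin.IH(2)[OF d(2) D]
 interpret C: banach "CD E" "ND E" by (rule banach_CD[OF E])
 interpret CD: banach "CD D" "ND D" by (rule banach_CD[OF D])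
 interpret h1: ring_hom_cring "CD D" "CD ?E1" "rs D ?E1" by (rule rs_hom[OF a(1)])
 interpret h2: ring_hom_cring "CD D" "CD ?E2" "rs D ?E2" by (rule rs_hom[OF a(2)])
 interpret k1: ring_hom_cring "CD E" "CD ?E1" "rs E ?E1" by (rule rs_hom[OF d(5)])
 interpret k2: ring_hom_cring "CD E" "CD ?E2" "rs E ?E2" by (rule rs_hom[OF d(6)])
 \<comment> \<open>An element of \<open>CD E\<close> is determined by its restrictions to the
   halves; every law for the glued map is checked there.\<close>
 have uniq: "x = y" if "x :[CD E]" "y :[CD E]" "rs E ?E1 x = rs E ?E1 y" "rs E ?E2 x = rs E ?E2 y" for x y
 proof (rule C.N_small_eq[OF that(1,2)])
  interpret B1: banach "CD ?E1" "ND ?E1" by (rule banach_CD[OF d(1)])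
  interpret B2: banach "CD ?E2" "ND ?E2" by (rule banach_CD[OF d(2)])
  fix e :: real assume e: "e > 0"
  obtain de where de: "de > 0" "ALL x:carrier (CD E). ND ?E1 (rs E ?E1 x) <= de --> ND ?E2 (rs E ?E2 x) <= de --> ND E x <= e"
   using bin_embedding[OF E b e] by (elim exE conjE)
  have 1: "rs E ?E1 (x -[CD E] y) = \<zero>[CD ?E1]" using that by (simp add: k1.hom_minus h1.S.minus_eq h1.S.r_neg)
  have 2: "rs E ?E2 (x -[CD E] y) = \<zero>[CD ?E2]" using that by (simp add: k2.hom_minus h2.S.minus_eq h2.S.r_neg)
  have "ND ?E1 (rs E ?E1 (x -[CD E] y)) <= de" "ND ?E2 (rs E ?E2 (x -[CD E] y)) <= de" unfolding 1 2 using de(1) B1.q_zero B2.q_zero by simp_all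
  thus "ND E (x -[CD E] y) <= e" by (rule de(2)[rule_format, OF C.minus_closed[OF that(1,2)]])
 qed
 have ex: "EX z:carrier (CD E). rs E ?E1 z = rs D ?E1 x & rs E ?E2 z = rs D ?E2 x" if x: "x :[CD D]" for x
  by (rule bin_glue[OF E b]) (use x rs_comp[OF a(1) d(7) x] rs_comp[OF a(2) d(8) x] in auto)
 define fi where "fi x = (SOME z. z :[CD E] & rs E ?E1 z = rs D ?E1 x & rs E ?E2 z = rs D ?E2 x)" for x
 have fi: "fi x :[CD E]" "rs E ?E1 (fi x) = rs D ?E1 x" "rs E ?E2 (fi x) = rs D ?E2 x" if x: "x :[CD D]" for x
 proof -
  have "EX z. z :[CD E] & rs E ?E1 z = rs D ?E1 x & rs E ?E2 z = rs D ?E2 x" using ex[OF x] unfolding Bex_def .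
  from someI_ex[OF this] show "fi x :[CD E]" "rs E ?E1 (fi x) = rs D ?E1 x" "rs E ?E2 (fi x) = rs D ?E2 x" unfolding fi_def by auto
 qed
 note c1 = adm_chom[OF a(1)] and c2 = adm_chom[OF a(2)] and e1 = adm_chom[OF d(5)] and e2 = adm_chom[OF d(6)]
 have "chom D E fi" unfolding chom_def
 proof (intro conjI allI impI ballI)
  show "fi:ring_hom (CD D) (CD E)"
  proof (rule ring_hom_memI)
   fix x y assume xy: "x :[CD D]" "y :[CD D]"
   note f = fi[OF xy(1)] fi[OF xy(2)]
   show "fi (x *[CD D] y) = fi x *[CD E] fi y" by (rule uniq) (use fi[of "x *[CD D] y"] f xy in auto)
   show "fi (x +[CD D] y) = fi x +[CD E] fi y" by (rule uniq) (use fi[of "x +[CD D] y"] f xy in auto)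
  next
   show "fi \<one>[CD D] = \<one>[CD E]" by (rule uniq) (use fi[of "\<one>[CD D]"] in auto)
  qed (use fi in auto)
  fix e :: real assume e: "e > 0"
  obtain de where de: "de > 0" "ALL x:carrier (CD E). ND ?E1 (rs E ?E1 x) <= de --> ND ?E2 (rs E ?E2 x) <= de --> ND E x <= e"
   using bin_embedding[OF E b e] by (elim exE conjE)
  obtain d1 where d1: "d1 > 0" "ALL x:carrier (CD D). ND D x <= d1 --> ND ?E1 (rs D ?E1 x) <= de" using chomD(2)[OF c1 de(1)] by (elim exE conjE)
  obtain d2 where d2: "d2 > 0" "ALL x:carrier (CD D). ND D x <= d2 --> ND ?E2 (rs D ?E2 x) <= de" using chomD(2)[OF c2 de(1)] by (elim exE conjE)
  have "ND E (fi x) <= e" if "x :[CD D]" "ND D x <= min d1 d2" for x by (rule de(2)[rule_format]) (use fi[OF that(1)] d1(2) d2(2) that in auto)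
  thus "EX d>0. ALL x:carrier (CD D). ND D x <= d --> ND E (fi x) <= e" using d1(1) d2(1) by (intro exI[of _ "min d1 d2"]) simp
 next
  fix b assume b: "b :[B]"
  note r = rat_map_closed[OF D b] rat_map_closed[OF E b]
  have q: "rs E ?E1 (rat_map B T E b) = rs D ?E1 (rat_map B T D b)" "rs E ?E2 (rat_map B T E b) = rs D ?E2 (rat_map B T D b)"
   using c1 c2 e1 e2 b by (simp_all add: chom_def)
  show "fi (rat_map B T D b) = rat_map B T E b" by (rule uniq[OF fi(1)[OF r(1)] r(2)]) (use fi(2,3)[OF r(1)] q in simp_all)
 qed
 thus ?case using D E by (auto simp: adm_def)
qed

text \<open>Inclusion of subsets does not give \<open>refines E D\<close>. But D alone covers E, so
  \<open>rational_compact\<close> splits E into data that do refine D.\<close>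

lemma RS_adm:
 assumes D: "D:RD" and E: "E:RD" and s: "RS E <= RS D"
 shows "adm D E"
proof (rule good_adm[OF rational_compact[OF E] E D])
 show "G':RD & refines G' D" if "G:RD" "G':RD" "refines G' G" "G:RD & refines G D" for G G'
  using refines_trans[OF RD_okd[OF D] RD_okd[OF that(1)] RD_okd[OF that(2)] that(3)] that by blast
 show "EX G:RD. p:RS G & G:RD & refines G D" if "p:RS E" for p using D s that refines_refl[OF RD_okd[OF D]] by blast
qed

text \<open>There is no point to cover, so the tree exists with the leaf property
  \<open>False\<close>, and then \<open>good_sep\<close> identifies any two elements.\<close>

lemma empty_zero:
 assumes E: "E:RD" and e: "RS E = {}"
 shows "carrier (CD E) = {\<zero>[CD E]}"
proof -
 have z: "\<zero> :[B]" "q0 \<zero> < 1" by (auto simp: q.q_zero)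
 have "good (%_. False) E" by (rule rational_compact[OF E]) (use e in auto)
 moreover have "x = \<zero>[CD E]" if "x :[CD E]" for x
  by (rule good_sep[OF calculation E that]) (use cring_CD[OF E] in \<open>auto simp: cring_def ring.ring_simprules(2)\<close>)
 ultimately show ?thesis using cring_CD[OF E] by (auto simp: cring_def ring.ring_simprules(2))
qed

text \<open>\<open>ta\<close> is a compatible family on all data subordinate to a covering. The
  conclusion speaks of all such data inside D, not just of the leaves of the tree, so that the
  gluings on two halves can be compared on their overlap.\<close>

lemma good_glue:
 assumes g: "good leaf D" and D: "D:RD"
  and leaf: "!!G. leaf G ==> G:RD & ta G :[CD G]"
  and sub: "!!G E. leaf G ==> E:RD ==> RS E <= RS G ==> leaf E & rs G E (ta G) = ta E"
 shows "EX x:carrier (CD D). ALL E. leaf E --> RS E <= RS D --> rs D E x = ta E" using g D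
proof (induction)
 case (good_leaf D)
 thus ?case using leaf[OF good_leaf.hyps] sub[OF good_leaf.hyps] leaf by (intro bexI[of _ "ta D"] allI impI) auto
next
 case (good_empty t D)
 note D = good_empty.prems
 have e: "RS D = {}" by (rule forces_one_RS[OF D good_empty.hyps])
 interpret C: banach "CD D" "ND D" by (rule banach_CD[OF D])
 have "rs D E \<zero>[CD D] = ta E" if E: "leaf E" "RS E <= RS D" for E
 proof -
  have ER: "E:RD" "ta E :[CD E]" using leaf[OF E(1)] by auto
  interpret h: ring_hom_cring "CD D" "CD E" "rs D E" by (rule rs_hom[OF RS_adm[OF D ER(1) E(2)]])
  have "carrier (CD E) = {\<zero>[CD E]}" by (rule empty_zero[OF ER(1)]) (use E e in auto)
  thus ?thesis using ER by simp
 qed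
 thus ?case by blast
next
 case (good_bin D f h S)
 note D = good_bin.prems and b = good_bin.hyps(1)
 let ?D1 = "Dl D f h S" and ?D2 = "Dl D h f S" let ?D12 = "meet ?D1 ?D2"
 note d = bin_data[OF D b] and d12 = bin_ok[OF D b]
 have r12: "RS ?D12 <= RS ?D1" "RS ?D12 <= RS ?D2" using refines_RS[OF RD_okd[OF d12(1)]] d12(2,3) by auto
 have r1: "RS ?D1 <= RS D" "RS ?D2 <= RS D" using bin_cover[OF D b] by auto
 obtain x1 where x1: "x1 :[CD ?D1]" "ALL E. leaf E --> RS E <= RS ?D1 --> rs ?D1 E x1 = ta E" using good_bin.IH(1)[OF d(1)] by (elim bexE)
 obtain x2 where x2: "x2 :[CD ?D2]" "ALL E. leaf E --> RS E <= RS ?D2 --> rs ?D2 E x2 = ta E" using good_bin.IH(2)[OF d(2)] by (elim bexE)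
 interpret h1: ring_hom_cring "CD ?D1" "CD ?D12" "rs ?D1 ?D12" by (rule rs_hom[OF d(7)])
 interpret h2: ring_hom_cring "CD ?D2" "CD ?D12" "rs ?D2 ?D12" by (rule rs_hom[OF d(8)])
 have g12: "good leaf ?D12" by (rule good_mono[OF good_bin.hyps(2) d(1) d12(1,2)]) (use sub refines_RS RD_okd in blast)
 have e12: "rs ?D1 ?D12 x1 = rs ?D2 ?D12 x2"
 proof (rule good_sep[OF g12 d12(1)])
  fix E assume E: "E:RD" "refines E ?D12" "leaf E"
  have s: "RS E <= RS ?D12" by (rule refines_RS[OF RD_okd[OF E(1)] E(2)])
  note a = RS_adm[OF d12(1) E(1) s]
  have "rs ?D12 E (rs ?D1 ?D12 x1) = ta E" using rs_comp[OF d(7) a x1(1)] x1(2) E(3) s r12 by auto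
  moreover have "rs ?D12 E (rs ?D2 ?D12 x2) = ta E" using rs_comp[OF d(8) a x2(1)] x2(2) E(3) s r12 by auto
  ultimately show "rs ?D12 E (rs ?D1 ?D12 x1) = rs ?D12 E (rs ?D2 ?D12 x2)" by simp
 qed (use x1 x2 in auto)
 obtain x where x: "x :[CD D]" "rs D ?D1 x = x1" "rs D ?D2 x = x2" using bin_glue[OF D b x1(1) x2(1) e12] by (elim bexE conjE)
 have "rs D E x = ta E" if E: "leaf E" "RS E <= RS D" for E
 proof -
  have ER: "E:RD" "ta E :[CD E]" using leaf[OF E(1)] by auto
  note a = RS_adm[OF D ER(1) E(2)]
  interpret hE: ring_hom_cring "CD D" "CD E" "rs D E" by (rule rs_hom[OF a])
  \<comment> \<open>E may meet both halves without lying in either; compactness splits it into data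
    that lie in one of them.\<close>
  have g: "good (%H. H:RD & (RS H <= RS ?D1 | RS H <= RS ?D2)) E"
  proof (rule rational_compact[OF ER(1)])
   show "G':RD & (RS G' <= RS ?D1 | RS G' <= RS ?D2)" if "G':RD" "refines G' G" "G:RD & (RS G <= RS ?D1 | RS G <= RS ?D2)" for G G'
    using refines_RS[OF RD_okd[OF that(1)] that(2)] that by blast
   show "EX G:RD. p:RS G & G:RD & (RS G <= RS ?D1 | RS G <= RS ?D2)" if "p:RS E" for p using that E(2) bin_cover[OF D b] d(1,2) by blast
  qed
  show ?thesis
  proof (rule good_sep[OF g ER(1)])
   fix H assume H: "H:RD" "refines H E" "H:RD & (RS H <= RS ?D1 | RS H <= RS ?D2)"
   have s: "RS H <= RS E" by (rule refines_RS[OF RD_okd[OF H(1)] H(2)])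
   note aH = RS_adm[OF ER(1) H(1) s] and tH = sub[OF E(1) H(1) s]
   have "rs D H x = ta H"
   proof (cases "RS H <= RS ?D1")
    case True
    thus ?thesis using rs_comp[OF d(5) RS_adm[OF d(1) H(1) True] x(1)] x(2) x1(2) tH by simp
   next
    case False
    hence s2: "RS H <= RS ?D2" using H(3) by blast
    thus ?thesis using rs_comp[OF d(6) RS_adm[OF d(2) H(1) s2] x(1)] x(3) x2(2) tH by simp
   qed
   thus "rs E H (rs D E x) = rs E H (ta E)" using rs_comp[OF a aH x(1)] tH by simp
  qed (use ER x in auto)
 qed
 thus ?case using x(1) by blast
qed

section \<open>Sections of the structure presheaf\<close>

abbreviation "SH \<equiv> structure_presheaf B T P"
abbreviation "SS \<equiv> structure_sections B T P"
abbreviation "DW \<equiv> data_within B T P"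

lemma DW_iff: "D:DW V \<longleftrightarrow> D:RD & RS D <= V" by (simp add: data_within_def)

lemma DW_mono: "W <= V ==> D:DW W ==> D:DW V" using order_trans[of "RS D" W V] by (simp add: DW_iff)

lemma SS_iff: "s:SS V \<longleftrightarrow> s:extensional (DW V) & (ALL D:DW V. s D :[CD D]) &
  (ALL D:DW V. ALL E:RD. RS E <= RS D --> rs D E (s D) = s E)"
proof -
 have "E:DW V" if "D:DW V" "E:RD" "RS E <= RS D" for D E using that by (auto simp: DW_iff)
 moreover have "E:RD" if "E:DW V" for E using that by (simp add: DW_iff)
 ultimately show ?thesis unfolding structure_sections_def PiE_def Pi_def by blast
qed

lemma SS_D: assumes "s:SS V" "D:DW V" shows "s D :[CD D]" "E:RD ==> RS E <= RS D ==> rs D E (s D) = s E" using assms by (auto simp: SS_iff)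

lemma SS_eq: "s:SS V ==> t:SS V ==> (!!D. D:DW V ==> s D = t D) ==> s = t" by (rule extensionalityI[of s "DW V"]) (auto simp: SS_iff)

lemma SS_build:
 assumes "!!D. D:DW V ==> t D :[CD D]"
  and "!!D E. D:DW V ==> E:DW V ==> adm D E ==> RS E <= RS D ==> rs D E (t D) = t E"
 shows "(\<lambda>D\<in>DW V. t D):SS V" unfolding SS_iff
proof (intro conjI ballI impI)
 fix D E assume D: "D:DW V" and E: "E:RD" "RS E <= RS D"
 have EV: "E:DW V" using D E by (auto simp: DW_iff)
 have "adm D E" using D E by (intro RS_adm) (auto simp: DW_iff)
 thus "rs D E ((\<lambda>D\<in>DW V. t D) D) = (\<lambda>D\<in>DW V. t D) E" using assms(2)[OF D EV] E D EV by simp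
qed (use assms(1) in auto)

lemma sect_simps:
 "carrier (sect SH V) = SS V"
 "\<zero>[sect SH V] = (\<lambda>D\<in>DW V. \<zero>[CD D])" "\<one>[sect SH V] = (\<lambda>D\<in>DW V. \<one>[CD D])"
 "s +[sect SH V] t = (\<lambda>D\<in>DW V. s D +[CD D] t D)" "s *[sect SH V] t = (\<lambda>D\<in>DW V. s D *[CD D] t D)"
 "sect_top SH V = subtopology (product_topology (rat_topology B T) (DW V)) (SS V)"
 "restr SH V W s = restrict s (DW W)" by (simp_all add: structure_presheaf_def)

lemma CD_cring: "D:DW V ==> cring (CD D)" by (rule cring_CD) (simp add: DW_iff)

lemma SS_closed:
 "\<zero>[sect SH V]:SS V" "\<one>[sect SH V]:SS V"
 "s:SS V ==> t:SS V ==> s +[sect SH V] t:SS V"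
 "s:SS V ==> t:SS V ==> s *[sect SH V] t:SS V"
 "s:SS V ==> (\<lambda>D\<in>DW V. -[CD D] s D):SS V"
proof -
 have c: "cring (CD D)" if "D:DW V" for D by (rule CD_cring[OF that])
 have r: "ring_hom_cring (CD D) (CD E) (rs D E)" if "adm D E" for D E by (rule rs_hom[OF that])
 have m: "E:RD" if "E:DW V" for E using that by (simp add: DW_iff)
 show "\<zero>[sect SH V]:SS V" unfolding sect_simps
  by (rule SS_build) (use c in \<open>simp_all add: ring_hom_cring.hom_zero[OF r] cring.cring_simprules(2)\<close>)
 show "\<one>[sect SH V]:SS V" unfolding sect_simps
  by (rule SS_build) (use c in \<open>simp_all add: ring_hom_one[OF ring_hom_cring.homh[OF r]] cring.cring_simprules(6)\<close>)
 assume s: "s:SS V"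
 note s1 = SS_D(1)[OF s] and s2 = SS_D(2)[OF s _ m]
 show "(\<lambda>D\<in>DW V. -[CD D] s D):SS V"
  by (rule SS_build) (use c in \<open>simp_all add: s1 s2 ring_hom_cring.hom_a_inv[OF r] cring.cring_simprules(3)\<close>)
 assume t: "t:SS V"
 note t1 = SS_D(1)[OF t] and t2 = SS_D(2)[OF t _ m]
 show "s +[sect SH V] t:SS V" unfolding sect_simps
  by (rule SS_build) (use c in \<open>simp_all add: s1 s2 t1 t2 ring_hom_add[OF ring_hom_cring.homh[OF r]] cring.cring_simprules(1)\<close>)
 show "s *[sect SH V] t:SS V" unfolding sect_simps
  by (rule SS_build) (use c in \<open>simp_all add: s1 s2 t1 t2 ring_hom_mult[OF ring_hom_cring.homh[OF r]] cring.cring_simprules(5)\<close>)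
qed

lemma SS_cring: "cring (sect SH V)"
proof (rule cringI)
 note c = CD_cring[of _ V] and cl = SS_closed[where V = V]
 show "abelian_group (sect SH V)"
 proof (rule abelian_groupI, unfold sect_simps(1))
  fix s t u assume s: "s:SS V" and t: "t:SS V" and u: "u:SS V"
  show "s +[sect SH V] t +[sect SH V] u = s +[sect SH V] (t +[sect SH V] u)" by (rule SS_eq[OF cl(3)[OF cl(3)[OF s t] u] cl(3)[OF s cl(3)[OF t u]]])
    (use c SS_D(1)[OF s] SS_D(1)[OF t] SS_D(1)[OF u] in \<open>simp add: sect_simps cring.cring_simprules(7)\<close>)
 next
  fix s t assume s: "s:SS V" and t: "t:SS V"
  show "s +[sect SH V] t = t +[sect SH V] s" by (rule SS_eq[OF cl(3)[OF s t] cl(3)[OF t s]])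
    (use c SS_D(1)[OF s] SS_D(1)[OF t] in \<open>simp add: sect_simps cring.cring_simprules(10)\<close>)
 next
  fix s assume s: "s:SS V"
  show "\<zero>[sect SH V] +[sect SH V] s = s"
   by (rule SS_eq[OF cl(3)[OF cl(1) s] s]) (use c SS_D(1)[OF s] in \<open>simp add: sect_simps cring.cring_simprules(8)\<close>)
  have "(\<lambda>D\<in>DW V. -[CD D] s D) +[sect SH V] s = \<zero>[sect SH V]"
   by (rule SS_eq[OF cl(3)[OF cl(5)[OF s] s] cl(1)]) (use c SS_D(1)[OF s] in \<open>simp add: sect_simps cring.cring_simprules(9)\<close>)
  thus "EX y:SS V. y +[sect SH V] s = \<zero>[sect SH V]" using cl(5)[OF s] by (rule bexI)
 qed (use cl in auto)
 show "comm_monoid (sect SH V)"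
 proof (rule comm_monoidI, unfold sect_simps(1))
  fix s t u assume s: "s:SS V" and t: "t:SS V" and u: "u:SS V"
  show "s *[sect SH V] t *[sect SH V] u = s *[sect SH V] (t *[sect SH V] u)" by (rule SS_eq[OF cl(4)[OF cl(4)[OF s t] u] cl(4)[OF s cl(4)[OF t u]]])
    (use c SS_D(1)[OF s] SS_D(1)[OF t] SS_D(1)[OF u] in \<open>simp add: sect_simps cring.cring_simprules(11)\<close>)
 next
  fix s t assume s: "s:SS V" and t: "t:SS V"
  show "s *[sect SH V] t = t *[sect SH V] s" by (rule SS_eq[OF cl(4)[OF s t] cl(4)[OF t s]])
    (use c SS_D(1)[OF s] SS_D(1)[OF t] in \<open>simp add: sect_simps cring.cring_simprules(14)\<close>)
 next
  fix s assume s: "s:SS V"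
  show "\<one>[sect SH V] *[sect SH V] s = s"
   by (rule SS_eq[OF cl(4)[OF cl(2) s] s]) (use c SS_D(1)[OF s] in \<open>simp add: sect_simps cring.cring_simprules(12)\<close>)
 qed (use cl in auto)
 fix s t u assume "s :[sect SH V]" "t :[sect SH V]" "u :[sect SH V]"
 hence s: "s:SS V" and t: "t:SS V" and u: "u:SS V" by (simp_all add: sect_simps)
 show "(s +[sect SH V] t) *[sect SH V] u = s *[sect SH V] u +[sect SH V] t *[sect SH V] u"
  by (rule SS_eq[OF cl(4)[OF cl(3)[OF s t] u] cl(3)[OF cl(4)[OF s u] cl(4)[OF t u]]])
   (use c SS_D(1)[OF s] SS_D(1)[OF t] SS_D(1)[OF u] in \<open>simp add: sect_simps cring.cring_simprules(13)\<close>)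
qed

lemma SS_neg: assumes s: "s:SS V" shows "-[sect SH V] s = (\<lambda>D\<in>DW V. -[CD D] s D)"
proof -
 interpret S: cring "sect SH V" by (rule SS_cring)
 note cl = SS_closed[where V = V]
 have "(\<lambda>D\<in>DW V. -[CD D] s D) +[sect SH V] s = \<zero>[sect SH V]"
  by (rule SS_eq[OF cl(3)[OF cl(5)[OF s] s] cl(1)]) (use CD_cring[of _ V] SS_D(1)[OF s] in \<open>simp add: sect_simps cring.cring_simprules(9)\<close>)
 thus ?thesis by (rule S.minus_equality) (use s cl in \<open>auto simp: sect_simps(1)\<close>)
qed

lemma top_CD: "D:RD ==> topological_ring (CD D) (rat_topology B T D)" using banach.topological_ring[OF banach_CD] ND_spec(3) by metis

lemma topspace_rat: "D:RD ==> topspace (rat_topology B T D) = carrier (CD D)" using top_CD by (simp add: topological_ring_def)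

lemma topspace_sect: "topspace (sect_top SH V) = SS V"
proof -
 have "SS V <= (\<Pi>\<^sub>E D\<in>DW V. topspace (rat_topology B T D))" using topspace_rat SS_D(1) by (auto simp: SS_iff DW_iff PiE_def Pi_def)
 thus ?thesis unfolding sect_simps by (auto simp: topspace_product_topology)
qed

lemma proj_cont: "D:DW V ==> continuous_map (sect_top SH V) (rat_topology B T D) (%s. s D)"
 unfolding sect_simps by (rule continuous_map_from_subtopology[OF continuous_map_product_projection])

lemma into_cont:
 assumes "!!D. D:DW V ==> continuous_map Y (rat_topology B T D) (%x. f x D)" and "!!x. x:topspace Y ==> f x:SS V"
 shows "continuous_map Y (sect_top SH V) f"
proof -
 have e: "f ` topspace Y <= extensional (DW V)" using assms(2) by (auto simp: SS_iff)
 show ?thesis unfolding sect_simps continuous_map_in_subtopology continuous_map_componentwise using assms e by auto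
qed

lemma sect_topological_ring: "topological_ring (sect SH V) (sect_top SH V)" unfolding topological_ring_def
proof (intro conjI SS_cring)
 note cl = SS_closed[where V = V]
 show "topspace (sect_top SH V) = carrier (sect SH V)" using topspace_sect by (simp add: sect_simps(1))
 have tr: "continuous_map (prod_topology (rat_topology B T D) (rat_topology B T D)) (rat_topology B T D) (%(x, y). x +[CD D] y)"
   "continuous_map (rat_topology B T D) (rat_topology B T D) (%x. -[CD D] x)"
   "continuous_map (prod_topology (rat_topology B T D) (rat_topology B T D)) (rat_topology B T D) (%(x, y). x *[CD D] y)"
  if "D:DW V" for D using top_CD that by (auto simp: topological_ring_def DW_iff)
 have pr: "continuous_map (prod_topology (sect_top SH V) (sect_top SH V)) (prod_topology (rat_topology B T D) (rat_topology B T D)) (%p. (fst p D, snd p D))"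
  if D: "D:DW V" for D by (rule continuous_map_pairedI)
   (use continuous_map_compose[OF continuous_map_fst proj_cont[OF D]] continuous_map_compose[OF continuous_map_snd proj_cont[OF D]] in \<open>auto simp: o_def\<close>)
 show "continuous_map (prod_topology (sect_top SH V) (sect_top SH V)) (sect_top SH V) (%(s, t). s +[sect SH V] t)"
 proof (rule into_cont)
  fix D assume D: "D:DW V"
  have "(%p. (case p of (s, t) => s +[sect SH V] t) D) = (%(x, y). x +[CD D] y) \<circ> (%p. (fst p D, snd p D))"
   using D by (auto simp: fun_eq_iff sect_simps)
  thus "continuous_map (prod_topology (sect_top SH V) (sect_top SH V)) (rat_topology B T D) (%p. (case p of (s, t) => s +[sect SH V] t) D)"
   using continuous_map_compose[OF pr[OF D] tr(1)[OF D]] by simp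
 next
  fix p assume "p:topspace (prod_topology (sect_top SH V) (sect_top SH V))"
  hence "fst p:SS V" "snd p:SS V" unfolding topspace_prod_topology topspace_sect by auto
  thus "(case p of (s, t) => s +[sect SH V] t):SS V" using cl(3)[of "fst p" "snd p"] by (simp add: case_prod_beta)
 qed
 show "continuous_map (prod_topology (sect_top SH V) (sect_top SH V)) (sect_top SH V) (%(s, t). s *[sect SH V] t)"
 proof (rule into_cont)
  fix D assume D: "D:DW V"
  have "(%p. (case p of (s, t) => s *[sect SH V] t) D) = (%(x, y). x *[CD D] y) \<circ> (%p. (fst p D, snd p D))"
   using D by (auto simp: fun_eq_iff sect_simps)
  thus "continuous_map (prod_topology (sect_top SH V) (sect_top SH V)) (rat_topology B T D) (%p. (case p of (s, t) => s *[sect SH V] t) D)"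
   using continuous_map_compose[OF pr[OF D] tr(3)[OF D]] by simp
 next
  fix p assume "p:topspace (prod_topology (sect_top SH V) (sect_top SH V))"
  hence "fst p:SS V" "snd p:SS V" unfolding topspace_prod_topology topspace_sect by auto
  thus "(case p of (s, t) => s *[sect SH V] t):SS V" using cl(4)[of "fst p" "snd p"] by (simp add: case_prod_beta)
 qed
 show "continuous_map (sect_top SH V) (sect_top SH V) (%s. -[sect SH V] s)"
 proof (rule continuous_map_eq[of _ _ "%s. \<lambda>D\<in>DW V. -[CD D] s D"])
  show "continuous_map (sect_top SH V) (sect_top SH V) (%s. \<lambda>D\<in>DW V. -[CD D] s D)"
  proof (rule into_cont)
   fix D assume D: "D:DW V"
   show "continuous_map (sect_top SH V) (rat_topology B T D) (%s. (\<lambda>D\<in>DW V. -[CD D] s D) D)"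
    using continuous_map_compose[OF proj_cont[OF D] tr(2)[OF D]] D by (simp add: o_def)
  qed (use cl(5) topspace_sect in auto)
 qed (use SS_neg topspace_sect in auto)
qed

lemma restr_SS: "W <= V ==> s:SS V ==> restr SH V W s:SS W" unfolding sect_simps by (rule SS_build) (use SS_D in \<open>auto simp: DW_iff\<close>)

lemma restr_hom: assumes "W <= V" shows "restr SH V W:ring_hom (sect SH V) (sect SH W)"
proof -
 have "DW W <= DW V" using DW_mono[OF assms] by blast
 thus ?thesis by (intro ring_hom_memI) (use restr_SS[OF assms] in \<open>auto simp: sect_simps fun_eq_iff restrict_def\<close>)
qed

lemma restr_comp: "Z <= W ==> restr SH W Z (restr SH V W s) = restr SH V Z s" by (auto simp: sect_simps fun_eq_iff restrict_def DW_iff)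

lemma restr_id: "s:SS V ==> restr SH V V s = s" by (simp add: sect_simps SS_iff extensional_restrict)

lemma restr_cont: assumes "W <= V" shows "continuous_map (sect_top SH V) (sect_top SH W) (restr SH V W)"
proof (rule into_cont)
 fix D assume D: "D:DW W"
 hence "D:DW V" using assms by (auto simp: DW_iff)
 thus "continuous_map (sect_top SH V) (rat_topology B T D) (%s. restr SH V W s D)" using proj_cont[of D V] D by (simp add: sect_simps)
qed (use restr_SS[OF assms] topspace_sect in auto)

lemma presheaf: "top_ring_presheaf TS SH" unfolding top_ring_presheaf_def sect_simps(1)
 using sect_topological_ring restr_id restr_hom restr_cont restr_comp by simp

text \<open>Over a rational subset the limit is just the localization at its own datum D, from which
  the values at all other data inside are restricted; \<open>SS_RS_eq\<close> is the
  uniqueness.\<close>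

lemma SS_RS:
 assumes D: "D:RD" and x: "x :[CD D]"
 shows "EX s:SS (RS D). s D = x"
proof -
 have a: "adm D E" if "E:DW (RS D)" for E using that D by (intro RS_adm) (auto simp: DW_iff)
 have "(\<lambda>E\<in>DW (RS D). rs D E x):SS (RS D)"
 proof (rule SS_build)
  show "rs D E x :[CD E]" if "E:DW (RS D)" for E using ring_hom_closed[OF ring_hom_cring.homh[OF rs_hom[OF a[OF that]]] x] .
  show "rs E G (rs D E x) = rs D G x" if "E:DW (RS D)" "adm E G" for E G by (rule rs_comp[OF a[OF that(1)] that(2) x])
 qed
 moreover have "D:DW (RS D)" using D by (simp add: DW_iff)
 ultimately show ?thesis using rs_id[OF D x] by (intro bexI[of _ "\<lambda>E\<in>DW (RS D). rs D E x"]) auto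
qed

lemma SS_RS_eq:
 assumes D: "D:RD" and s: "s:SS (RS D)" "t:SS (RS D)" and e: "s D = t D"
 shows "s = t"
proof (rule SS_eq[OF s])
 have DD: "D:DW (RS D)" using D by (simp add: DW_iff)
 fix E assume E: "E:DW (RS D)"
 thus "s E = t E" using SS_D(2)[OF s(1) DD, of E] SS_D(2)[OF s(2) DD, of E] e by (simp add: DW_iff)
qed

section \<open>The sheaf condition for a covering \<open>\<W>\<close> of V\<close>

context
 fixes V \<W> assumes V: "\<Union>\<W> = V" and op: "openin TS V" "ALL W:\<W>. openin TS W"
begin

definition sm :: "'a datum => bool" where "sm G \<longleftrightarrow> G:RD & (EX W:\<W>. RS G <= W)"

lemma sm_good: assumes D: "D:DW V" shows "good sm D"
proof (rule rational_compact)
 show "D:RD" using D by (simp add: DW_iff)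
 show "sm G'" if "G:RD" "G':RD" "refines G' G" "sm G" for G G' using refines_RS[OF RD_okd[OF that(2)] that(3)] that unfolding sm_def by blast
 fix p assume "p:RS D"
 then obtain W where W: "W:\<W>" "p:W" using D V by (auto simp: DW_iff)
 then obtain G where "G:RD" "p:RS G" "RS G <= W" using op(2) unfolding openin_TS by blast
 thus "EX G:RD. p:RS G & sm G" using W(1) unfolding sm_def by blast
qed

lemma sep:
 assumes s: "s:SS V" and t: "t:SS V" and eq: "!!W. W:\<W> ==> restr SH V W s = restr SH V W t"
 shows "s = t"
proof (rule SS_eq[OF s t])
 fix D assume D: "D:DW V"
 hence DR: "D:RD" by (simp add: DW_iff)
 show "s D = t D"
 proof (rule good_sep[OF sm_good[OF D] DR SS_D(1)[OF s D] SS_D(1)[OF t D]])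
  fix E assume E: "E:RD" "refines E D" "sm E"
  have sub: "RS E <= RS D" by (rule refines_RS[OF RD_okd[OF E(1)] E(2)])
  obtain W where W: "W:\<W>" "RS E <= W" using E(3) by (auto simp: sm_def)
  hence "E:DW W" using E(1) by (simp add: DW_iff)
  hence "s E = t E" using fun_cong[OF eq[OF W(1)], of E] by (simp add: sect_simps)
  thus "rs D E (s D) = rs D E (t D)" using SS_D(2)[OF s D E(1) sub] SS_D(2)[OF t D E(1) sub] by simp
 qed
qed

lemma glue:
 assumes u: "ALL W:\<W>. u W:SS W"
  and eq: "ALL W:\<W>. ALL W':\<W>. restr SH W (W Int W') (u W) = restr SH W' (W Int W') (u W')"
 shows "EX s:SS V. ALL W:\<W>. restr SH V W s = u W"
proof -
 define wi where "wi E = (SOME W. W:\<W> & RS E <= W)" for E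
 have wi: "wi E:\<W>" "RS E <= wi E" if "sm E" for E
 proof -
  have "EX W. W:\<W> & RS E <= W" using that by (auto simp: sm_def)
  from someI_ex[OF this] show "wi E:\<W>" "RS E <= wi E" unfolding wi_def by auto
 qed
 define ta where "ta E = u (wi E) E" for E
 have smR: "E:RD" if "sm E" for E using that by (simp add: sm_def)
 \<comment> \<open>The chosen member of the covering does not matter: E lies in the intersection
   with W, where the given sections agree.\<close>
 have ta: "ta E = u W E" if E: "sm E" and W: "W:\<W>" "RS E <= W" for E W
 proof -
  have "E:DW (wi E Int W)" using smR[OF E] wi(2)[OF E] W by (simp add: DW_iff)
  moreover have "restr SH (wi E) (wi E Int W) (u (wi E)) E = restr SH W (wi E Int W) (u W) E" using eq wi(1)[OF E] W(1) by simp
  ultimately show ?thesis by (simp add: ta_def sect_simps)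
 qed
 have wD: "E:DW (wi E)" if "sm E" for E using smR[OF that] wi(2)[OF that] by (simp add: DW_iff)
 have leaf: "G:RD & ta G :[CD G]" if "sm G" for G using smR[OF that] SS_D(1)[OF _ wD[OF that]] u wi(1)[OF that] by (simp add: ta_def)
 have sub: "sm E & rs G E (ta G) = ta E" if G: "sm G" and E: "E:RD" "RS E <= RS G" for G E
 proof -
  have sE: "sm E" using G E unfolding sm_def by blast
  have "rs G E (u (wi G) G) = u (wi G) E" by (rule SS_D(2)[OF _ wD[OF G] E]) (use u wi(1)[OF G] in blast)
  moreover have "ta E = u (wi G) E" by (rule ta[OF sE wi(1)[OF G]]) (use E wi(2)[OF G] in blast)
  ultimately show ?thesis using sE by (simp add: ta_def)
 qed
 have ex: "EX x. x :[CD D] & (ALL E. sm E --> RS E <= RS D --> rs D E x = ta E)" if D: "D:DW V" for D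
 proof -
  have DR: "D:RD" using D by (simp add: DW_iff)
  have "EX x:carrier (CD D). ALL E. sm E --> RS E <= RS D --> rs D E x = ta E"
   by (rule good_glue[where leaf = sm and ta = ta, OF sm_good[OF D] DR]) (erule leaf | erule (2) sub)+
  thus ?thesis unfolding Bex_def .
 qed
 define xx where "xx D = (SOME x. x :[CD D] & (ALL E. sm E --> RS E <= RS D --> rs D E x = ta E))" for D
 have xx: "xx D :[CD D]" "!!E. sm E ==> RS E <= RS D ==> rs D E (xx D) = ta E" if D: "D:DW V" for D
  using someI_ex[OF ex[OF D]] unfolding xx_def by auto
 have s: "(\<lambda>D\<in>DW V. xx D):SS V"
 proof (rule SS_build)
  fix D E assume D: "D:DW V" and E: "E:DW V" and a: "adm D E" and r: "RS E <= RS D"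
  have ER: "E:RD" using E by (simp add: DW_iff)
  interpret h: ring_hom_cring "CD D" "CD E" "rs D E" by (rule rs_hom[OF a])
  show "rs D E (xx D) = xx E"
  proof (rule good_sep[OF sm_good[OF E] ER _ xx(1)[OF E]])
   show "rs D E (xx D) :[CD E]" using xx(1)[OF D] by simp
   fix G assume G: "G:RD" "refines G E" "sm G"
   have rG: "RS G <= RS E" by (rule refines_RS[OF RD_okd[OF G(1)] G(2)])
   have "rs E G (rs D E (xx D)) = rs D G (xx D)" by (rule rs_comp[OF a refines_adm[OF ER G(1,2)] xx(1)[OF D]])
   also have "... = ta G" by (rule xx(2)[OF D G(3)]) (use rG r in blast)
   also have "... = rs E G (xx E)" using xx(2)[OF E G(3) rG] by simp
   finally show "rs E G (rs D E (xx D)) = rs E G (xx E)" .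
  qed
 qed (rule xx(1))
 have "restr SH V W (\<lambda>D\<in>DW V. xx D) = u W" if W: "W:\<W>" for W
 proof (rule SS_eq[OF restr_SS[OF _ s]])
  show WV: "W <= V" using W V by blast
  show "u W:SS W" using u W by blast
  fix D assume D: "D:DW W"
  hence DV: "D:DW V" and DR: "D:RD" using WV by (auto simp: DW_iff)
  have sD: "sm D" using D W by (auto simp: DW_iff sm_def)
  have "xx D = ta D" using xx(2)[OF DV sD] rs_id[OF DR xx(1)[OF DV]] by simp
  also have "ta D = u W D" by (rule ta[OF sD W]) (use D in \<open>simp add: DW_iff\<close>)
  finally show "restr SH V W (\<lambda>D\<in>DW V. xx D) D = u W D" using D DV by (simp add: sect_simps)
 qed
 thus ?thesis using s by blast
qed

text \<open>The main point is continuity of the inverse. Coordinate by coordinate,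
  \<open>good_bound\<close> bounds the value at D by the values at finitely many data K subordinate
  to the covering, each of them read off from one member.\<close>

lemma embed: "embedding_map (sect_top SH V) (product_topology (sect_top SH) \<W>) (%s. \<lambda>W\<in>\<W>. restr SH V W s)"
proof -
 let ?f = "%s. \<lambda>W\<in>\<W>. restr SH V W s"
 let ?Z = "product_topology (sect_top SH) \<W>"
 let ?Y = "subtopology ?Z (?f ` SS V)"
 have WV: "W <= V" if "W:\<W>" for W using V that by blast
 have cf: "continuous_map (sect_top SH V) ?Z ?f" unfolding continuous_map_componentwise using restr_cont[OF WV] by auto
 have inj: "inj_on ?f (SS V)"
 proof (rule inj_onI)
  fix s t assume st: "s:SS V" "t:SS V" and e: "?f s = ?f t"
  show "s = t"
  proof (rule sep[OF st])
   show "restr SH V W s = restr SH V W t" if "W:\<W>" for W using fun_cong[OF e, of W] that by simp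
  qed
 qed
 define g where "g = inv_into (SS V) ?f"
 have gf: "g (?f s) = s" if "s:SS V" for s unfolding g_def by (rule inv_into_f_f[OF inj that])
 have sub: "?f ` SS V <= topspace ?Z" using continuous_map_image_subset_topspace[OF cf] topspace_sect by simp
 have tY: "topspace ?Y = ?f ` SS V" using sub by auto
 have cg: "continuous_map ?Y (sect_top SH V) g"
 proof (rule into_cont)
  fix D assume D: "D:DW V"
  hence DR: "D:RD" by (simp add: DW_iff)
  interpret C: banach "CD D" "ND D" by (rule banach_CD[OF DR])
  obtain K where K: "finite K" "ALL E:K. E:RD & refines E D & sm E"
   "ALL e>0. EX d>0. ALL x:carrier (CD D). (ALL E:K. ND E (rs D E x) <= d) --> ND D x <= e" using good_bound[OF sm_good[OF D] DR] by (elim exE conjE)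
  show "continuous_map ?Y (rat_topology B T D) (%y. g y D)" unfolding ND_spec(3)[OF DR, symmetric] continuous_map_def
  proof (intro conjI allI impI)
   show "(%y. g y D):topspace ?Y \<rightarrow> topspace (norm_topology (CD D) (ND D))" unfolding tY C.topspace_norm using gf SS_D(1)[OF _ D] by auto
   fix O' assume O': "openin (norm_topology (CD D) (ND D)) O'"
   show "openin ?Y {y:topspace ?Y. g y D:O'}"
   proof (subst openin_subopen, intro ballI)
    fix y0 assume y0: "y0:{y:topspace ?Y. g y D:O'}"
    then obtain s0 where s0: "s0:SS V" "y0 = ?f s0" "s0 D:O'" unfolding tY using gf by auto
    obtain e where e: "e > 0" "ALL y:carrier (CD D). ND D (y -[CD D] s0 D) < e --> y:O'" using O' s0(3) unfolding C.openin_norm by blast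
    have e2: "e/2 > 0" using e(1) by simp
    obtain d where d: "d > 0" "ALL x:carrier (CD D). (ALL E:K. ND E (rs D E x) <= d) --> ND D x <= e/2" using K(3)[rule_format, OF e2] by (elim exE conjE)
    have "EX W. W:\<W> & RS E <= W" if "E:K" for E using K(2) that by (auto simp: sm_def)
    then obtain w where w: "!!E. E:K ==> w E:\<W> & RS E <= w E" by metis
    have wD: "E:DW (w E)" if "E:K" for E using w[OF that] K(2) that by (simp add: DW_iff)
    let ?ball = "%E. {z:carrier (CD E). ND E (z -[CD E] s0 E) < d}"
    let ?O = "%E. {y:topspace ?Y. y (w E) E:?ball E}"
    have oO: "openin ?Y (?O E)" if E: "E:K" for E
    proof (rule openin_continuous_map_preimage)
     have ER: "E:RD" using K(2) E by blast
     show "continuous_map ?Y (rat_topology B T E) (%y. y (w E) E)"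
      using continuous_map_compose[OF continuous_map_from_subtopology[OF continuous_map_product_projection[of "w E" \<W> "sect_top SH"]] proj_cont[OF wD[OF E]]] w[OF E]
      by (simp add: o_def)
     have ED: "E:DW V" using wD[OF E] w[OF E] WV by (auto simp: DW_iff)
     show "openin (rat_topology B T E) (?ball E)"
      unfolding ND_spec(3)[OF ER, symmetric] by (rule banach.open_ball[OF banach_CD[OF ER] SS_D(1)[OF s0(1) ED]])
    qed
    \<comment> \<open>The intersection with the whole space gives the right set when K is
      empty.\<close>
    let ?U = "(\<Inter>E\<in>K. ?O E) Int topspace ?Y"
    have "openin ?Y ?U" by (rule openin_INT[OF K(1) oO])
    moreover have val: "?f s (w E) E = s E" if "E:K" "s:SS V" for s E using w[OF that(1)] wD[OF that(1)] by (simp add: sect_simps)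
    have "y0:?U"
    proof -
     have "y0:?O E" if E: "E:K" for E
     proof -
      have ER: "E:RD" using K(2) E by blast
      interpret E: banach "CD E" "ND E" by (rule banach_CD[OF ER])
      have ED: "E:DW V" using wD[OF E] w[OF E] WV by (auto simp: DW_iff)
      have "s0 E :[CD E]" by (rule SS_D(1)[OF s0(1) ED])
      hence "s0 E:?ball E" using d(1) E.q_zero by (simp add: E.minus_eq E.r_neg)
      thus ?thesis using y0 val[OF E s0(1)] s0(2) by simp
     qed
     thus ?thesis using y0 by simp
    qed
    moreover have "?U <= {y:topspace ?Y. g y D:O'}"
    proof
     fix y assume y: "y:?U"
     hence "y:?f ` SS V" using tY by simp
     then obtain s where s: "s:SS V" "y = ?f s" by (elim imageE)
     note sc = SS_D(1)[OF s(1) D] and s0c = SS_D(1)[OF s0(1) D]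
     have "ND D (s D -[CD D] s0 D) <= e/2"
     proof (rule d(2)[rule_format])
      fix E assume E: "E:K"
      have ER: "E:RD" and rE: "refines E D" using K(2) E by auto
      interpret h: ring_hom_cring "CD D" "CD E" "rs D E" by (rule rs_hom[OF refines_adm[OF DR ER rE]])
      have sub: "RS E <= RS D" by (rule refines_RS[OF RD_okd[OF ER] rE])
      have "y:?O E" using y E by simp
      hence "ND E (s E -[CD E] s0 E) < d" using val[OF E s(1)] s(2) by simp
      thus "ND E (rs D E (s D -[CD D] s0 D)) <= d" unfolding h.hom_minus[OF sc s0c] SS_D(2)[OF s(1) D ER sub] SS_D(2)[OF s0(1) D ER sub] by simp
     qed (use sc s0c in simp)
     hence "s D:O'" using e sc by auto
     thus "y:{y:topspace ?Y. g y D:O'}" using s gf tY by auto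
    qed
    ultimately show "EX U. openin ?Y U & y0:U & U <= {y:topspace ?Y. g y D:O'}" by blast
   qed
  qed
 qed (use tY gf in auto)
 have "homeomorphic_maps (sect_top SH V) ?Y ?f g" unfolding homeomorphic_maps_def continuous_map_in_subtopology
  using cf cg gf tY topspace_sect by auto
 thus ?thesis unfolding embedding_map_def homeomorphic_map_maps topspace_sect by blast
qed

end

theorem structure_sheaf: "top_ring_sheaf TS SH" unfolding top_ring_sheaf_def sect_simps(1)
proof (intro conjI presheaf allI impI)
 fix V \<W> assume "openin TS V & (ALL W:\<W>. openin TS W) & \<Union>\<W> = V"
 hence VW: "\<Union>\<W> = V" "openin TS V" "ALL W:\<W>. openin TS W" by auto
 show "embedding_map (sect_top SH V) (product_topology (sect_top SH) \<W>) (%s. \<lambda>W\<in>\<W>. restr SH V W s)" by (rule embed[OF VW])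
 fix u assume "(ALL W:\<W>. u W:SS W) & (ALL W:\<W>. ALL W':\<W>. restr SH W (W Int W') (u W) = restr SH W' (W Int W') (u W'))"
 then obtain s where s: "s:SS V" "ALL W:\<W>. restr SH V W s = u W" using glue[OF VW, of u] by (elim conjE bexE) blast
 show "EX! s. s:SS V & (ALL W:\<W>. restr SH V W s = u W)" by (rule ex1I[of _ s]) (use s sep[OF VW] in auto)
qed

end

section \<open>Godement's resolution\<close>

locale rsheaf =
 fixes Y :: "'p topology" and F :: "('p, 's) ring_presheaf"
 assumes sh: "top_ring_sheaf Y F"
begin

lemma psh: "top_ring_presheaf Y F" using sh by (simp add: top_ring_sheaf_def)

lemma F_cring: "openin Y V ==> cring (sect F V)" using psh by (simp add: top_ring_presheaf_def topological_ring_def)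

lemma r_hom: "openin Y V ==> openin Y W ==> W <= V ==> ring_hom_cring (sect F V) (sect F W) (restr F V W)"
 using psh F_cring by (simp add: top_ring_presheaf_def ring_hom_cring_def ring_hom_cring_axioms_def)

lemma r_closed: "openin Y V ==> openin Y W ==> W <= V ==> s :[sect F V] ==> restr F V W s :[sect F W]"
 using ring_hom_closed[OF ring_hom_cring.homh[OF r_hom]] .

lemma r_comp: "openin Y V ==> openin Y W ==> openin Y Z ==> Z <= W ==> W <= V ==> s :[sect F V] ==>
  restr F W Z (restr F V W s) = restr F V Z s" using psh by (simp add: top_ring_presheaf_def)

lemma r_id: "openin Y V ==> s :[sect F V] ==> restr F V V s = s" using psh by (simp add: top_ring_presheaf_def)

lemma sheaf_glue:
 assumes "openin Y V" "ALL W:\<W>. openin Y W" "\<Union>\<W> = V" "ALL W:\<W>. t W :[sect F W]"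
  "ALL W:\<W>. ALL W':\<W>. restr F W (W Int W') (t W) = restr F W' (W Int W') (t W')"
 shows "EX! s. s :[sect F V] & (ALL W:\<W>. restr F V W s = t W)"
 by (rule sh[unfolded top_ring_sheaf_def, THEN conjunct2, THEN spec, THEN spec, THEN mp, THEN conjunct1, THEN spec, THEN mp])
  (use assms in auto)

abbreviation "ST \<equiv> stalk Y F"
abbreviation "gm \<equiv> germ Y F"

definition nb :: "'p => 'p set => 's => bool" where
 "nb x V s \<longleftrightarrow> openin Y V & x:V & s :[sect F V]"

lemma nb_restr: "nb x V s ==> openin Y Z ==> y:Z ==> Z <= V ==> nb y Z (restr F V Z s)" by (auto simp: nb_def intro: r_closed)

lemma germ_iff: "(W, u):gm x V s \<longleftrightarrow> nb x W u & (EX Z. openin Y Z & x:Z & Z <= V & Z <= W & restr F V Z s = restr F W Z u)"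
 by (auto simp: germ_def nb_def)

lemma germ_self: "nb x V s ==> (V, s):gm x V s" unfolding germ_iff by (auto simp: nb_def)

lemma germ_mono:
 assumes a: "nb x V s" and b: "nb x W u" and Z: "openin Y Z" "x:Z" "Z <= V" "Z <= W" and eq: "restr F V Z s = restr F W Z u"
 shows "gm x V s <= gm x W u"
proof (rule subrelI)
 fix Q v assume "(Q, v):gm x V s"
 then obtain Z' where q: "nb x Q v" and Z': "openin Y Z'" "x:Z'" "Z' <= V" "Z' <= Q" "restr F V Z' s = restr F Q Z' v" unfolding germ_iff by (elim exE conjE)
 let ?Z = "Z Int Z'"
 have o: "openin Y V" "openin Y W" "openin Y Q" "openin Y ?Z" using a b q Z Z' by (auto simp: nb_def)
 have c: "s :[sect F V]" "u :[sect F W]" "v :[sect F Q]" using a b q by (auto simp: nb_def)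
 have "restr F W ?Z u = restr F Z ?Z (restr F W Z u)" using r_comp[OF o(2) Z(1) o(4) _ Z(4) c(2)] by simp
 also have "... = restr F V ?Z s" unfolding eq[symmetric] using r_comp[OF o(1) Z(1) o(4) _ Z(3) c(1)] by simp
 also have "... = restr F Z' ?Z (restr F V Z' s)" using r_comp[OF o(1) Z'(1) o(4) _ Z'(3) c(1)] by simp
 also have "... = restr F Q ?Z v" unfolding Z'(5) using r_comp[OF o(3) Z'(1) o(4) _ Z'(4) c(3)] by simp
 finally show "(Q, v):gm x W u" unfolding germ_iff using q o(4) Z Z' by (intro conjI exI[of _ ?Z]) auto
qed

lemma germ_eqI:
 assumes "nb x V s" "nb x W u" "openin Y Z" "x:Z" "Z <= V" "Z <= W" "restr F V Z s = restr F W Z u"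
 shows "gm x V s = gm x W u" using germ_mono[OF assms] germ_mono[OF assms(2,1,3,4,6,5) assms(7)[symmetric]] by blast

lemma germ_eqD: "gm x V s = gm x W u ==> nb x W u ==> EX Z. openin Y Z & x:Z & Z <= V & Z <= W & restr F V Z s = restr F W Z u"
 using germ_self[of x W u] germ_iff[of W u x V s] by simp

lemma germ_restr: "nb x V s ==> openin Y Z ==> x:Z ==> Z <= V ==> gm x Z (restr F V Z s) = gm x V s"
 by (rule germ_eqI[of x Z _ V s Z]) (auto intro: nb_restr simp: r_id r_closed nb_def)

lemma stalk_carr: "A :[ST x] \<longleftrightarrow> (EX V s. nb x V s & A = gm x V s)" by (auto simp: stalk_def nb_def)

lemma stalk_rep2:
 assumes A: "nb x V s" and B: "B :[ST x]"
 shows "EX Z t. Z <= V & openin Y Z & x:Z & nb x Z t & gm x V s = gm x Z (restr F V Z s) & B = gm x Z t"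
proof -
 obtain W t where t: "nb x W t" "B = gm x W t" using B unfolding stalk_carr by (elim exE conjE)
 have Z: "openin Y (V Int W)" "x:V Int W" using A t by (auto simp: nb_def)
 show ?thesis using nb_restr[OF t(1) Z(1) Z(2)] germ_restr[OF A Z(1) Z(2)] germ_restr[OF t(1) Z(1) Z(2)] t(2) Z
  by (intro exI[of _ "V Int W"] exI[of _ "restr F W (V Int W) t"]) simp
qed

lemma germ_add:
 assumes s: "nb x V s" and t: "nb x V t"
 shows "gm x V s +[ST x] gm x V t = gm x V (s +[sect F V] t)"
proof -
 have V: "openin Y V" "x:V" and sc: "s :[sect F V]" "t :[sect F V]" using s t by (auto simp: nb_def)
 have "gm x V s +[ST x] gm x V t = germ_op Y F x ring.add (gm x V s) (gm x V t)" by (simp add: stalk_def)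
 also have "... = gm x V (s +[sect F V] t)"
 proof (intro equalityI subrelI)
  fix W u assume "(W, u):germ_op Y F x ring.add (gm x V s) (gm x V t)"
  then obtain V1 s1 V2 t1 Z where W: "openin Y W" "x:W" "u :[sect F W]" and 1: "(V1, s1):gm x V s" and 2: "(V2, t1):gm x V t"
   and Z: "openin Y Z" "x:Z" "Z <= V1 Int V2 Int W" "restr F W Z u = restr F V1 Z s1 +[sect F Z] restr F V2 Z t1" unfolding germ_op_def by blast
  obtain Z1 where n1: "nb x V1 s1" and Z1: "openin Y Z1" "x:Z1" "Z1 <= V" "Z1 <= V1" "restr F V Z1 s = restr F V1 Z1 s1" using 1 unfolding germ_iff by (elim exE conjE)
  obtain Z2 where n2: "nb x V2 t1" and Z2: "openin Y Z2" "x:Z2" "Z2 <= V" "Z2 <= V2" "restr F V Z2 t = restr F V2 Z2 t1" using 2 unfolding germ_iff by (elim exE conjE)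
  let ?Q = "Z Int Z1 Int Z2"
  have Q: "openin Y ?Q" "x:?Q" "?Q <= V" "?Q <= W" using Z Z1 Z2 by auto
  have oc: "openin Y V1" "openin Y V2" "s1 :[sect F V1]" "t1 :[sect F V2]" using n1 n2 by (auto simp: nb_def)
  have sub: "Z <= V1" "Z <= V2" "Z <= W" "?Q <= Z" "?Q <= Z1" "?Q <= Z2" using Z(3) by auto
  interpret h: ring_hom_cring "sect F Z" "sect F ?Q" "restr F Z ?Q" by (rule r_hom[OF Z(1) Q(1) sub(4)])
  interpret g: ring_hom_cring "sect F V" "sect F ?Q" "restr F V ?Q" by (rule r_hom[OF V(1) Q(1,3)])
  have e1: "restr F Z ?Q (restr F V1 Z s1) = restr F V ?Q s"
   using r_comp[OF oc(1) Z(1) Q(1) sub(4,1) oc(3)] r_comp[OF oc(1) Z1(1) Q(1) sub(5) Z1(4) oc(3)] r_comp[OF V(1) Z1(1) Q(1) sub(5) Z1(3) sc(1)] Z1(5) by simp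
  have e2: "restr F Z ?Q (restr F V2 Z t1) = restr F V ?Q t"
   using r_comp[OF oc(2) Z(1) Q(1) sub(4,2) oc(4)] r_comp[OF oc(2) Z2(1) Q(1) sub(6) Z2(4) oc(4)] r_comp[OF V(1) Z2(1) Q(1) sub(6) Z2(3) sc(2)] Z2(5) by simp
  have "restr F W ?Q u = restr F Z ?Q (restr F W Z u)" using r_comp[OF W(1) Z(1) Q(1) sub(4,3) W(3)] by simp
  also have "... = restr F V ?Q (s +[sect F V] t)"
   unfolding Z(4) using e1 e2 sc r_closed[OF oc(1) Z(1) sub(1) oc(3)] r_closed[OF oc(2) Z(1) sub(2) oc(4)] by simp
  finally show "(W, u):gm x V (s +[sect F V] t)" unfolding germ_iff using W Q by (auto simp: nb_def)
 next
  fix W u assume "(W, u):gm x V (s +[sect F V] t)"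
  then obtain Z where n: "nb x W u" and Z: "openin Y Z" "x:Z" "Z <= V" "Z <= W" "restr F V Z (s +[sect F V] t) = restr F W Z u" unfolding germ_iff by (elim exE conjE)
  interpret h: ring_hom_cring "sect F V" "sect F Z" "restr F V Z" by (rule r_hom[OF V(1) Z(1,3)])
  have e: "EX Z. openin Y Z & x:Z & Z <= V Int V Int W & restr F W Z u = restr F V Z s +[sect F Z] restr F V Z t"
   using Z sc by (intro exI[of _ Z]) simp
  have "EX (V1, s1):gm x V s. EX (V2, t1):gm x V t. EX Z. openin Y Z & x:Z & Z <= V1 Int V2 Int W &
    restr F W Z u = restr F V1 Z s1 +[sect F Z] restr F V2 Z t1"
   by (rule bexI[OF _ germ_self[OF s]], unfold prod.case, rule bexI[OF _ germ_self[OF t]], unfold prod.case) (rule e)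
  thus "(W, u):germ_op Y F x ring.add (gm x V s) (gm x V t)" unfolding germ_op_def using n by (simp add: nb_def)
 qed
 finally show ?thesis .
qed

lemma nb_ops: assumes "nb x V s" "nb x V t"
 shows "nb x V (s +[sect F V] t)" "nb x V \<zero>[sect F V]" "nb x V (-[sect F V] s)"
proof -
 interpret c: cring "sect F V" using F_cring assms by (simp add: nb_def)
 show "nb x V (s +[sect F V] t)" "nb x V \<zero>[sect F V]" "nb x V (-[sect F V] s)" using assms by (auto simp: nb_def)
qed

lemma germ_zero: assumes "openin Y V" "x:V" shows "gm x V \<zero>[sect F V] = \<zero>[ST x]"
proof -
 have T: "openin Y (topspace Y)" "V <= topspace Y" using openin_subset[OF assms(1)] by auto
 interpret c: cring "sect F V" by (rule F_cring[OF assms(1)])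
 interpret T: cring "sect F (topspace Y)" by (rule F_cring[OF T(1)])
 interpret h: ring_hom_cring "sect F (topspace Y)" "sect F V" "restr F (topspace Y) V" by (rule r_hom[OF T(1) assms(1) T(2)])
 have n: "nb x (topspace Y) \<zero>[sect F (topspace Y)]" using assms T by (auto simp: nb_def)
 show ?thesis using germ_restr[OF n assms T(2)] by (simp add: stalk_def)
qed

lemma stalk_group: assumes x: "x:topspace Y" shows "abelian_group (ST x)"
proof (rule abelian_groupI)
 show z: "\<zero>[ST x] :[ST x]"
 proof -
  interpret T: cring "sect F (topspace Y)" by (rule F_cring) simp
  show ?thesis unfolding stalk_carr using x germ_zero[of "topspace Y" x] by (intro exI[of _ "topspace Y"] exI[of _ "\<zero>[sect F (topspace Y)]"]) (simp add: nb_def)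
 qed
 fix A B C assume A: "A :[ST x]" and B: "B :[ST x]" and C: "C :[ST x]"
 obtain V s where s: "nb x V s" "A = gm x V s" using A unfolding stalk_carr by (elim exE conjE)
 obtain W t where W: "W <= V" "openin Y W" "x:W" and t: "nb x W t" "A = gm x W (restr F V W s)" "B = gm x W t" using stalk_rep2[OF s(1) B] s(2) by (elim exE conjE) simp
 obtain Z u where Z: "Z <= W" "openin Y Z" "x:Z" and u: "nb x Z u" "B = gm x Z (restr F W Z t)" "C = gm x Z u" using stalk_rep2[OF t(1) C] t(3) by (elim exE conjE) simp
 define a where "a = restr F V Z s"
 define b where "b = restr F W Z t"
 have a: "nb x Z a" "A = gm x Z a" unfolding a_def using nb_restr[OF s(1) Z(2,3)] germ_restr[OF s(1) Z(2,3)] s(2) W(1) Z(1) by auto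
 have b: "nb x Z b" "B = gm x Z b" unfolding b_def using nb_restr[OF t(1) Z(2,3,1)] u(2) by auto
 interpret c: cring "sect F Z" by (rule F_cring[OF Z(2)])
 have c: "a :[sect F Z]" "b :[sect F Z]" "u :[sect F Z]" using a b u by (auto simp: nb_def)
 note n = nb_ops[OF a(1) b(1)] nb_ops[OF b(1) u(1)] nb_ops[OF a(1) a(1)]
 show "A +[ST x] B :[ST x]" unfolding a(2) b(2) germ_add[OF a(1) b(1)] stalk_carr using n(1) by blast
 show "A +[ST x] B = B +[ST x] A" unfolding a(2) b(2) germ_add[OF a(1) b(1)] germ_add[OF b(1) a(1)] using c by (simp add: c.a_comm)
 show "A +[ST x] B +[ST x] C = A +[ST x] (B +[ST x] C)"
  unfolding a(2) b(2) u(3) germ_add[OF a(1) b(1)] germ_add[OF b(1) u(1)] germ_add[OF n(1) u(1)] germ_add[OF a(1) n(4)] using c by (simp add: c.a_assoc)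
 show "\<zero>[ST x] +[ST x] A = A" unfolding a(2) germ_zero[OF Z(2,3), symmetric] germ_add[OF n(2) a(1)] using c by simp
 show "EX y:carrier (ST x). y +[ST x] A = \<zero>[ST x]"
 proof (rule bexI)
  show "gm x Z (-[sect F Z] a) +[ST x] A = \<zero>[ST x]" unfolding a(2) germ_add[OF n(3) a(1)] using germ_zero[OF Z(2,3)] c by (simp add: c.l_neg)
  show "gm x Z (-[sect F Z] a) :[ST x]" unfolding stalk_carr using n(3) by blast
 qed
qed

lemma germ_carr: "nb x V s ==> gm x V s :[ST x]" unfolding stalk_carr by blast

lemma nb_top: "nb x V s ==> x:topspace Y" using openin_subset by (auto simp: nb_def)

lemma germ_minus:
 assumes s: "nb x V s" and t: "nb x V t"
 shows "gm x V s -[ST x] gm x V t = gm x V (s -[sect F V] t)"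
proof -
 interpret S: abelian_group "ST x" by (rule stalk_group[OF nb_top[OF s]])
 interpret c: cring "sect F V" using s F_cring by (simp add: nb_def)
 note n = nb_ops(3)[OF t t]
 have c: "s :[sect F V]" "t :[sect F V]" and V: "openin Y V" "x:V" using s t by (auto simp: nb_def)
 have "gm x V (-[sect F V] t) +[ST x] gm x V t = \<zero>[ST x]" unfolding germ_add[OF n t] using germ_zero[OF V] c by (simp add: c.l_neg)
 hence "-[ST x] gm x V t = gm x V (-[sect F V] t)" by (rule S.minus_equality) (use germ_carr n t in auto)
 thus ?thesis unfolding S.minus_eq c.minus_eq using germ_add[OF s n] by simp
qed

text \<open>Any two representatives of a germ agree near x, so the choice made in
  \<open>spread\<close> is invisible on a neighbourhood.\<close>

lemma spread_near:
 assumes s: "nb x V s"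
 shows "EX Z. openin Y Z & x:Z & Z <= V & (ALL y:Z. spread Y F (gm x V s) y = gm y V s)"
proof -
 obtain W u where p: "(SOME p. p:gm x V s) = (W, u)" by (cases "SOME p. p:gm x V s") auto
 have "(SOME p. p:gm x V s):gm x V s" by (rule someI[where P = "%p. p:gm x V s", OF germ_self[OF s]])
 then obtain Z where n: "nb x W u" and Z: "openin Y Z" "x:Z" "Z <= V" "Z <= W" "restr F V Z s = restr F W Z u" unfolding p germ_iff by (elim exE conjE)
 have "spread Y F (gm x V s) y = gm y V s" if y: "y:Z" for y
 proof -
  have "y:W" using y Z by blast
  hence "spread Y F (gm x V s) y = gm y W u" by (simp add: spread_def p)
  also have "... = gm y V s" by (rule germ_eqI[OF _ _ Z(1) y Z(4,3) Z(5)[symmetric]]) (use n s y Z in \<open>auto simp: nb_def\<close>)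
  finally show ?thesis .
 qed
 thus ?thesis using Z by blast
qed

lemma spread_closed: assumes A: "A :[ST x]" and y: "y:topspace Y" shows "spread Y F A y :[ST y]"
proof -
 obtain V s where s: "nb x V s" "A = gm x V s" using A unfolding stalk_carr by (elim exE conjE)
 obtain W u where p: "(SOME p. p:A) = (W, u)" by (cases "SOME p. p:A") auto
 have "(SOME p. p:A):A" unfolding s(2) by (rule someI[where P = "%p. p:gm x V s", OF germ_self[OF s(1)]])
 hence "(W, u):A" unfolding p .
 hence n: "nb x W u" unfolding s(2) germ_iff by blast
 interpret S: abelian_group "ST y" by (rule stalk_group[OF y])
 show ?thesis
 proof (cases "y:W")
  case True
  hence "nb y W u" using n by (simp add: nb_def)
  thus ?thesis using True germ_carr by (simp add: spread_def p)
 next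
  case False
  thus ?thesis by (simp add: spread_def p)
 qed
qed

text \<open>The sets on which s and t have equal restrictions cover V, and both s and t glue the
  restrictions of s to these sets.\<close>

lemma germs_eq:
 assumes V: "openin Y V" and s: "s :[sect F V]" "t :[sect F V]" and e: "!!y. y:V ==> gm y V s = gm y V t"
 shows "s = t"
proof -
 let ?W = "{Z. openin Y Z & Z <= V & restr F V Z s = restr F V Z t}"
 have "y:\<Union>?W" if y: "y:V" for y
 proof -
  have n: "nb y V t" using V s y by (simp add: nb_def)
  show ?thesis using germ_eqD[OF e[OF y] n] by blast
 qed
 hence c: "\<Union>?W = V" by blast
 have "EX! u. u :[sect F V] & (ALL W:?W. restr F V W u = restr F V W s)"
 proof (rule sheaf_glue[OF V _ c])
  show "ALL W:?W. restr F V W s :[sect F W]" using r_closed[OF V _ _ s(1)] by blast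
  show "ALL W:?W. ALL W':?W. restr F W (W Int W') (restr F V W s) = restr F W' (W Int W') (restr F V W' s)"
  proof (intro ballI)
   fix W W' assume "W:?W" "W':?W"
   hence o: "openin Y W" "openin Y W'" "W <= V" "W' <= V" by auto
   show "restr F W (W Int W') (restr F V W s) = restr F W' (W Int W') (restr F V W' s)"
    using r_comp[OF V o(1) openin_Int[OF o(1,2)] _ o(3) s(1)] r_comp[OF V o(2) openin_Int[OF o(1,2)] _ o(4) s(1)] by simp
  qed
 qed blast
 thus ?thesis using s by (elim ex1E) (simp, metis (no_types, lifting))
qed


section \<open>Cochains and the differential\<close>

lemma ch_0: "xs:chains Y 0 \<longleftrightarrow> (EX x:topspace Y. xs = [x])" by (cases xs) (auto simp: chains_def)

lemma ch_Cons: "x # ys:chains Y (Suc n) \<longleftrightarrow> x:topspace Y & ys:chains Y n" by (auto simp: chains_def)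

lemma ch_ne: "xs:chains Y n ==> xs ~= []" by (auto simp: chains_def)

lemma ch_last: "xs:chains Y n ==> last xs:topspace Y" using ch_ne[of xs n] last_in_set[of xs] by (auto simp: chains_def)

lemma last_Cons_ch: "ys:chains Y n ==> last (x # ys) = last ys" using ch_ne by simp

text \<open>Extensionality is dropped from \<open>cochains\<close> so that fixing the first point,
  \<open>%zs. f (x # zs)\<close>, again gives a cochain.\<close>

definition coch :: "nat => ('p list => ('p set \<times> 's) set) => bool" where
 "coch n f \<longleftrightarrow> (ALL xs:chains Y n. f xs :[ST (last xs)])"

abbreviation "dd \<equiv> differential Y F"
abbreviation "LO \<equiv> locally_on Y"
abbreviation "LE n U f g \<equiv> LO n U (%xs. f xs = g xs)"
abbreviation "LZ n U f \<equiv> LO n U (%xs. f xs = \<zero>[ST (last xs)])"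

lemma stalk_last: "xs:chains Y n ==> abelian_group (ST (last xs))" by (rule stalk_group[OF ch_last])

lemma ch_omit:
 assumes "xs:chains Y (Suc n)" "i <= n"
 shows "take i xs @ drop (Suc i) xs:chains Y n" "last (take i xs @ drop (Suc i) xs) = last xs"
proof -
 have l: "length xs = Suc (Suc n)" "set xs <= topspace Y" using assms by (auto simp: chains_def)
 have "drop (Suc i) xs ~= []" using l assms(2) by simp
 thus "last (take i xs @ drop (Suc i) xs) = last xs" by (simp add: last_drop)
 show "take i xs @ drop (Suc i) xs:chains Y n" using l assms(2) set_take_subset[of i xs] set_drop_subset[of "Suc i" xs] by (auto simp: chains_def)
qed

lemma ch_butlast: "xs:chains Y (Suc n) ==> butlast xs:chains Y n" by (auto simp: chains_def dest: in_set_butlastD)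

lemma coface_closed:
 assumes f: "coch n f" and xs: "xs:chains Y (Suc n)"
 shows "coface Y F n i f xs :[ST (last xs)]"
proof (cases "i <= n")
 case True
 thus ?thesis using f ch_omit[OF xs True] unfolding coch_def coface_def by force
next
 case False
 have "f (butlast xs) :[ST (last (butlast xs))]" using f ch_butlast[OF xs] unfolding coch_def by blast
 thus ?thesis using False spread_closed[OF _ ch_last[OF xs]] by (simp add: coface_def)
qed

definition tm :: "nat => ('p list => ('p set \<times> 's) set) => 'p list => nat => ('p set \<times> 's) set" where
 "tm n f xs i = (if even i then coface Y F n i f xs else -[ST (last xs)] coface Y F n i f xs)"

lemma dd_tm: "xs:chains Y (Suc n) ==> dd n f xs = (\<Oplus>\<^bsub>ST (last xs)\<^esub>i\<in>{..Suc n}. tm n f xs i)"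
 by (simp add: differential_def tm_def)

lemma tm_closed:
 assumes f: "coch n f" and xs: "xs:chains Y (Suc n)"
 shows "tm n f xs i :[ST (last xs)]"
proof -
 interpret S: abelian_group "ST (last xs)" by (rule stalk_last[OF xs])
 show ?thesis using coface_closed[OF f xs] by (simp add: tm_def)
qed

lemma dd_closed: assumes f: "coch n f" shows "coch (Suc n) (dd n f)" unfolding coch_def
proof
 fix xs assume xs: "xs:chains Y (Suc n)"
 interpret S: abelian_group "ST (last xs)" by (rule stalk_last[OF xs])
 show "dd n f xs :[ST (last xs)]" unfolding dd_tm[OF xs] by (rule S.finsum_closed) (use tm_closed[OF f xs] in auto)
qed

lemma dd_ext:
 assumes e: "!!xs. xs:chains Y n ==> f xs = g xs" and xs: "xs:chains Y (Suc n)"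
 shows "dd n f xs = dd n g xs"
proof -
 have cf: "coface Y F n i f xs = coface Y F n i g xs" for i using e[OF ch_omit(1)[OF xs]] e[OF ch_butlast[OF xs]] by (simp add: coface_def)
 show ?thesis unfolding dd_tm[OF xs] tm_def cf ..
qed

lemma dd_0:
 assumes f: "coch 0 f" and x: "x:topspace Y" and y: "y:topspace Y"
 shows "dd 0 f [x, y] = f [y] -[ST y] spread Y F (f [x]) y"
proof -
 have xs: "[x, y]:chains Y (Suc 0)" using x y by (simp add: chains_def)
 interpret S: abelian_group "ST y" by (rule stalk_group[OF y])
 have c: "tm 0 f [x, y] i :[ST y]" for i using tm_closed[OF f xs] by simp
 have "dd 0 f [x, y] = (\<Oplus>\<^bsub>ST y\<^esub>i\<in>{..Suc 0}. tm 0 f [x, y] i)" unfolding dd_tm[OF xs] by simp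
 also have "... = tm 0 f [x, y] 1 +[ST y] tm 0 f [x, y] 0" using c by (simp add: atMost_Suc)
 also have "... = f [y] -[ST y] spread Y F (f [x]) y"
  using c[of 0] c[of 1] coface_closed[OF f xs, of 0] coface_closed[OF f xs, of 1] by (simp add: tm_def coface_def S.minus_eq S.a_comm)
 finally show ?thesis .
qed

text \<open>Fixing the first point of a chain, the differential becomes the identity minus the
 differential in the remaining points. All further properties follow from this recursion.\<close>

lemma dd_Suc:
 assumes f: "coch (Suc n) f" and x: "x:topspace Y" and ys: "ys:chains Y (Suc n)"
 shows "dd (Suc n) f (x # ys) = f ys -[ST (last ys)] dd n (%zs. f (x # zs)) ys"
  and "coch n (%zs. f (x # zs))"
proof -
 show fx: "coch n (%zs. f (x # zs))" unfolding coch_def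
 proof
  fix zs assume z: "zs:chains Y n"
  hence "x # zs:chains Y (Suc n)" using x by (simp add: ch_Cons)
  thus "f (x # zs) :[ST (last zs)]" using f last_Cons_ch[OF z] unfolding coch_def by force
 qed
 have xy: "x # ys:chains Y (Suc (Suc n))" using x ys by (simp add: ch_Cons)
 have ne: "ys ~= []" by (rule ch_ne[OF ys])
 interpret S: abelian_group "ST (last ys)" by (rule stalk_last[OF ys])
 have cf: "coface Y F (Suc n) (Suc i) f (x # ys) = coface Y F n i (%zs. f (x # zs)) ys" for i using ne by (simp add: coface_def)
 have c0: "coface Y F (Suc n) 0 f (x # ys) = f ys" by (simp add: coface_def)
 have c: "tm (Suc n) f (x # ys) i :[ST (last ys)]" for i using tm_closed[OF f xy] ne by simp
 let ?t = "tm n (%zs. f (x # zs)) ys"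
 have t: "?t i :[ST (last ys)]" for i by (rule tm_closed[OF fx ys])
 have fy: "f ys :[ST (last ys)]" using f ys unfolding coch_def by blast
 have st: "tm (Suc n) f (x # ys) (Suc i) = -[ST (last ys)] ?t i" for i using ne cf[of i] coface_closed[OF fx ys] by (simp add: tm_def)
 have t0: "tm (Suc n) f (x # ys) 0 = f ys" by (simp add: tm_def c0)
 have fc: "(\<Oplus>\<^bsub>ST (last ys)\<^esub>i\<in>{..Suc n}. ?t i) :[ST (last ys)]" by (rule S.finsum_closed) (use t in auto)
 have "dd (Suc n) f (x # ys) = (\<Oplus>\<^bsub>ST (last ys)\<^esub>i\<in>{..Suc (Suc n)}. tm (Suc n) f (x # ys) i)" unfolding dd_tm[OF xy] using ne by simp
 also have "... = (\<Oplus>\<^bsub>ST (last ys)\<^esub>i\<in>{..Suc n}. tm (Suc n) f (x # ys) (Suc i)) +[ST (last ys)] tm (Suc n) f (x # ys) 0"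
  by (rule S.finsum_Suc2) (use c in auto)
 also have "... = (\<Oplus>\<^bsub>ST (last ys)\<^esub>i\<in>{..Suc n}. -[ST (last ys)] ?t i) +[ST (last ys)] f ys" unfolding st t0 ..
 also have "(\<Oplus>\<^bsub>ST (last ys)\<^esub>i\<in>{..Suc n}. -[ST (last ys)] ?t i) = -[ST (last ys)] (\<Oplus>\<^bsub>ST (last ys)\<^esub>i\<in>{..Suc n}. ?t i)"
 proof -
  have "(\<Oplus>\<^bsub>ST (last ys)\<^esub>i\<in>{..Suc n}. -[ST (last ys)] ?t i) +[ST (last ys)] (\<Oplus>\<^bsub>ST (last ys)\<^esub>i\<in>{..Suc n}. ?t i) =
    (\<Oplus>\<^bsub>ST (last ys)\<^esub>i\<in>{..Suc n}. -[ST (last ys)] ?t i +[ST (last ys)] ?t i)"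
   by (rule S.finsum_addf[symmetric]) (use t in auto)
  also have "... = \<zero>[ST (last ys)]" using t by (simp add: S.l_neg)
  finally have "-[ST (last ys)] (\<Oplus>\<^bsub>ST (last ys)\<^esub>i\<in>{..Suc n}. ?t i) = (\<Oplus>\<^bsub>ST (last ys)\<^esub>i\<in>{..Suc n}. -[ST (last ys)] ?t i)"
   by (rule S.minus_equality) (use t in \<open>auto intro!: S.finsum_closed\<close>)
  thus ?thesis by simp
 qed
 finally show "dd (Suc n) f (x # ys) = f ys -[ST (last ys)] dd n (%zs. f (x # zs)) ys"
  unfolding dd_tm[OF ys] using fy fc by (simp add: S.minus_eq S.a_comm)
qed

lemma LO_imp:
 assumes "LO n U P" "U <= topspace Y" "!!xs. xs:chains Y n ==> hd xs:U ==> P xs ==> Q xs"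
 shows "LO n U Q" using assms
proof (induction n arbitrary: U P Q)
 case 0
 have "Q [x]" if x: "x:U" for x by (rule "0.prems"(3)) (use "0.prems"(1,2) x in \<open>auto simp: chains_def\<close>)
 thus ?case by simp
next
 case (Suc n)
 have "EX V. openin Y V & x:V & LO n V (%xs. Q (x # xs))" if x: "x:U" for x
 proof -
  obtain V where V: "openin Y V" "x:V" "LO n V (%xs. P (x # xs))" using Suc.prems(1) x by auto
  have "LO n V (%xs. Q (x # xs))"
  proof (rule Suc.IH[OF V(3) openin_subset[OF V(1)]])
   fix xs assume "xs:chains Y n" "P (x # xs)"
   thus "Q (x # xs)" using Suc.prems(2) Suc.prems(3)[of "x # xs"] x by (auto simp: ch_Cons)
  qed
  thus ?thesis using V by blast
 qed
 thus ?case by simp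
qed

lemma LO_all: "U <= topspace Y ==> (!!xs. xs:chains Y n ==> hd xs:U ==> P xs) ==> LO n U P"
proof (induction n arbitrary: U P)
 case 0
 have "P [x]" if "x:U" for x by (rule "0.prems"(2)) (use "0.prems"(1) that in \<open>auto simp: chains_def\<close>)
 thus ?case by simp
next
 case (Suc n)
 have "LO n (topspace Y) (%xs. P (x # xs))" if x: "x:U" for x by (rule Suc.IH) (use Suc.prems x in \<open>auto simp: ch_Cons\<close>)
 thus ?case using Suc.prems(1) by (auto intro!: exI[of _ "topspace Y"])
qed

lemma LO_subset: "LO n U P ==> W <= U ==> LO n W P" by (cases n) auto
lemma LO_Un: "LO n U P ==> LO n W P ==> LO n (U Un W) P" by (cases n) auto

lemma LO_conj: "LO n U P ==> LO n U Q ==> LO n U (%xs. P xs & Q xs)"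
proof (induction n arbitrary: U P Q)
 case (Suc n)
 have "EX V. openin Y V & x:V & LO n V (%xs. P (x # xs) & Q (x # xs))" if x: "x:U" for x
 proof -
  obtain V where V: "openin Y V" "x:V" "LO n V (%xs. P (x # xs))" using Suc.prems(1) x by auto
  obtain W where W: "openin Y W" "x:W" "LO n W (%xs. Q (x # xs))" using Suc.prems(2) x by auto
  have "LO n (V Int W) (%xs. P (x # xs) & Q (x # xs))" by (rule Suc.IH) (rule LO_subset[OF V(3)], simp, rule LO_subset[OF W(3)], simp)
  thus ?thesis using V W by (intro exI[of _ "V Int W"]) auto
 qed
 thus ?case by simp
qed auto

lemma LO_SucI:
 "(!!x. x:U ==> EX V. openin Y V & x:V & LO n V (%ys. P (x # ys))) ==> LO (Suc n) U P" by simp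

definition sb :: "('p list => ('p set \<times> 's) set) => ('p list => ('p set \<times> 's) set) => 'p list => ('p set \<times> 's) set" where
 "sb f g xs = f xs -[ST (last xs)] g xs"

lemma sb_closed: "coch n f ==> coch n g ==> coch n (sb f g)" unfolding coch_def sb_def using stalk_last by (auto intro: abelian_group.minus_closed)

text \<open>This makes the differential well defined on sections of Godement's sheaves, which are
  functions up to local agreement.\<close>

lemma dd_cong_LO:
 assumes "openin Y U" "coch n f" "coch n g" "LE n U f g"
 shows "LE (Suc n) U (dd n f) (dd n g)" using assms
proof (induction n arbitrary: U f g)
 case 0
 have UT: "U <= topspace Y" by (rule openin_subset[OF "0.prems"(1)])
 show ?case
 proof (rule LO_SucI)
  fix x assume x: "x:U"
  have "LO 0 U (%ys. dd 0 f (x # ys) = dd 0 g (x # ys))" using "0.prems"(4) dd_0[OF "0.prems"(2)] dd_0[OF "0.prems"(3)] UT x by (auto simp: subset_eq)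
  thus "EX V. openin Y V & x:V & LO 0 V (%ys. dd 0 f (x # ys) = dd 0 g (x # ys))" using "0.prems"(1) x by blast
 qed
next
 case (Suc n)
 note U = Suc.prems(1) and f = Suc.prems(2) and g = Suc.prems(3)
 show ?case
 proof (rule LO_SucI)
  fix x assume x: "x:U"
  hence xT: "x:topspace Y" using openin_subset[OF U] by blast
  obtain V where V: "openin Y V" "x:V" "LO n V (%ys. f (x # ys) = g (x # ys))" using Suc.prems(4) x by auto
  let ?W = "U Int V"
  have W: "openin Y ?W" "x:?W" using U V x by auto
  note cf = dd_Suc(2)[OF f xT] and cg = dd_Suc(2)[OF g xT]
  have ne: "EX ys. ys:chains Y (Suc n)" using xT by (intro exI[of _ "replicate (Suc (Suc n)) x"]) (auto simp: chains_def)
  then obtain y0 where y0: "y0:chains Y (Suc n)" by (elim exE)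
  have 1: "LO (Suc n) ?W (%ys. dd n (%zs. f (x # zs)) ys = dd n (%zs. g (x # zs)) ys)"
   by (rule LO_subset[OF Suc.IH[OF V(1) cf[OF y0] cg[OF y0] V(3)]]) simp
  have 2: "LO (Suc n) ?W (%ys. f ys = g ys)" by (rule LO_subset[OF Suc.prems(4)]) simp
  have "LO (Suc n) ?W (%ys. dd (Suc n) f (x # ys) = dd (Suc n) g (x # ys))"
   by (rule LO_imp[OF LO_conj[OF 1 2] openin_subset[OF W(1)]]) (simp add: dd_Suc(1)[OF f xT] dd_Suc(1)[OF g xT])
  thus "EX V. openin Y V & x:V & LO (Suc n) V (%ys. dd (Suc n) f (x # ys) = dd (Suc n) g (x # ys))" using W by blast
 qed
qed


lemma (in abelian_group) sub_sub_swap: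
 assumes "a :[G]" "b :[G]" "p :[G]" "q :[G]"
 shows "(a -. b) -. (p -. q) = (a -. p) -. (b -. q)" using assms by (simp add: minus_eq minus_add a_ac)

lemma (in abelian_group) sub_self: "a :[G] ==> a -. a = \<zero>" by (simp add: minus_eq r_neg)
lemma (in abelian_group) sub_zero: "a :[G] ==> a -. \<zero> = a" by (simp add: minus_eq)

lemma (in abelian_group) sub_eq_zero:
 assumes "a :[G]" "b :[G]" "a -. b = \<zero>" shows "a = b"
proof -
 have "a = (a -. b) +. b" using assms(1,2) by (simp add: minus_eq a_assoc l_neg)
 thus ?thesis using assms by simp
qed

text \<open>Additivity holds only locally: \<open>spread\<close> picks representatives of the germs
  of f, of g and of their difference independently, and these match only near the base
  point.\<close>

lemma dd_sb:
 assumes "openin Y U" "coch n f" "coch n g"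
 shows "LE (Suc n) U (dd n (sb f g)) (sb (dd n f) (dd n g))" using assms
proof (induction n arbitrary: U f g)
 case 0
 note U = "0.prems"(1) and f = "0.prems"(2) and g = "0.prems"(3)
 note fg = sb_closed[OF f g]
 show ?case
 proof (rule LO_SucI)
  fix x assume x: "x:U"
  hence xT: "x:topspace Y" using openin_subset[OF U] by blast
  have xc: "[x]:chains Y 0" using xT by (simp add: ch_0)
  have fx: "f [x] :[ST x]" "g [x] :[ST x]" using f g xc unfolding coch_def by force+
  obtain V s where s: "nb x V s" "f [x] = gm x V s" using fx(1) unfolding stalk_carr by (elim exE conjE)
  obtain W t where W: "W <= V" "openin Y W" "x:W" and t: "nb x W t" "gm x V s = gm x W (restr F V W s)" "g [x] = gm x W t"
   using stalk_rep2[OF s(1) fx(2)] by (elim exE conjE)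
  define a where "a = restr F V W s"
  have a: "nb x W a" "f [x] = gm x W a" unfolding a_def using nb_restr[OF s(1) W(2,3,1)] s(2) t(2) by auto
  interpret c: cring "sect F W" by (rule F_cring[OF W(2)])
  have d: "nb x W (a -[sect F W] t)" using a t by (simp add: nb_def)
  have fgx: "sb f g [x] = gm x W (a -[sect F W] t)" unfolding sb_def last.simps a(2) t(3) using germ_minus[OF a(1) t(1)] by simp
  obtain Z1 where Z1: "openin Y Z1" "x:Z1" "Z1 <= W" "ALL y:Z1. spread Y F (gm x W a) y = gm y W a" using spread_near[OF a(1)] by (elim exE conjE)
  obtain Z2 where Z2: "openin Y Z2" "x:Z2" "Z2 <= W" "ALL y:Z2. spread Y F (gm x W t) y = gm y W t" using spread_near[OF t(1)] by (elim exE conjE)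
  obtain Z3 where Z3: "openin Y Z3" "x:Z3" "Z3 <= W" "ALL y:Z3. spread Y F (gm x W (a -[sect F W] t)) y = gm y W (a -[sect F W] t)" using spread_near[OF d] by (elim exE conjE)
  let ?Z = "Z1 Int Z2 Int Z3"
  have Z: "openin Y ?Z" "x:?Z" using Z1 Z2 Z3 by auto
  have "dd 0 (sb f g) [x, y] = sb (dd 0 f) (dd 0 g) [x, y]" if y: "y:?Z" for y
  proof -
   have yT: "y:topspace Y" using y openin_subset[OF Z(1)] by blast
   have yc: "[y]:chains Y 0" using yT by (simp add: ch_0)
   have fy: "f [y] :[ST y]" "g [y] :[ST y]" using f g yc unfolding coch_def by force+
   interpret S: abelian_group "ST y" by (rule stalk_group[OF yT])
   have n: "nb y W a" "nb y W t" using y Z1(3) a(1) t(1) by (auto simp: nb_def)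
   have 1: "spread Y F (f [x]) y = gm y W a" "spread Y F (g [x]) y = gm y W t" "spread Y F (sb f g [x]) y = gm y W a -[ST y] gm y W t"
    unfolding fgx a(2) t(3) germ_minus[OF n] using y Z1(4) Z2(4) Z3(4) by auto
   show ?thesis unfolding dd_0[OF fg xT yT] 1(3)
    using S.sub_sub_swap[OF fy germ_carr[OF n(1)] germ_carr[OF n(2)]] dd_0[OF f xT yT] dd_0[OF g xT yT] 1(1,2) by (simp add: sb_def)
  qed
  hence "LO 0 ?Z (%ys. dd 0 (sb f g) (x # ys) = sb (dd 0 f) (dd 0 g) (x # ys))" by simp
  thus "EX V. openin Y V & x:V & LO 0 V (%ys. dd 0 (sb f g) (x # ys) = sb (dd 0 f) (dd 0 g) (x # ys))" using Z by blast
 qed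
next
 case (Suc n)
 note U = Suc.prems(1) and f = Suc.prems(2) and g = Suc.prems(3)
 note fg = sb_closed[OF f g]
 show ?case
 proof (rule LO_SucI)
  fix x assume x: "x:U"
  hence xT: "x:topspace Y" using openin_subset[OF U] by blast
  have "EX ys. ys:chains Y (Suc n)" using xT by (intro exI[of _ "replicate (Suc (Suc n)) x"]) (auto simp: chains_def)
  then obtain y0 where y0: "y0:chains Y (Suc n)" by (elim exE)
  let ?f = "%zs. f (x # zs)" and ?g = "%zs. g (x # zs)"
  have cf: "coch n ?f" and cg: "coch n ?g" using dd_Suc(2)[OF f xT y0] dd_Suc(2)[OF g xT y0] by auto
  have 1: "LE (Suc n) U (dd n (sb ?f ?g)) (sb (dd n ?f) (dd n ?g))" by (rule Suc.IH[OF U cf cg])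
  have "LO (Suc n) U (%ys. dd (Suc n) (sb f g) (x # ys) = sb (dd (Suc n) f) (dd (Suc n) g) (x # ys))"
  proof (rule LO_imp[OF 1 openin_subset[OF U]])
   fix ys assume ys: "ys:chains Y (Suc n)" and e: "dd n (sb ?f ?g) ys = sb (dd n ?f) (dd n ?g) ys"
   interpret S: abelian_group "ST (last ys)" by (rule stalk_last[OF ys])
   have "dd n (%zs. sb f g (x # zs)) ys = dd n (sb ?f ?g) ys" by (rule dd_ext[OF _ ys]) (simp add: sb_def ch_ne)
   hence 2: "dd n (%zs. sb f g (x # zs)) ys = dd n ?f ys -[ST (last ys)] dd n ?g ys" using e by (simp add: sb_def)
   have c: "f ys :[ST (last ys)]" "g ys :[ST (last ys)]" "dd n ?f ys :[ST (last ys)]" "dd n ?g ys :[ST (last ys)]"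
    using f g dd_closed[OF cf] dd_closed[OF cg] ys unfolding coch_def by blast+
   have "dd (Suc n) (sb f g) (x # ys) = sb f g ys -[ST (last ys)] (dd n ?f ys -[ST (last ys)] dd n ?g ys)" using dd_Suc(1)[OF fg xT ys] 2 by simp
   also have "... = (f ys -[ST (last ys)] dd n ?f ys) -[ST (last ys)] (g ys -[ST (last ys)] dd n ?g ys)"
    unfolding sb_def by (rule S.sub_sub_swap[OF c])
   also have "... = sb (dd (Suc n) f) (dd (Suc n) g) (x # ys)" unfolding sb_def dd_Suc(1)[OF f xT ys] dd_Suc(1)[OF g xT ys] last_Cons_ch[OF ys] ..
   finally show "dd (Suc n) (sb f g) (x # ys) = sb (dd (Suc n) f) (dd (Suc n) g) (x # ys)" .
  qed
  thus "EX V. openin Y V & x:V & LO (Suc n) V (%ys. dd (Suc n) (sb f g) (x # ys) = sb (dd (Suc n) f) (dd (Suc n) g) (x # ys))" using U x by blast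
 qed
qed

text \<open>Write f_x for \<open>%zs. f (x # zs)\<close>. By \<open>dd_Suc\<close> the value of d d
  f on x # ys is d f - d (f - d f_x) = d d f_x at ys, which vanishes by induction. In degree 0 the
  inner term is the spread of one germ, whose differential vanishes near x.\<close>

lemma dd_dd:
 assumes "openin Y U" "coch n f"
 shows "LZ (Suc (Suc n)) U (dd (Suc n) (dd n f))" using assms
proof (induction n arbitrary: U f)
 case 0
 note U = "0.prems"(1) and f = "0.prems"(2)
 note df = dd_closed[OF f]
 show ?case
 proof (rule LO_SucI)
  fix x assume x: "x:U"
  hence xT: "x:topspace Y" using openin_subset[OF U] by blast
  have xc: "[x]:chains Y 0" using xT by (simp add: ch_0)
  have fx: "f [x] :[ST x]" using f xc unfolding coch_def by force
  obtain W t where t: "nb x W t" "f [x] = gm x W t" using fx unfolding stalk_carr by (elim exE conjE)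
  obtain Z where Z: "openin Y Z" "x:Z" "Z <= W" "ALL y:Z. spread Y F (gm x W t) y = gm y W t" using spread_near[OF t(1)] by (elim exE conjE)
  let ?s = "%zs. spread Y F (f [x]) (last zs)"
  have cs: "coch 0 ?s" unfolding coch_def using spread_closed[OF fx] by (auto simp: ch_0)
  have s0: "LO (Suc 0) Z (%ys. dd 0 ?s ys = \<zero>[ST (last ys)])"
  proof (rule LO_SucI)
   fix y assume y: "y:Z"
   hence yT: "y:topspace Y" using openin_subset[OF Z(1)] by blast
   have ny: "nb y W t" using t(1) y Z by (auto simp: nb_def)
   obtain Z' where Z': "openin Y Z'" "y:Z'" "Z' <= W" "ALL z:Z'. spread Y F (gm y W t) z = gm z W t" using spread_near[OF ny] by (elim exE conjE)
   have "dd 0 ?s [y, z] = \<zero>[ST z]" if z: "z:Z Int Z'" for z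
   proof -
    have zT: "z:topspace Y" using z openin_subset[OF Z(1)] by blast
    interpret S: abelian_group "ST z" by (rule stalk_group[OF zT])
    have nz: "nb z W t" using t(1) z Z by (auto simp: nb_def)
    have "dd 0 ?s [y, z] = gm z W t -[ST z] gm z W t" unfolding dd_0[OF cs yT zT] using y z Z(4) Z'(4) t(2) by simp
    thus ?thesis using S.sub_self[OF germ_carr[OF nz]] by simp
   qed
   hence "LO 0 (Z Int Z') (%zs. dd 0 ?s (y # zs) = \<zero>[ST (last (y # zs))])" by simp
   moreover have "openin Y (Z Int Z')" "y:Z Int Z'" using Z Z' y by auto
   ultimately show "EX V. openin Y V & y:V & LO 0 V (%zs. dd 0 ?s (y # zs) = \<zero>[ST (last (y # zs))])" by blast
  qed
  have "LO (Suc 0) Z (%ys. dd (Suc 0) (dd 0 f) (x # ys) = \<zero>[ST (last (x # ys))])"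
  proof (rule LO_imp[OF LO_conj[OF s0 dd_sb[OF Z(1) f cs]] openin_subset[OF Z(1)]])
   fix ys assume ys: "ys:chains Y (Suc 0)" and e: "dd 0 ?s ys = \<zero>[ST (last ys)] & dd 0 (sb f ?s) ys = sb (dd 0 f) (dd 0 ?s) ys"
   interpret S: abelian_group "ST (last ys)" by (rule stalk_last[OF ys])
   have c: "dd 0 f ys :[ST (last ys)]" using df ys unfolding coch_def by blast
   have "dd 0 (%zs. dd 0 f (x # zs)) ys = dd 0 (sb f ?s) ys"
   proof (rule dd_ext[OF _ ys])
    fix zs assume "zs:chains Y 0"
    then obtain z where z: "z:topspace Y" "zs = [z]" unfolding ch_0 by blast
    show "dd 0 f (x # zs) = sb f ?s zs" unfolding z(2) dd_0[OF f xT z(1)] sb_def by simp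
   qed
   hence "dd 0 (%zs. dd 0 f (x # zs)) ys = dd 0 f ys" using e S.sub_zero[OF c] by (simp add: sb_def)
   thus "dd (Suc 0) (dd 0 f) (x # ys) = \<zero>[ST (last (x # ys))]"
    unfolding dd_Suc(1)[OF df xT ys] last_Cons_ch[OF ys] using S.sub_self[OF c] by simp
  qed
  thus "EX V. openin Y V & x:V & LO (Suc 0) V (%ys. dd (Suc 0) (dd 0 f) (x # ys) = \<zero>[ST (last (x # ys))])" using Z by blast
 qed
next
 case (Suc n)
 note U = Suc.prems(1) and f = Suc.prems(2)
 note df = dd_closed[OF f]
 show ?case
 proof (rule LO_SucI)
  fix x assume x: "x:U"
  hence xT: "x:topspace Y" using openin_subset[OF U] by blast
  have "EX ys. ys:chains Y (Suc n)" using xT by (intro exI[of _ "replicate (Suc (Suc n)) x"]) (auto simp: chains_def)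
  then obtain y0 where y0: "y0:chains Y (Suc n)" by (elim exE)
  let ?f = "%zs. f (x # zs)"
  have cf: "coch n ?f" by (rule dd_Suc(2)[OF f xT y0])
  note dcf = dd_closed[OF cf]
  have "LO (Suc (Suc n)) U (%ys. dd (Suc (Suc n)) (dd (Suc n) f) (x # ys) = \<zero>[ST (last (x # ys))])"
  proof (rule LO_imp[OF LO_conj[OF Suc.IH[OF U cf] dd_sb[OF U f dcf]] openin_subset[OF U]])
   fix ys assume ys: "ys:chains Y (Suc (Suc n))"
    and e: "dd (Suc n) (dd n ?f) ys = \<zero>[ST (last ys)] & dd (Suc n) (sb f (dd n ?f)) ys = sb (dd (Suc n) f) (dd (Suc n) (dd n ?f)) ys"
   interpret S: abelian_group "ST (last ys)" by (rule stalk_last[OF ys])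
   have c: "dd (Suc n) f ys :[ST (last ys)]" using df ys unfolding coch_def by blast
   have "dd (Suc n) (%zs. dd (Suc n) f (x # zs)) ys = dd (Suc n) (sb f (dd n ?f)) ys" by (rule dd_ext[OF _ ys]) (simp add: dd_Suc(1)[OF f xT] sb_def)
   hence "dd (Suc n) (%zs. dd (Suc n) f (x # zs)) ys = dd (Suc n) f ys" using e S.sub_zero[OF c] by (simp add: sb_def)
   thus "dd (Suc (Suc n)) (dd (Suc n) f) (x # ys) = \<zero>[ST (last (x # ys))]"
    unfolding dd_Suc(1)[OF df xT ys] last_Cons_ch[OF ys] using S.sub_self[OF c] by simp
  qed
  thus "EX V. openin Y V & x:V & LO (Suc (Suc n)) V (%ys. dd (Suc (Suc n)) (dd (Suc n) f) (x # ys) = \<zero>[ST (last (x # ys))])" using U x by blast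
 qed
qed


text \<open>Fixing the first point is a contracting homotopy: on chains starting at x the cocycle
  condition reads 0 = f - d f(x, -) near x, by \<open>dd_Suc\<close>.\<close>

lemma local_exact:
 assumes U: "openin Y U" and f: "coch (Suc n) f" and z: "LZ (Suc (Suc n)) U (dd (Suc n) f)" and x: "x:U"
 shows "EX V. openin Y V & x:V & (EX h. coch n h & LE (Suc n) V f (dd n h))"
proof -
 have xT: "x:topspace Y" using openin_subset[OF U] x by blast
 have "EX ys. ys:chains Y (Suc n)" using xT by (intro exI[of _ "replicate (Suc (Suc n)) x"]) (auto simp: chains_def)
 then obtain y0 where y0: "y0:chains Y (Suc n)" by (elim exE)
 let ?h = "%zs. f (x # zs)"
 have h: "coch n ?h" by (rule dd_Suc(2)[OF f xT y0])
 obtain V where V: "openin Y V" "x:V" "LO (Suc n) V (%ys. dd (Suc n) f (x # ys) = \<zero>[ST (last (x # ys))])"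
  using z x unfolding locally_on.simps(2)[of _ "Suc n"] by blast
 have "LE (Suc n) V f (dd n ?h)"
 proof (rule LO_imp[OF V(3) openin_subset[OF V(1)]])
  fix ys assume ys: "ys:chains Y (Suc n)" and e: "dd (Suc n) f (x # ys) = \<zero>[ST (last (x # ys))]"
  interpret S: abelian_group "ST (last ys)" by (rule stalk_last[OF ys])
  have c: "f ys :[ST (last ys)]" "dd n ?h ys :[ST (last ys)]" using f dd_closed[OF h] ys unfolding coch_def by blast+
  show "f ys = dd n ?h ys" by (rule S.sub_eq_zero[OF c]) (use e dd_Suc(1)[OF f xT ys] last_Cons_ch[OF ys] in simp)
 qed
 thus ?thesis using V h by blast
qed

lemma dd_modify:
 assumes U: "openin Y U" and h: "coch n h" and k: "coch n k"
  and e: "LE (Suc n) U f (dd n h)" and z: "LZ (Suc n) U (dd n k)"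
 shows "LE (Suc n) U f (dd n (sb h k))"
proof (rule LO_imp[OF LO_conj[OF LO_conj[OF e z] dd_sb[OF U h k]] openin_subset[OF U]])
 fix xs assume xs: "xs:chains Y (Suc n)" and a: "(f xs = dd n h xs & dd n k xs = \<zero>[ST (last xs)]) & dd n (sb h k) xs = sb (dd n h) (dd n k) xs"
 interpret S: abelian_group "ST (last xs)" by (rule stalk_last[OF xs])
 have "dd n h xs :[ST (last xs)]" using dd_closed[OF h] xs unfolding coch_def by blast
 thus "f xs = dd n (sb h k) xs" using a by (simp add: sb_def S.sub_zero)
qed

text \<open>Cochains can be patched without any compatibility between neighbouring first points.\<close>

lemma dd_patch:
 assumes U: "openin Y U1" "openin Y U2" and h: "coch n h1" "coch n h2"
  and e: "LE (Suc n) U1 f (dd n h1)" "LE (Suc n) U2 f (dd n h2)"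
  and c: "LE n (U1 Int U2) h1 h2"
 shows "EX h. coch n h & LE (Suc n) (U1 Un U2) f (dd n h)"
proof -
 define h where "h xs = (if hd xs:U1 then h1 xs else h2 xs)" for xs
 have hc: "coch n h" using h unfolding coch_def h_def by simp
 have T: "U1 <= topspace Y" "U2 <= topspace Y" using U openin_subset by auto
 have 1: "LE n U1 h1 h" by (rule LO_all[OF T(1)]) (simp add: h_def)
 \<comment> \<open>Off U1 the patched function is h2 by definition; on the intersection the
   hypothesis c is used.\<close>
 have a: "LE n (U2 - U1) h2 h" by (rule LO_all) (use T in \<open>auto simp: h_def\<close>)
 have b: "LE n (U1 Int U2) h2 h" by (rule LO_imp[OF c]) (use T in \<open>auto simp: h_def\<close>)
 have "(U2 - U1) Un (U1 Int U2) = U2" by auto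
 hence 2: "LE n U2 h2 h" using LO_Un[OF a b] by simp
 have e1: "LE (Suc n) U1 f (dd n h)" by (rule LO_imp[OF LO_conj[OF e(1) dd_cong_LO[OF U(1) h(1) hc 1]] T(1)]) simp
 have e2: "LE (Suc n) U2 f (dd n h)" by (rule LO_imp[OF LO_conj[OF e(2) dd_cong_LO[OF U(2) h(2) hc 2]] T(2)]) simp
 show ?thesis by (rule exI, rule conjI[OF hc LO_Un[OF e1 e2]])
qed

lemma germ_cochain: "s :[sect F V] ==> openin Y V ==>
  coch 0 (%xs. if hd xs:V then gm (hd xs) V s else \<zero>[ST (hd xs)])" unfolding coch_def
proof
 fix xs assume s: "s :[sect F V]" "openin Y V" and "xs:chains Y 0"
 then obtain x where x: "x:topspace Y" "xs = [x]" unfolding ch_0 by blast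
 interpret S: abelian_group "ST x" by (rule stalk_group[OF x(1)])
 show "(if hd xs:V then gm (hd xs) V s else \<zero>[ST (hd xs)]) :[ST (last xs)]" using germ_carr[of x V s] s by (simp add: x(2) nb_def)
qed

lemma germ_cocycle:
 assumes V: "openin Y V" and s: "s :[sect F V]"
 shows "LO (Suc 0) V (%xs. dd 0 (%xs. if hd xs:V then gm (hd xs) V s else \<zero>[ST (hd xs)]) xs = \<zero>[ST (last xs)])"
proof (rule LO_SucI)
 let ?k = "%xs. if hd xs:V then gm (hd xs) V s else \<zero>[ST (hd xs)]"
 fix x assume x: "x:V"
 hence n: "nb x V s" using V s by (simp add: nb_def)
 obtain Z where Z: "openin Y Z" "x:Z" "Z <= V" "ALL y:Z. spread Y F (gm x V s) y = gm y V s" using spread_near[OF n] by (elim exE conjE)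
 have "dd 0 ?k [x, y] = \<zero>[ST y]" if y: "y:Z" for y
 proof -
  have ny: "nb y V s" using V s y Z by (auto simp: nb_def)
  interpret S: abelian_group "ST y" by (rule stalk_group[OF nb_top[OF ny]])
  have "dd 0 ?k [x, y] = gm y V s -[ST y] gm y V s" unfolding dd_0[OF germ_cochain[OF s V] nb_top[OF n] nb_top[OF ny]] using x y Z by auto
  thus ?thesis using S.sub_self[OF germ_carr[OF ny]] by simp
 qed
 hence "LO 0 Z (%ys. dd 0 ?k (x # ys) = \<zero>[ST (last (x # ys))])" by simp
 thus "EX V'. openin Y V' & x:V' & LO 0 V' (%ys. dd 0 ?k (x # ys) = \<zero>[ST (last (x # ys))])" using Z by blast
qed

text \<open>Near each point a 0-cocycle is the family of germs of one section; these local sections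
  agree on overlaps by \<open>germs_eq\<close>, and the sheaf axiom glues them.\<close>

lemma cocycle_section:
 assumes W: "openin Y W" and a: "coch 0 a" and z: "LZ (Suc 0) W (dd 0 a)"
 shows "EX c:carrier (sect F W). ALL y:W. gm y W c = a [y]"
proof -
 let ?P = "%Z s. s :[sect F Z] & (ALL y:Z. gm y Z s = a [y])"
 let ?W = "{Z. openin Y Z & Z <= W & (EX s. ?P Z s)}"
 have WT: "W <= topspace Y" by (rule openin_subset[OF W])
 have "x:\<Union>?W" if x: "x:W" for x
 proof -
  have xT: "x:topspace Y" using x WT by blast
  have "[x]:chains Y 0" using xT by (simp add: ch_0)
  hence ax: "a [x] :[ST x]" using a unfolding coch_def by force
  obtain V s where s: "nb x V s" "a [x] = gm x V s" using ax unfolding stalk_carr by (elim exE conjE)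
  obtain Z where Z: "openin Y Z" "x:Z" "Z <= V" "ALL y:Z. spread Y F (gm x V s) y = gm y V s" using spread_near[OF s(1)] by (elim exE conjE)
  obtain V' where V': "openin Y V'" "x:V'" "ALL y:V'. dd 0 a [x, y] = \<zero>[ST y]" using z x by auto
  let ?Q = "Z Int V' Int W"
  have Q: "openin Y ?Q" "x:?Q" "?Q <= V" "?Q <= W" using Z V' W x by auto
  have "gm y ?Q (restr F V ?Q s) = a [y]" if y: "y:?Q" for y
  proof -
   have yT: "y:topspace Y" using y WT by blast
   have yc: "[y]:chains Y 0" using yT by (simp add: ch_0)
   have ay: "a [y] :[ST y]" using a yc unfolding coch_def by force
   interpret S: abelian_group "ST y" by (rule stalk_group[OF yT])
   have ny: "nb y V s" using s(1) y Q(3) by (auto simp: nb_def)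
   have "a [y] -[ST y] gm y V s = \<zero>[ST y]" using V'(3) Z(4) y dd_0[OF a xT yT] s(2) by auto
   hence "a [y] = gm y V s" by (rule S.sub_eq_zero[OF ay germ_carr[OF ny]])
   thus ?thesis using germ_restr[OF ny Q(1) y Q(3)] by simp
  qed
  moreover have "restr F V ?Q s :[sect F ?Q]" using nb_restr[OF s(1) Q(1,2,3)] by (simp add: nb_def)
  ultimately have "?Q:?W" using Q by blast
  thus ?thesis using Q(2) by blast
 qed
 hence cov: "\<Union>?W = W" by blast
 define t where "t Z = (SOME s. ?P Z s)" for Z
 have t: "t Z :[sect F Z]" "!!y. y:Z ==> gm y Z (t Z) = a [y]" if "Z:?W" for Z
 proof -
  have "EX s. ?P Z s" using that by blast
  from someI_ex[OF this] show "t Z :[sect F Z]" "!!y. y:Z ==> gm y Z (t Z) = a [y]" unfolding t_def by blast+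
 qed
 have "EX! c. c :[sect F W] & (ALL Z:?W. restr F W Z c = t Z)"
 proof (rule sheaf_glue[OF W _ cov])
  show "ALL Z:?W. t Z :[sect F Z]" using t(1) by blast
  show "ALL Z:?W. ALL Z':?W. restr F Z (Z Int Z') (t Z) = restr F Z' (Z Int Z') (t Z')"
  proof (intro ballI)
   fix Z Z' assume Z: "Z:?W" and Z': "Z':?W"
   hence o: "openin Y Z" "openin Y Z'" by auto
   note oi = openin_Int[OF o]
   show "restr F Z (Z Int Z') (t Z) = restr F Z' (Z Int Z') (t Z')"
   proof (rule germs_eq[OF oi])
    show "restr F Z (Z Int Z') (t Z) :[sect F (Z Int Z')]" by (rule r_closed[OF o(1) oi _ t(1)[OF Z]]) simp
    show "restr F Z' (Z Int Z') (t Z') :[sect F (Z Int Z')]" by (rule r_closed[OF o(2) oi _ t(1)[OF Z']]) simp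
    fix y assume y: "y:Z Int Z'"
    have n: "nb y Z (t Z)" "nb y Z' (t Z')" using o y t(1)[OF Z] t(1)[OF Z'] by (auto simp: nb_def)
    show "gm y (Z Int Z') (restr F Z (Z Int Z') (t Z)) = gm y (Z Int Z') (restr F Z' (Z Int Z') (t Z'))"
     using germ_restr[OF n(1) oi y] germ_restr[OF n(2) oi y] t(2)[OF Z, of y] t(2)[OF Z', of y] y by simp
   qed
  qed
 qed blast
 from ex1_implies_ex[OF this] obtain c where c: "c :[sect F W]" "ALL Z:?W. restr F W Z c = t Z" by (elim exE conjE)
 have "gm y W c = a [y]" if y: "y:W" for y
 proof -
  have "y:\<Union>?W" by (subst cov) (rule y)
  then obtain Z where Z: "Z:?W" "y:Z" by (elim UnionE)
  have n: "nb y W c" using W y c(1) by (simp add: nb_def)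
  have "gm y Z (restr F W Z c) = gm y W c" by (rule germ_restr[OF n]) (use Z in auto)
  moreover have "restr F W Z c = t Z" using c(2) Z(1) by blast
  ultimately show ?thesis using t(2)[OF Z] by simp
 qed
 thus ?thesis using c(1) by blast
qed

text \<open>Vanishing of the first Cech cohomology of the covering by U1 and U2.\<close>

definition surj_pair :: "'p set => 'p set => bool" where
 "surj_pair U1 U2 \<longleftrightarrow> (ALL c:carrier (sect F (U1 Int U2)). EX c1:carrier (sect F U1). EX c2:carrier (sect F U2).
   c = restr F U1 (U1 Int U2) c1 +[sect F (U1 Int U2)] restr F U2 (U1 Int U2) c2)"

text \<open>A Mayer-Vietoris argument. Primitives h1, h2 over two parts differ on the intersection
  by a cocycle one degree lower; it is removed by the induction hypothesis, or in degree 0 by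
  \<open>surj_pair\<close>, and then the primitives are patched. The premise \<open>ind\<close>
  abstracts induction along splittings.\<close>

theorem cocycle_exact:
 assumes ind: "!!Q U. U:R ==> (!!x. x:U ==> EX V. openin Y V & x:V & Q V) ==> (!!V W. Q V ==> W <= V ==> Q W) ==> Q {} ==>
   (!!U1 U2. U1:R ==> U2:R ==> U1 Int U2:R ==> surj_pair U1 U2 ==> Q U1 ==> Q U2 ==> Q (U1 Un U2)) ==> Q U"
  and op: "!!U. U:R ==> openin Y U"
 shows "U:R ==> coch (Suc n) f ==> LZ (Suc (Suc n)) U (dd (Suc n) f) ==>
  EX h. coch n h & LE (Suc n) U f (dd n h)"
proof (induction n arbitrary: U f rule: less_induct)
 fix n U f
 assume IH: "!!m U f. m < n ==> U:R ==> coch (Suc m) f ==> LZ (Suc (Suc m)) U (dd (Suc m) f) ==>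
   EX h. coch m h & LE (Suc m) U f (dd m h)"
  and U: "U:R" and f: "coch (Suc n) f" and z: "LZ (Suc (Suc n)) U (dd (Suc n) f)"
 let ?Q = "%V. EX h. coch n h & LE (Suc n) V f (dd n h)"
 show "?Q U"
 proof (rule ind[of U ?Q, OF U])
  show "EX V. openin Y V & x:V & ?Q V" if "x:U" for x by (rule local_exact[OF op[OF U] f z that])
  show "?Q W" if "?Q V" "W <= V" for V W using that LO_subset by blast
  show "?Q {}"
  proof (intro exI conjI)
   show "coch n (%xs. \<zero>[ST (last xs)])" unfolding coch_def using stalk_last by (auto simp: abelian_group_def abelian_monoid.zero_closed)
  qed simp
  fix U1 U2 assume U12: "U1:R" "U2:R" "U1 Int U2:R" and sj: "surj_pair U1 U2" and Q: "?Q U1" "?Q U2"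
  note o = op[OF U12(1)] op[OF U12(2)] op[OF U12(3)]
  obtain h1 where h1: "coch n h1" "LE (Suc n) U1 f (dd n h1)" using Q(1) by (elim exE conjE)
  obtain h2 where h2: "coch n h2" "LE (Suc n) U2 f (dd n h2)" using Q(2) by (elim exE conjE)
  note hs = sb_closed[OF h1(1) h2(1)]
  have zs: "LZ (Suc n) (U1 Int U2) (dd n (sb h1 h2))"
  proof (rule LO_imp[OF LO_conj[OF LO_conj[OF LO_subset[OF h1(2)] LO_subset[OF h2(2)]] dd_sb[OF o(3) h1(1) h2(1)]] openin_subset[OF o(3)]])
   fix xs assume xs: "xs:chains Y (Suc n)"
    and e: "(f xs = dd n h1 xs & f xs = dd n h2 xs) & dd n (sb h1 h2) xs = sb (dd n h1) (dd n h2) xs"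
   interpret S: abelian_group "ST (last xs)" by (rule stalk_last[OF xs])
   have "f xs :[ST (last xs)]" using f xs unfolding coch_def by blast
   moreover have "dd n h1 xs = f xs" "dd n h2 xs = f xs" by (rule conjunct1[OF conjunct1[OF e], symmetric], rule conjunct2[OF conjunct1[OF e], symmetric])
   ultimately show "dd n (sb h1 h2) xs = \<zero>[ST (last xs)]" using conjunct2[OF e] S.sub_self[of "f xs"] by (simp only: sb_def)
  qed auto
  have "EX k1 k2. coch n k1 & coch n k2 & LZ (Suc n) U1 (dd n k1) &
   LZ (Suc n) U2 (dd n k2) & LE n (U1 Int U2) (sb h1 k1) (sb h2 k2)"
  proof (cases n)
   case 0
   let ?I = "U1 Int U2"
   obtain c where c: "c :[sect F ?I]" "ALL y:?I. gm y ?I c = sb h1 h2 [y]" using cocycle_section[OF o(3)] hs zs unfolding 0 by blast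
   obtain c1 c2 where c12: "c1 :[sect F U1]" "c2 :[sect F U2]" "c = restr F U1 ?I c1 +[sect F ?I] restr F U2 ?I c2"
    using sj c(1) unfolding surj_pair_def by blast
   interpret F2: cring "sect F U2" by (rule F_cring[OF o(2)])
   interpret F12: cring "sect F ?I" by (rule F_cring[OF o(3)])
   interpret r2: ring_hom_cring "sect F U2" "sect F ?I" "restr F U2 ?I" by (rule r_hom[OF o(2,3)]) simp
   interpret r1: ring_hom_cring "sect F U1" "sect F ?I" "restr F U1 ?I" by (rule r_hom[OF o(1,3)]) simp
   \<comment> \<open>The sign turns c = c1 + c2 into the difference of the two corrections, as
     needed for h1 - k1 = h2 - k2.\<close>
   let ?c2 = "-[sect F U2] c2"
   let ?k1 = "%xs. if hd xs:U1 then gm (hd xs) U1 c1 else \<zero>[ST (hd xs)]"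
   let ?k2 = "%xs. if hd xs:U2 then gm (hd xs) U2 ?c2 else \<zero>[ST (hd xs)]"
   have c2': "?c2 :[sect F U2]" using c12 by simp
   have "sb h1 ?k1 [y] = sb h2 ?k2 [y]" if y: "y:?I" for y
   proof -
    have yT: "y:topspace Y" using y openin_subset[OF o(3)] by blast
    have yc: "[y]:chains Y 0" using yT by (simp add: ch_0)
    interpret S: abelian_group "ST y" by (rule stalk_group[OF yT])
    have hc: "h1 [y] :[ST y]" "h2 [y] :[ST y]" using h1(1) h2(1) yc unfolding coch_def 0 by force+
    have n: "nb y U1 c1" "nb y U2 ?c2" using o y c12 c2' by (auto simp: nb_def)
    have g: "gm y U1 c1 = gm y ?I (restr F U1 ?I c1)" "gm y U2 ?c2 = gm y ?I (restr F U2 ?I ?c2)"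
     using germ_restr[OF n(1) o(3) y] germ_restr[OF n(2) o(3) y] by auto
    have nn: "nb y ?I (restr F U1 ?I c1)" "nb y ?I (restr F U2 ?I ?c2)" using nb_restr[OF n(1) o(3) y] nb_restr[OF n(2) o(3) y] by auto
    have "gm y U1 c1 -[ST y] gm y U2 ?c2 = gm y ?I (restr F U1 ?I c1 -[sect F ?I] restr F U2 ?I ?c2)" unfolding g by (rule germ_minus[OF nn])
    also have "restr F U1 ?I c1 -[sect F ?I] restr F U2 ?I ?c2 = c" unfolding c12(3) using c12 by (simp add: F12.minus_eq)
    finally have e: "h1 [y] -[ST y] h2 [y] = gm y U1 c1 -[ST y] gm y U2 ?c2" using c(2) y by (simp add: sb_def)
    have gc: "gm y U1 c1 :[ST y]" "gm y U2 ?c2 :[ST y]" using germ_carr n by auto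
    have "h1 [y] -[ST y] gm y U1 c1 = h2 [y] -[ST y] gm y U2 ?c2"
    proof (rule S.sub_eq_zero)
     show "(h1 [y] -[ST y] gm y U1 c1) -[ST y] (h2 [y] -[ST y] gm y U2 ?c2) = \<zero>[ST y]"
      unfolding S.sub_sub_swap[OF hc(1) gc(1) hc(2) gc(2)] e by (rule S.sub_self) (use gc in simp)
    qed (use hc gc in simp_all)
    thus ?thesis using y by (simp add: sb_def)
   qed
   hence "LE n ?I (sb h1 ?k1) (sb h2 ?k2)" unfolding 0 by simp
   moreover have "coch n ?k1" "coch n ?k2" unfolding 0 using germ_cochain c12(1) c2' o by auto
   moreover have "LZ (Suc n) U1 (dd n ?k1)" unfolding 0 by (rule germ_cocycle[OF o(1) c12(1)])
   moreover have "LZ (Suc n) U2 (dd n ?k2)" unfolding 0 by (rule germ_cocycle[OF o(2) c2'])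
   ultimately show ?thesis by blast
  next
   case (Suc m)
   hence mn: "m < n" by simp
   obtain k where k: "coch m k" "LE (Suc m) (U1 Int U2) (sb h1 h2) (dd m k)"
    using IH[OF mn U12(3) hs[unfolded Suc] zs[unfolded Suc]] by (elim exE conjE)
   \<comment> \<open>A cochain with value 0 in every stalk: in positive degree only h1 is
     corrected.\<close>
   let ?z = "sb h1 h1"
   have zc: "coch n ?z" by (rule sb_closed[OF h1(1) h1(1)])
   have kc: "coch n (dd m k)" unfolding Suc by (rule dd_closed[OF k(1)])
   have z0: "LZ (Suc n) U2 (dd n ?z)"
   proof (rule LO_imp[OF dd_sb[OF o(2) h1(1) h1(1)] openin_subset[OF o(2)]])
    fix xs assume xs: "xs:chains Y (Suc n)" and e: "dd n (sb h1 h1) xs = sb (dd n h1) (dd n h1) xs"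
    interpret S: abelian_group "ST (last xs)" by (rule stalk_last[OF xs])
    have "dd n h1 xs :[ST (last xs)]" using dd_closed[OF h1(1)] xs unfolding coch_def by blast
    thus "dd n ?z xs = \<zero>[ST (last xs)]" using e S.sub_self by (simp add: sb_def)
   qed
   have "LE n (U1 Int U2) (sb h1 (dd m k)) (sb h2 ?z)" unfolding Suc
   proof (rule LO_imp[OF k(2) openin_subset[OF o(3)]])
    fix xs assume xs: "xs:chains Y (Suc m)" and e: "sb h1 h2 xs = dd m k xs"
    interpret S: abelian_group "ST (last xs)" by (rule stalk_last[OF xs])
    have c: "h1 xs :[ST (last xs)]" "h2 xs :[ST (last xs)]" using h1(1) h2(1) xs unfolding coch_def Suc by blast+
    have "h1 xs -[ST (last xs)] (h1 xs -[ST (last xs)] h2 xs) = h2 xs"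
    proof (rule S.sub_eq_zero[OF _ c(2)])
     have "h1 xs -[ST (last xs)] (h1 xs -[ST (last xs)] h2 xs) -[ST (last xs)] h2 xs = (h1 xs -[ST (last xs)] h2 xs) -[ST (last xs)] (h1 xs -[ST (last xs)] h2 xs)"
      using c by (simp add: S.minus_eq S.minus_add S.a_ac)
     thus "h1 xs -[ST (last xs)] (h1 xs -[ST (last xs)] h2 xs) -[ST (last xs)] h2 xs = \<zero>[ST (last xs)]" using S.sub_self c by simp
    qed (use c in simp)
    thus "sb h1 (dd m k) xs = sb h2 ?z xs" using e c S.sub_self[OF c(1)] S.sub_zero[OF c(2)] by (simp add: sb_def)
   qed
   moreover have "LZ (Suc n) U1 (dd n (dd m k))" unfolding Suc by (rule dd_dd[OF o(1) k(1)])
   ultimately show ?thesis using kc zc z0 by blast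
  qed
  then obtain k1 k2 where k: "coch n k1" "coch n k2" "LZ (Suc n) U1 (dd n k1)"
   "LZ (Suc n) U2 (dd n k2)" "LE n (U1 Int U2) (sb h1 k1) (sb h2 k2)" by (elim exE conjE)
  show "?Q (U1 Un U2)" by (rule dd_patch[OF o(1,2) sb_closed[OF h1(1) k(1)] sb_closed[OF h2(1) k(2)] dd_modify[OF o(1) h1(1) k(1) h1(2) k(3)]
    dd_modify[OF o(2) h2(1) k(2) h2(2) k(4)] k(5)])
 qed

qed


section \<open>The cohomology groups\<close>

lemma cochains_carr: "f :[cochains Y F n] \<longleftrightarrow> coch n f & f:extensional (chains Y n)"
 by (auto simp: cochains_def coch_def PiE_def Pi_def)

lemma cochains_group: "group (cochains Y F n)" unfolding cochains_def by (rule product_group) (use abelian_group.a_group[OF stalk_last] in blast)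

lemma cocycles_sub: assumes U: "openin Y U" shows "subgroup (cocycles Y F n U) (cochains Y F n)"
proof -
 interpret C: group "cochains Y F n" by (rule cochains_group)
 have UT: "U <= topspace Y" by (rule openin_subset[OF U])
 have ab: "comm_group (add_monoid (ST (last xs)))" if "xs:chains Y n" for xs using abelian_group.a_comm_group[OF stalk_last[OF that]] .
 have Z: "f:cocycles Y F n U \<longleftrightarrow> f :[cochains Y F n] & LZ (Suc n) U (dd n f)" for f by (simp add: cocycles_def)
 have mi: "f *[cochains Y F n] inv[cochains Y F n] g = (\<lambda>xs\<in>chains Y n. sb f g xs)"
  if f: "f :[cochains Y F n]" and g: "g :[cochains Y F n]" for f g
 proof -
  have "inv[cochains Y F n] g = (\<lambda>xs\<in>chains Y n. -[ST (last xs)] g xs)" unfolding cochains_def a_inv_def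
   by (rule inv_product_group) (use g abelian_group.a_group[OF stalk_last] in \<open>auto simp: cochains_def\<close>)
  thus ?thesis by (auto simp: cochains_def sb_def a_minus_def fun_eq_iff)
 qed
 have cl: "f *[cochains Y F n] inv[cochains Y F n] g:cocycles Y F n U" if f: "f:cocycles Y F n U" and g: "g:cocycles Y F n U" for f g
 proof -
  have fc: "f :[cochains Y F n]" "g :[cochains Y F n]" using f g by (auto simp: Z)
  hence c: "coch n f" "coch n g" by (auto simp: cochains_carr)
  have "LZ (Suc n) U (dd n (\<lambda>xs\<in>chains Y n. sb f g xs))"
  proof (rule LO_imp[OF LO_conj[OF LO_conj[OF conjunct2[OF f[unfolded Z]] conjunct2[OF g[unfolded Z]]] dd_sb[OF U c]] UT])
   fix xs assume xs: "xs:chains Y (Suc n)"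
    and e: "(dd n f xs = \<zero>[ST (last xs)] & dd n g xs = \<zero>[ST (last xs)]) & dd n (sb f g) xs = sb (dd n f) (dd n g) xs"
   interpret S: abelian_group "ST (last xs)" by (rule stalk_last[OF xs])
   have "dd n (\<lambda>xs\<in>chains Y n. sb f g xs) xs = dd n (sb f g) xs" by (rule dd_ext[OF _ xs]) simp
   thus "dd n (\<lambda>xs\<in>chains Y n. sb f g xs) xs = \<zero>[ST (last xs)]" using e S.sub_self[OF S.zero_closed] by (simp add: sb_def)
  qed
  hence L: "LZ (Suc n) U (dd n (f *[cochains Y F n] inv[cochains Y F n] g))" unfolding mi[OF fc] .
  have m: "f *[cochains Y F n] inv[cochains Y F n] g :[cochains Y F n]" using fc by simp
  show ?thesis unfolding Z by (rule conjI[OF m L])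
 qed
 have one: "\<one>[cochains Y F n]:cocycles Y F n U"
 proof -
  have o: "\<one>[cochains Y F n] :[cochains Y F n]" by simp
  hence c: "coch n \<one>[cochains Y F n]" by (simp add: cochains_carr)
  have "LO (Suc n) U (%xs. dd n \<one>[cochains Y F n] xs = \<zero>[ST (last xs)])"
  proof (rule LO_imp[OF dd_sb[OF U c c] UT])
   fix xs assume xs: "xs:chains Y (Suc n)" and e: "dd n (sb \<one>[cochains Y F n] \<one>[cochains Y F n]) xs = sb (dd n \<one>[cochains Y F n]) (dd n \<one>[cochains Y F n]) xs"
   interpret S: abelian_group "ST (last xs)" by (rule stalk_last[OF xs])
   have cx: "dd n \<one>[cochains Y F n] xs :[ST (last xs)]" using dd_closed[OF c] xs unfolding coch_def by blast
   have "dd n \<one>[cochains Y F n] xs = dd n (sb \<one>[cochains Y F n] \<one>[cochains Y F n]) xs"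
   proof (rule dd_ext[OF _ xs])
    fix zs assume zs: "zs:chains Y n"
    show "\<one>[cochains Y F n] zs = sb \<one>[cochains Y F n] \<one>[cochains Y F n] zs" using mi[OF o o] zs by (simp add: fun_eq_iff restrict_def)
   qed
   thus "dd n \<one>[cochains Y F n] xs = \<zero>[ST (last xs)]" using e S.sub_self[OF cx] by (simp add: sb_def)
  qed
  thus ?thesis unfolding Z using o by (intro conjI)
 qed
 have inv: "inv[cochains Y F n] g:cocycles Y F n U" if g: "g:cocycles Y F n U" for g using cl[OF one g] g by (simp add: Z)
 show ?thesis
 proof (rule C.subgroupI)
  show "f *[cochains Y F n] g:cocycles Y F n U" if f: "f:cocycles Y F n U" and g: "g:cocycles Y F n U" for f g
   using cl[OF f inv[OF g]] conjunct1[OF g[unfolded Z]] by simp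
  show "cocycles Y F n U ~= {}" using one by blast
  show "cocycles Y F n U <= carrier (cochains Y F n)" by (simp add: cocycles_def)
 qed (rule inv)
qed

theorem cohomology_trivial:
 assumes U: "openin Y U"
  and exact: "!!f. coch (Suc n) f ==> LZ (Suc (Suc n)) U (dd (Suc n) f) ==>
   EX h. coch n h & LE (Suc n) U f (dd n h)"
 shows "trivial_group (sheaf_cohomology Y F (Suc n) U)"
proof -
 have UT: "U <= topspace Y" by (rule openin_subset[OF U])
 have eq: "coboundaries Y F (Suc n) U = cocycles Y F (Suc n) U"
 proof (intro equalityI subsetI)
  fix f assume "f:coboundaries Y F (Suc n) U"
  then obtain h where f: "f :[cochains Y F (Suc n)]" and h: "h :[cochains Y F n]" "LE (Suc n) U f (dd n h)" unfolding coboundaries_def by auto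
  have c: "coch (Suc n) f" "coch n h" using f h by (auto simp: cochains_carr)
  have "LZ (Suc (Suc n)) U (dd (Suc n) f)" by (rule LO_imp[OF LO_conj[OF dd_cong_LO[OF U c(1) dd_closed[OF c(2)] h(2)] dd_dd[OF U c(2)]] UT]) simp
  thus "f:cocycles Y F (Suc n) U" using f by (simp add: cocycles_def)
 next
  fix f assume "f:cocycles Y F (Suc n) U"
  hence f: "f :[cochains Y F (Suc n)]" and z: "LZ (Suc (Suc n)) U (dd (Suc n) f)" unfolding cocycles_def by blast+
  obtain h where h: "coch n h" "LE (Suc n) U f (dd n h)" using exact[OF _ z] f unfolding cochains_carr by blast
  let ?h = "restrict h (chains Y n)"
  have hc: "?h :[cochains Y F n]" using h(1) by (auto simp: cochains_carr coch_def)
  have hd: "LE (Suc n) U f (dd n ?h)"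
  proof (rule LO_imp[OF h(2) UT])
   fix xs assume xs: "xs:chains Y (Suc n)" and e: "f xs = dd n h xs"
   have "dd n ?h xs = dd n h xs" by (rule dd_ext[OF _ xs]) simp
   thus "f xs = dd n ?h xs" using e by simp
  qed
  have "EX h:carrier (cochains Y F n). LE (Suc n) U f (dd n h)" by (rule bexI[where x = ?h]) (rule hd, rule hc)
  thus "f:coboundaries Y F (Suc n) U" using f unfolding coboundaries_def by simp
 qed
 let ?G = "(cochains Y F (Suc n))\<lparr>carrier := cocycles Y F (Suc n) U\<rparr>"
 interpret C: group "cochains Y F (Suc n)" by (rule cochains_group)
 interpret G: group ?G by (rule subgroup.subgroup_is_group[OF cocycles_sub[OF U] C.group_axioms])
 let ?H = "carrier ?G"
 have H: "subgroup ?H ?G" by (rule G.subgroup_self)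
 have cos: "?H #>\<^bsub>?G\<^esub> a = ?H" "a <#\<^bsub>?G\<^esub> ?H = ?H" if "a:?H" for a
  using G.coset_join2[OF that H that] G.coset_join3[OF that H that] by auto
 have n: "?H \<lhd> ?G" by (rule G.normalI[OF H]) (use cos in blast)
 have "carrier (?G Mod ?H) = {\<one>[?G Mod ?H]}"
 proof -
  have "carrier (?G Mod ?H) = (\<Union>a\<in>?H. {?H #>\<^bsub>?G\<^esub> a})" by (simp only: FactGroup_def RCOSETS_def partial_object.simps)
  also have "... = {?H}" using cos(1) G.one_closed by blast
  finally show ?thesis by (simp add: FactGroup_def)
 qed
 hence "trivial_group (?G Mod ?H)" unfolding trivial_group_def using normal.factorgroup_is_group[OF n] by blast
 thus ?thesis unfolding sheaf_cohomology_def eq by simp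
qed

end

section \<open>Acyclicity\<close>

context hub_su
begin

text \<open>This is \<open>rational_compact\<close> with the leaf property \<open>Q (RS G)\<close>.
  \<open>bin_surj\<close> enters through \<open>SS_RS\<close>: sections over a rational subset are
  elements of its localization, so surjectivity for the halves becomes
  \<open>surj_pair\<close>.\<close>

lemma rational_induct:
 assumes U: "U:RS ` RD"
  and loc: "!!x. x:U ==> EX V. openin TS V & x:V & Q V" and mono: "!!V W. Q V ==> W <= V ==> Q W" and empty: "Q {}"
  and step: "!!U1 U2. U1:RS ` RD ==> U2:RS ` RD ==> U1 Int U2:RS ` RD ==> rsheaf.surj_pair SH U1 U2 ==>
   Q U1 ==> Q U2 ==> Q (U1 Un U2)"
 shows "Q U"
proof -
 have rsh: "rsheaf TS SH" by (rule rsheaf.intro[OF structure_sheaf])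
 obtain D where D: "D:RD" "U = RS D" using U by blast
 have "good (%G. G:RD & Q (RS G)) D"
 proof (rule rational_compact[OF D(1)])
  show "G':RD & Q (RS G')" if "G':RD" "refines G' G" "G:RD & Q (RS G)" for G G'
   using mono[OF conjunct2[OF that(3)] refines_RS[OF RD_okd[OF that(1)] that(2)]] that(1) by simp
  fix p assume "p:RS D"
  then obtain V where V: "openin TS V" "p:V" "Q V" using loc[of p] D(2) by blast
  obtain G where G: "G:RD" "p:RS G" "RS G <= V" using V(1,2) unfolding openin_TS by blast
  show "EX G:RD. p:RS G & G:RD & Q (RS G)" using G mono[OF V(3) G(3)] by blast
 qed
 hence "Q (RS D)" using D(1)
 proof (induction)
  case (good_leaf D) thus ?case by simp
 next
  case (good_empty t D)
  thus ?case using forces_one_RS empty by simp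
 next
  case (good_bin D f h S)
  note D = good_bin.prems and b = good_bin.hyps(1)
  let ?D1 = "Dl D f h S" and ?D2 = "Dl D h f S" let ?D12 = "meet ?D1 ?D2"
  note d = bin_data[OF D b] and d12 = bin_ok[OF D b]
  let ?I = "RS ?D1 Int RS ?D2"
  have I: "RS ?D12 = ?I" by (rule RS_meet[OF RD_okd[OF d(1)] RD_okd[OF d(2)]])
  have DI: "?D12:DW ?I" using d12(1) I by (simp add: DW_iff)
  have D1: "?D1:DW (RS ?D1)" and D2: "?D2:DW (RS ?D2)" using d(1,2) by (auto simp: DW_iff)
  have sj: "rsheaf.surj_pair SH (RS ?D1) (RS ?D2)" unfolding rsheaf.surj_pair_def[OF rsh] sect_simps(1)
  proof
   fix c assume c: "c:SS ?I"
   obtain y1 y2 where y: "y1 :[CD ?D1]" "y2 :[CD ?D2]" "c ?D12 = rs ?D1 ?D12 y1 +[CD ?D12] rs ?D2 ?D12 y2"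
    using bin_surj[OF D b SS_D(1)[OF c DI]] by (elim bexE)
   obtain s1 where s1: "s1:SS (RS ?D1)" "s1 ?D1 = y1" using SS_RS[OF d(1) y(1)] by (elim bexE)
   obtain s2 where s2: "s2:SS (RS ?D2)" "s2 ?D2 = y2" using SS_RS[OF d(2) y(2)] by (elim bexE)
   have r: "restr SH (RS ?D1) ?I s1:SS ?I" "restr SH (RS ?D2) ?I s2:SS ?I" using restr_SS[OF _ s1(1), of ?I] restr_SS[OF _ s2(1), of ?I] by auto
   have "s1 ?D12 = rs ?D1 ?D12 y1" "s2 ?D12 = rs ?D2 ?D12 y2" using SS_D(2)[OF s1(1) D1 d12(1)] SS_D(2)[OF s2(1) D2 d12(1)] s1(2) s2(2) I by auto
   hence "c ?D12 = (restr SH (RS ?D1) ?I s1 +[sect SH ?I] restr SH (RS ?D2) ?I s2) ?D12" using y(3) DI by (simp add: sect_simps)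
   hence "c = restr SH (RS ?D1) ?I s1 +[sect SH ?I] restr SH (RS ?D2) ?I s2" using SS_RS_eq[OF d12(1), unfolded I, OF c SS_closed(3)[OF r]] by simp
   thus "EX c1:SS (RS ?D1). EX c2:SS (RS ?D2). c = restr SH (RS ?D1) ?I c1 +[sect SH ?I] restr SH (RS ?D2) ?I c2" using s1(1) s2(1) by blast
  qed
  have R: "RS ?D1:RS ` RD" "RS ?D2:RS ` RD" "?I:RS ` RD" using d(1,2) d12(1) I by (auto intro: image_eqI[of _ _ ?D12])
  show ?case unfolding bin_cover[OF D b] by (rule step[OF R sj good_bin.IH(1)[OF d(1)] good_bin.IH(2)[OF d(2)]])
 qed
 thus ?thesis using D(2) by simp
qed

theorem acyclic: "structure_sheaf_acyclic B T P" unfolding structure_sheaf_acyclic_def rational_subspaces_def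
proof (intro ballI allI impI)
 fix U and i :: nat assume U: "U:RS ` RD" and "i > 0"
 then obtain n where i: "i = Suc n" by (cases i) auto
 interpret F: rsheaf TS SH by (rule rsheaf.intro[OF structure_sheaf])
 have op: "openin TS V" if "V:RS ` RD" for V using that openin_RS by blast
 show "trivial_group (sheaf_cohomology TS SH i U)" unfolding i
 proof (rule F.cohomology_trivial[OF op[OF U]])
  fix f assume f: "F.coch (Suc n) f" and z: "F.LO (Suc (Suc n)) U (%xs. F.dd (Suc n) f xs = \<zero>[F.ST (last xs)])"
  show "EX h. F.coch n h & F.LO (Suc n) U (%xs. f xs = F.dd n h xs)"
  proof (rule F.cocycle_exact[where R = "RS ` RD", OF _ _ U f z])
   show "openin TS V" if "V:RS ` RD" for V by (rule op[OF that])
   show "Q V" if "V:RS ` RD" "!!x. x:V ==> EX W. openin TS W & x:W & Q W" "!!V W. Q V ==> W <= V ==> Q W" "Q {}"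
    "!!U1 U2. U1:RS ` RD ==> U2:RS ` RD ==> U1 Int U2:RS ` RD ==> F.surj_pair U1 U2 ==> Q U1 ==> Q U2 ==> Q (U1 Un U2)" for Q V
    by (rule rational_induct[of V Q]) (fact that)+
  qed
 qed
qed

end

theorem theorem1p2:
  fixes B :: "'a ring" and N :: "'a \<Rightarrow> real" and Bplus :: "'a set"
  assumes "banach_ring B N"
    and "huber_pair B (norm_topology B N) Bplus"
    and "stably_uniform B (norm_topology B N)"
  shows "spa_is_adic_space B (norm_topology B N) Bplus
    \<and> structure_sheaf_acyclic B (norm_topology B N) Bplus"
proof -
  interpret hub_su B "norm_topology B N" Bplus by unfold_locales (fact assms)+
  show ?thesis unfolding spa_is_adic_space_def using structure_sheaf acyclic by simp
qed

end
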